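(* Let $Q=(q_{ij})_{i,j\in\mathcal{S}}$ be a quasi-stochastic matrix with positive left and right eigenvectors $\mathsf{u},\mathsf{v}$, and let $F=(F_{ij})_{i,j\in\mathcal{S}}$ be a matrix of proper distribution functions on $\mathbb{R}$. Suppose that $\sum_{n\ge 1}q_{ii}^{(n)}=\infty$ for some $i\in\mathcal{S}$, that $\mu:=\sum_{i,j\in\mathcal{S}}\mathsf{u}_i q_{ij}\mathsf{v}_j\int x\,F_{ij}(dx)>0$, and that $Q\otimes F$ is spread out. Then the matrix renewal measure $\mathbb{V}$ associated with $Q\otimes F$ allows a decomposition $\mathbb{V}=\mathbb{V}^1+\mathbb{V}^2$, where (a) $\mathbb{V}^1=(\mathbb{V}^1_{ij})_{i,j\in\mathcal{S}}$ consists of finite measures $\mathbb{V}^1_{ij}$; (b) $\mathbb{V}^2=(\mathbb{V}^2_{ij})_{i,j\in\mathcal{S}}$ consists of measures $\mathbb{V}^2_{ij}$ that are absolutely continuous with respect to Lebesgue measure $\lambda$, with densities $h_{ij}$ that are bounded, continuous and satisfy $$\lim_{t\to\infty}h_{ij}(t)=\frac{\mathsf{v}_i\mathsf{u}_j}{\mu}\quad\text{and}\quad\lim_{t\to-\infty}h_{ij}(t)=0$$ for all $i,j\in\mathcal{S}$. Furthermore, $$\lim_{t\to\infty}\ \sup_{B\subset[0,h],\,B\text{ Borel}}\left|\mathbb{V}_{ij}(t+B)-\frac{\mathsf{v}_i\mathsf{u}_j\,\lambda(B)}{\mu}\right|=0$$ for all $h>0$ and $i,j\in\mathcal{S}$.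
   Context: $\mathcal{S}=\{1,\dots,m\}$ for some $m\in\mathbb{N}$, or $\mathcal{S}=\mathbb{N}$. A matrix $Q=(q_{ij})_{i,j\in\mathcal{S}}$ is called quasi-stochastic if it is an irreducible nonnegative matrix with maximal eigenvalue $1$ for which there exist positive left and right eigenvectors $\mathsf{u}=(\mathsf{u}_i)_{i\in\mathcal{S}}$, $\mathsf{v}=(\mathsf{v}_i)_{i\in\mathcal{S}}$ (all entries strictly positive), unique up to scaling, i.e. $\mathsf{u}^\top Q=\mathsf{u}^\top$ and $Q\mathsf{v}=\mathsf{v}$. (For infinite $\mathcal{S}$, "maximal eigenvalue $1$" is understood to mean only that such positive eigenvectors for the eigenvalue $1$ exist and are unique up to scaling, so that e.g. every irreducible recurrent stochastic matrix is included.) Fix such $\mathsf{u},\mathsf{v}$ (if $\sum_i\mathsf{u}_i<\infty$ and $\sum_i \mathsf{u}_i\mathsf{v}_i<\infty$ they may be normalized by $\sum_i\mathsf{u}_i=\sum_i\mathsf{u}_i\mathsf{v}_i=1$). Write $Q^n=(q_{ij}^{(n)})$; all entries are finite. Distribution functions are identified with their probability measures. $Q\otimes F(t):=(q_{ij}F_{ij}(t))_{i,j}$. The convolution powers are $(Q\otimes F)^{*0}(t)=$ identity matrix for $t\ge0$ and zero matrix for $t<0$, and $(Q\otimes F)^{*n}_{ij}(t)=\sum_{k\in\mathcal{S}}\int_{\mathbb{R}}(Q\otimes F)^{*(n-1)}_{kj}(t-x)\,q_{ik}F_{ik}(dx)$ for $n\ge1$. When $q_{ij}^{(n)}>0$,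 $F_{ij}^{*n}$ denotes the distribution function with $(Q\otimes F)^{*n}_{ij}=q_{ij}^{(n)}F_{ij}^{*n}$. The matrix renewal measure associated with $Q\otimes F$ is $\mathbb{V}=(\mathbb{V}_{ij})_{i,j}$, the matrix of measures on $\mathbb{R}$ determined by $\mathbb{V}((t,t+h])=\sum_{n\ge0}\big((Q\otimes F)^{*n}(t+h)-(Q\otimes F)^{*n}(t)\big)$, $t\in\mathbb{R}$, $h>0$. In the definition of $\mu$ it is understood that the double sum/integral is well-defined (possibly $+\infty$), i.e. $\sum_{i,j}\mathsf{u}_iq_{ij}\mathsf{v}_j\int x^{-}F_{ij}(dx)<\infty$ or the same with $x^+$; if $\mu=\infty$, then $1/\mu:=0$. $Q\otimes F$ is called spread out if $F_{ij}^{*n}$ is nonsingular with respect to Lebesgue measure for some $n\in\mathbb{N}$ and some $i,j\in\mathcal{S}$ with $\mathsf{u}_iq_{ij}^{(n)}\mathsf{v}_j>0$. Here $t+B=\{t+b:b\in B\}$. *)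

theory Defs
  imports "HOL-Probability.Probability"
begin

text \<open>
  Matrices and vectors indexed by a set \<open>S\<close> are functions on \<^typ>\<open>nat\<close>; only their values on \<open>S\<close>
  matter.
\<close>

definition index_set :: "nat set \<Rightarrow> bool" where
  "index_set S \<longleftrightarrow> (\<exists>m\<ge>1. S = {1..m}) \<or> S = {1..}"

fun matpow :: "nat set \<Rightarrow> (nat \<Rightarrow> nat \<Rightarrow> real) \<Rightarrow> nat \<Rightarrow> nat \<Rightarrow> nat \<Rightarrow> real" where
  "matpow S Q 0 i j = (if i = j then 1 else 0)"
| "matpow S Q (Suc n) i j = (\<Sum>\<^sub>\<infinity>k\<in>S. Q i k * matpow S Q n k j)"

definition nonneg_matrix :: "nat set \<Rightarrow> (nat \<Rightarrow> nat \<Rightarrow> real) \<Rightarrow> bool" where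
  "nonneg_matrix S Q \<longleftrightarrow> (\<forall>i\<in>S. \<forall>j\<in>S. Q i j \<ge> 0)"

definition irreducible_matrix :: "nat set \<Rightarrow> (nat \<Rightarrow> nat \<Rightarrow> real) \<Rightarrow> bool" where
  "irreducible_matrix S Q \<longleftrightarrow> (\<forall>i\<in>S. \<forall>j\<in>S. \<exists>n\<ge>1. matpow S Q n i j > 0)"

definition matrix_eigenvalue :: "nat set \<Rightarrow> (nat \<Rightarrow> nat \<Rightarrow> real) \<Rightarrow> complex \<Rightarrow> bool" where
  "matrix_eigenvalue S Q z \<longleftrightarrow>
     (\<exists>x. (\<exists>i\<in>S. x i \<noteq> 0) \<and> (\<forall>i\<in>S. (\<Sum>j\<in>S. complex_of_real (Q i j) * x j) = z * x i))"

definition pos_left_eigenvector ::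
    "nat set \<Rightarrow> (nat \<Rightarrow> nat \<Rightarrow> real) \<Rightarrow> (nat \<Rightarrow> real) \<Rightarrow> bool" where
  "pos_left_eigenvector S Q u \<longleftrightarrow>
     (\<forall>i\<in>S. u i > 0) \<and> (\<forall>j\<in>S. ((\<lambda>i. u i * Q i j) has_sum u j) S)"

definition pos_right_eigenvector ::
    "nat set \<Rightarrow> (nat \<Rightarrow> nat \<Rightarrow> real) \<Rightarrow> (nat \<Rightarrow> real) \<Rightarrow> bool" where
  "pos_right_eigenvector S Q v \<longleftrightarrow>
     (\<forall>i\<in>S. v i > 0) \<and> (\<forall>i\<in>S. ((\<lambda>j. Q i j * v j) has_sum v i) S)"

text \<open>
  For finite \<open>S\<close>, maximality of the eigenvalue \<open>1\<close> is the Perron-Frobenius notion: no complex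
  eigenvalue has larger modulus. For infinite \<open>S\<close> it means no more than the existence and
  uniqueness of the positive eigenvectors. Uniqueness up to scaling is among positive vectors: a
  recurrent stochastic matrix may well have further eigenvectors of mixed sign.
\<close>

definition quasi_stochastic :: "nat set \<Rightarrow> (nat \<Rightarrow> nat \<Rightarrow> real) \<Rightarrow> bool" where
  "quasi_stochastic S Q \<longleftrightarrow>
     nonneg_matrix S Q \<and> irreducible_matrix S Q \<and>
     (finite S \<longrightarrow> matrix_eigenvalue S Q 1 \<and> (\<forall>z. matrix_eigenvalue S Q z \<longrightarrow> cmod z \<le> 1)) \<and>
     (\<exists>u. pos_left_eigenvector S Q u \<and>
        (\<forall>u'. pos_left_eigenvector S Q u' \<longrightarrow> (\<exists>c. \<forall>i\<in>S. u' i = c * u i))) \<and>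
     (\<exists>v. pos_right_eigenvector S Q v \<and>
        (\<forall>v'. pos_right_eigenvector S Q v' \<longrightarrow> (\<exists>c. \<forall>i\<in>S. v' i = c * v i)))"

text \<open>\<open>conv_power S Q F n i j t\<close> is the entry \<open>(Q \<otimes> F)\<^sup>*\<^sup>n\<^sub>i\<^sub>j(t)\<close>; a distribution function is given by
  its probability measure \<open>F i j\<close>.\<close>

fun conv_power ::
    "nat set \<Rightarrow> (nat \<Rightarrow> nat \<Rightarrow> real) \<Rightarrow> (nat \<Rightarrow> nat \<Rightarrow> real measure) \<Rightarrow>
     nat \<Rightarrow> nat \<Rightarrow> nat \<Rightarrow> real \<Rightarrow> real" where
  "conv_power S Q F 0 i j t = (if i = j \<and> t \<ge> 0 then 1 else 0)"
| "conv_power S Q F (Suc n) i j t =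
     (\<Sum>\<^sub>\<infinity>k\<in>S. Q i k * (\<integral>x. conv_power S Q F n k j (t - x) \<partial>F i k))"

text \<open>The distribution \<open>F\<^sub>i\<^sub>j\<^sup>*\<^sup>n\<close> with \<open>(Q \<otimes> F)\<^sup>*\<^sup>n\<^sub>i\<^sub>j = q\<^sub>i\<^sub>j\<^sup>(\<^sup>n\<^sup>) F\<^sub>i\<^sub>j\<^sup>*\<^sup>n\<close>, meaningful if \<open>q\<^sub>i\<^sub>j\<^sup>(\<^sup>n\<^sup>) > 0\<close>.\<close>

definition conv_distr ::
    "nat set \<Rightarrow> (nat \<Rightarrow> nat \<Rightarrow> real) \<Rightarrow> (nat \<Rightarrow> nat \<Rightarrow> real measure) \<Rightarrow>
     nat \<Rightarrow> nat \<Rightarrow> nat \<Rightarrow> real measure" where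
  "conv_distr S Q F n i j =
     interval_measure (\<lambda>t. conv_power S Q F n i j t / matpow S Q n i j)"

definition singular_wrt_lborel :: "real measure \<Rightarrow> bool" where
  "singular_wrt_lborel M \<longleftrightarrow>
     (\<exists>A\<in>sets borel. emeasure lborel A = 0 \<and> emeasure M (- A) = 0)"

definition spread_out ::
    "nat set \<Rightarrow> (nat \<Rightarrow> nat \<Rightarrow> real) \<Rightarrow> (nat \<Rightarrow> nat \<Rightarrow> real measure) \<Rightarrow>
     (nat \<Rightarrow> real) \<Rightarrow> (nat \<Rightarrow> real) \<Rightarrow> bool" where
  "spread_out S Q F u v \<longleftrightarrow>
     (\<exists>n\<ge>1. \<exists>i\<in>S. \<exists>j\<in>S. u i * matpow S Q n i j * v j > 0 \<and>
        \<not> singular_wrt_lborel (conv_distr S Q F n i j))"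

text \<open>Positive and negative part of the mean \<open>\<mu>\<close>, and \<open>\<mu>\<close> itself; the difference is meaningful only if
  one of the two parts is finite (in \<^typ>\<open>ereal\<close>, \<open>\<infinity> - \<infinity> = \<infinity>\<close>).\<close>

definition mean_pos_part ::
    "nat set \<Rightarrow> (nat \<Rightarrow> nat \<Rightarrow> real) \<Rightarrow> (nat \<Rightarrow> nat \<Rightarrow> real measure) \<Rightarrow>
     (nat \<Rightarrow> real) \<Rightarrow> (nat \<Rightarrow> real) \<Rightarrow> ennreal" where
  "mean_pos_part S Q F u v =
     (\<Sum>\<^sub>\<infinity>(i, j)\<in>S \<times> S. ennreal (u i * Q i j * v j) * (\<integral>\<^sup>+x. ennreal (max x 0) \<partial>F i j))"

definition mean_neg_part ::
    "nat set \<Rightarrow> (nat \<Rightarrow> nat \<Rightarrow> real) \<Rightarrow> (nat \<Rightarrow> nat \<Rightarrow> real measure) \<Rightarrow>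
     (nat \<Rightarrow> real) \<Rightarrow> (nat \<Rightarrow> real) \<Rightarrow> ennreal" where
  "mean_neg_part S Q F u v =
     (\<Sum>\<^sub>\<infinity>(i, j)\<in>S \<times> S. ennreal (u i * Q i j * v j) * (\<integral>\<^sup>+x. ennreal (max (- x) 0) \<partial>F i j))"

definition mean_well_defined ::
    "nat set \<Rightarrow> (nat \<Rightarrow> nat \<Rightarrow> real) \<Rightarrow> (nat \<Rightarrow> nat \<Rightarrow> real measure) \<Rightarrow>
     (nat \<Rightarrow> real) \<Rightarrow> (nat \<Rightarrow> real) \<Rightarrow> bool" where
  "mean_well_defined S Q F u v \<longleftrightarrow>
     mean_neg_part S Q F u v < \<infinity> \<or> mean_pos_part S Q F u v < \<infinity>"

definition mean ::
    "nat set \<Rightarrow> (nat \<Rightarrow> nat \<Rightarrow> real) \<Rightarrow> (nat \<Rightarrow> nat \<Rightarrow> real measure) \<Rightarrow>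
     (nat \<Rightarrow> real) \<Rightarrow> (nat \<Rightarrow> real) \<Rightarrow> ereal" where
  "mean S Q F u v =
     enn2ereal (mean_pos_part S Q F u v) - enn2ereal (mean_neg_part S Q F u v)"

text \<open>The matrix renewal measure is the sum over \<open>n\<close> of the measures with distribution functions
  \<open>(Q \<otimes> F)\<^sup>*\<^sup>n\<^sub>i\<^sub>j\<close>; \<open>emeasure_renewal_measure_Ioc\<close> below gives its values on half-open intervals.\<close>

definition renewal_measure ::
    "nat set \<Rightarrow> (nat \<Rightarrow> nat \<Rightarrow> real) \<Rightarrow> (nat \<Rightarrow> nat \<Rightarrow> real measure) \<Rightarrow>
     nat \<Rightarrow> nat \<Rightarrow> real measure" where
  "renewal_measure S Q F i j =
     measure_of UNIV (sets borel)
       (\<lambda>B. \<Sum>n. emeasure (interval_measure (conv_power S Q F n i j)) B)"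

lemma sets_renewal_measure [simp, measurable_cong]:
  "sets (renewal_measure S Q F i j) = sets borel"
  unfolding renewal_measure_def
  by (metis sets.sets_measure_of_eq space_borel)

lemma emeasure_renewal_measure:
  assumes "B \<in> sets borel"
  shows "emeasure (renewal_measure S Q F i j) B =
           (\<Sum>n. emeasure (interval_measure (conv_power S Q F n i j)) B)"
proof (rule emeasure_measure_of[OF renewal_measure_def])
  let ?M = "\<lambda>n. interval_measure (conv_power S Q F n i j)"
  show "countably_additive (sets (renewal_measure S Q F i j)) (\<lambda>B. \<Sum>n. emeasure (?M n) B)"
  proof (rule countably_additiveI)
    fix A :: "nat \<Rightarrow> real set"
    assume A: "range A \<subseteq> sets (renewal_measure S Q F i j)" "disjoint_family A"
    have "(\<Sum>k. \<Sum>n. emeasure (?M n) (A k)) = (\<Sum>n. \<Sum>k. emeasure (?M n) (A k))"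
      using nn_integral_suminf[of "\<lambda>n k. emeasure (?M n) (A k)" "count_space UNIV"]
      by (simp add: nn_integral_count_space_nat)
    also have "\<dots> = (\<Sum>n. emeasure (?M n) (\<Union>k. A k))"
      using A by (intro suminf_cong suminf_emeasure) auto
    finally show "(\<Sum>k. \<Sum>n. emeasure (?M n) (A k)) = (\<Sum>n. emeasure (?M n) (\<Union>k. A k))" .
  qed
qed (use assms in \<open>auto simp: positive_def\<close>)

lemma conv_power_regular:
  assumes nonneg: "nonneg_matrix S Q"
    and v: "pos_right_eigenvector S Q v"
    and F: "\<And>i j. i \<in> S \<Longrightarrow> j \<in> S \<Longrightarrow> real_distribution (F i j)"
    and "i \<in> S" "j \<in> S"
  shows "mono (conv_power S Q F n i j) \<and>
         (\<forall>t. continuous (at_right t) (conv_power S Q F n i j)) \<and>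
         (\<forall>t. 0 \<le> conv_power S Q F n i j t \<and> conv_power S Q F n i j t \<le> v i / v j)"
  using \<open>i \<in> S\<close>
proof (induction n arbitrary: i)
  case 0
  have vp: "v i > 0" "v j > 0"
    using v 0 \<open>j \<in> S\<close> by (auto simp: pos_right_eigenvector_def)
  have "continuous (at_right t) (\<lambda>t. conv_power S Q F 0 i j t)" for t
  proof -
    have "eventually (\<lambda>s. conv_power S Q F 0 i j s = conv_power S Q F 0 i j t) (at_right t)"
    proof (cases "t \<ge> 0")
      case True
      then show ?thesis by (auto simp: eventually_at_filter)
    next
      case False
      then have "eventually (\<lambda>s. s < 0) (at_right t)"
        by (intro eventually_at_right_less[THEN eventually_mono] eventually_at_rightI[of _ 0]) auto
      then show ?thesis by eventually_elim (use False in auto)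
    qed
    then show ?thesis
      unfolding continuous_within by (rule tendsto_eventually)
  qed
  then show ?case
    using vp by (auto simp: mono_def)
next
  case (Suc n)
  let ?C = "conv_power S Q F n"
  have vp: "v k > 0" if "k \<in> S" for k
    using v that by (auto simp: pos_right_eigenvector_def)
  have vsum: "((\<lambda>k. Q i k * v k) has_sum v i) S"
    using v Suc.prems by (auto simp: pos_right_eigenvector_def)
  have Q0: "Q i k \<ge> 0" if "k \<in> S" for k
    using nonneg that Suc.prems by (auto simp: nonneg_matrix_def)
  have mono_C: "mono (?C k j)" and cont_C: "continuous (at_right t) (?C k j)"
    and C0: "0 \<le> ?C k j t" and C1: "?C k j t \<le> v k / v j" if "k \<in> S" for k t
    using Suc.IH[OF that] by auto
  define g where "g = (\<lambda>k t. Q i k * (\<integral>x. ?C k j (t - x) \<partial>F i k))"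
  have [measurable]: "?C k j \<in> borel_measurable borel" if "k \<in> S" for k
    using mono_C[OF that] by (rule borel_measurable_mono)
  have int: "integrable (F i k) (\<lambda>x. ?C k j (t - x))" if k: "k \<in> S" for k t
  proof -
    interpret real_distribution "F i k" using F Suc.prems k by auto
    note k[measurable]
    show ?thesis
      using k C0 C1 by (intro integrable_const_bound[where B = "v k / v j"]) auto
  qed
  have g_mono: "g k s \<le> g k t" if "k \<in> S" "s \<le> t" for k s t
    unfolding g_def using that Q0 int mono_C
    by (intro mult_left_mono integral_mono) (auto simp: mono_def)
  have g_bound: "0 \<le> g k t \<and> g k t \<le> Q i k * v k / v j" if k: "k \<in> S" for k t
  proof -
    interpret real_distribution "F i k" using F Suc.prems k by auto
    have "(\<integral>x. ?C k j (t - x) \<partial>F i k) \<le> (\<integral>x. v k / v j \<partial>F i k)"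
      using k int C1 by (intro integral_mono) auto
    then have "(\<integral>x. ?C k j (t - x) \<partial>F i k) \<le> v k / v j"
      using prob_space space_eq_univ by simp
    moreover have "(\<integral>x. ?C k j (t - x) \<partial>F i k) \<ge> 0"
      using k C0 by (intro Bochner_Integration.integral_nonneg) auto
    ultimately show ?thesis
      using Q0[OF k] mult_left_mono[of "\<integral>x. ?C k j (t - x) \<partial>F i k" "v k / v j" "Q i k"]
      by (auto simp: g_def)
  qed
  have g_cont: "(g k \<longlongrightarrow> g k t) (at_right t)" if k: "k \<in> S" for k t
  proof -
    interpret real_distribution "F i k" using F Suc.prems k by auto
    have "((\<lambda>s. \<integral>x. ?C k j (s - x) \<partial>F i k) \<longlongrightarrow> (\<integral>x. ?C k j (t - x) \<partial>F i k)) (at_right t)"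
    proof (rule tendsto_at_right_sequentially[of t "t + 1"])
      fix X :: "nat \<Rightarrow> real"
      assume X: "\<And>n. t < X n" "X \<longlonglongrightarrow> t"
      show "(\<lambda>n. \<integral>x. ?C k j (X n - x) \<partial>F i k) \<longlonglongrightarrow> (\<integral>x. ?C k j (t - x) \<partial>F i k)"
      proof (rule integral_dominated_convergence[where w = "\<lambda>_. v k / v j"])
        show "AE x in F i k. (\<lambda>n. ?C k j (X n - x)) \<longlonglongrightarrow> ?C k j (t - x)"
        proof (intro AE_I2)
          fix x
          have "X n \<noteq> t" for n
            using X(1)[of n] by simp
          then have "filterlim (\<lambda>n. X n - x) (at_right (t - x)) sequentially"
            using X by (auto simp: filterlim_at intro!: tendsto_intros)
          then show "(\<lambda>n. ?C k j (X n - x)) \<longlonglongrightarrow> ?C k j (t - x)"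
            using cont_C[OF k, of "t - x"] unfolding continuous_within
            by (rule filterlim_compose[rotated])
        qed
      qed (use k C0 C1 in \<open>auto\<close>)
    qed auto
    then show ?thesis
      unfolding g_def by (rule tendsto_mult[OF tendsto_const])
  qed
  have M: "((\<lambda>k. Q i k * v k / v j) has_sum v i / v j) S"
    using has_sum_cmult_left[OF vsum, of "inverse (v j)"] by (simp add: divide_inverse)
  have g_summable: "(\<lambda>k. g k t) summable_on S" for t
    by (rule summable_on_comparison_test[OF has_sum_imp_summable[OF M]]) (use g_bound in auto)
  have eq: "conv_power S Q F (Suc n) i j = (\<lambda>t. \<Sum>\<^sub>\<infinity>k\<in>S. g k t)"
    by (simp add: g_def fun_eq_iff)
  have unif: "uniform_limit UNIV (\<lambda>A t. \<Sum>k\<in>A. g k t) (\<lambda>t. \<Sum>\<^sub>\<infinity>k\<in>S. g k t) (finite_subsets_at_top S)"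
    using M g_bound
    by (intro Weierstrass_m_test_general[where M = "\<lambda>k. Q i k * v k / v j"] has_sum_imp_summable) auto
  have "((\<lambda>s. \<Sum>\<^sub>\<infinity>k\<in>S. g k s) \<longlongrightarrow> (\<Sum>\<^sub>\<infinity>k\<in>S. g k t)) (at_right t)" for t
  proof (rule swap_uniform_limit'[where S = UNIV and F = "finite_subsets_at_top S" and f = "\<lambda>A t. \<Sum>k\<in>A. g k t" and g = "\<lambda>A. \<Sum>k\<in>A. g k t"])
    show "\<forall>\<^sub>F A in finite_subsets_at_top S. ((\<lambda>s. \<Sum>k\<in>A. g k s) \<longlongrightarrow> (\<Sum>k\<in>A. g k t)) (at_right t)"
      using g_cont by (intro eventually_finite_subsets_at_top_weakI tendsto_sum) auto
    show "((\<lambda>A. \<Sum>k\<in>A. g k t) \<longlongrightarrow> (\<Sum>\<^sub>\<infinity>k\<in>S. g k t)) (finite_subsets_at_top S)"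
      using has_sum_infsum[OF g_summable] by (simp add: has_sum_def)
    show "\<forall>\<^sub>F s in at_right t. s \<in> UNIV" by simp
    show "uniform_limit UNIV (\<lambda>A t. \<Sum>k\<in>A. g k t) (\<lambda>t. \<Sum>\<^sub>\<infinity>k\<in>S. g k t) (finite_subsets_at_top S)"
      by (rule unif)
  qed simp
  moreover have "0 \<le> (\<Sum>\<^sub>\<infinity>k\<in>S. g k t)" for t
    using g_bound by (intro infsum_nonneg) auto
  moreover have "(\<Sum>\<^sub>\<infinity>k\<in>S. g k t) \<le> v i / v j" for t
    using g_bound by (intro has_sum_mono[OF has_sum_infsum[OF g_summable] M]) auto
  moreover have "(\<Sum>\<^sub>\<infinity>k\<in>S. g k s) \<le> (\<Sum>\<^sub>\<infinity>k\<in>S. g k t)" if "s \<le> t" for s t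
    using g_mono that g_summable by (intro infsum_mono) auto
  ultimately show ?case
    unfolding eq by (auto simp: mono_def continuous_within)
qed

lemma emeasure_renewal_measure_Ioc:
  assumes "nonneg_matrix S Q" "pos_right_eigenvector S Q v"
    and "\<And>i j. i \<in> S \<Longrightarrow> j \<in> S \<Longrightarrow> real_distribution (F i j)"
    and "i \<in> S" "j \<in> S" and "h > 0"
  shows "emeasure (renewal_measure S Q F i j) {t<..t+h} =
           (\<Sum>n. ennreal (conv_power S Q F n i j (t + h) - conv_power S Q F n i j t))"
proof -
  have "emeasure (interval_measure (conv_power S Q F n i j)) {t<..t+h} =
          ennreal (conv_power S Q F n i j (t + h) - conv_power S Q F n i j t)" for n
    using conv_power_regular[OF assms(1-5), where n = n] \<open>h > 0\<close>
    by (intro emeasure_interval_measure_Ioc) (auto simp: mono_def)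
  then show ?thesis
    by (simp add: emeasure_renewal_measure)
qed

end

theory Submission
  imports Defs "HOL-Library.Diagonal_Subsequence"
begin

text \<open>
  Conjugating \<open>Q\<close> by \<open>v\<close> turns \<open>Q \<otimes> F\<close> into a Markov random walk whose driving chain has the stationary
  measure \<open>w i = u i * v i\<close>; the renewal measures become its potentials. Recurrence together with the
  uniqueness of \<open>v\<close> says that bounded superharmonic functions of the driving chain are constant.
  Some power of the kernel dominates a kernel with a continuous compactly supported density, so that
  a bounded Lipschitz function which is harmonic for the walk is constant (Choquet-Deny). Hence
  limits of translates of the smoothed potential are constant, and their values at both ends are
  identified by counting the stationary flux across a level, which is the mean drift. Cutting the
  density piece off the power of the kernel and expanding in the number of cuts finally splits the
  potential into a finite measure and one with a continuous density (Stone's decomposition).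
\<close>

section \<open>Translation-invariant operators\<close>

text \<open>The obstacle is that \<open>W\<close> may have infinite mass and \<open>mean_pos\<close>
  may be infinite, so masses cannot simply be subtracted. Hence most of the argument runs in
  \<open>ennreal\<close>, with matrices of measures as positive operators. The level-crossing
  balance is set up for finite horizons, with a factor \<open>r\<close> charged at each visit to one
  state \<open>j\<close>: there half-line masses are finite and can be cancelled. Charging at
  \<open>j\<close> alone makes the loss on a bounded interval of order 1 - r even for infinite
  \<open>W\<close>. As \<open>r\<close> tends to 1 a constant \<open>E\<close>, the same for every
  level, survives. It is found at minus infinity: the source term has disappeared there, and
  \<open>mean_neg < mean_pos\<close> leaves room only for \<open>E = 0\<close> and limit 0. For
  finite \<open>mean_pos\<close>, the balance at plus infinity then reads b * mean_pos = W{j} *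
  (integral of the test function) + b * mean_neg. The limit v_i u_j / \<mu> arises from W{j} = u_j
  v_j, divided by the drift, times the factor v_i / v_j that undoes the conjugation.\<close>

definition mfun :: "(nat \<Rightarrow> real \<Rightarrow> ennreal) \<Rightarrow> bool" where
  "mfun f \<longleftrightarrow> (\<forall>k. f k \<in> borel_measurable borel)"

definition at_state :: "nat \<Rightarrow> (real \<Rightarrow> ennreal) \<Rightarrow> nat \<Rightarrow> real \<Rightarrow> ennreal" where
  "at_state j f = (\<lambda>k t. if k = j then f t else 0)"

text \<open>A matrix of measures acting by convolution, described by properties instead of entries.
  Continuity is asked along increasing sequences only, so sums, powers and resolvents stay in the
  class without finiteness conditions.\<close>

definition kop :: "((nat \<Rightarrow> real \<Rightarrow> ennreal) \<Rightarrow> nat \<Rightarrow> real \<Rightarrow> ennreal) \<Rightarrow> bool" where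
  "kop \<Phi> \<longleftrightarrow>
     (\<forall>f. mfun f \<longrightarrow> mfun (\<Phi> f)) \<and>
     (\<forall>f g. mfun f \<longrightarrow> mfun g \<longrightarrow> \<Phi> (\<lambda>k t. f k t + g k t) = (\<lambda>k t. \<Phi> f k t + \<Phi> g k t)) \<and>
     (\<forall>c f. mfun f \<longrightarrow> \<Phi> (\<lambda>k t. c * f k t) = (\<lambda>k t. c * \<Phi> f k t)) \<and>
     (\<forall>f. (\<forall>n. mfun (f n)) \<longrightarrow> incseq f \<longrightarrow>
        \<Phi> (\<lambda>k t. SUP n. f n k t) = (\<lambda>k t. SUP n. \<Phi> (f n) k t)) \<and>
     (\<forall>a f. mfun f \<longrightarrow> \<Phi> (\<lambda>k t. f k (t - a)) = (\<lambda>k t. \<Phi> f k (t - a)))"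

lemma mfunD [measurable_dest]: "mfun f \<Longrightarrow> f k \<in> borel_measurable borel"
  by (simp add: mfun_def)

lemma mfun_at_state [intro, simp]: "f \<in> borel_measurable borel \<Longrightarrow> mfun (at_state j f)"
  by (simp add: mfun_def at_state_def)

lemma mfun_const [simp]: "mfun (\<lambda>k t. c k)"
  by (simp add: mfun_def)

lemma mfun_add [intro]:
  assumes "mfun f" "mfun g" shows "mfun (\<lambda>k t. f k t + g k t)"
  using assms[THEN mfunD, measurable] by (simp add: mfun_def)

lemma mfun_cmult [intro]:
  assumes "mfun f" shows "mfun (\<lambda>k t. c k * f k t)"
  using assms[THEN mfunD, measurable] by (simp add: mfun_def)

lemma mfun_sum [intro]:
  assumes "\<And>n. n \<in> A \<Longrightarrow> mfun (f n)" shows "mfun (\<lambda>k t. \<Sum>n\<in>A. f n k t)"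
  using assms[THEN mfunD] by (auto simp: mfun_def intro!: borel_measurable_sum)

lemma mfun_suminf [intro]:
  assumes "\<And>n. mfun (f n)" shows "mfun (\<lambda>k t. \<Sum>n. f n k t)"
  using assms[THEN mfunD, measurable] by (simp add: mfun_def)

lemma mfun_transl [intro]:
  assumes "mfun f" shows "mfun (\<lambda>k t. f k (t - a))"
  using assms[THEN mfunD, measurable] by (simp add: mfun_def)

lemma kop_mfun: "kop \<Phi> \<Longrightarrow> mfun f \<Longrightarrow> mfun (\<Phi> f)"
  and kop_add: "kop \<Phi> \<Longrightarrow> mfun f \<Longrightarrow> mfun g \<Longrightarrow> \<Phi> (\<lambda>k t. f k t + g k t) = (\<lambda>k t. \<Phi> f k t + \<Phi> g k t)"
  and kop_cmult: "kop \<Phi> \<Longrightarrow> mfun f \<Longrightarrow> \<Phi> (\<lambda>k t. c * f k t) = (\<lambda>k t. c * \<Phi> f k t)"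
  and kop_SUP: "kop \<Phi> \<Longrightarrow> (\<And>n. mfun (F n)) \<Longrightarrow> incseq F \<Longrightarrow>
        \<Phi> (\<lambda>k t. SUP n. F n k t) = (\<lambda>k t. SUP n. \<Phi> (F n) k t)"
  and kop_transl: "kop \<Phi> \<Longrightarrow> mfun f \<Longrightarrow> \<Phi> (\<lambda>k t. f k (t - a)) = (\<lambda>k t. \<Phi> f k (t - a))"
  unfolding kop_def by blast+

lemma kop_zero: "kop \<Phi> \<Longrightarrow> \<Phi> (\<lambda>k t. 0) = (\<lambda>k t. 0)"
  using kop_cmult[of \<Phi> "\<lambda>k t. 0" 0] by simp

text \<open>Monotonicity is continuity along the increasing sequence f, g, g, ..., which avoids the
  difference of functions that may be infinite.\<close>

lemma kop_mono:
  assumes "kop \<Phi>" "mfun f" "mfun g" "\<And>k t. f k t \<le> g k t"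
  shows "\<Phi> f i s \<le> \<Phi> g i s"
proof -
  let ?F = "\<lambda>n::nat. if n = 0 then f else g"
  have inc: "incseq ?F"
    using assms(4) by (auto simp: incseq_def le_fun_def)
  have *: "(\<lambda>k t. SUP n. ?F n k t) = g"
  proof (intro ext antisym)
    fix k t
    show "(SUP n. ?F n k t) \<le> g k t" using assms(4) by (auto intro!: SUP_least)
    show "g k t \<le> (SUP n. ?F n k t)" by (rule SUP_upper2[of 1]) auto
  qed
  have "\<Phi> g = (\<lambda>k t. SUP n. \<Phi> (?F n) k t)"
    using kop_SUP[OF assms(1) _ inc] assms(2,3) unfolding * by simp
  then show ?thesis
    by (auto intro!: SUP_upper2[of 0])
qed

lemma kop_sum:
  assumes "kop \<Phi>" "finite A" "\<And>n. n \<in> A \<Longrightarrow> mfun (f n)"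
  shows "\<Phi> (\<lambda>k t. \<Sum>n\<in>A. f n k t) = (\<lambda>k t. \<Sum>n\<in>A. \<Phi> (f n) k t)"
  using assms(2,3)
proof (induction A rule: finite_induct)
  case empty
  then show ?case using kop_zero[OF assms(1)] by simp
next
  case (insert x F)
  then show ?case
    using kop_add[OF assms(1), of "f x" "\<lambda>k t. \<Sum>n\<in>F. f n k t"] by (auto intro!: mfun_sum)
qed

lemma kop_suminf:
  assumes "kop \<Phi>" "\<And>n. mfun (f n)"
  shows "\<Phi> (\<lambda>k t. \<Sum>n. f n k t) = (\<lambda>k t. \<Sum>n. \<Phi> (f n) k t)"
proof -
  have inc: "incseq (\<lambda>N k t. \<Sum>n<N. f n k t)"
    by (auto simp: incseq_def le_fun_def intro!: sum_mono2)
  have "\<Phi> (\<lambda>k t. SUP N. \<Sum>n<N. f n k t) = (\<lambda>k t. SUP N. \<Phi> (\<lambda>k t. \<Sum>n<N. f n k t) k t)"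
    using assms by (intro kop_SUP inc mfun_sum) auto
  then show ?thesis
    using kop_sum[OF assms(1), of _ f] assms(2) by (simp add: suminf_eq_SUP)
qed

lemma kop_comp:
  assumes "kop \<Phi>" "kop \<Psi>"
  shows "kop (\<lambda>f. \<Phi> (\<Psi> f))"
  unfolding kop_def
proof (intro conjI allI impI)
  fix f :: "nat \<Rightarrow> nat \<Rightarrow> real \<Rightarrow> ennreal" assume f: "\<forall>n. mfun (f n)" "incseq f"
  have "incseq (\<lambda>n. \<Psi> (f n))"
    using f by (auto simp: incseq_def le_fun_def intro!: kop_mono[OF assms(2)])
  then show "\<Phi> (\<Psi> (\<lambda>k t. SUP n. f n k t)) = (\<lambda>k t. SUP n. \<Phi> (\<Psi> (f n)) k t)"
    using f assms by (simp add: kop_SUP[OF assms(2)] kop_SUP[OF assms(1)] kop_mfun)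
qed (use assms in \<open>simp_all add: kop_mfun kop_add kop_cmult kop_transl\<close>)

lemma kop_id: "kop (\<lambda>f. f)"
  by (simp add: kop_def)

lemma kop_funpow: "kop \<Phi> \<Longrightarrow> kop (\<Phi> ^^ n)"
proof (induction n)
  case 0
  then show ?case using kop_id by (simp add: id_def)
next
  case (Suc n)
  then show ?case using kop_comp[of \<Phi> "\<Phi> ^^ n"] by (simp add: comp_def)
qed

lemma kop_sum_op:
  assumes "finite A" "\<And>n. n \<in> A \<Longrightarrow> kop (\<Phi> n)"
  shows "kop (\<lambda>f k t. \<Sum>n\<in>A. \<Phi> n f k t)"
  unfolding kop_def
proof (intro conjI allI impI)
  fix f :: "nat \<Rightarrow> nat \<Rightarrow> real \<Rightarrow> ennreal" assume f: "\<forall>n. mfun (f n)" "incseq f"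
  have "incseq (\<lambda>n. \<Phi> m (f n) k t)" if "m \<in> A" for m k t
    using f assms that by (auto simp: incseq_def le_fun_def intro!: kop_mono[of "\<Phi> m"])
  then show "(\<lambda>k t. \<Sum>m\<in>A. \<Phi> m (\<lambda>k t. SUP n. f n k t) k t) = (\<lambda>k t. SUP n. \<Sum>m\<in>A. \<Phi> m (f n) k t)"
    using f assms by (subst ennreal_SUP_sum) (auto simp: fun_eq_iff kop_SUP intro!: sum.cong)
qed (use assms in \<open>auto simp: kop_add kop_cmult kop_transl sum.distrib sum_distrib_left intro!: mfun_sum intro: kop_mfun\<close>)

lemma kop_suminf_op:
  assumes "\<And>n. kop (\<Phi> n)"
  shows "kop (\<lambda>f k t. \<Sum>n. \<Phi> n f k t)"
  unfolding kop_def
proof (intro conjI allI impI)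
  fix f :: "nat \<Rightarrow> nat \<Rightarrow> real \<Rightarrow> ennreal" assume f: "\<forall>n. mfun (f n)" "incseq f"
  have "incseq (\<lambda>n. \<Phi> m (f n) k t)" for m k t
    using f assms by (auto simp: incseq_def le_fun_def intro!: kop_mono[of "\<Phi> m"])
  then show "(\<lambda>k t. \<Sum>m. \<Phi> m (\<lambda>k t. SUP n. f n k t) k t) = (\<lambda>k t. SUP n. \<Sum>m. \<Phi> m (f n) k t)"
    using f assms by (subst ennreal_suminf_SUP_eq[symmetric]) (auto simp: fun_eq_iff kop_SUP intro!: suminf_cong)
qed (use assms in \<open>auto simp: kop_add kop_cmult kop_transl suminf_add[symmetric] intro!: mfun_suminf intro: kop_mfun\<close>)

text \<open>The operators act through f (t - x), so at t = 0 a set \<open>B\<close> has to be fed in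
  reflected to come out as the measure of \<open>B\<close>.\<close>

definition kop_measure ::
    "((nat \<Rightarrow> real \<Rightarrow> ennreal) \<Rightarrow> nat \<Rightarrow> real \<Rightarrow> ennreal) \<Rightarrow> nat \<Rightarrow> nat \<Rightarrow> real measure" where
  "kop_measure \<Phi> i j =
     measure_of UNIV (sets borel) (\<lambda>B. \<Phi> (at_state j (\<lambda>x. indicator B (- x))) i 0)"

lemma sets_kop_measure [simp, measurable_cong]: "sets (kop_measure \<Phi> i j) = sets borel"
  unfolding kop_measure_def by (metis sets.sets_measure_of_eq space_borel)

lemma space_kop_measure [simp]: "space (kop_measure \<Phi> i j) = UNIV"
  unfolding kop_measure_def by (simp add: space_measure_of_conv)

lemma emeasure_kop_measure:
  assumes "kop \<Phi>" "B \<in> sets borel"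
  shows "emeasure (kop_measure \<Phi> i j) B = \<Phi> (at_state j (\<lambda>x. indicator B (- x))) i 0"
proof (rule emeasure_measure_of[OF kop_measure_def])
  have "at_state j (\<lambda>x. 0) = (\<lambda>k t. 0)" by (simp add: at_state_def fun_eq_iff)
  then show "positive (sets (kop_measure \<Phi> i j)) (\<lambda>B. \<Phi> (at_state j (\<lambda>x. indicator B (- x))) i 0)"
    using kop_zero[OF assms(1)] by (simp add: positive_def)
  show "countably_additive (sets (kop_measure \<Phi> i j)) (\<lambda>B. \<Phi> (at_state j (\<lambda>x. indicator B (- x))) i 0)"
  proof (rule countably_additiveI)
    fix A :: "nat \<Rightarrow> real set"
    assume A: "range A \<subseteq> sets (kop_measure \<Phi> i j)" "disjoint_family A"
    then have [measurable]: "A n \<in> sets borel" for n by auto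
    have "at_state j (\<lambda>x. indicator (\<Union>n. A n) (- x)) =
        (\<lambda>k t. \<Sum>n. at_state j (\<lambda>x. indicator (A n) (- x)) k t)"
      using A(2) by (auto simp: at_state_def fun_eq_iff suminf_indicator)
    then show "(\<Sum>n. \<Phi> (at_state j (\<lambda>x. indicator (A n) (- x))) i 0) =
        \<Phi> (at_state j (\<lambda>x. indicator (\<Union>n. A n) (- x))) i 0"
      using kop_suminf[OF assms(1), of "\<lambda>n. at_state j (\<lambda>x. indicator (A n) (- x))"] by simp
  qed
qed (use assms in auto)

lemma nn_integral_kop_measure0:
  assumes \<Phi>: "kop \<Phi>" and f: "f \<in> borel_measurable borel"
  shows "(\<integral>\<^sup>+x. f x \<partial>kop_measure \<Phi> i j) = \<Phi> (at_state j (\<lambda>x. f (- x))) i 0"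
  using f
proof (induction rule: borel_measurable_induct)
  case (cong f g)
  have "f = g" by (rule ext) (rule cong.hyps(3), simp)
  with cong.IH show ?case by (simp only:)
next
  case (set A)
  then show ?case using \<Phi> by (simp add: emeasure_kop_measure)
next
  case (mult u c)
  have m: "(\<lambda>x. u (- x)) \<in> borel_measurable borel"
    using mult.hyps(2) by (rule measurable_compose[rotated]) simp
  have "at_state j (\<lambda>x. c * u (- x)) = (\<lambda>k t. c * at_state j (\<lambda>x. u (- x)) k t)"
    by (simp add: at_state_def fun_eq_iff)
  then have "\<Phi> (at_state j (\<lambda>x. c * u (- x))) i 0 = c * \<Phi> (at_state j (\<lambda>x. u (- x))) i 0"
    using kop_cmult[OF \<Phi> mfun_at_state[OF m]] by simp
  also have "\<dots> = (\<integral>\<^sup>+x. c * u x \<partial>kop_measure \<Phi> i j)"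
    unfolding mult.IH[symmetric] using mult.hyps(2) by (subst nn_integral_cmult) simp_all
  finally show ?case by (rule sym)
next
  case (add u v)
  have m: "(\<lambda>x. u (- x)) \<in> borel_measurable borel" "(\<lambda>x. v (- x)) \<in> borel_measurable borel"
    by (rule measurable_compose[OF _ add.hyps(1)] measurable_compose[OF _ add.hyps(3)], simp)+
  have "at_state j (\<lambda>x. v (- x) + u (- x)) = (\<lambda>k t. at_state j (\<lambda>x. v (- x)) k t + at_state j (\<lambda>x. u (- x)) k t)"
    by (simp add: at_state_def fun_eq_iff)
  then have "\<Phi> (at_state j (\<lambda>x. v (- x) + u (- x))) i 0 =
      \<Phi> (at_state j (\<lambda>x. v (- x))) i 0 + \<Phi> (at_state j (\<lambda>x. u (- x))) i 0"
    using kop_add[OF \<Phi> mfun_at_state[OF m(2)] mfun_at_state[OF m(1)]] by simp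
  also have "\<dots> = (\<integral>\<^sup>+x. v x + u x \<partial>kop_measure \<Phi> i j)"
    unfolding add.IH[symmetric] using add.hyps(1,3) by (subst nn_integral_add) simp_all
  finally show ?case by (rule sym)
next
  case (seq U)
  have S: "(SUP i. U i) = (\<lambda>x. SUP i. U i x)"
    by (rule ext) (rule SUP_apply)
  have a: "at_state j (\<lambda>x. SUP i. U i (- x)) = (\<lambda>k t. SUP n. at_state j (\<lambda>x. U n (- x)) k t)"
    by (simp add: at_state_def fun_eq_iff)
  have b: "(\<lambda>x. U n (- x)) \<in> borel_measurable borel" for n
    using seq.hyps(1)[of n] by (rule measurable_compose[rotated]) simp
  have c: "incseq (\<lambda>n. at_state j (\<lambda>x. U n (- x)))"
    using \<open>incseq U\<close> by (auto simp: incseq_def le_fun_def at_state_def)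
  have d: "(\<integral>\<^sup>+x. (SUP i. U i x) \<partial>kop_measure \<Phi> i j) = (SUP n. \<integral>\<^sup>+x. U n x \<partial>kop_measure \<Phi> i j)"
    using seq.hyps(1) \<open>incseq U\<close> by (intro nn_integral_monotone_convergence_SUP) simp_all
  have "\<Phi> (at_state j (\<lambda>x. SUP i. U i (- x))) = (\<lambda>k t. SUP n. \<Phi> (at_state j (\<lambda>x. U n (- x))) k t)"
    unfolding a by (rule kop_SUP[OF \<Phi> _ c]) (rule mfun_at_state[OF b])
  then have e: "\<Phi> (at_state j (\<lambda>x. SUP i. U i (- x))) i 0 = (SUP n. \<Phi> (at_state j (\<lambda>x. U n (- x))) i 0)"
    by simp
  have "(\<integral>\<^sup>+x. (SUP i. U i x) \<partial>kop_measure \<Phi> i j) = \<Phi> (at_state j (\<lambda>x. SUP i. U i (- x))) i 0"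
    unfolding d e by (rule SUP_cong[OF refl seq.IH])
  then show ?case
    by (simp only: S)
qed

lemma nn_integral_kop_measure:
  assumes \<Phi>: "kop \<Phi>" and f: "f \<in> borel_measurable borel"
  shows "(\<integral>\<^sup>+x. f (t - x) \<partial>kop_measure \<Phi> i j) = \<Phi> (at_state j f) i t"
proof -
  have "\<Phi> (at_state j f) i (0 - - t) = \<Phi> (\<lambda>k s. at_state j f k (s - - t)) i 0"
    using kop_transl[OF \<Phi>, of "at_state j f" "- t"] f by simp
  also have "\<dots> = \<Phi> (at_state j (\<lambda>s. f (t + s))) i 0"
    by (simp add: at_state_def add.commute)
  finally show ?thesis
    using nn_integral_kop_measure0[OF \<Phi>, of "\<lambda>x. f (t - x)"] f by simp
qed

text \<open>All arrivals at states other than \<open>j\<close> are discarded; this is how lower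
  bounds are chained along a path of states.\<close>

lemma kop_ge_at_state:
  assumes "kop \<Phi>" "mfun f"
  shows "\<Phi> f i t \<ge> (\<integral>\<^sup>+x. f j (t - x) \<partial>kop_measure \<Phi> i j)"
  unfolding nn_integral_kop_measure[OF assms(1) mfunD[OF assms(2)]]
  by (rule kop_mono[OF assms(1) mfun_at_state[OF mfunD[OF assms(2)]] assms(2)]) (simp add: at_state_def)

section \<open>Markov random walks and the stationary flux\<close>

lemma mfun_comp [measurable (raw)]:
  assumes "mfun f" "g \<in> measurable N (count_space UNIV)" "h \<in> borel_measurable N"
  shows "(\<lambda>x. f (g x) (h x)) \<in> borel_measurable N"
proof (rule measurable_compose_countable[where f = "\<lambda>k x. f k (h x)" and g = g])
  fix k
  note mfunD[OF assms(1), measurable] assms(3)[measurable]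
  show "(\<lambda>x. f k (h x)) \<in> borel_measurable N" by measurable
qed (rule assms(2))

locale markov_walk =
  fixes K :: "nat \<Rightarrow> (nat \<times> real) measure" and S :: "nat set"
  assumes prob_K: "prob_space (K i)"
    and sets_K [measurable_cong, simp]: "sets (K i) = sets (count_space UNIV \<Otimes>\<^sub>M borel)"
    and K_in_S: "AE z in K i. fst z \<in> S"
begin

lemma space_K [simp]: "space (K i) = UNIV"
  using sets_eq_imp_space_eq[OF sets_K] by (simp add: space_pair_measure)

lemma emeasure_K_UNIV [simp]: "emeasure (K i) UNIV = 1"
  using prob_space.emeasure_space_1[OF prob_K, of i] by simp

lemma sigma_finite_K: "sigma_finite_measure (K i)"
  using prob_K prob_space_imp_sigma_finite by blast

text \<open>A point \<open>z\<close> of \<open>K i\<close> is the pair (next state, increment). With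
  the minus sign, \<open>op ^^ n\<close> turns the half-line function \<open>indicator {0..}\<close>
  at \<open>j\<close> into the distribution function of the n-step displacement on arrival at
  \<open>j\<close>, as in \<open>conv_power\<close>.\<close>

definition op :: "(nat \<Rightarrow> real \<Rightarrow> ennreal) \<Rightarrow> nat \<Rightarrow> real \<Rightarrow> ennreal" where
  "op f i t = (\<integral>\<^sup>+z. f (fst z) (t - snd z) \<partial>K i)"

lemma kop_op: "kop op"
  unfolding kop_def
proof (intro conjI allI impI)
  fix f :: "nat \<Rightarrow> real \<Rightarrow> ennreal" assume f: "mfun f"
  note f[measurable]
  show "mfun (op f)"
    unfolding mfun_def op_def
    by (intro allI sigma_finite_measure.borel_measurable_nn_integral[OF sigma_finite_K]) measurable
  fix c
  show "op (\<lambda>k t. c * f k t) = (\<lambda>k t. c * op f k t)"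
    unfolding op_def by (intro ext nn_integral_cmult) measurable
  show "op (\<lambda>k t. f k (t - a)) = (\<lambda>k t. op f k (t - a))" for a
    unfolding op_def by (simp add: algebra_simps)
  fix g :: "nat \<Rightarrow> real \<Rightarrow> ennreal" assume g: "mfun g"
  note g[measurable]
  show "op (\<lambda>k t. f k t + g k t) = (\<lambda>k t. op f k t + op g k t)"
    unfolding op_def by (intro ext nn_integral_add) measurable
next
  fix f :: "nat \<Rightarrow> nat \<Rightarrow> real \<Rightarrow> ennreal" assume f: "\<forall>n. mfun (f n)" "incseq f"
  note f(1)[rule_format, measurable]
  show "op (\<lambda>k t. SUP n. f n k t) = (\<lambda>k t. SUP n. op (f n) k t)"
    unfolding op_def
    by (intro ext nn_integral_monotone_convergence_SUP) (use f(2) in \<open>auto simp: incseq_def le_fun_def\<close>)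
qed

lemma kop_opn: "kop (op ^^ n)"
  by (rule kop_funpow[OF kop_op])

lemma op_const: "op (\<lambda>k t. c) = (\<lambda>k t. c)"
  by (simp add: op_def fun_eq_iff)

lemma opn_const: "(op ^^ n) (\<lambda>k t. c) = (\<lambda>k t. c)"
  by (induction n) (simp_all add: op_const)

lemma opn_bounded:
  assumes "mfun f" "\<And>k t. f k t \<le> c"
  shows "(op ^^ n) f i t \<le> c"
  using kop_mono[OF kop_opn assms(1), of "\<lambda>k t. c" n i t] assms by (simp add: opn_const)

lemma emeasure_opn_le_1: "emeasure (kop_measure (op ^^ n) i j) UNIV \<le> 1"
  by (subst emeasure_kop_measure[OF kop_opn])
     (auto simp: at_state_def mfun_def intro!: opn_bounded)

lemma finite_opn: "finite_measure (kop_measure (op ^^ n) i j)"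
  using emeasure_opn_le_1[of n i j] by (intro finite_measureI) (auto simp: top_unique)

end

text \<open>With \<open>s\<close> the position relative to a level, \<open>cut_pos x s\<close> says
  that a jump by \<open>x\<close> takes mass from at or below the level to above it, and
  \<open>cut_neg\<close> the reverse. Integrating over \<open>s\<close> gives the positive and the
  negative part of \<open>x\<close>, which is how the mean drift enters. The half-open intervals
  match \<open>indicator {..t}\<close>.\<close>

definition cut_pos :: "real \<Rightarrow> real \<Rightarrow> ennreal" where
  "cut_pos x s = (if - max x 0 < s \<and> s \<le> 0 then 1 else 0)"

definition cut_neg :: "real \<Rightarrow> real \<Rightarrow> ennreal" where
  "cut_neg x s = (if 0 < s \<and> s \<le> max (- x) 0 then 1 else 0)"

lemma cut_measurable [measurable]:
  "case_prod cut_pos \<in> borel_measurable (borel \<Otimes>\<^sub>M borel)"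
  "case_prod cut_neg \<in> borel_measurable (borel \<Otimes>\<^sub>M borel)"
  unfolding cut_pos_def[abs_def] cut_neg_def[abs_def] by measurable

lemma nn_integral_cut:
  "(\<integral>\<^sup>+s. cut_pos x s \<partial>lborel) = ennreal (max x 0)"
  "(\<integral>\<^sup>+s. cut_neg x s \<partial>lborel) = ennreal (max (- x) 0)"
proof -
  have "(\<integral>\<^sup>+s. cut_pos x s \<partial>lborel) = (\<integral>\<^sup>+s. indicator {- max x 0<..0} s \<partial>lborel)"
    by (intro nn_integral_cong) (auto simp: cut_pos_def split: split_indicator)
  then show "(\<integral>\<^sup>+s. cut_pos x s \<partial>lborel) = ennreal (max x 0)" by simp
  have "(\<integral>\<^sup>+s. cut_neg x s \<partial>lborel) = (\<integral>\<^sup>+s. indicator {0<..max (- x) 0} s \<partial>lborel)"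
    by (intro nn_integral_cong) (auto simp: cut_neg_def split: split_indicator)
  then show "(\<integral>\<^sup>+s. cut_neg x s \<partial>lborel) = ennreal (max (- x) 0)" by simp
qed

lemma nn_integral_shift:
  fixes f :: "real \<Rightarrow> ennreal"
  assumes [measurable]: "f \<in> borel_measurable borel"
  shows "(\<integral>\<^sup>+s. f (t + s) \<partial>lborel) = (\<integral>\<^sup>+s. f s \<partial>lborel)"
  by (subst nn_integral_real_affine[of f 1 t]) (auto simp: one_ennreal_def[symmetric])

lemma nn_integral_reflect:
  fixes f :: "real \<Rightarrow> ennreal"
  assumes [measurable]: "f \<in> borel_measurable borel"
  shows "(\<integral>\<^sup>+s. f (t - s) \<partial>lborel) = (\<integral>\<^sup>+s. f s \<partial>lborel)"
  by (subst nn_integral_real_affine[of f "-1" t]) (auto simp: one_ennreal_def[symmetric])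

text \<open>Splits the half line up to \<open>t\<close> at \<open>t - x\<close>, for either sign of \<open>x\<close>.\<close>

lemma half_line_split:
  fixes g :: "real \<Rightarrow> ennreal"
  assumes [measurable]: "g \<in> borel_measurable borel"
  shows "(\<integral>\<^sup>+s. indicator {..t} s * g (s - x) \<partial>lborel) + (\<integral>\<^sup>+s. cut_pos x s * g (t + s) \<partial>lborel) =
         (\<integral>\<^sup>+s. indicator {..t} s * g s \<partial>lborel) + (\<integral>\<^sup>+s. cut_neg x s * g (t + s) \<partial>lborel)"
proof -
  have 1: "(\<integral>\<^sup>+s. indicator {..t} s * g (s - x) \<partial>lborel) = (\<integral>\<^sup>+s. indicator {..-x} s * g (t + s) \<partial>lborel)"
    by (subst nn_integral_shift[of _ "t + x", symmetric])
       (auto intro!: nn_integral_cong simp: algebra_simps split: split_indicator)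
  have 2: "(\<integral>\<^sup>+s. indicator {..t} s * g s \<partial>lborel) = (\<integral>\<^sup>+s. indicator {..0} s * g (t + s) \<partial>lborel)"
    by (subst nn_integral_shift[of _ t, symmetric])
       (auto intro!: nn_integral_cong simp: algebra_simps split: split_indicator)
  show ?thesis
    unfolding 1 2
    by (subst (1 2) nn_integral_add[symmetric])
       (auto intro!: nn_integral_cong simp: cut_pos_def cut_neg_def max_def split: split_indicator)
qed

locale stationary_walk = markov_walk K S
  for K :: "nat \<Rightarrow> (nat \<times> real) measure" and S :: "nat set" +
  fixes W :: "nat measure"
  assumes sets_W [measurable_cong, simp]: "sets W = UNIV"
    and W_pos: "i \<in> S \<Longrightarrow> emeasure W {i} > 0"
    and W_fin: "emeasure W {i} < \<infinity>"
    and W_inv: "(\<integral>\<^sup>+i. (\<integral>\<^sup>+z. f (fst z) \<partial>K i) \<partial>W) = (\<integral>\<^sup>+i. f i \<partial>W)"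
begin

lemma measurable_W [simp, measurable]: "f \<in> borel_measurable W"
  using measurable_count_space_eq1[of f UNIV borel] sets_W
  by (auto simp: measurable_def sets_eq_imp_space_eq[of W "count_space UNIV"])

lemma space_W [simp]: "space W = UNIV"
  using sets_eq_imp_space_eq[of W "count_space UNIV"] by simp

lemma nn_integral_W_at: "(\<integral>\<^sup>+i. at_state j f i t \<partial>W) = f t * emeasure W {j}"
proof -
  have "(\<integral>\<^sup>+i. at_state j f i t \<partial>W) = (\<integral>\<^sup>+i. f t * indicator {j} i \<partial>W)"
    by (intro nn_integral_cong) (auto simp: at_state_def)
  then show ?thesis by (simp add: nn_integral_cmult)
qed

definition flux :: "(real \<Rightarrow> real \<Rightarrow> ennreal) \<Rightarrow> (nat \<Rightarrow> real \<Rightarrow> ennreal) \<Rightarrow> ennreal" where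
  "flux c g = (\<integral>\<^sup>+i. (\<integral>\<^sup>+z. (\<integral>\<^sup>+s. c (snd z) s * g (fst z) s \<partial>lborel) \<partial>K i) \<partial>W)"

definition half_mass :: "(nat \<Rightarrow> real \<Rightarrow> ennreal) \<Rightarrow> real \<Rightarrow> ennreal" where
  "half_mass g t = (\<integral>\<^sup>+i. (\<integral>\<^sup>+s. indicator {..t} s * g i s \<partial>lborel) \<partial>W)"

lemma flux_inner_measurable:
  assumes [measurable]: "case_prod c \<in> borel_measurable (borel \<Otimes>\<^sub>M borel)" and g[measurable]: "mfun g"
  shows "(\<lambda>z. \<integral>\<^sup>+s. c (snd z) s * g (fst z) s \<partial>lborel) \<in> borel_measurable (K i)"
  by (intro lborel.borel_measurable_nn_integral) measurable

text \<open>One step preserves the total weight on states by \<open>W_inv\<close>, so the mass below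
  \<open>t\<close> changes only by what crosses \<open>t\<close>. Both crossing terms are added
  rather than subtracted because every term may be infinite.\<close>

lemma flux_identity:
  assumes g: "mfun g"
  shows "half_mass (op g) t + flux cut_pos (\<lambda>k s. g k (t + s)) =
         half_mass g t + flux cut_neg (\<lambda>k s. g k (t + s))"
proof -
  note g[measurable]
  define G where "G k = (\<integral>\<^sup>+s. indicator {..t} s * g k s \<partial>lborel)" for k
  have g': "mfun (\<lambda>k s. g k (t + s))" using mfun_transl[OF g, of "- t"] by (simp add: add.commute)
  have 1: "(\<integral>\<^sup>+s. indicator {..t} s * op g i s \<partial>lborel) =
      (\<integral>\<^sup>+z. (\<integral>\<^sup>+s. indicator {..t} s * g (fst z) (s - snd z) \<partial>lborel) \<partial>K i)" for i
  proof -
    interpret k: sigma_finite_measure "K i" by (rule sigma_finite_K)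
    interpret pair_sigma_finite "K i" lborel ..
    have "(\<integral>\<^sup>+s. indicator {..t} s * op g i s \<partial>lborel) =
        (\<integral>\<^sup>+s. (\<integral>\<^sup>+z. indicator {..t} s * g (fst z) (s - snd z) \<partial>K i) \<partial>lborel)"
      unfolding op_def by (intro nn_integral_cong nn_integral_cmult[symmetric]) measurable
    also have "\<dots> = (\<integral>\<^sup>+z. (\<integral>\<^sup>+s. indicator {..t} s * g (fst z) (s - snd z) \<partial>lborel) \<partial>K i)"
      by (rule Fubini') measurable
    finally show ?thesis .
  qed
  have m1: "(\<lambda>z. \<integral>\<^sup>+s. indicator {..t} s * g (fst z) (s - snd z) \<partial>lborel) \<in> borel_measurable (K i)" for i
    by (intro lborel.borel_measurable_nn_integral) measurable
  have "(\<integral>\<^sup>+z. (\<integral>\<^sup>+s. indicator {..t} s * g (fst z) (s - snd z) \<partial>lborel) \<partial>K i) +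
      (\<integral>\<^sup>+z. (\<integral>\<^sup>+s. cut_pos (snd z) s * g (fst z) (t + s) \<partial>lborel) \<partial>K i) =
      (\<integral>\<^sup>+z. G (fst z) \<partial>K i) +
      (\<integral>\<^sup>+z. (\<integral>\<^sup>+s. cut_neg (snd z) s * g (fst z) (t + s) \<partial>lborel) \<partial>K i)" for i
    unfolding G_def
    using flux_inner_measurable[OF _ g', of cut_pos] flux_inner_measurable[OF _ g', of cut_neg] m1
    by (subst (1 2) nn_integral_add[symmetric])
       (auto intro!: nn_integral_cong half_line_split lborel.borel_measurable_nn_integral mfunD[OF g])
  then have "half_mass (op g) t + flux cut_pos (\<lambda>k s. g k (t + s)) =
      (\<integral>\<^sup>+i. (\<integral>\<^sup>+z. G (fst z) \<partial>K i) \<partial>W) + flux cut_neg (\<lambda>k s. g k (t + s))"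
    unfolding half_mass_def flux_def 1 by (subst (1 2) nn_integral_add[symmetric]) auto
  then show ?thesis
    unfolding W_inv by (simp add: half_mass_def G_def[abs_def])
qed

end

section \<open>Bounded harmonic functions\<close>

text \<open>Boundedness and a Lipschitz constant, both uniform in the state: a class closed under
  translations and pointwise limits, and sequentially compact for pointwise convergence.\<close>

definition tame :: "real \<Rightarrow> real \<Rightarrow> (nat \<Rightarrow> real \<Rightarrow> real) \<Rightarrow> bool" where
  "tame C L \<gamma> \<longleftrightarrow> (\<forall>i t. \<bar>\<gamma> i t\<bar> \<le> C) \<and> (\<forall>i t s. \<bar>\<gamma> i t - \<gamma> i s\<bar> \<le> L * \<bar>t - s\<bar>)"

lemma tameD: "tame C L \<gamma> \<Longrightarrow> \<bar>\<gamma> i t\<bar> \<le> C" "tame C L \<gamma> \<Longrightarrow> \<bar>\<gamma> i t - \<gamma> i s\<bar> \<le> L * \<bar>t - s\<bar>"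
  by (auto simp: tame_def)

lemma tame_nonneg: assumes "tame C L \<gamma>" shows "C \<ge> 0" "L \<ge> 0"
  using order_trans[OF abs_ge_zero tameD(1)[OF assms, of 0 0]]
    order_trans[OF abs_ge_zero tameD(2)[OF assms, of 0 0 1]] by auto

lemma tame_shift: "tame C L \<gamma> \<Longrightarrow> tame C L (\<lambda>k t. \<gamma> k (a + t))"
  by (fastforce simp: tame_def intro: order_trans)

lemma tame_uminus: "tame C L \<gamma> \<Longrightarrow> tame C L (\<lambda>k t. - \<gamma> k t)"
  by (fastforce simp: tame_def abs_minus_commute)

lemma tame_continuous:
  assumes "tame C L \<gamma>" shows "continuous_on UNIV (\<gamma> i)"
proof (rule continuous_on_iff[THEN iffD2], intro ballI allI impI)
  fix x e :: real assume "e > 0"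
  have L: "L \<ge> 0" using tame_nonneg[OF assms] by simp
  have "\<bar>\<gamma> i x' - \<gamma> i x\<bar> < e" if "dist x' x < e / (L + 1)" for x'
  proof -
    have "\<bar>\<gamma> i x' - \<gamma> i x\<bar> \<le> L * \<bar>x' - x\<bar>" by (rule tameD(2)[OF assms])
    also have "\<dots> \<le> (L + 1) * \<bar>x' - x\<bar>" by (simp add: mult_right_mono)
    also have "\<dots> < e" using that L by (simp add: dist_real_def field_simps)
    finally show ?thesis .
  qed
  then show "\<exists>d>0. \<forall>x'\<in>UNIV. dist x' x < d \<longrightarrow> dist (\<gamma> i x') (\<gamma> i x) < e"
    using \<open>e > 0\<close> L by (intro exI[of _ "e / (L + 1)"]) (auto simp: dist_real_def)
qed

lemma tame_measurable: "tame C L \<gamma> \<Longrightarrow> \<gamma> i \<in> borel_measurable borel"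
  by (rule borel_measurable_continuous_onI[OF tame_continuous])

lemma tame_limit:
  assumes "\<And>n. tame C L (G n)" "\<And>i t. (\<lambda>n. G n i t) \<longlonglongrightarrow> \<gamma> i t"
  shows "tame C L \<gamma>"
  unfolding tame_def
proof (intro conjI allI)
  show "\<bar>\<gamma> i t\<bar> \<le> C" for i t
    using tameD(1)[OF assms(1)]
    by (intro LIMSEQ_le_const2[OF tendsto_rabs[OF assms(2)]]) auto
  show "\<bar>\<gamma> i t - \<gamma> i s\<bar> \<le> L * \<bar>t - s\<bar>" for i t s
    using tameD(2)[OF assms(1)]
    by (intro LIMSEQ_le_const2[OF tendsto_rabs[OF tendsto_diff[OF assms(2) assms(2)]]]) auto
qed

text \<open>Arzela-Ascoli: a diagonal sequence converges at all pairs (state, rational), and the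
  common Lipschitz constant extends the convergence to real arguments.\<close>

lemma tame_convergent_subsequence:
  fixes G :: "nat \<Rightarrow> nat \<Rightarrow> real \<Rightarrow> real"
  assumes G: "\<And>n. tame C L (G n)"
  obtains r \<gamma> where "strict_mono (r :: nat \<Rightarrow> nat)" "tame C L \<gamma>" "\<And>i t. (\<lambda>n. G (r n) i t) \<longlonglongrightarrow> \<gamma> i t"
proof -
  define \<sigma> :: "nat \<Rightarrow> nat \<times> rat" where "\<sigma> = from_nat"
  define P where "P n s = convergent (\<lambda>k. G (s k) (fst (\<sigma> n)) (of_rat (snd (\<sigma> n))))" for n and s :: "nat \<Rightarrow> nat"
  interpret subseqs P
  proof
    fix n and s :: "nat \<Rightarrow> nat"
    have "seq_compact {-C..C}" by (rule compact_imp_seq_compact) simp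
    moreover have "G m i t \<in> {-C..C}" for m i t
      using tameD(1)[OF G, of m i t] by auto
    then have "\<forall>k. G (s k) (fst (\<sigma> n)) (of_rat (snd (\<sigma> n))) \<in> {-C..C}"
      by blast
    ultimately obtain l r where "strict_mono r" "((\<lambda>k. G (s k) (fst (\<sigma> n)) (of_rat (snd (\<sigma> n)))) \<circ> r) \<longlonglongrightarrow> l"
      unfolding seq_compact_def by metis
    then show "\<exists>r'. strict_mono r' \<and> P n (s \<circ> r')"
      unfolding P_def convergent_def comp_def by blast
  qed
  have "P k (diagseq \<circ> ((+) (Suc k)))" for k
  proof (rule diagseq_holds)
    fix r s :: "nat \<Rightarrow> nat" and n assume "strict_mono r" "P n s"
    then show "P n (s \<circ> r)"
      unfolding P_def convergent_def using LIMSEQ_subseq_LIMSEQ by (fastforce simp: comp_def)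
  qed
  then have *: "P k (diagseq \<circ> ((+) (Suc k)))" for k .
  have conv: "convergent (\<lambda>k. G (diagseq k) i (of_rat q))" for i q
  proof -
    have "convergent (\<lambda>m. G (diagseq (m + Suc (to_nat (i, q)))) i (of_rat q))"
      using *[of "to_nat (i, q)"] unfolding P_def[of "to_nat (i, q)" "diagseq \<circ> _"]
      by (simp add: \<sigma>_def comp_def add.commute)
    then show ?thesis
      by (subst (asm) convergent_ignore_initial_segment)
  qed
  have L: "L \<ge> 0" using tame_nonneg[OF G] by simp
  have conv': "Cauchy (\<lambda>k. G (diagseq k) i t)" for i t
  proof (rule metric_CauchyI)
    fix e :: real assume "e > 0"
    \<comment> \<open>\<open>L + 1\<close> replaces \<open>L\<close> to allow \<open>L = 0\<close>;
      each of the two comparisons with the rational point then costs at most e / 4.\<close>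
    obtain q where q: "t < of_rat q" "of_rat q < t + e / (4 * (L + 1))"
      using of_rat_dense[of t "t + e / (4 * (L + 1))"] \<open>e > 0\<close> L by auto
    have "Cauchy (\<lambda>k. G (diagseq k) i (of_rat q))"
      using conv by (rule convergent_Cauchy)
    then obtain M where M: "\<And>m n. m \<ge> M \<Longrightarrow> n \<ge> M \<Longrightarrow>
        dist (G (diagseq m) i (of_rat q)) (G (diagseq n) i (of_rat q)) < e / 2"
      using metric_CauchyD[of "\<lambda>k. G (diagseq k) i (of_rat q)" "e / 2"] \<open>e > 0\<close> by auto
    have near: "\<bar>G (diagseq m) i t - G (diagseq m) i (of_rat q)\<bar> \<le> e / 4" for m
    proof -
      have "\<bar>G (diagseq m) i t - G (diagseq m) i (of_rat q)\<bar> \<le> L * \<bar>t - of_rat q\<bar>"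
        by (rule tameD(2)[OF G])
      also have "\<dots> \<le> (L + 1) * (e / (4 * (L + 1)))"
        using q L by (intro mult_mono) auto
      also have "\<dots> = e / 4" using L by (simp add: divide_simps)
      finally show ?thesis .
    qed
    show "\<exists>M. \<forall>m\<ge>M. \<forall>n\<ge>M. dist (G (diagseq m) i t) (G (diagseq n) i t) < e"
    proof (intro exI[of _ M] allI impI)
      fix m n assume "m \<ge> M" "n \<ge> M"
      from M[OF this] near[of m] near[of n]
      show "dist (G (diagseq m) i t) (G (diagseq n) i t) < e" unfolding dist_real_def by linarith
    qed
  qed
  then have lim: "(\<lambda>k. G (diagseq k) i t) \<longlonglongrightarrow> lim (\<lambda>k. G (diagseq k) i t)" for i t
    using Cauchy_convergent convergent_LIMSEQ_iff by blast
  show ?thesis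
    by (rule that[OF subseq_diagseq tame_limit[of C L "\<lambda>k. G (diagseq k)", OF G lim] lim])
qed

text \<open>A triangular bump of height \<open>c\<close> and half-width \<open>d\<close> around
  \<open>a\<close>. A continuous bump is taken instead of an interval because its Lipschitz bound
  makes the potential of the bump Lipschitz.\<close>

definition tent :: "real \<Rightarrow> real \<Rightarrow> real \<Rightarrow> real \<Rightarrow> real" where
  "tent c a d y = c * max 0 (1 - \<bar>y - a\<bar> / d)"

lemma continuous_tent [continuous_intros]: "continuous_on A (tent c a d)"
  unfolding tent_def[abs_def] divide_inverse by (intro continuous_intros)

lemma measurable_tent [measurable]: "tent c a d \<in> borel_measurable borel"
  by (rule borel_measurable_continuous_onI[OF continuous_tent])

lemma tent_nonneg: "c \<ge> 0 \<Longrightarrow> tent c a d y \<ge> 0"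
  by (simp add: tent_def)

lemma tent_pos: "c > 0 \<Longrightarrow> d > 0 \<Longrightarrow> \<bar>y - a\<bar> < d \<Longrightarrow> tent c a d y > 0"
  by (simp add: tent_def max_def field_simps)

text \<open>Domination of the density \<open>tent c a d\<close> by the diagonal entry of
  \<open>op ^^ p\<close>, tested against functions. The entry is diagonal because the propagation of
  maxima and the splitting of the potential both work at one fixed state.\<close>

definition (in markov_walk) spread_at :: "nat \<Rightarrow> nat \<Rightarrow> real \<Rightarrow> real \<Rightarrow> real \<Rightarrow> bool" where
  "spread_at i p c a d \<longleftrightarrow> p \<ge> 1 \<and> c > 0 \<and> d > 0 \<and>
     (\<forall>f\<in>borel_measurable borel. \<forall>t.
        (\<integral>\<^sup>+y. ennreal (tent c a d y) * f (t - y) \<partial>lborel) \<le> (op ^^ p) (at_state i f) i t)"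

text \<open>The interface between matrix and analysis; \<open>Q\<close> no longer occurs. The strict
  \<open>ennreal\<close> inequality \<open>drift\<close> contains finiteness of the negative part
  and still admits an infinite positive part.\<close>

locale renewal_walk = stationary_walk K S W
  for K :: "nat \<Rightarrow> (nat \<times> real) measure" and S :: "nat set" and W :: "nat measure" +
  assumes S_nonempty: "S \<noteq> {}"
    and liouville: "\<And>(H :: nat \<Rightarrow> real) C i j. (\<And>k. 0 \<le> H k) \<Longrightarrow> (\<And>k. H k \<le> C) \<Longrightarrow>
      (\<And>k. (\<integral>z. H (fst z) \<partial>K k) \<le> H k) \<Longrightarrow> i \<in> S \<Longrightarrow> j \<in> S \<Longrightarrow> H i = H j"
    and spread: "\<And>i. i \<in> S \<Longrightarrow> \<exists>p c a d. spread_at i p c a d"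
    and drift: "(\<integral>\<^sup>+i. (\<integral>\<^sup>+z. ennreal (max (- snd z) 0) \<partial>K i) \<partial>W) <
                (\<integral>\<^sup>+i. (\<integral>\<^sup>+z. ennreal (max (snd z) 0) \<partial>K i) \<partial>W)"
begin

lemma finite_K: "finite_measure (K i)"
  using prob_K by (rule prob_space.finite_measure)

lemma measurable_comp_K:
  fixes f :: "nat \<Rightarrow> real \<Rightarrow> real"
  assumes "\<And>k. f k \<in> borel_measurable borel"
  shows "(\<lambda>z. f (fst z) (t - snd z)) \<in> borel_measurable (K i)"
proof (rule measurable_compose_countable[where f = "\<lambda>k z. f k (t - snd z)" and g = fst])
  fix k
  note assms[measurable]
  show "(\<lambda>z. f k (t - snd z)) \<in> borel_measurable (K i)" by measurable
qed measurable

lemma integrable_comp_K: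
  assumes "tame C L \<gamma>"
  shows "integrable (K i) (\<lambda>z. \<gamma> (fst z) (t - snd z))"
  using measurable_comp_K[OF tame_measurable[OF assms]] tameD(1)[OF assms]
  by (intro finite_measure.integrable_const_bound[OF finite_K, where B = C]) auto

lemma integrable_fst_K:
  fixes H :: "nat \<Rightarrow> real"
  assumes "\<And>k. \<bar>H k\<bar> \<le> C"
  shows "integrable (K i) (\<lambda>z. H (fst z))"
  using assms measurable_comp_K[of "\<lambda>k t. H k" 0 i]
  by (intro finite_measure.integrable_const_bound[OF finite_K, where B = C]) auto

lemma integral_K_const [simp]: "(\<integral>z. (c::real) \<partial>K i) = c"
  by (simp add: measure_def)

lemma measure_K_UNIV [simp]: "measure (K i) UNIV = 1"
  by (simp add: measure_def)

lemma integrable_K_const [simp]: "integrable (K i) (\<lambda>z. (c::real))"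
  by (rule finite_measure.integrable_const[OF finite_K])

lemma integral_K_diff_const:
  assumes "integrable (K i) f"
  shows "(\<integral>z. (c::real) - f z \<partial>K i) = c - (\<integral>z. f z \<partial>K i)"
  using Bochner_Integration.integral_diff[OF integrable_K_const assms] by simp

definition harmonic :: "(nat \<Rightarrow> real \<Rightarrow> real) \<Rightarrow> bool" where
  "harmonic \<gamma> \<longleftrightarrow> (\<forall>i t. \<gamma> i t = (\<integral>z. \<gamma> (fst z) (t - snd z) \<partial>K i))"

lemma integral_K_limit:
  assumes "\<And>n. tame C L (G n)" "\<And>i t. (\<lambda>n. G n i t) \<longlonglongrightarrow> \<gamma> i t"
  shows "(\<lambda>n. \<integral>z. G n (fst z) (t - snd z) \<partial>K i) \<longlonglongrightarrow> (\<integral>z. \<gamma> (fst z) (t - snd z) \<partial>K i)"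
proof (rule integral_dominated_convergence[where w = "\<lambda>_. C"])
  show "(\<lambda>z. \<gamma> (fst z) (t - snd z)) \<in> borel_measurable (K i)"
    by (rule measurable_comp_K[OF tame_measurable[OF tame_limit[OF assms]]])
  show "(\<lambda>z. G n (fst z) (t - snd z)) \<in> borel_measurable (K i)" for n
    by (rule measurable_comp_K[OF tame_measurable[OF assms(1)]])
  show "integrable (K i) (\<lambda>_. C)" by simp
qed (use assms tameD(1)[OF assms(1)] in auto)

text \<open>The suprema over \<open>t\<close> form a bounded subharmonic function \<open>H\<close>
  of the driving chain, so C - H is superharmonic and \<open>liouville\<close> makes
  \<open>H\<close> constant on \<open>S\<close>. A start outside \<open>S\<close> is covered because
  the next state already lies in \<open>S\<close>.\<close>

lemma superharmonic_sup:
  fixes \<delta> :: "nat \<Rightarrow> real \<Rightarrow> real"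
  assumes \<delta>: "harmonic \<delta>" "tame C L \<delta>"
    and j: "j \<in> S"
  shows "\<delta> i t \<le> (SUP t. \<delta> j t)"
proof -
  define H where "H i = (SUP t. \<delta> i t)" for i
  have bdd: "bdd_above (range (\<delta> i))" for i
    by (rule bdd_aboveI[of _ C]) (use abs_le_D1[OF tameD(1)[OF \<delta>(2)]] in blast)
  have up: "\<delta> i t \<le> H i" for i t
    unfolding H_def by (rule cSUP_upper[OF _ bdd]) simp
  have H_le: "H i \<le> C" for i
    unfolding H_def by (rule cSUP_least) (use abs_le_D1[OF tameD(1)[OF \<delta>(2)]] in simp_all)
  have H_ge: "H i \<ge> - C" for i
    using up[of i 0] tameD(1)[OF \<delta>(2), of i 0] by linarith
  have int_H: "integrable (K i) (\<lambda>z. H (fst z))" for i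
  proof (rule integrable_fst_K)
    show "\<bar>H k\<bar> \<le> C" for k using H_le[of k] H_ge[of k] by linarith
  qed
  have sub: "H i \<le> (\<integral>z. H (fst z) \<partial>K i)" for i
    unfolding H_def[of i]
  proof (rule cSUP_least)
    fix t
    have "\<delta> i t = (\<integral>z. \<delta> (fst z) (t - snd z) \<partial>K i)"
      using \<delta>(1) unfolding harmonic_def by blast
    also have "\<dots> \<le> (\<integral>z. H (fst z) \<partial>K i)"
      by (rule integral_mono[OF integrable_comp_K[OF \<delta>(2)] int_H up])
    finally show "\<delta> i t \<le> (\<integral>z. H (fst z) \<partial>K i)" .
  qed simp
  have const: "H k = H j" if "k \<in> S" for k
  proof -
    have "C - H k = C - H j"
    proof (rule liouville[where H = "\<lambda>k. C - H k" and C = "2 * C"])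
      show "(\<integral>z. C - H (fst z) \<partial>K k) \<le> C - H k" for k
        unfolding integral_K_diff_const[OF int_H] using sub[of k] by linarith
      show "0 \<le> C - H k" "C - H k \<le> 2 * C" for k
        using H_le[of k] H_ge[of k] by auto
    qed (use that j in auto)
    then show ?thesis by simp
  qed
  have "\<delta> i t \<le> H i" by (rule up)
  also have "\<dots> \<le> (\<integral>z. H (fst z) \<partial>K i)" by (rule sub)
  also have "\<dots> = (\<integral>z. H j \<partial>K i)"
  proof (rule integral_cong_AE)
    show "AE z in K i. H (fst z) = H j" using K_in_S by eventually_elim (rule const)
  qed (use int_H in auto)
  finally show ?thesis by (simp add: H_def)
qed

text \<open>M - \<delta> is nonnegative and fixed by \<open>op ^^ p\<close>. Where it vanishes, its
  integral against the dominated tent vanishes too, and continuity turns this into vanishing on the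
  whole support interval.\<close>

lemma harmonic_max_propagates:
  assumes f: "harmonic \<delta>" "tame C L \<delta>" "\<And>i t. \<delta> i t \<le> M"
    and max: "\<delta> j t = M" and sp: "spread_at j p c a d" and y: "\<bar>y - a\<bar> < d"
  shows "\<delta> j (t - y) = M"
proof -
  define f where "f k t = ennreal (M - \<delta> k t)" for k t
  have mf: "mfun f"
    using tame_measurable[OF f(2)] by (auto simp: mfun_def f_def)
  have "op f i t = f i t" for i t
  proof -
    have int: "integrable (K i) (\<lambda>z. M - \<delta> (fst z) (t - snd z))"
      by (rule Bochner_Integration.integrable_diff[OF integrable_K_const integrable_comp_K[OF f(2)]])
    have "op f i t = ennreal (\<integral>z. M - \<delta> (fst z) (t - snd z) \<partial>K i)"
      unfolding op_def f_def using f(3) by (intro nn_integral_eq_integral int) auto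
    also have "(\<integral>z. M - \<delta> (fst z) (t - snd z) \<partial>K i) = M - \<delta> i t"
      unfolding integral_K_diff_const[OF integrable_comp_K[OF f(2)]]
      using f(1) unfolding harmonic_def by metis
    finally show ?thesis by (simp only: f_def[of i t])
  qed
  then have "op f = f" by (simp add: fun_eq_iff)
  then have opn: "(op ^^ p) f = f"
    by (induction p) auto
  have "(\<integral>\<^sup>+y. ennreal (tent c a d y) * f j (t - y) \<partial>lborel) \<le> (op ^^ p) (at_state j (f j)) j t"
    using sp mfunD[OF mf] unfolding spread_at_def by blast
  also have "\<dots> \<le> (op ^^ p) f j t"
    by (rule kop_mono[OF kop_opn mfun_at_state[OF mfunD[OF mf]] mf]) (simp add: at_state_def)
  finally have z: "(\<integral>\<^sup>+y. ennreal (tent c a d y) * f j (t - y) \<partial>lborel) = 0"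
    unfolding opn f_def max by simp
  have c: "c > 0" "d > 0" using sp by (auto simp: spread_at_def)
  \<comment> \<open>The set of violations is open, so being a null set forces it to be
    empty.\<close>
  define A where "A = {y. 0 < tent c a d y * (M - \<delta> j (t - y))}"
  have "open A"
    unfolding A_def
    by (intro open_Collect_less continuous_intros
        continuous_on_compose2[OF tame_continuous[OF f(2)]] continuous_on_subset[OF continuous_tent]) auto
  moreover have "A \<in> null_sets lborel"
  proof -
    have [measurable]: "f j \<in> borel_measurable borel" "\<delta> j \<in> borel_measurable borel"
      using mfunD[OF mf] tame_measurable[OF f(2)] by auto
    have "AE y in lborel. ennreal (tent c a d y) * f j (t - y) = 0"
      using z by (subst (asm) nn_integral_0_iff_AE) auto
    then have "AE y in lborel. y \<notin> A"
    proof eventually_elim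
      case (elim y)
      then have "tent c a d y = 0 \<or> M - \<delta> j (t - y) \<le> 0"
        using tent_nonneg[of c a d y] c by (auto simp: f_def)
      then show ?case
        using tent_nonneg[of c a d y] c f(3)[of j "t - y"] by (auto simp: A_def)
    qed
    then show ?thesis
      using \<open>open A\<close> by (subst AE_iff_null_sets) auto
  qed
  ultimately have "A = {}"
    using open_not_negligible[of A] by (auto simp: negligible_iff_null_sets null_sets_completionI)
  then have "\<not> 0 < tent c a d y * (M - \<delta> j (t - y))" by (auto simp: A_def)
  then show ?thesis
    using tent_pos[OF c y] f(3)[of j "t - y"] by (auto simp: zero_less_mult_iff)
qed

text \<open>If the increment \<gamma> (t - y) - \<gamma> t had a positive supremum M, a limit of
  translates would attain it. The maximum then propagates to all multiples of -y, and increments all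
  equal to M contradict boundedness.\<close>

lemma harmonic_shift_le:
  assumes \<gamma>: "harmonic \<gamma>" "tame C L \<gamma>" and j: "j \<in> S" and sp: "spread_at j p c a d" and y: "\<bar>y - a\<bar> < d"
  shows "\<gamma> i (t - y) \<le> \<gamma> i t"
proof -
  define \<delta> :: "(nat \<Rightarrow> real \<Rightarrow> real) \<Rightarrow> nat \<Rightarrow> real \<Rightarrow> real"
    where "\<delta> \<gamma> i t = \<gamma> i (t - y) - \<gamma> i t" for \<gamma> i t
  have tame_\<delta>: "tame (2 * C) (2 * L) (\<delta> \<gamma>)" if "tame C L \<gamma>" for \<gamma>
    unfolding tame_def \<delta>_def
  proof (intro conjI allI)
    fix i t s
    show "\<bar>\<gamma> i (t - y) - \<gamma> i t\<bar> \<le> 2 * C"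
      using tameD(1)[OF that, of i "t - y"] tameD(1)[OF that, of i t] by linarith
    show "\<bar>\<gamma> i (t - y) - \<gamma> i t - (\<gamma> i (s - y) - \<gamma> i s)\<bar> \<le> 2 * L * \<bar>t - s\<bar>"
      using tameD(2)[OF that, of i "t - y" "s - y"] tameD(2)[OF that, of i t s] by simp
  qed
  have harmonic_\<delta>: "harmonic (\<delta> \<gamma>)" if "tame C L \<gamma>" "harmonic \<gamma>" for \<gamma>
    unfolding harmonic_def \<delta>_def
  proof (intro allI)
    fix i t
    have "(\<integral>z. \<gamma> (fst z) (t - snd z - y) - \<gamma> (fst z) (t - snd z) \<partial>K i) =
        (\<integral>z. \<gamma> (fst z) ((t - y) - snd z) \<partial>K i) - (\<integral>z. \<gamma> (fst z) (t - snd z) \<partial>K i)"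
      using integrable_comp_K[OF that(1), of i "t - y"] integrable_comp_K[OF that(1), of i t]
      by (subst Bochner_Integration.integral_diff[symmetric]) (auto simp: algebra_simps)
    also have "\<dots> = \<gamma> i (t - y) - \<gamma> i t"
      using that(2) unfolding harmonic_def by metis
    finally show "\<gamma> i (t - y) - \<gamma> i t = (\<integral>z. \<gamma> (fst z) (t - snd z - y) - \<gamma> (fst z) (t - snd z) \<partial>K i)" by simp
  qed
  define M where "M = (SUP t. \<delta> \<gamma> j t)"
  have le_M: "\<delta> \<gamma> i t \<le> M" for i t
    unfolding M_def by (rule superharmonic_sup[OF harmonic_\<delta>[OF \<gamma>(2,1)] tame_\<delta>[OF \<gamma>(2)] j])
  have "M \<le> 0"
  proof (rule ccontr)
    assume M: "\<not> M \<le> 0"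
    have bdd: "bdd_above (range (\<delta> \<gamma> j))"
      by (rule bdd_aboveI[of _ "2 * C"]) (use abs_le_D1[OF tameD(1)[OF tame_\<delta>[OF \<gamma>(2)]]] in blast)
    have "\<exists>t. M - inverse (real (Suc n)) < \<delta> \<gamma> j t" for n
    proof (rule ccontr)
      assume "\<not> ?thesis"
      then have "M \<le> M - inverse (real (Suc n))"
        unfolding M_def by (intro cSUP_least) (auto simp: not_less)
      then show False by simp
    qed
    \<comment> \<open>Points where the increment comes within 1 / (n + 1) of its supremum;
      recentring there makes the limit function attain M at 0.\<close>
    then obtain T where T: "\<And>n. M - inverse (real (Suc n)) < \<delta> \<gamma> j (T n)" by metis
    obtain r \<gamma>' where r: "strict_mono (r :: nat \<Rightarrow> nat)" and \<gamma>': "tame C L \<gamma>'"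
      and lim: "\<And>i t. (\<lambda>n. \<gamma> i (T (r n) + t)) \<longlonglongrightarrow> \<gamma>' i t"
      using tame_convergent_subsequence[of C L "\<lambda>n i t. \<gamma> i (T n + t)"] tame_shift[OF \<gamma>(2)] by metis
    have h': "harmonic \<gamma>'"
      unfolding harmonic_def
    proof (intro allI)
      fix i t
      have "(\<lambda>n. \<integral>z. \<gamma> (fst z) (T (r n) + (t - snd z)) \<partial>K i) \<longlonglongrightarrow> (\<integral>z. \<gamma>' (fst z) (t - snd z) \<partial>K i)"
        using integral_K_limit[of C L "\<lambda>n i t. \<gamma> i (T (r n) + t)", OF tame_shift[OF \<gamma>(2)] lim] .
      moreover have "(\<integral>z. \<gamma> (fst z) (T (r n) + (t - snd z)) \<partial>K i) = \<gamma> i (T (r n) + t)" for n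
        using \<gamma>(1) unfolding harmonic_def by (metis (no_types, lifting) add_diff_eq Bochner_Integration.integral_cong)
      ultimately show "\<gamma>' i t = (\<integral>z. \<gamma>' (fst z) (t - snd z) \<partial>K i)"
        using lim[of i t] LIMSEQ_unique by fastforce
    qed
    have lim\<delta>: "(\<lambda>n. \<delta> \<gamma> i (T (r n) + t)) \<longlonglongrightarrow> \<delta> \<gamma>' i t" for i t
      unfolding \<delta>_def using tendsto_diff[OF lim[of i "t - y"] lim[of i t]] by (simp add: algebra_simps)
    have le: "\<delta> \<gamma>' i t \<le> M" for i t
      using le_M by (intro LIMSEQ_le_const2[OF lim\<delta>]) auto
    have "(\<lambda>n. M - inverse (real (Suc (r n)))) \<longlonglongrightarrow> M - 0"
      by (intro tendsto_diff tendsto_const) (rule LIMSEQ_subseq_LIMSEQ[OF LIMSEQ_inverse_real_of_nat r, unfolded comp_def])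
    then have "M \<le> \<delta> \<gamma>' j 0"
      using lim\<delta>[of j 0] T by (intro LIMSEQ_le[of "\<lambda>n. M - inverse (real (Suc (r n)))" _ "\<lambda>n. \<delta> \<gamma> j (T (r n) + 0)"]) (auto intro: less_imp_le)
    then have 0: "\<delta> \<gamma>' j 0 = M" using le[of j 0] by simp
    have step: "\<delta> \<gamma>' j (- real n * y) = M" for n
    proof (induction n)
      case (Suc n)
      have "\<delta> \<gamma>' j (- real n * y - y) = M"
        by (rule harmonic_max_propagates[OF harmonic_\<delta>[OF \<gamma>' h'] tame_\<delta>[OF \<gamma>'] le Suc sp y])
      moreover have "- real (Suc n) * y = - real n * y - y" by (simp add: algebra_simps)
      ultimately show ?case by (simp only:)
    qed (simp add: 0)
    \<comment> \<open>Telescoping of the maximal increments gives linear growth in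
      \<open>n\<close>.\<close>
    have "\<gamma>' j (- real n * y) = \<gamma>' j 0 + real n * M" for n
    proof (induction n)
      case (Suc n)
      have "- real (Suc n) * y = - real n * y - y" by (simp add: algebra_simps)
      then have "\<gamma>' j (- real (Suc n) * y) = \<gamma>' j (- real n * y - y)" by (rule arg_cong)
      then have "\<gamma>' j (- real (Suc n) * y) = \<gamma>' j (- real n * y) + M"
        using step[of n] unfolding \<delta>_def by linarith
      then show ?case unfolding Suc by (simp add: algebra_simps)
    qed simp
    then have "real n * M \<le> 2 * C" for n
      using tameD(1)[OF \<gamma>', of j "- real n * y"] tameD(1)[OF \<gamma>', of j 0] by (smt (verit))
    moreover obtain n :: nat where "real n > 2 * C / M" using reals_Archimedean2 by blast
    ultimately show False
      using M by (simp add: field_simps) (meson not_less)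
  qed
  then show ?thesis using le_M[of i t] by (simp add: \<delta>_def)
qed

text \<open>The shift inequality for \<gamma> and for -\<gamma> makes every y within
  \<open>d\<close> of \<open>a\<close> a period, hence \<gamma> does not depend on the position.
  What remains is a bounded harmonic function of the state, to which \<open>liouville\<close>
  applies.\<close>

lemma harmonic_const:
  assumes \<gamma>: "harmonic \<gamma>" "tame C L \<gamma>"
  obtains b where "\<And>i t. \<gamma> i t = b"
proof -
  obtain j where j: "j \<in> S" using S_nonempty by blast
  obtain p c a d where sp: "spread_at j p c a d" using spread[OF j] by blast
  have d: "d > 0" using sp by (simp add: spread_at_def)
  have h: "harmonic (\<lambda>k t. - \<gamma> k t)"
    unfolding harmonic_def Bochner_Integration.integral_minus
  proof (intro allI)
    fix i t
    have "\<gamma> i t = (\<integral>z. \<gamma> (fst z) (t - snd z) \<partial>K i)"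
      using \<gamma>(1) unfolding harmonic_def by blast
    then show "- \<gamma> i t = - (\<integral>z. \<gamma> (fst z) (t - snd z) \<partial>K i)" by (rule arg_cong)
  qed
  have per: "\<gamma> i (t - y) = \<gamma> i t" if "\<bar>y - a\<bar> < d" for i t y
    using harmonic_shift_le[OF \<gamma> j sp that, of i t] harmonic_shift_le[OF h tame_uminus[OF \<gamma>(2)] j sp that, of i t]
    by simp
  \<comment> \<open>The difference of the periods a + s and a is a period, so all small numbers are
    periods.\<close>
  have small: "\<gamma> i (t + s) = \<gamma> i t" if "\<bar>s\<bar> < d" for i t s
  proof -
    have "\<gamma> i (t + s) = \<gamma> i (t + s - (a + s))"
      using per[of "a + s" i "t + s"] that by simp
    also have "t + s - (a + s) = t - a" by simp
    also have "\<gamma> i (t - a) = \<gamma> i t" using per[of a i t] d by simp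
    finally show ?thesis .
  qed
  have mult: "\<gamma> i (t + real n * s) = \<gamma> i t" if "\<bar>s\<bar> < d" for i t s n
  proof (induction n)
    case (Suc n)
    then show ?case using small[OF that, of i "t + real n * s"] by (simp add: algebra_simps)
  qed simp
  have const: "\<gamma> i t = \<gamma> i 0" for i t
  proof -
    obtain n :: nat where n: "real n > \<bar>t\<bar> / d" using reals_Archimedean2 by blast
    then have n0: "real n > 0" using d by (intro le_less_trans[OF _ n]) simp
    have "\<bar>t / real n\<bar> < d" using n n0 d by (simp add: divide_less_eq mult.commute)
    from mult[OF this, of i 0 n] show ?thesis using n0 by simp
  qed
  have mean: "\<gamma> i 0 = (\<integral>z. \<gamma> (fst z) 0 \<partial>K i)" for i
  proof -
    have "\<gamma> i 0 = (\<integral>z. \<gamma> (fst z) (0 - snd z) \<partial>K i)" using \<gamma>(1) unfolding harmonic_def by blast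
    also have "\<dots> = (\<integral>z. \<gamma> (fst z) 0 \<partial>K i)"
      by (intro Bochner_Integration.integral_cong refl const)
    finally show ?thesis .
  qed
  have int: "integrable (K i) (\<lambda>z. \<gamma> (fst z) 0)" for i
    using tameD(1)[OF \<gamma>(2)] by (intro integrable_fst_K)
  have on_S: "\<gamma> i 0 = \<gamma> j 0" if "i \<in> S" for i
  proof -
    have "\<gamma> i 0 + C = \<gamma> j 0 + C"
    proof (rule liouville[where H = "\<lambda>k. \<gamma> k 0 + C" and C = "2 * C"])
      fix k
      have "(\<integral>z. \<gamma> (fst z) 0 + C \<partial>K k) = \<gamma> k 0 + C"
        using Bochner_Integration.integral_add[OF int[of k] integrable_K_const[of k C]] mean[of k] by simp
      then show "(\<integral>z. \<gamma> (fst z) 0 + C \<partial>K k) \<le> \<gamma> k 0 + C" by simp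
      show "0 \<le> \<gamma> k 0 + C" "\<gamma> k 0 + C \<le> 2 * C"
        using tameD(1)[OF \<gamma>(2), of k 0] by linarith+
    qed (use that j in auto)
    then show ?thesis by simp
  qed
  have zero: "\<gamma> i 0 = \<gamma> j 0" for i
  proof -
    have "(\<integral>z. \<gamma> (fst z) 0 \<partial>K i) = (\<integral>z. \<gamma> j 0 \<partial>K i)"
    proof (rule integral_cong_AE)
      show "AE z in K i. \<gamma> (fst z) 0 = \<gamma> j 0" using K_in_S by eventually_elim (rule on_S)
    qed (use int in auto)
    then show ?thesis using mean[of i] by simp
  qed
  have "\<gamma> i t = \<gamma> j 0" for i t
    using const[of i t] zero[of i] by (rule trans)
  then show ?thesis by (rule that)
qed

text \<open>The defect of harmonicity disappears in a locally uniform limit, which is therefore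
  constant in state and position. This serves both the boundedness of the potential and its limits
  at infinity.\<close>

lemma asymptotically_harmonic:
  fixes G :: "nat \<Rightarrow> nat \<Rightarrow> real \<Rightarrow> real"
  assumes G: "\<And>n. tame C L (G n)"
    and asym: "\<And>i t. (\<lambda>n. G n i t - (\<integral>z. G n (fst z) (t - snd z) \<partial>K i)) \<longlonglongrightarrow> 0"
  obtains r b where "strict_mono (r :: nat \<Rightarrow> nat)" "\<And>i t. (\<lambda>n. G (r n) i t) \<longlonglongrightarrow> b"
proof -
  obtain r \<gamma> where r: "strict_mono (r :: nat \<Rightarrow> nat)" and \<gamma>: "tame C L \<gamma>" and lim: "\<And>i t. (\<lambda>n. G (r n) i t) \<longlonglongrightarrow> \<gamma> i t"
    using tame_convergent_subsequence[of C L G, OF G] by metis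
  have "harmonic \<gamma>"
    unfolding harmonic_def
  proof (intro allI)
    fix i t
    have "(\<lambda>n. G (r n) i t - (\<integral>z. G (r n) (fst z) (t - snd z) \<partial>K i)) \<longlonglongrightarrow> \<gamma> i t - (\<integral>z. \<gamma> (fst z) (t - snd z) \<partial>K i)"
      by (intro tendsto_diff lim integral_K_limit[where C = C and L = L] G)
    moreover have "(\<lambda>n. G (r n) i t - (\<integral>z. G (r n) (fst z) (t - snd z) \<partial>K i)) \<longlonglongrightarrow> 0"
      using LIMSEQ_subseq_LIMSEQ[OF asym r] by (simp add: comp_def)
    ultimately show "\<gamma> i t = (\<integral>z. \<gamma> (fst z) (t - snd z) \<partial>K i)"
      using LIMSEQ_unique by fastforce
  qed
  then obtain b where b: "\<And>i t. \<gamma> i t = b" using harmonic_const[OF _ \<gamma>] by blast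
  have "(\<lambda>n. G (r n) i t) \<longlonglongrightarrow> b" for i t
    using lim[of i t] unfolding b .
  then show ?thesis by (rule that[OF r])
qed

end

section \<open>Boundedness of the potential\<close>

text \<open>Combines three balance equations by cancelling \<open>H\<close>, the only quantity
  assumed finite; \<open>d\<close> and \<open>p\<close> are eliminated without being
  subtracted.\<close>

lemma ennreal_cancel_identity:
  fixes H :: ennreal
  assumes "d + F = p + e" "d + P = H + N" "H + A = p" "H \<noteq> \<top>"
  shows "A + e + P = F + N"
proof -
  have "H + (A + e + P) = (H + A) + e + P" by (simp only: add.assoc)
  also have "\<dots> = (d + F) + P" unfolding assms(1,3) ..
  also have "\<dots> = (d + P) + F" by (simp only: ac_simps)
  also have "\<dots> = H + (F + N)" unfolding assms(2) by (simp only: ac_simps)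
  finally show ?thesis using assms(4) by (simp add: ennreal_add_left_cancel)
qed

lemma ennreal_add_eq_imp_le: "a + b = c \<Longrightarrow> a \<le> (c::ennreal)"
  by auto

section \<open>Linearity and limits of flux, half-line mass and total mass; damped
  potentials\<close>

context stationary_walk
begin

lemma flux_add:
  assumes [measurable]: "case_prod c \<in> borel_measurable (borel \<Otimes>\<^sub>M borel)" and f[measurable]: "mfun f" and g[measurable]: "mfun g"
  shows "flux c (\<lambda>k s. f k s + g k s) = flux c f + flux c g"
proof -
  have "(\<integral>\<^sup>+s. c (snd z) s * (f (fst z) s + g (fst z) s) \<partial>lborel) =
      (\<integral>\<^sup>+s. c (snd z) s * f (fst z) s \<partial>lborel) + (\<integral>\<^sup>+s. c (snd z) s * g (fst z) s \<partial>lborel)" for z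
    unfolding distrib_left by (rule nn_integral_add) measurable
  then show ?thesis
    unfolding flux_def
    using flux_inner_measurable[OF assms(1) f] flux_inner_measurable[OF assms(1) g]
    by (simp add: nn_integral_add)
qed

lemma flux_cmult:
  assumes [measurable]: "case_prod c \<in> borel_measurable (borel \<Otimes>\<^sub>M borel)" and f[measurable]: "mfun f"
  shows "flux c (\<lambda>k s. a * f k s) = a * flux c f"
proof -
  have "(\<integral>\<^sup>+s. c (snd z) s * (a * f (fst z) s) \<partial>lborel) =
      a * (\<integral>\<^sup>+s. c (snd z) s * f (fst z) s \<partial>lborel)" for z
    by (subst nn_integral_cmult[symmetric]) (auto simp: mult.left_commute)
  then show ?thesis
    unfolding flux_def
    using flux_inner_measurable[OF assms(1) f]
    by (simp add: nn_integral_cmult)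
qed

lemma flux_mono:
  assumes "\<And>k s. f k s \<le> g k s"
  shows "flux c f \<le> flux c g"
  unfolding flux_def using assms by (intro nn_integral_mono mult_left_mono) auto

lemma flux_liminf:
  assumes [measurable]: "case_prod c \<in> borel_measurable (borel \<Otimes>\<^sub>M borel)" and f: "\<And>n. mfun (f n)"
    and lim: "\<And>k s. (\<lambda>n. f n k s) \<longlonglongrightarrow> g k s"
  shows "flux c g \<le> liminf (\<lambda>n. flux c (f n))"
proof -
  note f[measurable]
  \<comment> \<open>Multiplication by \<infinity> is not continuous at 0 in \<open>ennreal\<close>;
    but a positive limit has eventually positive approximants, whose product with \<infinity> is
    \<infinity>.\<close>
  have le: "c x s * g k s \<le> liminf (\<lambda>n. c x s * f n k s)" for x s k
  proof (cases "c x s = \<top>")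
    case True
    show ?thesis
    proof (cases "g k s = 0")
      case False
      then have "eventually (\<lambda>n. 0 < f n k s) sequentially"
        by (intro order_tendstoD(1)[OF lim]) (auto simp: zero_less_iff_neq_zero)
      then have "eventually (\<lambda>n. c x s * g k s \<le> c x s * f n k s) sequentially"
        by eventually_elim (auto simp: True ennreal_top_mult)
      then show ?thesis by (rule Liminf_bounded)
    qed simp
  next
    case False
    then have "(\<lambda>n. c x s * f n k s) \<longlonglongrightarrow> c x s * g k s"
      by (intro ennreal_tendsto_cmult lim) (auto simp: less_top)
    then show ?thesis by (simp add: lim_imp_Liminf)
  qed
  have 1: "(\<integral>\<^sup>+s. c (snd z) s * g (fst z) s \<partial>lborel) \<le>
      liminf (\<lambda>n. \<integral>\<^sup>+s. c (snd z) s * f n (fst z) s \<partial>lborel)" for z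
    by (rule order_trans[OF nn_integral_mono[OF le] nn_integral_liminf]) measurable
  have 2: "(\<integral>\<^sup>+z. (\<integral>\<^sup>+s. c (snd z) s * g (fst z) s \<partial>lborel) \<partial>K i) \<le>
      liminf (\<lambda>n. \<integral>\<^sup>+z. (\<integral>\<^sup>+s. c (snd z) s * f n (fst z) s \<partial>lborel) \<partial>K i)" for i
    by (rule order_trans[OF nn_integral_mono[OF 1] nn_integral_liminf[OF flux_inner_measurable[OF assms(1) f]]])
  show ?thesis
    unfolding flux_def
    by (rule order_trans[OF nn_integral_mono[OF 2] nn_integral_liminf[OF measurable_W]])
qed

lemma flux_SUP:
  assumes c[measurable]: "case_prod c \<in> borel_measurable (borel \<Otimes>\<^sub>M borel)" and f: "\<And>n. mfun (f n)"
    and inc: "incseq f"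
  shows "flux c (\<lambda>k s. SUP n. f n k s) = (SUP n. flux c (f n))"
proof (rule antisym)
  have inc': "incseq (\<lambda>n. f n k s)" for k s
    using inc by (auto simp: incseq_def le_fun_def)
  have "incseq (\<lambda>n. flux c (f n))"
    using inc' by (auto simp: incseq_def intro!: flux_mono)
  then have "(\<lambda>n. flux c (f n)) \<longlonglongrightarrow> (SUP n. flux c (f n))" by (rule LIMSEQ_SUP)
  then have "liminf (\<lambda>n. flux c (f n)) = (SUP n. flux c (f n))" by (simp add: lim_imp_Liminf)
  then show "flux c (\<lambda>k s. SUP n. f n k s) \<le> (SUP n. flux c (f n))"
    using flux_liminf[where f = f and g = "\<lambda>k s. SUP n. f n k s", OF c f LIMSEQ_SUP[OF inc']] by simp
  show "(SUP n. flux c (f n)) \<le> flux c (\<lambda>k s. SUP n. f n k s)"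
    by (intro SUP_least flux_mono SUP_upper) auto
qed

lemma half_mass_add:
  assumes "mfun f" "mfun g"
  shows "half_mass (\<lambda>k s. f k s + g k s) t = half_mass f t + half_mass g t"
proof -
  note assms[measurable]
  have "(\<integral>\<^sup>+s. indicator {..t} s * (f i s + g i s) \<partial>lborel) =
     (\<integral>\<^sup>+s. indicator {..t} s * f i s \<partial>lborel) + (\<integral>\<^sup>+s. indicator {..t} s * g i s \<partial>lborel)" for i
    unfolding distrib_left by (rule nn_integral_add) measurable
  then show ?thesis by (simp add: half_mass_def nn_integral_add)
qed

lemma half_mass_at_state:
  assumes "f \<in> borel_measurable borel"
  shows "half_mass (at_state j f) t = emeasure W {j} * (\<integral>\<^sup>+s. indicator {..t} s * f s \<partial>lborel)"
proof -
  have "half_mass (at_state j f) t = (\<integral>\<^sup>+i. at_state j (\<lambda>t. \<integral>\<^sup>+s. indicator {..t} s * f s \<partial>lborel) i t \<partial>W)"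
    unfolding half_mass_def by (intro nn_integral_cong) (auto simp: at_state_def)
  then show ?thesis by (simp add: nn_integral_W_at mult.commute)
qed

definition total_mass :: "(nat \<Rightarrow> real \<Rightarrow> ennreal) \<Rightarrow> ennreal" where
  "total_mass g = (\<integral>\<^sup>+i. (\<integral>\<^sup>+s. g i s \<partial>lborel) \<partial>W)"

lemma half_mass_le_total: "half_mass g t \<le> total_mass g"
  unfolding half_mass_def total_mass_def
  by (intro nn_integral_mono) (auto split: split_indicator)

lemma total_mass_add:
  assumes "mfun f" "mfun g"
  shows "total_mass (\<lambda>k s. f k s + g k s) = total_mass f + total_mass g"
proof -
  note assms[measurable]
  show ?thesis by (simp add: total_mass_def nn_integral_add)
qed

lemma total_mass_at_state:
  "total_mass (at_state j f) = emeasure W {j} * (\<integral>\<^sup>+s. f s \<partial>lborel)"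
proof -
  have "total_mass (at_state j f) = (\<integral>\<^sup>+i. at_state j (\<lambda>t. \<integral>\<^sup>+s. f s \<partial>lborel) i 0 \<partial>W)"
    unfolding total_mass_def by (intro nn_integral_cong) (auto simp: at_state_def)
  then show ?thesis by (simp add: nn_integral_W_at mult.commute)
qed

text \<open>Stationarity of \<open>W\<close> together with translation invariance of
  \<open>lborel\<close> makes their product invariant for the walk.\<close>

lemma total_mass_op:
  assumes g: "mfun g"
  shows "total_mass (op g) = total_mass g"
proof -
  note g[measurable]
  have "(\<integral>\<^sup>+s. op g i s \<partial>lborel) = (\<integral>\<^sup>+z. (\<integral>\<^sup>+s. g (fst z) s \<partial>lborel) \<partial>K i)" for i
  proof -
    interpret k: sigma_finite_measure "K i" by (rule sigma_finite_K)
    interpret pair_sigma_finite "K i" lborel ..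
    have *: "(\<integral>\<^sup>+s. g k (s - x) \<partial>lborel) = (\<integral>\<^sup>+s. g k s \<partial>lborel)" for k x
      using nn_integral_shift[of "g k" "- x"] by (simp add: mfunD[OF g])
    have "(\<integral>\<^sup>+s. op g i s \<partial>lborel) = (\<integral>\<^sup>+z. (\<integral>\<^sup>+s. g (fst z) (s - snd z) \<partial>lborel) \<partial>K i)"
      unfolding op_def by (rule Fubini') measurable
    then show ?thesis unfolding * .
  qed
  then show ?thesis by (simp add: total_mass_def W_inv[of "\<lambda>k. \<integral>\<^sup>+s. g k s \<partial>lborel"])
qed

text \<open>The factor is charged at state \<open>j\<close> only, so the lost mass is a multiple of
  the entry at \<open>j\<close>. This keeps the loss over a bounded interval of order 1 - r when
  \<open>W\<close> has infinite mass.\<close>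

definition damp :: "nat \<Rightarrow> ennreal \<Rightarrow> (nat \<Rightarrow> real \<Rightarrow> ennreal) \<Rightarrow> nat \<Rightarrow> real \<Rightarrow> ennreal" where
  "damp j r f = (\<lambda>k t. (if k = j then r else 1) * f k t)"

definition dop :: "nat \<Rightarrow> ennreal \<Rightarrow> (nat \<Rightarrow> real \<Rightarrow> ennreal) \<Rightarrow> nat \<Rightarrow> real \<Rightarrow> ennreal" where
  "dop j r f = op (damp j r f)"

definition pot :: "nat \<Rightarrow> ennreal \<Rightarrow> nat \<Rightarrow> (real \<Rightarrow> ennreal) \<Rightarrow> nat \<Rightarrow> real \<Rightarrow> ennreal" where
  "pot j r m f = (\<lambda>k t. \<Sum>n<m. (dop j r ^^ n) (at_state j f) k t)"

lemma damp_1 [simp]: "damp j 1 f = f"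
  by (simp add: damp_def fun_eq_iff)

lemma dop_1: "dop j 1 = op"
  by (simp add: dop_def fun_eq_iff)

lemma kop_damp: "kop (damp j r)"
  unfolding kop_def damp_def
  by (auto intro: mfun_cmult simp: distrib_left mult.left_commute SUP_mult_left_ennreal)

lemma kop_dop: "kop (dop j r)"
  using kop_comp[OF kop_op kop_damp] by (simp add: dop_def[abs_def])

lemma kop_dopn: "kop (dop j r ^^ n)"
  by (rule kop_funpow[OF kop_dop])

lemma mfun_pot:
  assumes "f \<in> borel_measurable borel" shows "mfun (pot j r m f)"
  unfolding pot_def using assms by (intro mfun_sum kop_mfun[OF kop_dopn] mfun_at_state)

lemma pot_step:
  assumes "f \<in> borel_measurable borel"
  shows "dop j r (pot j r m f) k t + at_state j f k t =
         pot j r m f k t + (dop j r ^^ m) (at_state j f) k t"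
proof -
  have "dop j r (pot j r m f) = (\<lambda>k t. \<Sum>n<m. dop j r ((dop j r ^^ n) (at_state j f)) k t)"
    unfolding pot_def using assms by (intro kop_sum kop_dop kop_mfun[OF kop_dopn] mfun_at_state) auto
  then have "dop j r (pot j r m f) k t + at_state j f k t = (\<Sum>n<Suc m. (dop j r ^^ n) (at_state j f) k t)"
    by (subst sum.lessThan_Suc_shift) (simp add: add.commute)
  then show ?thesis by (simp add: pot_def)
qed

lemma total_mass_damp:
  assumes r: "r \<le> 1" and g: "mfun g"
  shows "total_mass (damp j r g) + (1 - r) * emeasure W {j} * (\<integral>\<^sup>+s. g j s \<partial>lborel) = total_mass g"
proof -
  note [measurable] = mfunD[OF g]
  have "total_mass g = total_mass (\<lambda>k s. damp j r g k s + at_state j (\<lambda>s. (1 - r) * g j s) k s)"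
    using r by (intro arg_cong[where f = "total_mass"])
      (auto simp: fun_eq_iff damp_def at_state_def distrib_right[symmetric] add_diff_inverse_ennreal)
  also have "\<dots> = total_mass (damp j r g) + total_mass (at_state j (\<lambda>s. (1 - r) * g j s))"
    using total_mass_add[of "damp j r g" "at_state j (\<lambda>s. (1 - r) * g j s)"] kop_mfun[OF kop_damp g] by simp
  finally show ?thesis
    by (simp add: total_mass_at_state nn_integral_cmult ac_simps)
qed

lemma half_mass_damp:
  assumes r: "r \<le> 1" and g: "mfun g"
  shows "half_mass (damp j r g) t + (1 - r) * emeasure W {j} * (\<integral>\<^sup>+s. indicator {..t} s * g j s \<partial>lborel) = half_mass g t"
proof -
  note [measurable] = mfunD[OF g]
  have "half_mass g t = half_mass (\<lambda>k s. damp j r g k s + at_state j (\<lambda>s. (1 - r) * g j s) k s) t"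
    using r by (intro arg_cong[where f = "\<lambda>g. half_mass g t"])
      (auto simp: fun_eq_iff damp_def at_state_def distrib_right[symmetric] add_diff_inverse_ennreal)
  also have "\<dots> = half_mass (damp j r g) t + half_mass (at_state j (\<lambda>s. (1 - r) * g j s)) t"
    using half_mass_add[of "damp j r g" "at_state j (\<lambda>s. (1 - r) * g j s)"] kop_mfun[OF kop_damp g] by simp
  finally show ?thesis
    by (simp add: half_mass_at_state nn_integral_cmult[symmetric] ac_simps)
qed

text \<open>Bookkeeping: \<open>op\<close> preserves the total mass, so what is left after
  \<open>m\<close> steps and what was charged at \<open>j\<close> on the way add up to the initial
  mass.\<close>

lemma total_mass_dopn:
  assumes r: "r \<le> 1" and f: "f \<in> borel_measurable borel"
  shows "total_mass ((dop j r ^^ m) (at_state j f)) +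
      (1 - r) * emeasure W {j} * (\<Sum>n<m. \<integral>\<^sup>+s. (dop j r ^^ n) (at_state j f) j s \<partial>lborel) =
      emeasure W {j} * (\<integral>\<^sup>+s. f s \<partial>lborel)"
proof (induction m)
  case 0
  then show ?case by (simp add: total_mass_at_state)
next
  case (Suc m)
  let ?e = "(dop j r ^^ m) (at_state j f)"
  have m: "mfun ?e" using f by (intro kop_mfun[OF kop_dopn] mfun_at_state)
  have "total_mass ((dop j r ^^ Suc m) (at_state j f)) = total_mass (damp j r ?e)"
    using total_mass_op[OF kop_mfun[OF kop_damp m]] by (simp add: dop_def)
  then have "total_mass ((dop j r ^^ Suc m) (at_state j f)) +
      (1 - r) * emeasure W {j} * (\<Sum>n<Suc m. \<integral>\<^sup>+s. (dop j r ^^ n) (at_state j f) j s \<partial>lborel) =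
      (total_mass (damp j r ?e) + (1 - r) * emeasure W {j} * (\<integral>\<^sup>+s. ?e j s \<partial>lborel)) +
      (1 - r) * emeasure W {j} * (\<Sum>n<m. \<integral>\<^sup>+s. (dop j r ^^ n) (at_state j f) j s \<partial>lborel)"
    by (simp only: sum.lessThan_Suc distrib_left ac_simps)
  then show ?case
    unfolding total_mass_damp[OF r m] Suc .
qed

text \<open>Each of the \<open>m\<close> summands carries at most the initial mass. This supplies
  the finiteness needed for the cancellation in the balance.\<close>

lemma total_mass_pot_finite:
  assumes r: "r \<le> 1" and f: "f \<in> borel_measurable borel" "(\<integral>\<^sup>+s. f s \<partial>lborel) < \<infinity>"
  shows "total_mass (pot j r m f) < \<infinity>"
proof (induction m)
  case 0
  then show ?case by (simp add: pot_def total_mass_def)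
next
  case (Suc m)
  have "total_mass ((dop j r ^^ m) (at_state j f)) \<le> emeasure W {j} * (\<integral>\<^sup>+s. f s \<partial>lborel)"
    by (rule ennreal_add_eq_imp_le[OF total_mass_dopn[OF r f(1)]])
  also have "\<dots> < \<infinity>" using f(2) W_fin[of j] by (simp add: ennreal_mult_less_top)
  finally have "total_mass ((dop j r ^^ m) (at_state j f)) < \<infinity>" .
  moreover have "pot j r (Suc m) f = (\<lambda>k s. pot j r m f k s + (dop j r ^^ m) (at_state j f) k s)"
    by (simp add: pot_def fun_eq_iff)
  ultimately show ?case
    using Suc by (simp add: total_mass_add[OF mfun_pot[OF f(1)] kop_mfun[OF kop_dopn mfun_at_state[OF f(1)]]])
qed

text \<open>Three equations with a common half-line mass: the telescoped potential equation, the
  crossing balance and the loss by damping. The finite horizon makes the common term finite, at the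
  price of the remainder \<open>?e\<close>.\<close>

lemma pot_identity:
  assumes r: "r \<le> 1" and f: "f \<in> borel_measurable borel" "(\<integral>\<^sup>+s. f s \<partial>lborel) < \<infinity>"
  shows "(1 - r) * emeasure W {j} * (\<integral>\<^sup>+s. indicator {..t} s * pot j r m f j s \<partial>lborel) +
      half_mass ((dop j r ^^ m) (at_state j f)) t + flux cut_pos (\<lambda>k s. damp j r (pot j r m f) k (t + s)) =
      emeasure W {j} * (\<integral>\<^sup>+s. indicator {..t} s * f s \<partial>lborel) +
      flux cut_neg (\<lambda>k s. damp j r (pot j r m f) k (t + s))" (is "?A + ?e + ?P = ?F + ?N")
proof -
  let ?p = "pot j r m f"
  have m: "mfun ?p" "mfun (damp j r ?p)" "mfun ((dop j r ^^ m) (at_state j f))" "mfun (dop j r ?p)"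
    by (rule mfun_pot[OF f(1)] kop_mfun[OF kop_damp mfun_pot[OF f(1)]]
        kop_mfun[OF kop_dopn mfun_at_state[OF f(1)]] kop_mfun[OF kop_dop mfun_pot[OF f(1)]])+
  let ?H = "half_mass (damp j r ?p) t"
  have 1: "half_mass (dop j r ?p) t + ?F = half_mass ?p t + ?e"
    unfolding half_mass_at_state[OF f(1), symmetric] half_mass_add[OF m(4) mfun_at_state[OF f(1)], symmetric]
      half_mass_add[OF m(1,3), symmetric] pot_step[OF f(1)] ..
  have 2: "half_mass (dop j r ?p) t + ?P = ?H + ?N"
    unfolding dop_def by (rule flux_identity[OF m(2)])
  have 3: "?H + ?A = half_mass ?p t"
    by (rule half_mass_damp[OF r m(1)])
  have "?H \<le> half_mass ?p t" by (rule ennreal_add_eq_imp_le[OF 3])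
  also have "\<dots> \<le> total_mass ?p" by (rule half_mass_le_total)
  also have "\<dots> < \<infinity>" by (rule total_mass_pot_finite[OF r f])
  finally have fin: "?H \<noteq> \<top>" by simp
  show ?thesis by (rule ennreal_cancel_identity[OF 1 2 3 fin])
qed

end

text \<open>Test functions controlled by the single profile exp(-|t|), both in size and in their
  change under small shifts. A positive operator that is bounded on the profile is then bounded on
  all of them, with Lipschitz values.\<close>

definition dominated :: "real \<Rightarrow> (real \<Rightarrow> real) \<Rightarrow> bool" where
  "dominated c f \<longleftrightarrow> f \<in> borel_measurable borel \<and> (\<forall>t. 0 \<le> f t) \<and> (\<forall>t. f t \<le> c * exp (- \<bar>t\<bar>)) \<and>
     (\<forall>t s. \<bar>s\<bar> \<le> 1 \<longrightarrow> \<bar>f (t + s) - f t\<bar> \<le> c * \<bar>s\<bar> * exp (- \<bar>t\<bar>))"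

lemma dominatedD:
  assumes "dominated c f"
  shows "f \<in> borel_measurable borel" "0 \<le> f t" "f t \<le> c * exp (- \<bar>t\<bar>)" "c \<ge> 0"
    "\<bar>s\<bar> \<le> 1 \<Longrightarrow> \<bar>f (t + s) - f t\<bar> \<le> c * \<bar>s\<bar> * exp (- \<bar>t\<bar>)"
proof -
  have "0 \<le> f 0" "f 0 \<le> c * exp (- \<bar>0\<bar>)" using assms unfolding dominated_def by blast+
  then show "c \<ge> 0" by simp
  from assms show "f \<in> borel_measurable borel" "0 \<le> f t" "f t \<le> c * exp (- \<bar>t\<bar>)"
    "\<bar>s\<bar> \<le> 1 \<Longrightarrow> \<bar>f (t + s) - f t\<bar> \<le> c * \<bar>s\<bar> * exp (- \<bar>t\<bar>)"
    unfolding dominated_def by auto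
qed

lemma dominated_exp: "dominated 2 (\<lambda>t. exp (- \<bar>t\<bar>))"
  unfolding dominated_def
proof (intro conjI allI impI)
  fix t s :: real assume s: "\<bar>s\<bar> \<le> 1"
  \<comment> \<open>For |s| at most 1 the quadratic term of exp is at most |s|; this is the origin
    of the constant 2.\<close>
  have e: "exp \<bar>s\<bar> \<le> 1 + 2 * \<bar>s\<bar>"
  proof -
    have "exp \<bar>s\<bar> \<le> 1 + \<bar>s\<bar> + \<bar>s\<bar>\<^sup>2" using s by (intro exp_bound) auto
    moreover have "\<bar>s\<bar>\<^sup>2 \<le> 1 * \<bar>s\<bar>" unfolding power2_eq_square using s by (intro mult_right_mono) auto
    ultimately show ?thesis by linarith
  qed
  have 1: "exp (- \<bar>t + s\<bar>) \<le> exp (- \<bar>t\<bar>) * exp \<bar>s\<bar>"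
    by (simp add: exp_add[symmetric])
  have 2: "exp (- \<bar>t\<bar>) * (1 - 2 * \<bar>s\<bar>) \<le> exp (- \<bar>t + s\<bar>)"
  proof -
    have "exp (- \<bar>t\<bar>) * (1 - 2 * \<bar>s\<bar>) \<le> exp (- \<bar>t\<bar>) * exp (- \<bar>s\<bar>)"
      using exp_ge_add_one_self[of "- \<bar>s\<bar>"] by (intro mult_left_mono) auto
    also have "\<dots> \<le> exp (- \<bar>t + s\<bar>)" by (simp add: exp_add[symmetric])
    finally show ?thesis .
  qed
  have 3: "exp (- \<bar>t\<bar>) * exp \<bar>s\<bar> \<le> exp (- \<bar>t\<bar>) * (1 + 2 * \<bar>s\<bar>)"
    using e by (intro mult_left_mono) auto
  have "\<bar>x - E\<bar> \<le> 2 * S * E" if "x \<le> E * q" "E * (1 - 2 * S) \<le> x" "E * q \<le> E * (1 + 2 * S)"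
    for x E q S :: real
    using that by (simp add: algebra_simps)
  from this[OF 1 2 3]
  show "\<bar>exp (- \<bar>t + s\<bar>) - exp (- \<bar>t\<bar>)\<bar> \<le> 2 * \<bar>s\<bar> * exp (- \<bar>t\<bar>)" .
next
  show "(\<lambda>t :: real. exp (- \<bar>t\<bar>)) \<in> borel_measurable borel" by measurable
qed simp_all

lemma nn_integral_exp_abs_finite: "(\<integral>\<^sup>+t. ennreal (exp (- \<bar>t\<bar>)) \<partial>lborel) < \<infinity>"
proof -
  let ?e = "\<lambda>x. ennreal (exponential_density 1 x)"
  have "prob_space (density lborel ?e)"
    by (rule prob_space_exponential_density) simp
  then have 1: "(\<integral>\<^sup>+x. ?e x \<partial>lborel) = 1"
    using prob_space.emeasure_space_1[of "density lborel ?e"] by (simp add: emeasure_density)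
  have "(\<integral>\<^sup>+t. ennreal (exp (- \<bar>t\<bar>)) \<partial>lborel) \<le> (\<integral>\<^sup>+t. ?e t + ?e (0 - t) \<partial>lborel)"
    by (intro nn_integral_mono) (auto simp: exponential_density_def)
  also have "\<dots> = (\<integral>\<^sup>+t. ?e t \<partial>lborel) + (\<integral>\<^sup>+t. ?e (0 - t) \<partial>lborel)"
    by (rule nn_integral_add) measurable
  also have "\<dots> < \<infinity>"
    by (subst nn_integral_reflect) (simp_all add: 1)
  finally show ?thesis .
qed

lemma dominated_integral_finite:
  assumes "dominated c f" shows "(\<integral>\<^sup>+t. ennreal (f t) \<partial>lborel) < \<infinity>"
proof -
  have "(\<integral>\<^sup>+t. ennreal (f t) \<partial>lborel) \<le> (\<integral>\<^sup>+t. ennreal c * ennreal (exp (- \<bar>t\<bar>)) \<partial>lborel)"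
    using dominatedD[OF assms] by (intro nn_integral_mono) (auto simp: ennreal_mult[symmetric])
  also have "\<dots> = ennreal c * (\<integral>\<^sup>+t. ennreal (exp (- \<bar>t\<bar>)) \<partial>lborel)"
    by (intro nn_integral_cmult) measurable
  also have "\<dots> < \<infinity>" using nn_integral_exp_abs_finite by (simp add: ennreal_mult_less_top)
  finally show ?thesis .
qed

lemma dominated_tent:
  assumes "b > 0" "d > 0" obtains c where "dominated c (tent b a d)"
proof -
  \<comment> \<open>The larger of height \<open>b\<close> and slope \<open>b / d\<close>, divided by
    the least value of exp(-|t|) within distance d + 1 of \<open>a\<close>. Outside that range the
    tent and its shifts by at most 1 vanish.\<close>
  define c where "c = max 1 (1 / d) * b * exp (\<bar>a\<bar> + d + 1)"
  have out: "tent b a d t = 0" if "\<bar>t - a\<bar> \<ge> d" for t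
    using that assms by (simp add: tent_def max_def field_simps)
  have le_b: "tent b a d t \<le> b" for t
    using assms by (simp add: tent_def)
  have aux: "\<bar>max 0 x - max 0 y\<bar> \<le> \<bar>x - y\<bar>" for x y :: real
    by (auto simp: max_def)
  have lip: "\<bar>tent b a d t - tent b a d s\<bar> \<le> b / d * \<bar>t - s\<bar>" for t s
  proof -
    have "\<bar>max 0 (1 - \<bar>t - a\<bar> / d) - max 0 (1 - \<bar>s - a\<bar> / d)\<bar> \<le> \<bar>\<bar>t - a\<bar> / d - \<bar>s - a\<bar> / d\<bar>"
      using aux[of "1 - \<bar>t - a\<bar> / d" "1 - \<bar>s - a\<bar> / d"] by linarith
    also have "\<dots> \<le> \<bar>t - s\<bar> / d"
      unfolding diff_divide_distrib[symmetric] abs_divide using assms(2)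
      by (simp only: abs_of_pos, intro divide_right_mono) auto
    finally have "b * \<bar>max 0 (1 - \<bar>t - a\<bar> / d) - max 0 (1 - \<bar>s - a\<bar> / d)\<bar> \<le> b * (\<bar>t - s\<bar> / d)"
      using assms by (intro mult_left_mono) auto
    moreover have "\<bar>b * x - b * y\<bar> = b * \<bar>x - y\<bar>" for x y
      unfolding right_diff_distrib[symmetric] abs_mult using assms(1) by simp
    ultimately show ?thesis unfolding tent_def by simp
  qed
  have e: "1 \<le> exp (\<bar>a\<bar> + d + 1) * exp (- \<bar>t\<bar>)" if "\<bar>t - a\<bar> < d + 1" for t
    using that by (simp add: exp_add[symmetric])
  define X where "X = b * exp (\<bar>a\<bar> + d + 1)"
  have X: "X \<ge> 0" and cX: "c = max 1 (1 / d) * X"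
    using assms by (simp_all add: X_def c_def mult.assoc)
  have c1: "b * exp (\<bar>a\<bar> + d + 1) \<le> c" "b / d * exp (\<bar>a\<bar> + d + 1) \<le> c" "0 \<le> c"
    using mult_right_mono[OF max.cobounded1[of 1 "1 / d"] X] mult_right_mono[OF max.cobounded2[of "1 / d" 1] X] X
    unfolding cX by (simp_all add: X_def)
  have "dominated c (tent b a d)"
    unfolding dominated_def
  proof (intro conjI allI impI)
    fix t
    show "0 \<le> tent b a d t" using assms by (intro tent_nonneg) simp
    show "tent b a d t \<le> c * exp (- \<bar>t\<bar>)"
    proof (cases "\<bar>t - a\<bar> < d")
      case True
      have "tent b a d t \<le> b * 1" using le_b by simp
      also have "\<dots> \<le> b * (exp (\<bar>a\<bar> + d + 1) * exp (- \<bar>t\<bar>))"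
        using e[of t] True assms by (intro mult_left_mono) auto
      also have "\<dots> \<le> c * exp (- \<bar>t\<bar>)"
        using c1(1) by (simp add: mult.assoc[symmetric] mult_right_mono)
      finally show ?thesis .
    qed (use out c1(3) in auto)
    fix s :: real assume s: "\<bar>s\<bar> \<le> 1"
    show "\<bar>tent b a d (t + s) - tent b a d t\<bar> \<le> c * \<bar>s\<bar> * exp (- \<bar>t\<bar>)"
    proof (cases "\<bar>t - a\<bar> < d + 1")
      case True
      have "\<bar>tent b a d (t + s) - tent b a d t\<bar> \<le> b / d * \<bar>s\<bar> * 1"
        using lip[of "t + s" t] by simp
      also have "\<dots> \<le> b / d * \<bar>s\<bar> * (exp (\<bar>a\<bar> + d + 1) * exp (- \<bar>t\<bar>))"
        using e[OF True] assms by (intro mult_left_mono) auto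
      also have "\<dots> = (b / d * exp (\<bar>a\<bar> + d + 1)) * (\<bar>s\<bar> * exp (- \<bar>t\<bar>))"
        by (simp only: ac_simps)
      also have "\<dots> \<le> c * (\<bar>s\<bar> * exp (- \<bar>t\<bar>))"
        by (intro mult_right_mono c1) simp
      finally show ?thesis by (simp add: mult.assoc)
    next
      case False
      then have "tent b a d (t + s) = 0" "tent b a d t = 0"
        using s by (auto intro!: out)
      then show ?thesis using c1(3) by simp
    qed
  qed measurable
  then show ?thesis by (rule that)
qed

lemma enn2real_le_add:
  assumes "X \<le> Y + ennreal z" "Y < \<top>" "z \<ge> 0"
  shows "enn2real X \<le> enn2real Y + z"
proof (rule enn2real_leI)
  show "X \<le> ennreal (enn2real Y + z)" using assms by simp
qed (use assms in simp)

lemma tame_kop_dominated: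
  assumes \<Phi>: "kop \<Phi>" and M: "M \<ge> 0" and b: "\<And>i t. \<Phi> (at_state j (\<lambda>t. ennreal (exp (- \<bar>t\<bar>)))) i t \<le> ennreal M"
    and f: "dominated c f"
  shows "\<Phi> (at_state j (\<lambda>t. ennreal (f t))) i t \<le> ennreal (c * M)"
    and "tame (c * M) (c * M) (\<lambda>i t. enn2real (\<Phi> (at_state j (\<lambda>t. ennreal (f t))) i t))"
proof -
  let ?e = "at_state j (\<lambda>t. ennreal (exp (- \<bar>t\<bar>)))"
  let ?f = "at_state j (\<lambda>t. ennreal (f t))"
  note [measurable] = dominatedD(1)[OF f]
  have c: "c \<ge> 0" by (rule dominatedD(4)[OF f])
  have me: "mfun ?e" by (rule mfun_at_state) measurable
  have mf: "mfun ?f" by (rule mfun_at_state) measurable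
  have mae: "mfun (\<lambda>k t. a * ?e k t)" for a by (rule mfun_cmult[OF me])
  have bound: "\<Phi> ?f i t \<le> ennreal (c * M)" for i t
  proof -
    have "\<Phi> ?f i t \<le> \<Phi> (\<lambda>k t. ennreal c * ?e k t) i t"
      using dominatedD[OF f] by (intro kop_mono[OF \<Phi> mf mae]) (auto simp: at_state_def ennreal_mult[symmetric])
    also have "\<dots> \<le> ennreal c * ennreal M"
      unfolding kop_cmult[OF \<Phi> me] by (intro mult_left_mono b) simp
    finally show ?thesis using c M by (simp add: ennreal_mult)
  qed
  then show "\<Phi> ?f i t \<le> ennreal (c * M)" .
  let ?g = "\<lambda>i t. enn2real (\<Phi> ?f i t)"
  have fin: "\<Phi> ?f i t < \<top>" for i t
    by (rule le_less_trans[OF bound]) simp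
  have g_le: "0 \<le> ?g i t" "?g i t \<le> c * M" for i t
    using enn2real_leI[OF _ bound[of i t]] c M by simp_all
  have mfs: "mfun (\<lambda>k t. ?f k (t + s))" for s
    using mfun_transl[OF mf, of "- s"] by simp
  have sh: "\<Phi> (\<lambda>k t. ?f k (t + s)) i t = \<Phi> ?f i (t + s)" for s i t
    using kop_transl[OF \<Phi> mf, of "- s"] by simp
  have lip1: "\<bar>?g i (t + s) - ?g i t\<bar> \<le> c * M * \<bar>s\<bar>" if s: "\<bar>s\<bar> \<le> 1" for i t s
  proof -
    let ?a = "ennreal (c * \<bar>s\<bar>)"
    have ab: "?a * \<Phi> ?e i t \<le> ennreal (c * M * \<bar>s\<bar>)"
    proof -
      have "?a * \<Phi> ?e i t \<le> ?a * ennreal M" by (intro mult_left_mono b) simp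
      also have "\<dots> = ennreal (c * M * \<bar>s\<bar>)" using c M by (simp add: ennreal_mult[symmetric] ac_simps)
      finally show ?thesis .
    qed
    have "\<Phi> ?f i (t + s) \<le> \<Phi> (\<lambda>k t. ?f k t + ?a * ?e k t) i t"
      unfolding sh[symmetric]
    proof (rule kop_mono[OF \<Phi> mfs mfun_add[OF mf mae]])
      fix k t
      have "f (t + s) \<le> f t + c * \<bar>s\<bar> * exp (- \<bar>t\<bar>)" using dominatedD(5)[OF f s, of t] by linarith
      then show "?f k (t + s) \<le> ?f k t + ?a * ?e k t"
        using dominatedD(2)[OF f] c by (auto simp: at_state_def ennreal_mult[symmetric] ennreal_plus[symmetric] simp del: ennreal_plus)
    qed
    also have "\<dots> \<le> \<Phi> ?f i t + ennreal (c * M * \<bar>s\<bar>)"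
      unfolding kop_add[OF \<Phi> mf mae] kop_cmult[OF \<Phi> me] by (intro add_left_mono ab)
    finally have 1: "?g i (t + s) \<le> ?g i t + c * M * \<bar>s\<bar>"
      by (rule enn2real_le_add[OF _ fin]) (use c M in simp)
    have "\<Phi> ?f i t \<le> \<Phi> (\<lambda>k t. ?f k (t + s) + ?a * ?e k t) i t"
    proof (rule kop_mono[OF \<Phi> mf mfun_add[OF mfs mae]])
      fix k t
      have "f t \<le> f (t + s) + c * \<bar>s\<bar> * exp (- \<bar>t\<bar>)" using dominatedD(5)[OF f s, of t] by linarith
      then show "?f k t \<le> ?f k (t + s) + ?a * ?e k t"
        using dominatedD(2)[OF f] c by (auto simp: at_state_def ennreal_mult[symmetric] ennreal_plus[symmetric] simp del: ennreal_plus)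
    qed
    also have "\<dots> \<le> \<Phi> ?f i (t + s) + ennreal (c * M * \<bar>s\<bar>)"
      unfolding kop_add[OF \<Phi> mfs mae] kop_cmult[OF \<Phi> me] sh by (intro add_left_mono ab)
    finally have 2: "?g i t \<le> ?g i (t + s) + c * M * \<bar>s\<bar>"
      by (rule enn2real_le_add[OF _ fin]) (use c M in simp)
    show ?thesis using 1 2 by linarith
  qed
  show "tame (c * M) (c * M) ?g"
    unfolding tame_def
  proof (intro conjI allI)
    show "\<bar>?g i t\<bar> \<le> c * M" for i t using g_le by simp
    fix i t s
    show "\<bar>?g i t - ?g i s\<bar> \<le> c * M * \<bar>t - s\<bar>"
    proof (cases "\<bar>t - s\<bar> \<le> 1")
      case True
      then show ?thesis using lip1[of "t - s" i s] by simp
    next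
      \<comment> \<open>Beyond distance 1 the bound on the values already serves as a Lipschitz
        bound.\<close>
      case False
      have "\<bar>?g i t - ?g i s\<bar> \<le> c * M * 1"
        using g_le[of i t] g_le[of i s] by linarith
      also have "\<dots> \<le> c * M * \<bar>t - s\<bar>" using False c M by (intro mult_left_mono) auto
      finally show ?thesis .
    qed
  qed
qed

lemma ennreal_add_eq_imp_le2: "a + b = c \<Longrightarrow> b \<le> (c::ennreal)"
  by auto

section \<open>Mean drift and partial sums of the undamped potential\<close>

context stationary_walk
begin

definition mean_pos :: ennreal where
  "mean_pos = (\<integral>\<^sup>+i. (\<integral>\<^sup>+z. ennreal (max (snd z) 0) \<partial>K i) \<partial>W)"

definition mean_neg :: ennreal where
  "mean_neg = (\<integral>\<^sup>+i. (\<integral>\<^sup>+z. ennreal (max (- snd z) 0) \<partial>K i) \<partial>W)"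

lemma flux_const:
  "flux cut_pos (\<lambda>k s. c) = c * mean_pos" "flux cut_neg (\<lambda>k s. c) = c * mean_neg"
proof -
  have "flux cut_pos (\<lambda>k s. c * 1) = c * flux cut_pos (\<lambda>k s. 1)"
    by (rule flux_cmult) (auto simp: mfun_def)
  then show "flux cut_pos (\<lambda>k s. c) = c * mean_pos"
    by (simp add: flux_def mean_pos_def nn_integral_cut)
  have "flux cut_neg (\<lambda>k s. c * 1) = c * flux cut_neg (\<lambda>k s. 1)"
    by (rule flux_cmult) (auto simp: mfun_def)
  then show "flux cut_neg (\<lambda>k s. c) = c * mean_neg"
    by (simp add: flux_def mean_neg_def nn_integral_cut)
qed

abbreviation expf :: "real \<Rightarrow> ennreal" where
  "expf \<equiv> \<lambda>t. ennreal (exp (- \<bar>t\<bar>))"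

abbreviation rpot :: "nat \<Rightarrow> nat \<Rightarrow> (real \<Rightarrow> ennreal) \<Rightarrow> nat \<Rightarrow> real \<Rightarrow> ennreal" where
  "rpot j N f \<equiv> pot j 1 N f"

lemma rpot_eq: "rpot j N f = (\<lambda>k t. \<Sum>n<N. (op ^^ n) (at_state j f) k t)"
  by (simp add: pot_def dop_1)

lemma rpot_Suc:
  assumes "f \<in> borel_measurable borel"
  shows "rpot j (Suc N) f k t = at_state j f k t + op (rpot j N f) k t"
proof -
  have "op (rpot j N f) k t + at_state j f k t = rpot j N f k t + (op ^^ N) (at_state j f) k t"
    using pot_step[OF assms, of j 1 N k t] by (simp add: dop_1)
  then show ?thesis
    by (simp add: rpot_eq add.commute)
qed

text \<open>Away from \<open>j\<close> there is no source, so the potential is an average of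
  potentials with a smaller horizon; by induction its supremum is controlled at
  \<open>j\<close>.\<close>

lemma rpot_max_principle:
  assumes f: "f \<in> borel_measurable borel" and B: "\<And>t. rpot j N f j t \<le> B"
  shows "rpot j N f i t \<le> B"
  using B
proof (induction N arbitrary: i t)
  case 0
  then show ?case by (simp add: pot_def)
next
  case (Suc N)
  have le: "rpot j N f j t \<le> rpot j (Suc N) f j t" for t
    by (rule ennreal_add_eq_imp_le[of _ "(op ^^ N) (at_state j f) j t"]) (simp only: rpot_eq sum.lessThan_Suc)
  have IH: "rpot j N f i t \<le> B" for i t
  proof (rule Suc.IH)
    show "rpot j N f j t \<le> B" for t
      using le[of t] Suc.prems[of t] by (rule order_trans)
  qed
  show ?case
  proof (cases "i = j")
    case False
    have "rpot j (Suc N) f i t = op (rpot j N f) i t"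
      using False by (simp add: rpot_Suc[OF f]) (simp add: at_state_def)
    also have "\<dots> \<le> op (\<lambda>k t. B) i t"
      by (rule kop_mono[OF kop_op mfun_pot[OF f]]) (auto simp: IH)
    finally show ?thesis by (simp add: op_const)
  qed (use Suc.prems in simp)
qed

lemma rpot_flux_le:
  assumes f: "f \<in> borel_measurable borel" "(\<integral>\<^sup>+s. f s \<partial>lborel) < \<infinity>"
  shows "flux cut_pos (\<lambda>k s. rpot j N f k (t + s)) \<le>
      emeasure W {j} * (\<integral>\<^sup>+s. f s \<partial>lborel) + flux cut_neg (\<lambda>k s. rpot j N f k (t + s))"
proof -
  have "half_mass ((op ^^ N) (at_state j f)) t + flux cut_pos (\<lambda>k s. rpot j N f k (t + s)) =
      emeasure W {j} * (\<integral>\<^sup>+s. indicator {..t} s * f s \<partial>lborel) + flux cut_neg (\<lambda>k s. rpot j N f k (t + s))"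
    using pot_identity[OF order_refl f, of j t N] by (simp add: dop_1)
  then have "flux cut_pos (\<lambda>k s. rpot j N f k (t + s)) \<le>
      emeasure W {j} * (\<integral>\<^sup>+s. indicator {..t} s * f s \<partial>lborel) + flux cut_neg (\<lambda>k s. rpot j N f k (t + s))"
    by (rule ennreal_add_eq_imp_le2)
  also have "\<dots> \<le> emeasure W {j} * (\<integral>\<^sup>+s. f s \<partial>lborel) + flux cut_neg (\<lambda>k s. rpot j N f k (t + s))"
    by (intro add_right_mono mult_left_mono nn_integral_mono) (auto split: split_indicator)
  finally show ?thesis .
qed

end

section \<open>Uniform bound on the partial potentials\<close>

context renewal_walk
begin

lemma mean_neg_less_pos: "mean_neg < mean_pos"
  using drift by (simp add: mean_neg_def mean_pos_def)

lemma op_ennreal: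
  assumes "tame C L \<gamma>" "\<And>i t. 0 \<le> \<gamma> i t"
  shows "op (\<lambda>k t. ennreal (\<gamma> k t)) i t = ennreal (\<integral>z. \<gamma> (fst z) (t - snd z) \<partial>K i)"
  unfolding op_def by (rule nn_integral_eq_integral[OF integrable_comp_K[OF assms(1)]]) (simp add: assms(2))

text \<open>The partial potential fails to be harmonic only by the source and by the last power.
  Both lie between 0 and 1, so the defect stays at most 1 however large \<open>M\<close> is and
  becomes negligible after division by it.\<close>

lemma rpot_exp_tame:
  assumes M: "M \<ge> 0" "\<And>t. rpot j N expf j t \<le> ennreal M"
  shows "rpot j N expf i t \<le> ennreal M"
    and "tame (2 * M) (2 * M) (\<lambda>i t. enn2real (rpot j N expf i t))"
    and "\<bar>enn2real (rpot j N expf i t) - (\<integral>z. enn2real (rpot j N expf (fst z) (t - snd z)) \<partial>K i)\<bar> \<le> 1"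
proof -
  have e: "expf \<in> borel_measurable borel" by measurable
  have b: "rpot j N expf i t \<le> ennreal M" for i t
    by (rule rpot_max_principle[OF e M(2)])
  then show "rpot j N expf i t \<le> ennreal M" .
  have k: "kop (\<lambda>f k t. \<Sum>n<N. (op ^^ n) f k t)"
    by (rule kop_sum_op[OF _ kop_opn]) simp
  show t: "tame (2 * M) (2 * M) (\<lambda>i t. enn2real (rpot j N expf i t))"
    using tame_kop_dominated(2)[OF k M(1) _ dominated_exp, of j] b unfolding rpot_eq by simp
  let ?g = "\<lambda>i t. enn2real (rpot j N expf i t)"
  have fin: "rpot j N expf i t < \<top>" for i t
    by (rule le_less_trans[OF b]) simp
  then have "(\<lambda>i t. ennreal (?g i t)) = rpot j N expf"
    by (simp add: fun_eq_iff)
  then have op: "op (rpot j N expf) i t = ennreal (\<integral>z. ?g (fst z) (t - snd z) \<partial>K i)"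
    using op_ennreal[OF t, of i t] by simp
  have le1: "at_state j expf k s \<le> 1" for k s
    by (simp add: at_state_def)
  have eN: "(op ^^ N) (at_state j expf) i t \<le> 1"
    by (rule opn_bounded[OF mfun_at_state[OF e] le1])
  have eq: "ennreal (\<integral>z. ?g (fst z) (t - snd z) \<partial>K i) + at_state j expf i t =
      rpot j N expf i t + (op ^^ N) (at_state j expf) i t"
    using pot_step[OF e, of j 1 N i t] by (simp add: dop_1 op)
  have I0: "0 \<le> (\<integral>z. ?g (fst z) (t - snd z) \<partial>K i)" by simp
  have "?g i t \<le> (\<integral>z. ?g (fst z) (t - snd z) \<partial>K i) + 1"
  proof (rule enn2real_leI)
    have "rpot j N expf i t \<le> ennreal (\<integral>z. ?g (fst z) (t - snd z) \<partial>K i) + at_state j expf i t"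
      unfolding eq by simp
    also have "\<dots> \<le> ennreal (\<integral>z. ?g (fst z) (t - snd z) \<partial>K i) + 1"
      by (intro add_left_mono le1)
    finally show "rpot j N expf i t \<le> ennreal ((\<integral>z. ?g (fst z) (t - snd z) \<partial>K i) + 1)"
      using I0 by simp
  qed (use I0 in simp)
  moreover have "(\<integral>z. ?g (fst z) (t - snd z) \<partial>K i) \<le> ?g i t + 1"
  proof -
    have "ennreal (\<integral>z. ?g (fst z) (t - snd z) \<partial>K i) \<le> rpot j N expf i t + 1"
      by (rule order_trans[OF ennreal_add_eq_imp_le[OF eq] add_left_mono[OF eN]])
    then have "enn2real (ennreal (\<integral>z. ?g (fst z) (t - snd z) \<partial>K i)) \<le> ?g i t + 1"
      by (intro enn2real_le_add[OF _ fin]) simp_all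
    then show ?thesis unfolding enn2real_ennreal[OF I0] .
  qed
  ultimately show "\<bar>?g i t - (\<integral>z. ?g (fst z) (t - snd z) \<partial>K i)\<bar> \<le> 1" by linarith
qed

text \<open>A potential that is unbounded in \<open>N\<close> would, after normalisation at a near-maximum, converge
  to the constant \<open>1\<close>, and the flux balance would then give \<open>mean_pos \<le> mean_neg\<close>.\<close>

lemma rpot_exp_bounded:
  obtains M where "M \<ge> 0" "\<And>N i t. rpot j N expf i t \<le> ennreal M"
proof -
  have e: "expf \<in> borel_measurable borel" by measurable
  let ?g = "\<lambda>N t. enn2real (rpot j N expf j t)"
  \<comment> \<open>A crude bound growing with the horizon; its only role is to make every supremum
    finite.\<close>
  have le_N: "rpot j N expf i t \<le> ennreal (real N)" for N i t
  proof -
    have "(op ^^ n) (at_state j expf) i t \<le> 1" for n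
      by (rule opn_bounded) (auto simp: at_state_def mfun_def)
    then have "rpot j N expf i t \<le> (\<Sum>n<N. 1)"
      unfolding rpot_eq by (intro sum_mono)
    then show ?thesis by (simp add: ennreal_of_nat_eq_real_of_nat)
  qed
  then have fin: "rpot j N expf i t < \<top>" for N i t
    by (rule le_less_trans) simp
  define M where "M N = (SUP t. ?g N t)" for N
  have bdd: "bdd_above (range (?g N))" for N
    by (rule bdd_aboveI[of _ "real N"]) (use enn2real_leI[OF _ le_N] in auto)
  have up: "?g N t \<le> M N" for N t
    unfolding M_def by (rule cSUP_upper[OF _ bdd]) simp
  have M0: "M N \<ge> 0" for N
    by (rule order_trans[OF enn2real_nonneg up[of N 0]])
  have up': "rpot j N expf j t \<le> ennreal (M N)" for N t
    using ennreal_leI[OF up[of N t]] ennreal_enn2real[OF fin[of N j t]] by simp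
  show thesis
  proof (cases "\<exists>B. \<forall>N. M N \<le> B")
    case True
    then obtain B where B: "\<And>N. M N \<le> B" by blast
    show ?thesis
    proof (rule that[of B])
      show "B \<ge> 0" using M0[of 0] B[of 0] by simp
      fix N i t
      have "rpot j N expf i t \<le> ennreal (M N)" by (rule rpot_exp_tame(1)[OF M0 up'])
      also have "\<dots> \<le> ennreal B" by (intro ennreal_leI B)
      finally show "rpot j N expf i t \<le> ennreal B" .
    qed
  next
    case False
    \<comment> \<open>The extra 1 makes the normalising factor \<open>a n\<close> at most 1 / (n +
      1).\<close>
    then have "\<forall>n::nat. \<exists>N. M N > real n + 1" by (meson not_le)
    then obtain N where N: "\<And>n. M (N n) > real n + 1" by metis
    have "\<exists>t. ?g (N n) t > M (N n) - 1" for n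
    proof (rule ccontr)
      assume "\<not> ?thesis"
      then have "M (N n) \<le> M (N n) - 1"
        unfolding M_def by (intro cSUP_least) (auto simp: not_less)
      then show False by simp
    qed
    then obtain T where T: "\<And>n. ?g (N n) (T n) > M (N n) - 1" by metis
    define a where "a n = inverse (M (N n))" for n
    have Mpos: "M (N n) > 0" for n using N[of n] by linarith
    have a0: "a n > 0" for n using Mpos by (simp add: a_def)
    have a_le: "a n \<le> inverse (real (Suc n))" for n
      unfolding a_def using N[of n] by (intro le_imp_inverse_le) auto
    have a_lim: "a \<longlonglongrightarrow> 0"
    proof (rule tendsto_sandwich[OF _ _ tendsto_const LIMSEQ_inverse_real_of_nat])
      show "\<forall>\<^sub>F n in sequentially. 0 \<le> a n"
        using a0 by (intro always_eventually allI less_imp_le)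
      show "\<forall>\<^sub>F n in sequentially. a n \<le> inverse (real (Suc n))"
        using a_le by (intro always_eventually allI)
    qed
    define G where "G n i t = a n * enn2real (rpot j (N n) expf i (T n + t))" for n i t
    have aM: "a n * (2 * M (N n)) = 2" "a n * M (N n) = 1" for n
      using Mpos[of n] by (simp_all add: a_def)
    have tame_G: "tame 2 2 (G n)" for n
    proof -
      have t: "tame (2 * M (N n)) (2 * M (N n)) (\<lambda>i t. enn2real (rpot j (N n) expf i t))"
        by (rule rpot_exp_tame(2)[OF M0 up'])
      show ?thesis
        unfolding tame_def
      proof (intro conjI allI)
        fix i t s
        have "a n * \<bar>enn2real (rpot j (N n) expf i (T n + t))\<bar> \<le> a n * (2 * M (N n))"
          using a0[of n] by (intro mult_left_mono tameD(1)[OF t]) simp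
        then show "\<bar>G n i t\<bar> \<le> 2"
          unfolding aM using a0[of n] by (simp add: G_def abs_mult)
        have "a n * \<bar>enn2real (rpot j (N n) expf i (T n + t)) - enn2real (rpot j (N n) expf i (T n + s))\<bar>
            \<le> a n * (2 * M (N n) * \<bar>(T n + t) - (T n + s)\<bar>)"
          using a0[of n] by (intro mult_left_mono tameD(2)[OF t]) simp
        also have "\<dots> = 2 * \<bar>t - s\<bar>" unfolding mult.assoc[symmetric] using aM(1)[of n] by (simp add: mult.assoc)
        finally show "\<bar>G n i t - G n i s\<bar> \<le> 2 * \<bar>t - s\<bar>"
          using a0[of n] by (simp add: G_def abs_mult right_diff_distrib[symmetric])
      qed
    qed
    have asym: "(\<lambda>n. G n i t - (\<integral>z. G n (fst z) (t - snd z) \<partial>K i)) \<longlonglongrightarrow> 0" for i t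
    proof (rule Lim_null_comparison[OF _ a_lim], rule always_eventually, rule allI)
      fix n
      let ?h = "\<lambda>i t. enn2real (rpot j (N n) expf i t)"
      have "(\<integral>z. G n (fst z) (t - snd z) \<partial>K i) = a n * (\<integral>z. ?h (fst z) ((T n + t) - snd z) \<partial>K i)"
        unfolding G_def by (simp add: add_diff_eq)
      then have "G n i t - (\<integral>z. G n (fst z) (t - snd z) \<partial>K i) =
          a n * (?h i (T n + t) - (\<integral>z. ?h (fst z) ((T n + t) - snd z) \<partial>K i))"
        by (simp add: G_def right_diff_distrib)
      also have "\<bar>\<dots>\<bar> \<le> a n * 1"
        unfolding abs_mult using a0[of n]
        by (intro mult_mono rpot_exp_tame(3)[OF M0 up']) auto
      finally show "norm (G n i t - (\<integral>z. G n (fst z) (t - snd z) \<partial>K i)) \<le> a n" by simp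
    qed
    obtain r b where r: "strict_mono r" and lim: "\<And>i t. (\<lambda>n. G (r n) i t) \<longlonglongrightarrow> b"
      using asymptotically_harmonic[OF tame_G asym] by metis
    have ar: "(\<lambda>n. a (r n)) \<longlonglongrightarrow> 0"
      using LIMSEQ_subseq_LIMSEQ[OF a_lim r] by (simp add: comp_def)
    \<comment> \<open>\<open>T n\<close> is within 1 of the supremum \<open>M (N n)\<close>; after
      normalisation the gap is at most \<open>a n\<close> and vanishes.\<close>
    have "1 \<le> b"
    proof (rule LIMSEQ_le[OF _ lim[of j 0]])
      show "(\<lambda>n. 1 - a (r n)) \<longlonglongrightarrow> 1" using tendsto_diff[OF tendsto_const[of 1] ar] by simp
      have "1 - a n \<le> G n j 0" for n
      proof -
        have "1 - a n = a n * (M (N n) - 1)" using aM[of n] by (simp add: right_diff_distrib)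
        also have "\<dots> \<le> G n j 0"
          unfolding G_def using T[of n] a0[of n] by (intro mult_left_mono) auto
        finally show ?thesis .
      qed
      then show "\<exists>N. \<forall>n\<ge>N. 1 - a (r n) \<le> G (r n) j 0" by blast
    qed
    let ?f = "\<lambda>n k s. ennreal (a n) * rpot j (N n) expf k (T n + s)"
    have fG: "?f n k s = ennreal (G n k s)" for n k s
      using a0[of n] fin[of "N n" k "T n + s"] by (simp add: G_def ennreal_mult)
    have mfr: "mfun (\<lambda>k s. rpot j (N n) expf k (T n + s))" for n
      using mfun_transl[where a = "- T n", OF mfun_pot[OF e]] by (simp add: add.commute)
    have f1: "?f n k s \<le> 1" for n k s
    proof -
      have "?f n k s \<le> ennreal (a n) * ennreal (M (N n))"
        by (intro mult_left_mono rpot_exp_tame(1)[OF M0 up']) simp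
      also have "\<dots> = 1" using aM(2)[of n] a0[of n] by (simp add: ennreal_mult[symmetric] Mpos less_imp_le)
      finally show ?thesis .
    qed
    define I where "I = emeasure W {j} * (\<integral>\<^sup>+s. expf s \<partial>lborel)"
    have I: "I < \<top>"
      using W_fin[of j] nn_integral_exp_abs_finite by (simp add: I_def ennreal_mult_less_top)
    \<comment> \<open>Scaling makes the source term \<open>ennreal (a n) * I\<close> negligible,
      while the downward flux stays below that of the constant 1.\<close>
    have bal: "flux cut_pos (?f n) \<le> ennreal (a n) * I + mean_neg" for n
    proof -
      have "flux cut_pos (?f n) = ennreal (a n) * flux cut_pos (\<lambda>k s. rpot j (N n) expf k (T n + s))"
        by (rule flux_cmult[OF cut_measurable(1) mfr])
      also have "\<dots> \<le> ennreal (a n) * (I + flux cut_neg (\<lambda>k s. rpot j (N n) expf k (T n + s)))"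
        unfolding I_def by (intro mult_left_mono rpot_flux_le e nn_integral_exp_abs_finite) simp
      also have "\<dots> = ennreal (a n) * I + flux cut_neg (?f n)"
        unfolding flux_cmult[OF cut_measurable(2) mfr] by (rule distrib_left)
      also have "flux cut_neg (?f n) \<le> flux cut_neg (\<lambda>k s. 1)"
        by (rule flux_mono[OF f1])
      finally show ?thesis by (simp add: flux_const)
    qed
    have "mean_pos = flux cut_pos (\<lambda>k s. 1)" by (simp add: flux_const)
    also have "\<dots> \<le> flux cut_pos (\<lambda>k s. ennreal b)"
      using \<open>1 \<le> b\<close> by (intro flux_mono) (simp add: ennreal_1[symmetric] del: ennreal_1)
    also have "\<dots> \<le> liminf (\<lambda>n. flux cut_pos (?f (r n)))"
    proof (rule flux_liminf[OF cut_measurable(1)])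
      show "mfun (?f (r n))" for n by (rule mfun_cmult[OF mfr])
      show "(\<lambda>n. ?f (r n) k s) \<longlonglongrightarrow> ennreal b" for k s
        unfolding fG by (rule tendsto_ennrealI[OF lim])
    qed
    also have "\<dots> \<le> liminf (\<lambda>n. ennreal (a (r n)) * I + mean_neg)"
      by (rule Liminf_mono) (simp add: bal)
    also have "\<dots> = mean_neg"
    proof (rule lim_imp_Liminf)
      have "(\<lambda>n. I * ennreal (a (r n))) \<longlonglongrightarrow> I * ennreal 0"
        by (rule ennreal_tendsto_cmult[OF I tendsto_ennrealI[OF ar]])
      then have "(\<lambda>n. ennreal (a (r n)) * I + mean_neg) \<longlonglongrightarrow> 0 + mean_neg"
        by (intro tendsto_add tendsto_const) (simp add: mult.commute)
      then show "(\<lambda>n. ennreal (a (r n)) * I + mean_neg) \<longlonglongrightarrow> mean_neg" by simp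
    qed simp
    finally show ?thesis using mean_neg_less_pos by simp
  qed
qed

end

section \<open>Renewal limits\<close>

lemma ennreal_squeeze_liminf:
  fixes a :: "nat \<Rightarrow> ennreal"
  assumes "\<And>n. a n \<le> L" "L \<le> liminf a"
  shows "a \<longlonglongrightarrow> L"
proof -
  have "limsup a \<le> L" by (rule Limsup_bounded) (simp add: assms(1))
  moreover have "liminf a \<le> limsup a" by (rule Liminf_le_Limsup) simp
  ultimately show ?thesis
    using assms(2) by (subst tendsto_iff_Liminf_eq_Limsup) auto
qed

text \<open>Fatou for a sequence and for its complement in a fixed finite sum gives both one-sided
  bounds, hence convergence.\<close>

lemma ennreal_tendsto_of_complement:
  fixes a b :: "nat \<Rightarrow> ennreal"
  assumes sum: "\<And>n. a n + b n = A + B" and fin: "A + B < \<top>" and "A \<le> liminf a" "B \<le> liminf b"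
  shows "a \<longlonglongrightarrow> A"
proof -
  let ?C = "A + B"
  have a_le: "a n \<le> ?C" for n
    by (rule ennreal_add_eq_imp_le[OF sum])
  have b_eq: "b = (\<lambda>n. ?C - a n)"
  proof
    fix n
    have "a n \<noteq> \<top>" using le_less_trans[OF a_le fin] by (rule less_imp_neq)
    then have "a n + b n - a n = b n" by (rule ennreal_add_diff_cancel_left)
    then show "b n = ?C - a n" unfolding sum by (rule sym)
  qed
  let ?L = "limsup a"
  have L: "?L \<le> ?C" by (rule Limsup_bounded) (simp add: a_le)
  have "B \<le> ?C - ?L"
    using assms(4) unfolding b_eq ennreal_liminf_minus[of a ?C, OF a_le] .
  then have "B + ?L \<le> B + A"
    using add_right_mono[of B "?C - ?L" ?L] ennreal_ineq_diff_add[OF L] by (simp add: add.commute)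
  moreover have "B \<noteq> \<top>" using fin by auto
  ultimately have "limsup a \<le> A" by simp
  moreover have "liminf a \<le> limsup a" by (rule Liminf_le_Limsup) simp
  ultimately show ?thesis
    using assms(3) by (subst tendsto_iff_Liminf_eq_Limsup) auto
qed

section \<open>Continuity of the flux; infinite damped potentials\<close>

context stationary_walk
begin

lemma flux_tendsto_below:
  assumes c: "case_prod c \<in> borel_measurable (borel \<Otimes>\<^sub>M borel)" and f: "\<And>n. mfun (f n)"
    and le: "\<And>n k s. f n k s \<le> g k s" and lim: "\<And>k s. (\<lambda>n. f n k s) \<longlonglongrightarrow> g k s"
  shows "(\<lambda>n. flux c (f n)) \<longlonglongrightarrow> flux c g"
  by (rule ennreal_squeeze_liminf[OF flux_mono[OF le] flux_liminf[where f = f, OF c f lim]])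

text \<open>Bounded convergence for a threefold integral, obtained from \<open>flux_liminf\<close>
  for \<open>f n\<close> and for its complement in the bound. Finiteness of the flux of the bound is
  essential, and it may fail for \<open>cut_pos\<close>.\<close>

lemma flux_tendsto_bounded:
  assumes c: "case_prod c \<in> borel_measurable (borel \<Otimes>\<^sub>M borel)" and f: "\<And>n. mfun (f n)"
    and le: "\<And>n k s. f n k s \<le> ennreal B" and lim: "\<And>k s. (\<lambda>n. f n k s) \<longlonglongrightarrow> g k s"
    and fin: "flux c (\<lambda>k s. ennreal B) < \<infinity>"
  shows "(\<lambda>n. flux c (f n)) \<longlonglongrightarrow> flux c g"
proof -
  have g: "mfun g"
    unfolding mfun_def
  proof (intro allI)
    fix k
    show "g k \<in> borel_measurable borel"
      by (rule borel_measurable_LIMSEQ_order[where u = "\<lambda>n. f n k"]) (use lim mfunD[OF f] in auto)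
  qed
  have g_le: "g k s \<le> ennreal B" for k s
  proof (rule LIMSEQ_le_const2[OF lim])
    show "\<exists>N. \<forall>n\<ge>N. f n k s \<le> ennreal B" by (intro exI allI impI le)
  qed
  have mB: "mfun (\<lambda>k s. ennreal B - h k s)" if "mfun h" for h
    unfolding mfun_def
  proof (intro allI)
    fix k
    note mfunD[OF that, measurable]
    show "(\<lambda>s. ennreal B - h k s) \<in> borel_measurable borel" by measurable
  qed
  have split: "flux c h + flux c (\<lambda>k s. ennreal B - h k s) = flux c (\<lambda>k s. ennreal B)"
    if "mfun h" "\<And>k s. h k s \<le> ennreal B" for h
    using flux_add[OF c that(1) mB[OF that(1)]] that(2) by (simp add: add_diff_inverse_ennreal)
  have lim': "(\<lambda>n. ennreal B - f n k s) \<longlonglongrightarrow> ennreal B - g k s" for k s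
    using g_le[of k s] by (intro tendsto_diff_ennreal tendsto_const lim) (auto simp: top_unique)
  show ?thesis
  proof (rule ennreal_tendsto_of_complement)
    show "flux c (f n) + flux c (\<lambda>k s. ennreal B - f n k s) = flux c g + flux c (\<lambda>k s. ennreal B - g k s)" for n
      unfolding split[OF f le] split[OF g g_le] ..
    show "flux c g + flux c (\<lambda>k s. ennreal B - g k s) < \<top>"
      unfolding split[OF g g_le] using fin by simp
    show "flux c g \<le> liminf (\<lambda>n. flux c (f n))" by (rule flux_liminf[where f = f, OF c f lim])
    show "flux c (\<lambda>k s. ennreal B - g k s) \<le> liminf (\<lambda>n. flux c (\<lambda>k s. ennreal B - f n k s))"
      by (rule flux_liminf[where f = "\<lambda>n k s. ennreal B - f n k s", OF c mB[OF f] lim'])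
  qed
qed

definition dpot :: "nat \<Rightarrow> ennreal \<Rightarrow> (real \<Rightarrow> ennreal) \<Rightarrow> nat \<Rightarrow> real \<Rightarrow> ennreal" where
  "dpot j r f = (\<lambda>k t. \<Sum>n. (dop j r ^^ n) (at_state j f) k t)"

lemma incseq_pot: "incseq (\<lambda>m. pot j r m f)"
  by (auto simp: incseq_def le_fun_def pot_def intro!: sum_mono2)

lemma dpot_SUP: "dpot j r f = (\<lambda>k t. SUP m. pot j r m f k t)"
  by (simp add: dpot_def pot_def suminf_eq_SUP)

lemma pot_Suc:
  assumes "f \<in> borel_measurable borel"
  shows "pot j r (Suc m) f = (\<lambda>k t. at_state j f k t + dop j r (pot j r m f) k t)"
proof -
  have "pot j r (Suc m) f k t = pot j r m f k t + (dop j r ^^ m) (at_state j f) k t" for k t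
    by (simp only: pot_def sum.lessThan_Suc)
  then show ?thesis
    unfolding pot_step[OF assms, symmetric] by (simp only: fun_eq_iff add.commute[of "at_state j f _ _"] simp_thms)
qed

lemma mfun_dpot: "f \<in> borel_measurable borel \<Longrightarrow> mfun (dpot j r f)"
  unfolding dpot_def by (intro mfun_suminf kop_mfun[OF kop_dopn] mfun_at_state)

lemma dpot_eq:
  assumes f: "f \<in> borel_measurable borel"
  shows "dpot j r f = (\<lambda>k t. at_state j f k t + dop j r (dpot j r f) k t)"
proof -
  have "dop j r (dpot j r f) = (\<lambda>k t. SUP m. dop j r (pot j r m f) k t)"
    unfolding dpot_SUP by (rule kop_SUP[OF kop_dop mfun_pot[OF f] incseq_pot])
  then have "at_state j f k t + dop j r (dpot j r f) k t = (SUP m. pot j r (Suc m) f k t)" for k t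
    unfolding pot_Suc[OF f] by (simp add: ennreal_SUP_add_right)
  also have "(SUP m. pot j r (Suc m) f k t) = (SUP m. pot j r m f k t)" for k t
  proof (rule SUP_eq)
    show "\<exists>m\<in>UNIV. pot j r (Suc n) f k t \<le> pot j r m f k t" for n by blast
    have "pot j r n f k t \<le> pot j r (Suc n) f k t" for n
      using incseq_SucD[OF incseq_pot[of j r f], of n] by (simp add: le_fun_def)
    then show "\<exists>m\<in>UNIV. pot j r n f k t \<le> pot j r (Suc m) f k t" for n by blast
  qed
  finally show ?thesis by (simp add: dpot_SUP)
qed

lemma dop_le_one: assumes "r \<le> 1" "mfun f" "\<And>k t. f k t \<le> 1" shows "(dop j r ^^ n) f i t \<le> 1"
proof (induction n arbitrary: i t)
  case (Suc n)
  have m: "mfun ((dop j r ^^ n) f)" by (rule kop_mfun[OF kop_dopn assms(2)])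
  have "(dop j r ^^ Suc n) f i t = op (damp j r ((dop j r ^^ n) f)) i t"
    by (simp add: dop_def)
  also have "\<dots> \<le> op (\<lambda>k t. 1) i t"
  proof (rule kop_mono[OF kop_op kop_mfun[OF kop_damp m]])
    show "damp j r ((dop j r ^^ n) f) k t \<le> 1" for k t
      using mult_mono[OF assms(1) Suc, of k t] Suc[of k t] by (cases "k = j") (auto simp: damp_def)
  qed simp
  finally show ?case by (simp add: op_const)
qed (use assms in simp)

lemma nn_integral_kop:
  assumes \<Phi>: "kop \<Phi>" and fin: "\<Phi> (at_state j (\<lambda>_. 1)) i 0 < \<top>" and f: "f \<in> borel_measurable borel"
  shows "(\<integral>\<^sup>+s. \<Phi> (at_state j f) i s \<partial>lborel) = (\<integral>\<^sup>+s. f s \<partial>lborel) * \<Phi> (at_state j (\<lambda>_. 1)) i 0"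
proof -
  let ?M = "kop_measure \<Phi> i j"
  have U: "emeasure ?M UNIV = \<Phi> (at_state j (\<lambda>_. 1)) i 0"
    by (subst emeasure_kop_measure[OF \<Phi>]) auto
  interpret M: finite_measure ?M
    using fin U by (intro finite_measureI) simp
  interpret pair_sigma_finite ?M lborel ..
  note f[measurable]
  have "(\<integral>\<^sup>+s. \<Phi> (at_state j f) i s \<partial>lborel) = (\<integral>\<^sup>+s. (\<integral>\<^sup>+x. f (s - x) \<partial>?M) \<partial>lborel)"
    by (simp add: nn_integral_kop_measure[OF \<Phi> f])
  also have "\<dots> = (\<integral>\<^sup>+x. (\<integral>\<^sup>+s. f (s - x) \<partial>lborel) \<partial>?M)"
    by (rule Fubini') measurable
  also have "\<dots> = (\<integral>\<^sup>+x. (\<integral>\<^sup>+s. f s \<partial>lborel) \<partial>?M)"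
    using nn_integral_shift[OF f, of "- _"] by simp
  finally show ?thesis using U by simp
qed

end

section \<open>Recurrence removes the finite horizon from the balance\<close>

context renewal_walk
begin

text \<open>The expected \<open>r\<close>-discounted number of visits to \<open>j\<close> is that of a chain which returns with
  certainty, because \<open>damp\<close> turns it into a bounded superharmonic function.\<close>

lemma dpot_one:
  assumes j: "j \<in> S" and r: "0 < r" "r < 1"
  shows "dpot j (ennreal r) (\<lambda>_. 1) j 0 = ennreal (1 / (1 - r))"
proof -
  let ?r = "ennreal r" and ?one = "\<lambda>_::real. 1 :: ennreal"
  \<comment> \<open>The fixed point of c = r * (1 + c): the damped number of visits to
    \<open>j\<close>, multiplied by r, for a chain that always returns.\<close>
  define c where "c = r / (1 - r)"
  have c: "c \<ge> 0" "r * (1 + c) = c" using r by (simp_all add: c_def field_simps)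
  have cE: "?r * (1 + ennreal c) = ennreal c"
    using c r by (simp add: ennreal_mult[symmetric] ennreal_plus[symmetric] flip: ennreal_1 del: ennreal_plus)
  have o: "?one \<in> borel_measurable borel" by simp
  let ?Y = "dpot j ?r ?one"
  define X where "X = damp j ?r ?Y"
  have mX: "mfun X" unfolding X_def by (rule kop_mfun[OF kop_damp mfun_dpot[OF o]])
  have bound: "damp j ?r (pot j ?r m ?one) k t \<le> ennreal c" for m k t
  proof (induction m arbitrary: k t)
    case 0
    then show ?case by (simp add: pot_def damp_def)
  next
    case (Suc m)
    have "dop j ?r (pot j ?r m ?one) k t \<le> op (\<lambda>k t. ennreal c) k t"
      unfolding dop_def by (rule kop_mono[OF kop_op kop_mfun[OF kop_damp mfun_pot[OF o]]]) (auto simp: Suc)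
    then have le: "dop j ?r (pot j ?r m ?one) k t \<le> ennreal c" by (simp add: op_const)
    show ?case
    proof (cases "k = j")
      case True
      have "?r * (1 + dop j ?r (pot j ?r m ?one) k t) \<le> ?r * (1 + ennreal c)"
        by (intro mult_left_mono add_left_mono le) simp
      then show ?thesis
        using True cE unfolding pot_Suc[OF o] damp_def by (simp add: at_state_def)
    next
      case False
      then show ?thesis
        using le unfolding pot_Suc[OF o] damp_def by (simp add: at_state_def)
    qed
  qed
  have X_le: "X k t \<le> ennreal c" for k t
  proof -
    have "X k t = (SUP m. damp j ?r (pot j ?r m ?one) k t)"
      unfolding X_def dpot_SUP by (simp add: damp_def SUP_mult_left_ennreal)
    then show ?thesis by (simp add: SUP_le_iff bound)
  qed
  have shift: "X k t = X k 0" for k t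
  proof -
    have "(dop j ?r ^^ n) (at_state j ?one) k t = (dop j ?r ^^ n) (at_state j ?one) k 0" for n
    proof -
      have "(dop j ?r ^^ n) (\<lambda>k s. at_state j ?one k (s - t)) k t = (dop j ?r ^^ n) (at_state j ?one) k (t - t)"
        by (subst kop_transl[OF kop_dopn mfun_at_state[OF o]]) (rule refl)
      moreover have "(\<lambda>k s. at_state j ?one k (s - t)) = at_state j ?one"
        by (simp add: at_state_def)
      ultimately show ?thesis by simp
    qed
    then show ?thesis by (simp add: X_def damp_def dpot_def)
  qed
  define H where "H k = enn2real (X k 0)" for k
  have X_H: "X k t = ennreal (H k)" for k t
    unfolding shift[of k t] H_def using le_less_trans[OF X_le[of k 0]] by simp
  have H0: "0 \<le> H k" and Hc: "H k \<le> c" for k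
    unfolding H_def using enn2real_leI[OF c(1) X_le[of k 0]] by simp_all
  have int: "integrable (K i) (\<lambda>z. H (fst z))" for i
    using H0 Hc by (intro integrable_fst_K[where C = c]) (simp add: abs_of_nonneg)
  define mH where "mH i = (\<integral>z. H (fst z) \<partial>K i)" for i
  have mH0: "0 \<le> mH i" for i unfolding mH_def using H0 by simp
  have opX: "op X i t = ennreal (mH i)" for i t
    unfolding op_def X_H mH_def by (rule nn_integral_eq_integral[OF int]) (simp add: H0)
  have Y: "?Y k t = at_state j ?one k t + op X k t" for k t
  proof -
    have "dpot j ?r ?one k t = (\<lambda>k t. at_state j ?one k t + dop j ?r (dpot j ?r ?one) k t) k t"
      by (rule arg_cong[where f = "\<lambda>h. h k t", OF dpot_eq[OF o]])
    then show ?thesis by (simp only: dop_def X_def)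
  qed
  have Hj: "H j = r * (1 + mH j)"
  proof -
    have Xj: "X j 0 = ?r * (1 + op X j 0)"
      using Y[of j 0] by (simp only: X_def damp_def at_state_def if_True refl)
    have "ennreal (H j) = ennreal (r * (1 + mH j))"
      using Xj mH0[of j] r unfolding X_H opX by (simp add: ennreal_mult)
    moreover have "0 \<le> r * (1 + mH j)" using mH0[of j] r by simp
    ultimately show ?thesis using H0[of j] by (simp only: ennreal_inj)
  qed
  have Hi: "H i = mH i" if "i \<noteq> j" for i
  proof -
    have "X i 0 = op X i 0"
      using Y[of i 0] that by (simp add: X_def damp_def at_state_def)
    then show ?thesis using H0[of i] mH0[of i] unfolding X_H opX by (simp only: ennreal_inj)
  qed
  \<comment> \<open>At \<open>j\<close> the bound H j \<le> c, rewritten through H j = r * (1 + mH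
    j), is exactly this inequality; elsewhere \<open>H\<close> is harmonic.\<close>
  have "mH i \<le> H i" for i
  proof (cases "i = j")
    case True
    have "H j * (1 - r) \<le> c * (1 - r)" using Hc r by (intro mult_right_mono) auto
    then have "H j * (1 - r) \<le> r" using r by (simp add: c_def)
    then have "r * mH j \<le> r * H j" using Hj by (simp add: algebra_simps)
    then show ?thesis using True r by simp
  qed (simp add: Hi)
  then have const: "H k = H j" if "k \<in> S" for k
    unfolding mH_def by (intro liouville[where H = H and C = c] H0 Hc that j)
  have "mH j = (\<integral>z. H j \<partial>K j)"
    unfolding mH_def
  proof (rule integral_cong_AE)
    show "AE z in K j. H (fst z) = H j" using K_in_S by eventually_elim (rule const)
  qed (use int in auto)
  then have "mH j = H j" by simp
  then have "H j = c" using Hj r by (simp add: c_def field_simps)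
  then have "1 + mH j = 1 / (1 - r)" using \<open>mH j = H j\<close> r by (simp add: c_def field_simps)
  then show ?thesis
    unfolding Y opX using mH0[of j] by (simp add: at_state_def ennreal_plus[symmetric] flip: ennreal_1 del: ennreal_plus)
qed

text \<open>The horizon is sent to infinity in \<open>pot_identity\<close>. The remainder vanishes
  because, by \<open>dpot_one\<close>, the losses charged at \<open>j\<close> add up to the whole
  initial mass, so no mass is left over.\<close>

lemma killed_identity:
  assumes j: "j \<in> S" and r: "0 < r" "r < 1"
    and f: "f \<in> borel_measurable borel" "(\<integral>\<^sup>+s. f s \<partial>lborel) < \<infinity>"
  shows "(1 - ennreal r) * emeasure W {j} * (\<integral>\<^sup>+s. indicator {..t} s * dpot j (ennreal r) f j s \<partial>lborel) +
      flux cut_pos (\<lambda>k s. damp j (ennreal r) (dpot j (ennreal r) f) k (t + s)) =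
      emeasure W {j} * (\<integral>\<^sup>+s. indicator {..t} s * f s \<partial>lborel) +
      flux cut_neg (\<lambda>k s. damp j (ennreal r) (dpot j (ennreal r) f) k (t + s))"
proof -
  let ?r = "ennreal r" and ?w = "emeasure W {j}" and ?I = "\<integral>\<^sup>+s. f s \<partial>lborel"
  have r1: "?r \<le> 1" using r by simp
  have q: "1 - ?r = ennreal (1 - r)"
    using r by (simp add: ennreal_minus[symmetric])
  have q_fin: "1 - ?r < \<top>" unfolding q by simp
  define y where "y n = (dop j ?r ^^ n) (at_state j (\<lambda>_. 1)) j 0" for n
  have y1: "y n \<le> 1" for n
    unfolding y_def by (rule dop_le_one[OF r1 mfun_at_state]) (auto simp: at_state_def)
  have inty: "(\<integral>\<^sup>+s. (dop j ?r ^^ n) (at_state j f) j s \<partial>lborel) = ?I * y n" for n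
    unfolding y_def using y1[of n] by (intro nn_integral_kop[OF kop_dopn _ f(1)]) (auto simp: y_def intro: le_less_trans)
  let ?b = "\<lambda>m. (1 - ?r) * ?w * (\<Sum>n<m. ?I * y n)"
  let ?tm = "\<lambda>m. total_mass ((dop j ?r ^^ m) (at_state j f))"
  have tm: "?tm m + ?b m = ?w * ?I" for m
    using total_mass_dopn[OF r1 f(1), where j = j and m = m] unfolding inty .
  have wI: "?w * ?I < \<top>" using f(2) W_fin[of j] by (simp add: ennreal_mult_less_top)
  have "suminf y = ennreal (1 / (1 - r))"
    using dpot_one[OF j r] unfolding dpot_def y_def[symmetric] .
  then have "(\<lambda>m. \<Sum>n<m. y n) \<longlonglongrightarrow> ennreal (1 / (1 - r))"
    using summable_LIMSEQ[OF summableI, of y] by simp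
  then have "(\<lambda>m. ((1 - ?r) * ?w * ?I) * (\<Sum>n<m. y n)) \<longlonglongrightarrow> ((1 - ?r) * ?w * ?I) * ennreal (1 / (1 - r))"
    using wI q_fin by (intro ennreal_tendsto_cmult) (auto simp: mult.assoc ennreal_mult_less_top)
  moreover have "((1 - ?r) * ?w * ?I) * ennreal (1 / (1 - r)) = ?w * ?I"
  proof -
    have "(1 - ?r) * ennreal (1 / (1 - r)) = 1"
      unfolding q using r by (simp add: ennreal_mult[symmetric])
    moreover have "((1 - ?r) * ?w * ?I) * ennreal (1 / (1 - r)) = ((1 - ?r) * ennreal (1 / (1 - r))) * (?w * ?I)"
      by (simp only: ac_simps)
    ultimately show ?thesis by simp
  qed
  ultimately have b_lim: "?b \<longlonglongrightarrow> ?w * ?I"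
    by (simp add: sum_distrib_left[symmetric] mult.assoc)
  have b_fin: "?b m < \<top>" for m
    using ennreal_add_eq_imp_le2[OF tm[of m]] wI by (rule le_less_trans)
  have "(\<lambda>m. ?w * ?I - ?b m) \<longlonglongrightarrow> ?w * ?I - ?w * ?I"
    using wI by (intro tendsto_diff_ennreal tendsto_const b_lim) auto
  moreover have "?w * ?I - ?b m = ?tm m" for m
    unfolding tm[of m, symmetric] using b_fin[of m] by (intro ennreal_add_diff_cancel_right) simp
  moreover have "?w * ?I - ?w * ?I = 0" using wI by simp
  ultimately have tm_lim: "?tm \<longlonglongrightarrow> 0" by simp
  have h_lim: "(\<lambda>m. half_mass ((dop j ?r ^^ m) (at_state j f)) t) \<longlonglongrightarrow> 0"
    by (rule tendsto_sandwich[OF _ _ tendsto_const tm_lim]) (auto simp: half_mass_le_total)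
  let ?q = "\<lambda>m k s. damp j ?r (pot j ?r m f) k (t + s)"
  have inc: "incseq (\<lambda>m. pot j ?r m f k s)" for k s
    using incseq_pot[of j ?r f] by (auto simp: incseq_def le_fun_def)
  have incq: "incseq ?q"
    using inc by (auto simp: incseq_def le_fun_def damp_def intro!: mult_left_mono)
  have mq: "mfun (?q m)" for m
    using mfun_transl[where a = "- t", OF kop_mfun[OF kop_damp mfun_pot[OF f(1)]]] by (simp add: add.commute)
  have Sq: "(\<lambda>k s. SUP m. ?q m k s) = (\<lambda>k s. damp j ?r (dpot j ?r f) k (t + s))"
    unfolding dpot_SUP by (simp add: damp_def SUP_mult_left_ennreal)
  have fl: "(\<lambda>m. flux c (?q m)) \<longlonglongrightarrow> flux c (\<lambda>k s. damp j ?r (dpot j ?r f) k (t + s))"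
    if c: "case_prod c \<in> borel_measurable (borel \<Otimes>\<^sub>M borel)" for c
    unfolding Sq[symmetric] flux_SUP[OF c mq incq]
    using incq by (intro LIMSEQ_SUP) (auto simp: incseq_def le_fun_def intro!: flux_mono)
  have i_lim: "(\<lambda>m. \<integral>\<^sup>+s. indicator {..t} s * pot j ?r m f j s \<partial>lborel) \<longlonglongrightarrow>
      (\<integral>\<^sup>+s. indicator {..t} s * dpot j ?r f j s \<partial>lborel)"
  proof -
    note mfunD[OF mfun_pot[OF f(1)], measurable]
    have "(\<integral>\<^sup>+s. indicator {..t} s * dpot j ?r f j s \<partial>lborel) =
        (\<integral>\<^sup>+s. (SUP m. indicator {..t} s * pot j ?r m f j s) \<partial>lborel)"
      unfolding dpot_SUP by (simp add: SUP_mult_left_ennreal)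
    also have "\<dots> = (SUP m. \<integral>\<^sup>+s. indicator {..t} s * pot j ?r m f j s \<partial>lborel)"
      using inc by (intro nn_integral_monotone_convergence_SUP) (auto simp: incseq_def le_fun_def intro!: mult_left_mono)
    finally show ?thesis
      using inc by (simp, intro LIMSEQ_SUP) (auto simp: incseq_def intro!: nn_integral_mono mult_left_mono)
  qed
  have w1: "(1 - ?r) * ?w < \<top>"
    using W_fin[of j] q_fin by (simp add: ennreal_mult_less_top)
  have "(\<lambda>m. (1 - ?r) * ?w * (\<integral>\<^sup>+s. indicator {..t} s * pot j ?r m f j s \<partial>lborel) +
      half_mass ((dop j ?r ^^ m) (at_state j f)) t + flux cut_pos (?q m)) \<longlonglongrightarrow>
      (1 - ?r) * ?w * (\<integral>\<^sup>+s. indicator {..t} s * dpot j ?r f j s \<partial>lborel) + 0 +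
      flux cut_pos (\<lambda>k s. damp j ?r (dpot j ?r f) k (t + s))"
    by (intro tendsto_add h_lim fl cut_measurable ennreal_tendsto_cmult[OF w1 i_lim])
  then have "(\<lambda>m. ?w * (\<integral>\<^sup>+s. indicator {..t} s * f s \<partial>lborel) + flux cut_neg (?q m)) \<longlonglongrightarrow>
      (1 - ?r) * ?w * (\<integral>\<^sup>+s. indicator {..t} s * dpot j ?r f j s \<partial>lborel) +
      flux cut_pos (\<lambda>k s. damp j ?r (dpot j ?r f) k (t + s))"
    unfolding pot_identity[OF r1 f] by simp
  moreover have "(\<lambda>m. ?w * (\<integral>\<^sup>+s. indicator {..t} s * f s \<partial>lborel) + flux cut_neg (?q m)) \<longlonglongrightarrow>
      ?w * (\<integral>\<^sup>+s. indicator {..t} s * f s \<partial>lborel) + flux cut_neg (\<lambda>k s. damp j ?r (dpot j ?r f) k (t + s))"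
    by (intro tendsto_add tendsto_const fl cut_measurable)
  ultimately show ?thesis by (rule LIMSEQ_unique)
qed

end

section \<open>The undamped potential as a limit of damped ones\<close>

context stationary_walk
begin

text \<open>The potential of the walk smoothed by \<open>f\<close>. For \<open>f\<close> the
  reflected indicator of \<open>B\<close> and at position 0 it is the renewal measure of
  \<open>B\<close> up to the factor v i / v j.\<close>

definition rmeas :: "nat \<Rightarrow> (real \<Rightarrow> ennreal) \<Rightarrow> nat \<Rightarrow> real \<Rightarrow> ennreal" where
  "rmeas j f = (\<lambda>k t. \<Sum>n. (op ^^ n) (at_state j f) k t)"

lemma rmeas_SUP: "rmeas j f = (\<lambda>k t. SUP m. rpot j m f k t)"
  by (simp add: rmeas_def rpot_eq suminf_eq_SUP)

lemma rmeas_dpot: "rmeas j f = dpot j 1 f"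
  by (simp add: rmeas_def dpot_def dop_1)

lemma kop_V: "kop (\<lambda>f k t. \<Sum>n. (op ^^ n) f k t)"
  by (rule kop_suminf_op[OF kop_opn])

text \<open>Each damped step multiplies by \<open>r\<close> or by 1, so \<open>n\<close> steps lose
  at most the factor r ^ n.\<close>

lemma dopn_le_opn:
  assumes r: "0 \<le> r" "r \<le> 1" and f: "mfun f"
  shows "(dop j (ennreal r) ^^ n) f k t \<le> (op ^^ n) f k t"
    and "ennreal (r ^ n) * (op ^^ n) f k t \<le> (dop j (ennreal r) ^^ n) f k t"
proof -
  show "(dop j (ennreal r) ^^ n) f k t \<le> (op ^^ n) f k t"
  proof (induction n arbitrary: k t)
    case (Suc n)
    have "(dop j (ennreal r) ^^ Suc n) f k t = op (damp j (ennreal r) ((dop j (ennreal r) ^^ n) f)) k t"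
      by (simp add: dop_def)
    also have "\<dots> \<le> op ((op ^^ n) f) k t"
    proof (rule kop_mono[OF kop_op kop_mfun[OF kop_damp kop_mfun[OF kop_dopn f]] kop_mfun[OF kop_opn f]])
      fix k t
      have "(if k = j then ennreal r else 1) * (dop j (ennreal r) ^^ n) f k t \<le> 1 * (op ^^ n) f k t"
        using r by (intro mult_mono Suc) auto
      then show "damp j (ennreal r) ((dop j (ennreal r) ^^ n) f) k t \<le> (op ^^ n) f k t"
        by (simp add: damp_def)
    qed
    finally show ?case by simp
  qed simp
  show "ennreal (r ^ n) * (op ^^ n) f k t \<le> (dop j (ennreal r) ^^ n) f k t"
  proof (induction n arbitrary: k t)
    case (Suc n)
    have mo: "mfun ((op ^^ n) f)" by (rule kop_mfun[OF kop_opn f])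
    have "ennreal (r ^ Suc n) * (op ^^ Suc n) f k t = op (\<lambda>k t. ennreal (r ^ Suc n) * (op ^^ n) f k t) k t"
      using kop_cmult[OF kop_op mo, of "ennreal (r ^ Suc n)"] by simp
    also have "\<dots> \<le> op (damp j (ennreal r) ((dop j (ennreal r) ^^ n) f)) k t"
    proof (rule kop_mono[OF kop_op mfun_cmult[OF mo] kop_mfun[OF kop_damp kop_mfun[OF kop_dopn f]]])
      fix k t
      have "ennreal r * (ennreal (r ^ n) * (op ^^ n) f k t) \<le>
          (if k = j then ennreal r else 1) * (dop j (ennreal r) ^^ n) f k t"
        using r by (intro mult_mono Suc) auto
      then show "ennreal (r ^ Suc n) * (op ^^ n) f k t \<le> damp j (ennreal r) ((dop j (ennreal r) ^^ n) f) k t"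
        using r by (simp add: damp_def ennreal_mult mult.assoc)
    qed
    also have "\<dots> = (dop j (ennreal r) ^^ Suc n) f k t" by (simp add: dop_def)
    finally show ?case .
  qed simp
qed

lemma damp_dpot_tendsto:
  assumes f: "f \<in> borel_measurable borel" and r: "\<And>n. 0 \<le> r n" "\<And>n. r n \<le> 1" "r \<longlonglongrightarrow> 1"
  shows "damp j (ennreal (r n)) (dpot j (ennreal (r n)) f) k t \<le> rmeas j f k t"
    and "dpot j (ennreal (r n)) f k t \<le> rmeas j f k t"
    and "(\<lambda>n. damp j (ennreal (r n)) (dpot j (ennreal (r n)) f) k t) \<longlonglongrightarrow> rmeas j f k t"
proof -
  note m = mfun_at_state[OF f, of j]
  show le: "dpot j (ennreal (r n)) f k t \<le> rmeas j f k t" for n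
    unfolding dpot_def rmeas_def by (intro suminf_le dopn_le_opn(1) r m summableI)
  show le': "damp j (ennreal (r n)) (dpot j (ennreal (r n)) f) k t \<le> rmeas j f k t" for n
  proof -
    have "(if k = j then ennreal (r n) else 1) * dpot j (ennreal (r n)) f k t \<le> 1 * rmeas j f k t"
      using r by (intro mult_mono le) auto
    then show ?thesis by (simp add: damp_def)
  qed
  show "(\<lambda>n. damp j (ennreal (r n)) (dpot j (ennreal (r n)) f) k t) \<longlonglongrightarrow> rmeas j f k t"
  proof (rule ennreal_squeeze_liminf[OF le'])
    show "rmeas j f k t \<le> liminf (\<lambda>n. damp j (ennreal (r n)) (dpot j (ennreal (r n)) f) k t)"
      unfolding rmeas_SUP
    proof (rule SUP_least)
      fix N
      \<comment> \<open>\<open>N\<close> factors bound the damping inside the first \<open>N\<close>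
        powers, and one more comes from the outer \<open>damp\<close>.\<close>
      have low: "ennreal (r n ^ Suc N) * rpot j N f k t \<le> damp j (ennreal (r n)) (dpot j (ennreal (r n)) f) k t" for n
      proof -
        have "ennreal (r n ^ N) * rpot j N f k t = (\<Sum>m<N. ennreal (r n ^ N) * (op ^^ m) (at_state j f) k t)"
          unfolding rpot_eq by (rule sum_distrib_left)
        also have "\<dots> \<le> (\<Sum>m<N. (dop j (ennreal (r n)) ^^ m) (at_state j f) k t)"
        proof (rule sum_mono)
          fix m assume "m \<in> {..<N}"
          then have "ennreal (r n ^ N) \<le> ennreal (r n ^ m)"
            using r by (intro ennreal_leI power_decreasing) auto
          then have "ennreal (r n ^ N) * (op ^^ m) (at_state j f) k t \<le> ennreal (r n ^ m) * (op ^^ m) (at_state j f) k t"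
            by (rule mult_right_mono) simp
          also have "\<dots> \<le> (dop j (ennreal (r n)) ^^ m) (at_state j f) k t"
            by (rule dopn_le_opn(2)[OF r(1,2) m])
          finally show "ennreal (r n ^ N) * (op ^^ m) (at_state j f) k t \<le> (dop j (ennreal (r n)) ^^ m) (at_state j f) k t" .
        qed
        also have "\<dots> \<le> dpot j (ennreal (r n)) f k t"
          unfolding dpot_def by (rule sum_le_suminf) (auto simp: summableI)
        finally have 1: "ennreal (r n ^ N) * rpot j N f k t \<le> dpot j (ennreal (r n)) f k t" .
        have "ennreal (r n) * (ennreal (r n ^ N) * rpot j N f k t) \<le>
            (if k = j then ennreal (r n) else 1) * dpot j (ennreal (r n)) f k t"
          using r by (intro mult_mono 1) auto
        then show ?thesis
          using r by (simp add: damp_def ennreal_mult mult.assoc)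
      qed
      have "(\<lambda>n. r n ^ Suc N) \<longlonglongrightarrow> 1 ^ Suc N"
        by (intro tendsto_power r)
      then have lim1: "(\<lambda>n. ennreal (r n ^ Suc N)) \<longlonglongrightarrow> 1"
        using tendsto_ennrealI[of "\<lambda>n. r n ^ Suc N" 1] by simp
      show "rpot j N f k t \<le> liminf (\<lambda>n. damp j (ennreal (r n)) (dpot j (ennreal (r n)) f) k t)"
      proof (cases "rpot j N f k t = \<top>")
        case False
        then have "(\<lambda>n. rpot j N f k t * ennreal (r n ^ Suc N)) \<longlonglongrightarrow> rpot j N f k t * 1"
          by (intro ennreal_tendsto_cmult lim1) (simp add: less_top)
        then have "(\<lambda>n. ennreal (r n ^ Suc N) * rpot j N f k t) \<longlonglongrightarrow> rpot j N f k t"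
          by (simp add: mult.commute)
        then have "liminf (\<lambda>n. ennreal (r n ^ Suc N) * rpot j N f k t) = rpot j N f k t"
          by (rule lim_imp_Liminf[rotated]) simp
        then show ?thesis
          using Liminf_mono[of "\<lambda>n. ennreal (r n ^ Suc N) * rpot j N f k t"
              "\<lambda>n. damp j (ennreal (r n)) (dpot j (ennreal (r n)) f) k t" sequentially] low by simp
      next
        case True
        \<comment> \<open>For an infinite partial potential any positive factor already forces the
          value \<infinity>, so convergence of the factor is used only through positivity.\<close>
        have "eventually (\<lambda>n. 0 < ennreal (r n ^ Suc N)) sequentially"
          by (rule order_tendstoD(1)[OF lim1]) simp
        then have "eventually (\<lambda>n. \<top> \<le> damp j (ennreal (r n)) (dpot j (ennreal (r n)) f) k t) sequentially"
        proof eventually_elim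
          case (elim n)
          then have "ennreal (r n ^ Suc N) * \<top> = \<top>" by (simp only: ennreal_mult_eq_top_iff) auto
          then show ?case using low[of n] unfolding True by (simp only:)
        qed
        then show ?thesis unfolding True by (rule Liminf_bounded)
      qed
    qed
  qed
qed

end

context renewal_walk
begin

text \<open>As \<open>r\<close> tends to 1 both fluxes converge and the downward one has a finite
  limit, so the damping loss converges too. Its limit \<open>E\<close> need not vanish for visible
  reasons, since loss may accumulate far to the left, but it does not depend on the level.\<close>

lemma rmeas_identity:
  assumes j: "j \<in> S" and f: "f \<in> borel_measurable borel" "(\<integral>\<^sup>+s. f s \<partial>lborel) < \<infinity>"
    and B: "\<And>k t. rmeas j f k t \<le> ennreal B"
  obtains E where "\<And>t. E + flux cut_pos (\<lambda>k s. rmeas j f k (t + s)) =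
      emeasure W {j} * (\<integral>\<^sup>+s. indicator {..t} s * f s \<partial>lborel) + flux cut_neg (\<lambda>k s. rmeas j f k (t + s))"
proof -
  let ?w = "emeasure W {j}"
  \<comment> \<open>The index shift by two starts at 1/2, so that every term lies strictly between 0
    and 1.\<close>
  define r where "r n = 1 - inverse (real (Suc (Suc n)))" for n
  have r: "0 < r n" "r n < 1" for n by (auto simp: r_def field_simps)
  have r_lim: "r \<longlonglongrightarrow> 1"
    unfolding r_def using LIMSEQ_Suc[OF LIMSEQ_inverse_real_of_nat] tendsto_diff[of "\<lambda>_. 1" 1] by fastforce
  let ?D = "\<lambda>n. damp j (ennreal (r n)) (dpot j (ennreal (r n)) f)"
  have r': "0 \<le> r n" "r n \<le> 1" for n using r[of n] by simp_all
  note D = damp_dpot_tendsto[where r = r, OF f(1) r' r_lim]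
  have mD: "mfun (\<lambda>k s. ?D n k (t + s))" for n t
    using mfun_transl[where a = "- t", OF kop_mfun[OF kop_damp mfun_dpot[OF f(1)]]] by (simp add: add.commute)
  define e where "e n t = (1 - ennreal (r n)) * ?w * (\<integral>\<^sup>+s. indicator {..t} s * dpot j (ennreal (r n)) f j s \<partial>lborel)" for n t
  define P where "P n t = flux cut_pos (\<lambda>k s. ?D n k (t + s))" for n t
  define N where "N n t = flux cut_neg (\<lambda>k s. ?D n k (t + s))" for n t
  define P' where "P' t = flux cut_pos (\<lambda>k s. rmeas j f k (t + s))" for t
  define N' where "N' t = flux cut_neg (\<lambda>k s. rmeas j f k (t + s))" for t
  define F where "F t = ?w * (\<integral>\<^sup>+s. indicator {..t} s * f s \<partial>lborel)" for t
  have id: "e n t + P n t = F t + N n t" for n t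
    unfolding e_def P_def N_def F_def by (rule killed_identity[OF j r f])
  have P_lim: "(\<lambda>n. P n t) \<longlonglongrightarrow> P' t" for t
    unfolding P_def P'_def by (rule flux_tendsto_below[OF cut_measurable(1) mD D(1) D(3)])
  have N_lim: "(\<lambda>n. N n t) \<longlonglongrightarrow> N' t" for t
    unfolding N_def N'_def by (rule flux_tendsto_below[OF cut_measurable(2) mD D(1) D(3)])
  have mneg: "mean_neg < \<top>" using mean_neg_less_pos by (rule less_le_trans) simp
  have N'_fin: "N' t < \<top>" for t
  proof -
    have "N' t \<le> flux cut_neg (\<lambda>k s. ennreal B)" unfolding N'_def by (rule flux_mono[OF B])
    also have "\<dots> < \<top>" using mneg by (simp add: flux_const ennreal_mult_less_top)
    finally show ?thesis .
  qed
  have F_fin: "F t < \<top>" for t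
  proof -
    have "F t \<le> ?w * (\<integral>\<^sup>+s. f s \<partial>lborel)"
      unfolding F_def by (intro mult_left_mono nn_integral_mono) (auto split: split_indicator)
    also have "\<dots> < \<top>" using f(2) W_fin[of j] by (simp add: ennreal_mult_less_top)
    finally show ?thesis .
  qed
  have N_le: "N n t \<le> N' t" for n t
    unfolding N_def N'_def by (rule flux_mono[OF D(1)])
  have P_le: "P n t \<le> F t + N' t" for n t
    using ennreal_add_eq_imp_le2[OF id] add_left_mono[OF N_le] by (rule order_trans)
  have FN: "F t + N' t < \<top>" for t using F_fin[of t] N'_fin[of t] by simp
  have P'_le: "P' t \<le> F t + N' t" for t
    by (rule LIMSEQ_le_const2[OF P_lim]) (intro exI allI impI P_le)
  have e_eq: "e n t = (F t + N n t) - P n t" for n t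
    unfolding id[symmetric] using le_less_trans[OF P_le FN, of n t] by (intro ennreal_add_diff_cancel_right[symmetric]) simp
  define E where "E t = (F t + N' t) - P' t" for t
  have e_lim: "(\<lambda>n. e n t) \<longlonglongrightarrow> E t" for t
    unfolding e_eq E_def using FN[of t] le_less_trans[OF P'_le FN, of t]
    by (intro tendsto_diff_ennreal tendsto_add tendsto_const N_lim P_lim) auto
  \<comment> \<open>Between two levels the loss is at most 1 - r times W{j}, the bound on the
    potential and the length of the interval.\<close>
  have mono_E: "E t = E s" if "s \<le> t" for s t
  proof -
    let ?d = "\<lambda>n. (1 - ennreal (r n)) * ?w * (\<integral>\<^sup>+x. indicator {s<..t} x * dpot j (ennreal (r n)) f j x \<partial>lborel)"
    have split: "e n t = e n s + ?d n" for n
    proof -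
      note mfunD[OF mfun_dpot[OF f(1)], measurable]
      have "(\<integral>\<^sup>+x. indicator {..t} x * dpot j (ennreal (r n)) f j x \<partial>lborel) =
          (\<integral>\<^sup>+x. indicator {..s} x * dpot j (ennreal (r n)) f j x + indicator {s<..t} x * dpot j (ennreal (r n)) f j x \<partial>lborel)"
        using that by (intro nn_integral_cong) (auto split: split_indicator)
      then show ?thesis
        unfolding e_def by (simp add: nn_integral_add distrib_left)
    qed
    have d_le: "?d n \<le> ennreal (1 - r n) * (?w * (ennreal B * ennreal (t - s)))" for n
    proof -
      have "(\<integral>\<^sup>+x. indicator {s<..t} x * dpot j (ennreal (r n)) f j x \<partial>lborel) \<le>
          (\<integral>\<^sup>+x. ennreal B * indicator {s<..t} x \<partial>lborel)"
        using order_trans[OF D(2) B] by (intro nn_integral_mono) (auto split: split_indicator)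
      also have "\<dots> = ennreal B * ennreal (t - s)"
        using that by (subst nn_integral_cmult_indicator) auto
      finally have "(1 - ennreal (r n)) * (?w * (\<integral>\<^sup>+x. indicator {s<..t} x * dpot j (ennreal (r n)) f j x \<partial>lborel)) \<le>
          (1 - ennreal (r n)) * (?w * (ennreal B * ennreal (t - s)))"
        by (intro mult_left_mono) auto
      moreover have "1 - ennreal (r n) = ennreal (1 - r n)"
        using r[of n] by (simp add: ennreal_minus[symmetric])
      ultimately show ?thesis by (simp add: mult.assoc)
    qed
    let ?c = "?w * (ennreal B * ennreal (t - s))"
    have c: "?c < \<top>" using W_fin[of j] by (simp add: ennreal_mult_less_top)
    have "(\<lambda>n. 1 - r n) \<longlonglongrightarrow> 1 - 1" by (intro tendsto_diff tendsto_const r_lim)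
    then have "(\<lambda>n. ?c * ennreal (1 - r n)) \<longlonglongrightarrow> ?c * ennreal 0"
      by (intro ennreal_tendsto_cmult c tendsto_ennrealI) simp
    then have "(\<lambda>n. ennreal (1 - r n) * ?c) \<longlonglongrightarrow> 0" by (simp add: mult.commute)
    then have "?d \<longlonglongrightarrow> 0"
      by (rule tendsto_sandwich[OF _ _ tendsto_const, rotated 2]) (auto simp: d_le)
    then have "(\<lambda>n. e n s + ?d n) \<longlonglongrightarrow> E s + 0" by (intro tendsto_add e_lim)
    then have "(\<lambda>n. e n t) \<longlonglongrightarrow> E s" unfolding split by simp
    with e_lim[of t] show ?thesis by (rule LIMSEQ_unique)
  qed
  have E0: "E t = E 0" for t
  proof (cases "0 \<le> t")
    case True
    then show ?thesis by (rule mono_E)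
  next
    case False
    then have "t \<le> 0" by simp
    then show ?thesis by (rule mono_E[symmetric])
  qed
  show thesis
  proof (rule that[of "E 0"])
    fix t
    have "E t + P' t = F t + N' t"
      unfolding E_def using P'_le[of t] by (simp add: diff_add_cancel_ennreal)
    then show "E 0 + flux cut_pos (\<lambda>k s. rmeas j f k (t + s)) =
        ?w * (\<integral>\<^sup>+s. indicator {..t} s * f s \<partial>lborel) + flux cut_neg (\<lambda>k s. rmeas j f k (t + s))"
      unfolding P'_def N'_def F_def E0[of t] .
  qed
qed

end

lemma ennreal_add_liminf_le:
  fixes p R :: "nat \<Rightarrow> ennreal"
  assumes A: "A \<le> liminf p" and eq: "\<And>n. E + p n = R n" and R: "R \<longlonglongrightarrow> L"
  shows "E + A \<le> L"
proof (cases "L = \<top>")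
  case False
  have "E \<le> L"
    by (rule LIMSEQ_le_const[OF R]) (intro exI allI impI ennreal_add_eq_imp_le[OF eq])
  then have E: "E \<noteq> \<top>" using False by (auto simp: top_unique)
  have "p = (\<lambda>n. R n - E)"
    unfolding eq[symmetric] by (rule ext) (rule ennreal_add_diff_cancel_left[OF E, symmetric])
  then have "p \<longlonglongrightarrow> L - E"
    using tendsto_diff_ennreal[OF R tendsto_const False E] by simp
  then have "liminf p = L - E" by (rule lim_imp_Liminf[rotated]) simp
  then have "E + A \<le> E + (L - E)" using A by (intro add_left_mono) simp
  also have "\<dots> = L" by (rule ennreal_ineq_diff_add[OF \<open>E \<le> L\<close>, symmetric])
  finally show ?thesis .
qed simp

text \<open>Compactness provides only subsequential limits; this is where their identification turns
  into convergence.\<close>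

lemma tendsto_at_top_by_subsequences:
  fixes f :: "real \<Rightarrow> real"
  assumes "\<And>X. (\<And>n::nat. real n \<le> X n) \<Longrightarrow> \<exists>r::nat \<Rightarrow> nat. (\<lambda>n. f (X (r n))) \<longlonglongrightarrow> y"
  shows "(f \<longlongrightarrow> y) at_top"
proof (rule ccontr)
  assume "\<not> ?thesis"
  then obtain e where e: "e > 0" "\<not> eventually (\<lambda>x. dist (f x) y < e) at_top"
    unfolding tendsto_iff by blast
  have "\<exists>x. real n \<le> x \<and> e \<le> dist (f x) y" for n
    using e(2) unfolding eventually_at_top_linorder by (meson not_less)
  then obtain X where X: "\<And>n. real n \<le> X n" "\<And>n. e \<le> dist (f (X n)) y" by metis
  obtain r :: "nat \<Rightarrow> nat" where "(\<lambda>n. f (X (r n))) \<longlonglongrightarrow> y" using assms[OF X(1)] by blast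
  then have "eventually (\<lambda>n. dist (f (X (r n))) y < e) sequentially"
    using e(1) by (rule tendstoD)
  then show False
    using X(2) by (metis (no_types, lifting) eventually_sequentially not_less order_refl)
qed

section \<open>Limits of the smoothed potential at both ends\<close>

context renewal_walk
begin

text \<open>The number 1 / \<mu> as a real, with the convention that it is 0 when the positive part
  of the drift is infinite.\<close>

definition rate :: real where
  "rate = (if mean_pos = \<top> then 0 else 1 / (enn2real mean_pos - enn2real mean_neg))"

lemma mean_neg_finite: "mean_neg < \<top>"
  using mean_neg_less_pos by (rule less_le_trans) simp

lemma rmeas_exp_bounded:
  obtains M where "M \<ge> 0" "\<And>i t. rmeas j expf i t \<le> ennreal M"
proof -
  obtain M where M: "M \<ge> 0" "\<And>N i t. rpot j N expf i t \<le> ennreal M"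
    using rpot_exp_bounded[of j] by metis
  have "rmeas j expf i t \<le> ennreal M" for i t
    unfolding rmeas_SUP by (rule SUP_least) (rule M(2))
  with M(1) show thesis by (rule that)
qed

lemma rmeas_dominated:
  assumes f: "dominated c f"
  obtains B where "\<And>i t. rmeas j (\<lambda>t. ennreal (f t)) i t \<le> ennreal B" "B \<ge> 0"
    "tame B B (\<lambda>i t. enn2real (rmeas j (\<lambda>t. ennreal (f t)) i t))"
proof -
  obtain M where M: "M \<ge> 0" "\<And>i t. rmeas j expf i t \<le> ennreal M" using rmeas_exp_bounded[of j] by metis
  have M': "(\<Sum>n. (op ^^ n) (at_state j expf) i t) \<le> ennreal M" for i t
    using M(2)[of i t] by (simp only: rmeas_def)
  note t = tame_kop_dominated[OF kop_V M(1) M' f]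
  show thesis
  proof (rule that[of "c * M"])
    show "c * M \<ge> 0" using dominatedD(4)[OF f] M(1) by simp
  qed (use t in \<open>simp_all only: rmeas_def\<close>)
qed

text \<open>The renewal equation differs from harmonicity only by the source \<open>f\<close> at
  state \<open>j\<close>, which dies out as the centre \<open>X n\<close> moves off to either
  side.\<close>

lemma rmeas_subsequence_const:
  assumes f: "dominated c f" and X: "\<And>n. real n \<le> \<bar>X n\<bar>"
    and B: "\<And>i t. rmeas j (\<lambda>t. ennreal (f t)) i t \<le> ennreal B" "B \<ge> 0"
    "tame B B (\<lambda>i t. enn2real (rmeas j (\<lambda>t. ennreal (f t)) i t))"
  obtains r :: "nat \<Rightarrow> nat" and b where "strict_mono r" "b \<ge> 0"
    "\<And>k s. (\<lambda>n. enn2real (rmeas j (\<lambda>t. ennreal (f t)) k (X (r n) + s))) \<longlonglongrightarrow> b"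
    "\<And>k s. (\<lambda>n. rmeas j (\<lambda>t. ennreal (f t)) k (X (r n) + s)) \<longlonglongrightarrow> ennreal b"
proof -
  let ?f = "\<lambda>t. ennreal (f t)"
  let ?g = "\<lambda>i t. enn2real (rmeas j ?f i t)"
  note [measurable] = dominatedD(1)[OF f]
  have fm: "?f \<in> borel_measurable borel" by measurable
  have fin: "rmeas j ?f i t < \<top>" for i t by (rule le_less_trans[OF B(1)]) simp
  have ge: "(\<lambda>i t. ennreal (?g i t)) = rmeas j ?f" using fin by (simp add: fun_eq_iff)
  have op: "op (rmeas j ?f) i t = ennreal (\<integral>z. ?g (fst z) (t - snd z) \<partial>K i)" for i t
    using op_ennreal[OF B(3), of i t] unfolding ge by simp
  have eq: "?g i t - (\<integral>z. ?g (fst z) (t - snd z) \<partial>K i) = (if i = j then f t else 0)" for i t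
  proof -
    have "rmeas j ?f i t = (\<lambda>k t. at_state j ?f k t + dop j 1 (dpot j 1 ?f) k t) i t"
      unfolding rmeas_dpot by (rule arg_cong[where f = "\<lambda>h. h i t", OF dpot_eq[OF fm]])
    then have "rmeas j ?f i t = at_state j ?f i t + ennreal (\<integral>z. ?g (fst z) (t - snd z) \<partial>K i)"
      by (simp only: dop_1 rmeas_dpot[symmetric] op)
    also have "at_state j ?f i t = ennreal (if i = j then f t else 0)"
      by (simp add: at_state_def)
    finally have *: "rmeas j ?f i t = ennreal (if i = j then f t else 0) + ennreal (\<integral>z. ?g (fst z) (t - snd z) \<partial>K i)" .
    define a where "a = (if i = j then f t else 0)"
    define I where "I = (\<integral>z. ?g (fst z) (t - snd z) \<partial>K i)"
    have "0 \<le> a" "0 \<le> I" using dominatedD(2)[OF f] by (simp_all add: a_def I_def)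
    then have "ennreal a + ennreal I = ennreal (a + I)" by (rule ennreal_plus[symmetric])
    then have "?g i t = a + I"
      unfolding * a_def[symmetric] I_def[symmetric] using \<open>0 \<le> a\<close> \<open>0 \<le> I\<close> by (simp only: enn2real_ennreal add_nonneg_nonneg)
    then show ?thesis unfolding a_def I_def by linarith
  qed
  let ?G = "\<lambda>n i t. ?g i (X n + t)"
  have tG: "tame B B (?G n)" for n by (rule tame_shift[OF B(3)])
  have asym: "(\<lambda>n. ?G n i t - (\<integral>z. ?G n (fst z) (t - snd z) \<partial>K i)) \<longlonglongrightarrow> 0" for i t
  proof -
    have e: "?G n i t - (\<integral>z. ?G n (fst z) (t - snd z) \<partial>K i) = (if i = j then f (X n + t) else 0)" for n
      using eq[of i "X n + t"] by (simp add: add_diff_eq)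
    have f_le: "f (X n + t) \<le> c * (exp \<bar>t\<bar> * exp (- real n))" for n
    proof -
      have "f (X n + t) \<le> c * exp (- \<bar>X n + t\<bar>)" by (rule dominatedD(3)[OF f])
      also have "\<dots> \<le> c * (exp \<bar>t\<bar> * exp (- real n))"
        unfolding exp_add[symmetric] using dominatedD(4)[OF f] X[of n]
        by (intro mult_left_mono) auto
      finally show ?thesis .
    qed
    have "(\<lambda>n. exp (- real n)) \<longlonglongrightarrow> 0"
      using filterlim_compose[OF exp_at_bot] filterlim_uminus_at_bot_at_top filterlim_real_sequentially
      by (metis filterlim_compose)
    then have l: "(\<lambda>n. c * (exp \<bar>t\<bar> * exp (- real n))) \<longlonglongrightarrow> 0"
      by (intro tendsto_mult_right_zero)
    show ?thesis
      unfolding e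
    proof (rule tendsto_sandwich[OF _ _ tendsto_const l])
      show "\<forall>\<^sub>F n in sequentially. 0 \<le> (if i = j then f (X n + t) else 0)"
        using dominatedD(2)[OF f] by (intro always_eventually) simp
      show "\<forall>\<^sub>F n in sequentially. (if i = j then f (X n + t) else 0) \<le> c * (exp \<bar>t\<bar> * exp (- real n))"
        using f_le dominatedD(4)[OF f] by (intro always_eventually) simp
    qed
  qed
  obtain r b where r: "strict_mono r" and lim: "\<And>i t. (\<lambda>n. ?G (r n) i t) \<longlonglongrightarrow> b"
    using asymptotically_harmonic[OF tG asym] by metis
  have b0: "b \<ge> 0" by (rule LIMSEQ_le_const[OF lim[of 0 0]]) simp
  have "(\<lambda>n. rmeas j ?f k (X (r n) + s)) \<longlonglongrightarrow> ennreal b" for k s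
    using tendsto_ennrealI[OF lim[of k s]] fin by simp
  then show thesis by (rule that[OF r b0 lim])
qed

lemma half_line_limits:
  fixes X :: "nat \<Rightarrow> real" and f :: "real \<Rightarrow> ennreal"
  assumes f: "f \<in> borel_measurable borel" "(\<integral>\<^sup>+s. f s \<partial>lborel) < \<infinity>"
  shows "filterlim X at_top sequentially \<Longrightarrow> (\<lambda>n. \<integral>\<^sup>+s. indicator {..X n} s * f s \<partial>lborel) \<longlonglongrightarrow> (\<integral>\<^sup>+s. f s \<partial>lborel)"
    and "filterlim X at_bot sequentially \<Longrightarrow> (\<lambda>n. \<integral>\<^sup>+s. indicator {..X n} s * f s \<partial>lborel) \<longlonglongrightarrow> 0"
proof -
  note f(1)[measurable]
  assume X: "filterlim X at_top sequentially"
  show "(\<lambda>n. \<integral>\<^sup>+s. indicator {..X n} s * f s \<partial>lborel) \<longlonglongrightarrow> (\<integral>\<^sup>+s. f s \<partial>lborel)"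
  proof (rule nn_integral_dominated_convergence[where w = f])
    show "AE s in lborel. (\<lambda>n. indicator {..X n} s * f s) \<longlonglongrightarrow> f s"
    proof (rule AE_I2)
      fix s
      have "eventually (\<lambda>n. s \<le> X n) sequentially" by (rule eventually_compose_filterlim[OF eventually_ge_at_top X])
      then have "eventually (\<lambda>n. indicator {..X n} s * f s = f s) sequentially"
        by eventually_elim simp
      then show "(\<lambda>n. indicator {..X n} s * f s) \<longlonglongrightarrow> f s" by (rule tendsto_eventually)
    qed
  qed (use f(2) in \<open>auto split: split_indicator\<close>)
next
  note f(1)[measurable]
  assume X: "filterlim X at_bot sequentially"
  have "(\<lambda>n. \<integral>\<^sup>+s. indicator {..X n} s * f s \<partial>lborel) \<longlonglongrightarrow> (\<integral>\<^sup>+s. 0 \<partial>(lborel :: real measure))"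
  proof (rule nn_integral_dominated_convergence[where w = f])
    show "AE s in lborel. (\<lambda>n. indicator {..X n} s * f s) \<longlonglongrightarrow> 0"
    proof (rule AE_I2)
      fix s
      have "eventually (\<lambda>n. X n \<le> s - 1) sequentially" by (rule eventually_compose_filterlim[OF eventually_le_at_bot X])
      then have "eventually (\<lambda>n. indicator {..X n} s * f s = 0) sequentially"
        by eventually_elim simp
      then show "(\<lambda>n. indicator {..X n} s * f s) \<longlonglongrightarrow> 0" by (rule tendsto_eventually)
    qed
  qed (use f(2) in \<open>auto split: split_indicator\<close>)
  then show "(\<lambda>n. \<integral>\<^sup>+s. indicator {..X n} s * f s \<partial>lborel) \<longlonglongrightarrow> 0" by simp
qed

text \<open>Every subsequential limit is a constant b, and the balance evaluates it. The left end
  comes first in the argument, because it yields \<open>E = 0\<close>, which the right end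
  needs.\<close>

lemma renewal_limits:
  assumes j: "j \<in> S" and f: "dominated c f"
  shows "((\<lambda>t. enn2real (rmeas j (\<lambda>t. ennreal (f t)) i t)) \<longlongrightarrow>
      enn2real (emeasure W {j} * (\<integral>\<^sup>+s. ennreal (f s) \<partial>lborel)) * rate) at_top" (is ?top)
    and "((\<lambda>t. enn2real (rmeas j (\<lambda>t. ennreal (f t)) i t)) \<longlongrightarrow> 0) at_bot" (is ?bot)
proof -
  let ?f = "\<lambda>t. ennreal (f t)" and ?w = "emeasure W {j}"
  let ?\<Phi> = "?w * (\<integral>\<^sup>+s. ?f s \<partial>lborel)"
  note [measurable] = dominatedD(1)[OF f]
  have fm: "?f \<in> borel_measurable borel" by measurable
  have fi: "(\<integral>\<^sup>+s. ?f s \<partial>lborel) < \<infinity>" by (rule dominated_integral_finite[OF f])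
  obtain B where B: "\<And>i t. rmeas j ?f i t \<le> ennreal B" "B \<ge> 0"
      "tame B B (\<lambda>i t. enn2real (rmeas j ?f i t))"
    using rmeas_dominated[OF f, of j] by metis
  obtain E where E: "\<And>t. E + flux cut_pos (\<lambda>k s. rmeas j ?f k (t + s)) =
      ?w * (\<integral>\<^sup>+s. indicator {..t} s * ?f s \<partial>lborel) + flux cut_neg (\<lambda>k s. rmeas j ?f k (t + s))"
    by (rule rmeas_identity[OF j fm fi B(1)]) (rule that)
  have mr: "mfun (\<lambda>k s. rmeas j ?f k (t + s))" for t
    using mfun_transl[where a = "- t", OF mfun_dpot[OF fm]] unfolding rmeas_dpot by (simp add: add.commute)
  have w: "?w < \<top>" using W_fin by simp
  have neg_fin: "flux cut_neg (\<lambda>k s. ennreal B) < \<infinity>"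
    using mean_neg_finite by (simp add: flux_const ennreal_mult_less_top)
  have negl: "(\<lambda>n. flux cut_neg (\<lambda>k s. rmeas j ?f k (Y n + s))) \<longlonglongrightarrow> ennreal b * mean_neg"
    if "\<And>k s. (\<lambda>n. rmeas j ?f k (Y n + s)) \<longlonglongrightarrow> ennreal b" for Y b
    using flux_tendsto_bounded[OF cut_measurable(2) mr B(1) that neg_fin] by (simp add: flux_const)
  have posl: "ennreal b * mean_pos \<le> liminf (\<lambda>n. flux cut_pos (\<lambda>k s. rmeas j ?f k (Y n + s)))"
    if "\<And>k s. (\<lambda>n. rmeas j ?f k (Y n + s)) \<longlonglongrightarrow> ennreal b" for Y b
    using flux_liminf[where f = "\<lambda>n k s. rmeas j ?f k (Y n + s)" and g = "\<lambda>k s. ennreal b", OF cut_measurable(1) mr that]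
    by (simp add: flux_const)
  \<comment> \<open>Only Fatou is used for the upward flux, as \<open>mean_pos\<close> may be
    infinite; the downward flux converges.\<close>
  have bal: "E + ennreal b * mean_pos \<le> l + ennreal b * mean_neg"
    if lim: "\<And>k s. (\<lambda>n. rmeas j ?f k (Y n + s)) \<longlonglongrightarrow> ennreal b"
      and l: "(\<lambda>n. ?w * (\<integral>\<^sup>+s. indicator {..Y n} s * ?f s \<partial>lborel)) \<longlonglongrightarrow> l" for Y b l
    by (rule ennreal_add_liminf_le[OF posl[OF lim] E tendsto_add[OF l negl[OF lim]]])
  have bneg: "ennreal b * mean_neg < \<top>" for b
    using mean_neg_finite by (simp add: ennreal_mult_less_top)
  have zero: "E = 0 \<and> b = 0" if b: "b \<ge> 0" "E + ennreal b * mean_pos \<le> 0 + ennreal b * mean_neg" for b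
  proof -
    have "b = 0"
    proof (rule ccontr)
      assume "b \<noteq> 0"
      then have "ennreal b * mean_neg < ennreal b * mean_pos"
        using b(1) mean_neg_less_pos by (intro ennreal_mult_strict_left_mono) auto
      also have "\<dots> \<le> E + ennreal b * mean_pos" by simp
      finally show False using b(2) by simp
    qed
    then show ?thesis using b(2) by simp
  qed
  have bot_seq: "E = 0 \<and> (\<exists>r::nat \<Rightarrow> nat. (\<lambda>n. enn2real (rmeas j ?f i (- X (r n)))) \<longlonglongrightarrow> 0)"
    if X: "\<And>n::nat. real n \<le> X n" for X :: "nat \<Rightarrow> real"
  proof -
    have X': "real n \<le> \<bar>- X n\<bar>" for n using X[of n] by simp
    obtain r :: "nat \<Rightarrow> nat" and b where r: "strict_mono r" "b \<ge> 0"
      and lim: "\<And>k s. (\<lambda>n. enn2real (rmeas j ?f k (- X (r n) + s))) \<longlonglongrightarrow> b"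
        "\<And>k s. (\<lambda>n. rmeas j ?f k (- X (r n) + s)) \<longlonglongrightarrow> ennreal b"
      by (rule rmeas_subsequence_const[OF f X' B]) (rule that)
    have "filterlim (\<lambda>n. X (r n)) at_top sequentially"
      using filterlim_at_top_mono[OF filterlim_real_sequentially, of X] X filterlim_subseq[OF r(1)]
      by (auto intro: filterlim_compose)
    then have "filterlim (\<lambda>n. - X (r n)) at_bot sequentially" by (simp add: filterlim_uminus_at_bot)
    then have "(\<lambda>n. ?w * (\<integral>\<^sup>+s. indicator {..- X (r n)} s * ?f s \<partial>lborel)) \<longlonglongrightarrow> ?w * 0"
      by (intro ennreal_tendsto_cmult[OF w] half_line_limits(2)[OF fm fi])
    then have l: "(\<lambda>n. ?w * (\<integral>\<^sup>+s. indicator {..- X (r n)} s * ?f s \<partial>lborel)) \<longlonglongrightarrow> 0" by simp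
    have "E = 0 \<and> b = 0" by (rule zero[OF r(2) bal[OF lim(2) l]])
    then show ?thesis using lim(1)[of i 0] by (intro conjI exI[of _ r]) auto
  qed
  \<comment> \<open>\<open>E\<close> is independent of the sequence, so evaluating along the single
    sequence -n suffices.\<close>
  have E0: "E = 0" using bot_seq[of real] by simp
  have "((\<lambda>t. enn2real (rmeas j ?f i (- t))) \<longlongrightarrow> 0) at_top"
    by (rule tendsto_at_top_by_subsequences) (use bot_seq in blast)
  then show ?bot by (simp add: filterlim_at_bot_mirror)
  show ?top
  proof (rule tendsto_at_top_by_subsequences)
    fix X :: "nat \<Rightarrow> real" assume X: "\<And>n. real n \<le> X n"
    have X': "real n \<le> \<bar>X n\<bar>" for n using X[of n] by linarith
    obtain r :: "nat \<Rightarrow> nat" and b where r: "strict_mono r" "b \<ge> 0"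
      and lim: "\<And>k s. (\<lambda>n. enn2real (rmeas j ?f k (X (r n) + s))) \<longlonglongrightarrow> b"
        "\<And>k s. (\<lambda>n. rmeas j ?f k (X (r n) + s)) \<longlonglongrightarrow> ennreal b"
      by (rule rmeas_subsequence_const[OF f X' B]) (rule that)
    have "filterlim (\<lambda>n. X (r n)) at_top sequentially"
      using filterlim_at_top_mono[OF filterlim_real_sequentially, of X] X filterlim_subseq[OF r(1)]
      by (auto intro: filterlim_compose)
    then have l: "(\<lambda>n. ?w * (\<integral>\<^sup>+s. indicator {..X (r n)} s * ?f s \<partial>lborel)) \<longlonglongrightarrow> ?\<Phi>"
      by (intro ennreal_tendsto_cmult[OF w] half_line_limits(1)[OF fm fi])
    have \<Phi>: "?\<Phi> < \<top>" using w fi by (simp add: ennreal_mult_less_top)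
    have le: "ennreal b * mean_pos \<le> ?\<Phi> + ennreal b * mean_neg"
      using bal[OF lim(2) l] unfolding E0 by simp
    have "b = enn2real ?\<Phi> * rate"
    proof (cases "mean_pos = \<top>")
      \<comment> \<open>The inequality from Fatou suffices here: a positive b would make its left
        side infinite.\<close>
      case True
      have "b = 0"
      proof (rule ccontr)
        assume "b \<noteq> 0"
        then have "ennreal b * mean_pos = \<top>" using r(2) True by (simp add: ennreal_mult_top)
        then show False using le \<Phi> bneg[of b] by (auto simp: top_unique)
      qed
      then show ?thesis using True by (simp add: rate_def)
    next
      case False
      then have "flux cut_pos (\<lambda>k s. ennreal B) < \<infinity>"
        by (simp add: flux_const ennreal_mult_eq_top_iff less_top[symmetric])
      from flux_tendsto_bounded[OF cut_measurable(1) mr B(1) lim(2) this]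
      have "(\<lambda>n. flux cut_pos (\<lambda>k s. rmeas j ?f k (X (r n) + s))) \<longlonglongrightarrow> ennreal b * mean_pos"
        by (simp add: flux_const)
      moreover have "flux cut_pos (\<lambda>k s. rmeas j ?f k (X (r n) + s)) =
          ?w * (\<integral>\<^sup>+s. indicator {..X (r n)} s * ?f s \<partial>lborel) + flux cut_neg (\<lambda>k s. rmeas j ?f k (X (r n) + s))" for n
        using E[of "X (r n)"] unfolding E0 by simp
      ultimately have "(\<lambda>n. ?w * (\<integral>\<^sup>+s. indicator {..X (r n)} s * ?f s \<partial>lborel) +
          flux cut_neg (\<lambda>k s. rmeas j ?f k (X (r n) + s))) \<longlonglongrightarrow> ennreal b * mean_pos" by simp
      then have "ennreal b * mean_pos = ?\<Phi> + ennreal b * mean_neg"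
        by (rule LIMSEQ_unique) (intro tendsto_add l negl lim)
      then have "enn2real (ennreal b * mean_pos) = enn2real (?\<Phi> + ennreal b * mean_neg)" by simp
      then have eq: "b * enn2real mean_pos = enn2real ?\<Phi> + b * enn2real mean_neg"
        using \<Phi> bneg[of b] r(2) by (simp add: enn2real_mult enn2real_plus)
      have "enn2real mean_neg < enn2real mean_pos"
        using mean_neg_less_pos False by (simp add: enn2real_less_iff less_top)
      then show ?thesis
        using eq False by (simp add: rate_def field_simps)
    qed
    then show "\<exists>r::nat \<Rightarrow> nat. (\<lambda>n. enn2real (rmeas j ?f i (X (r n)))) \<longlonglongrightarrow> enn2real ?\<Phi> * rate"
      using lim(1)[of i 0] by (intro exI[of _ r]) simp
  qed
qed

end

section \<open>The decomposition of the potential\<close>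

lemma kop_row:
  assumes "kop \<Phi>" "kop \<Psi>"
  shows "kop (\<lambda>f k t. if k = i then \<Phi> f k t else \<Psi> f k t)"
  unfolding kop_def
proof (intro conjI allI impI)
  fix f :: "nat \<Rightarrow> real \<Rightarrow> ennreal" assume f: "mfun f"
  show "mfun (\<lambda>k t. if k = i then \<Phi> f k t else \<Psi> f k t)"
    unfolding mfun_def
  proof
    fix k
    show "(\<lambda>t. if k = i then \<Phi> f k t else \<Psi> f k t) \<in> borel_measurable borel"
      using mfunD[OF kop_mfun[OF assms(1) f]] mfunD[OF kop_mfun[OF assms(2) f]] by (cases "k = i") simp_all
  qed
  show "(\<lambda>k t. if k = i then \<Phi> (\<lambda>k t. c * f k t) k t else \<Psi> (\<lambda>k t. c * f k t) k t) =
      (\<lambda>k t. c * (if k = i then \<Phi> f k t else \<Psi> f k t))" for c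
    unfolding kop_cmult[OF assms(1) f] kop_cmult[OF assms(2) f] by (simp add: fun_eq_iff)
  show "(\<lambda>k t. if k = i then \<Phi> (\<lambda>k t. f k (t - a)) k t else \<Psi> (\<lambda>k t. f k (t - a)) k t) =
      (\<lambda>k t. if k = i then \<Phi> f k (t - a) else \<Psi> f k (t - a))" for a
    unfolding kop_transl[OF assms(1) f] kop_transl[OF assms(2) f] ..
  fix g :: "nat \<Rightarrow> real \<Rightarrow> ennreal" assume g: "mfun g"
  show "(\<lambda>k t. if k = i then \<Phi> (\<lambda>k t. f k t + g k t) k t else \<Psi> (\<lambda>k t. f k t + g k t) k t) =
      (\<lambda>k t. (if k = i then \<Phi> f k t else \<Psi> f k t) + (if k = i then \<Phi> g k t else \<Psi> g k t))"
    unfolding kop_add[OF assms(1) f g] kop_add[OF assms(2) f g] by (simp add: fun_eq_iff)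
next
  fix f :: "nat \<Rightarrow> nat \<Rightarrow> real \<Rightarrow> ennreal" assume f: "\<forall>n. mfun (f n)" "incseq f"
  show "(\<lambda>k t. if k = i then \<Phi> (\<lambda>k t. SUP n. f n k t) k t else \<Psi> (\<lambda>k t. SUP n. f n k t) k t) =
      (\<lambda>k t. SUP n. if k = i then \<Phi> (f n) k t else \<Psi> (f n) k t)"
    unfolding kop_SUP[OF assms(1) f(1)[rule_format] f(2)] kop_SUP[OF assms(2) f(1)[rule_format] f(2)]
    by (simp add: fun_eq_iff)
qed

lemma kop_mask: "kop (\<lambda>f k t. if k = i then 0 else f k t)"
proof -
  have "kop (\<lambda>f k t. \<Sum>n\<in>({} :: nat set). f k t)"
    by (rule kop_sum_op) simp_all
  then have "kop (\<lambda>f k t. 0)" by (simp only: sum.empty)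
  from kop_row[OF this kop_id, of i] show ?thesis .
qed

lemma kop_conv:
  assumes M: "finite_measure M" and [measurable_cong, simp]: "sets M = sets borel"
  shows "kop (\<lambda>f k t. \<integral>\<^sup>+y. f i (t - y) \<partial>M)"
proof -
  interpret finite_measure M by (rule M)
  show ?thesis
    unfolding kop_def
  proof (intro conjI allI impI)
    fix f :: "nat \<Rightarrow> real \<Rightarrow> ennreal" assume f: "mfun f"
    note [measurable] = mfunD[OF f]
    show "mfun (\<lambda>k t. \<integral>\<^sup>+y. f i (t - y) \<partial>M)"
      unfolding mfun_def by (intro allI borel_measurable_nn_integral) measurable
    show "(\<lambda>k t. \<integral>\<^sup>+y. c * f i (t - y) \<partial>M) = (\<lambda>k t. c * (\<integral>\<^sup>+y. f i (t - y) \<partial>M))" for c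
      by (intro ext nn_integral_cmult) measurable
    show "(\<lambda>k t. \<integral>\<^sup>+y. f i (t - y - a) \<partial>M) = (\<lambda>k t. \<integral>\<^sup>+y. f i (t - a - y) \<partial>M)" for a
      by (simp add: algebra_simps)
    fix g :: "nat \<Rightarrow> real \<Rightarrow> ennreal" assume g: "mfun g"
    note [measurable] = mfunD[OF g]
    show "(\<lambda>k t. \<integral>\<^sup>+y. f i (t - y) + g i (t - y) \<partial>M) =
        (\<lambda>k t. (\<integral>\<^sup>+y. f i (t - y) \<partial>M) + (\<integral>\<^sup>+y. g i (t - y) \<partial>M))"
      by (intro ext nn_integral_add) measurable
  next
    fix f :: "nat \<Rightarrow> nat \<Rightarrow> real \<Rightarrow> ennreal" assume f: "\<forall>n. mfun (f n)" "incseq f"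
    have [measurable]: "f n i \<in> borel_measurable borel" for n using f(1) mfunD by blast
    show "(\<lambda>k t. \<integral>\<^sup>+y. (SUP n. f n i (t - y)) \<partial>M) = (\<lambda>k t. SUP n. \<integral>\<^sup>+y. f n i (t - y) \<partial>M)"
      by (intro ext nn_integral_monotone_convergence_SUP) (use f(2) in \<open>auto simp: incseq_def le_fun_def\<close>)
  qed
qed

lemma kop_add_op:
  assumes "kop \<Phi>" "kop \<Psi>" shows "kop (\<lambda>f k t. \<Phi> f k t + \<Psi> f k t)"
proof -
  have "kop (\<lambda>f k t. \<Sum>b\<in>{True, False}. (if b then \<Phi> else \<Psi>) f k t)"
    by (rule kop_sum_op) (use assms in auto)
  then show ?thesis by simp
qed

lemma kop_const_shift:
  assumes "kop \<Phi>" shows "\<Phi> (\<lambda>k s. X k) k t = \<Phi> (\<lambda>k s. X k) k 0"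
proof -
  have "(\<lambda>k s. \<Phi> (\<lambda>k s. X k) k (s - t)) = \<Phi> (\<lambda>k s. X k)"
    using kop_transl[OF assms, of "\<lambda>k s. X k" t] by simp
  then have "\<Phi> (\<lambda>k s. X k) k (t - t) = \<Phi> (\<lambda>k s. X k) k t"
    by (rule fun_cong[OF fun_cong])
  then show ?thesis by simp
qed

lemma nn_integral_measure_add:
  assumes s: "sets M = sets borel" "sets M1 = sets borel" "sets M2 = sets borel"
    and e: "\<And>B. B \<in> sets borel \<Longrightarrow> emeasure M B = emeasure M1 B + emeasure M2 B"
    and f: "f \<in> borel_measurable borel"
  shows "(\<integral>\<^sup>+x. f x \<partial>M) = (\<integral>\<^sup>+x. f x \<partial>M1) + (\<integral>\<^sup>+x. f x \<partial>(M2 :: real measure))"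
proof -
  have m: "g \<in> borel_measurable M" "g \<in> borel_measurable M1" "g \<in> borel_measurable M2"
    if "g \<in> borel_measurable borel" for g :: "real \<Rightarrow> ennreal"
    using that by (simp_all add: measurable_cong_sets[OF s(1) refl] measurable_cong_sets[OF s(2) refl]
        measurable_cong_sets[OF s(3) refl])
  from f show ?thesis
  proof (induction rule: borel_measurable_induct)
    case (cong f g)
    have "f = g" by (rule ext) (rule cong.hyps(3), simp)
    with cong.IH show ?case by (simp only:)
  next
    case (set A)
    then show ?case using s by (simp add: e)
  next
    case (mult u c)
    show ?case
      using mult.IH by (simp add: nn_integral_cmult m[OF mult.hyps(2)] distrib_left)
  next
    case (add u v)
    show ?case
      using add.IH by (simp add: nn_integral_add m[OF add.hyps(1)] m[OF add.hyps(3)] ac_simps)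
  next
    case (seq U)
    have S: "(SUP i. U i) = (\<lambda>x. SUP i. U i x)" by (rule ext) (rule SUP_apply)
    have inc: "incseq (\<lambda>n. \<integral>\<^sup>+x. U n x \<partial>N)" for N
      using \<open>incseq U\<close> by (auto simp: incseq_def le_fun_def intro!: nn_integral_mono)
    have "(\<integral>\<^sup>+x. (SUP i. U i x) \<partial>M) = (SUP n. \<integral>\<^sup>+x. U n x \<partial>M)"
      by (rule nn_integral_monotone_convergence_SUP[OF \<open>incseq U\<close> m(1)[OF seq.hyps(1)]])
    also have "\<dots> = (SUP n. (\<integral>\<^sup>+x. U n x \<partial>M1) + (\<integral>\<^sup>+x. U n x \<partial>M2))"
      by (rule SUP_cong[OF refl seq.IH])
    also have "\<dots> = (SUP n. \<integral>\<^sup>+x. U n x \<partial>M1) + (SUP n. \<integral>\<^sup>+x. U n x \<partial>M2)"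
      by (rule ennreal_SUP_add[OF inc inc])
    also have "(SUP n. \<integral>\<^sup>+x. U n x \<partial>M1) = (\<integral>\<^sup>+x. (SUP i. U i x) \<partial>M1)"
      by (rule nn_integral_monotone_convergence_SUP[OF \<open>incseq U\<close> m(2)[OF seq.hyps(1)], symmetric])
    also have "(SUP n. \<integral>\<^sup>+x. U n x \<partial>M2) = (\<integral>\<^sup>+x. (SUP i. U i x) \<partial>M2)"
      by (rule nn_integral_monotone_convergence_SUP[OF \<open>incseq U\<close> m(3)[OF seq.hyps(1)], symmetric])
    finally show ?case by (simp only: S)
  qed
qed

section \<open>Convolution of bounded functions with a finite measure\<close>

lemma conv_integrable:
  fixes g :: "real \<Rightarrow> real"
  assumes M: "finite_measure M" and s [measurable_cong, simp]: "sets M = sets borel"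
    and g [measurable]: "g \<in> borel_measurable borel" and B: "\<And>x. \<bar>g x\<bar> \<le> B"
  shows "integrable M (\<lambda>x. g (t - x))"
  by (rule finite_measure.integrable_const_bound[OF M, where B = B]) (use B in auto)

lemma conv_at_top:
  fixes g :: "real \<Rightarrow> real"
  assumes M: "finite_measure M" and s [measurable_cong, simp]: "sets M = sets borel"
    and g [measurable]: "g \<in> borel_measurable borel" and B: "\<And>x. \<bar>g x\<bar> \<le> B"
    and lim: "(g \<longlongrightarrow> l) at_top"
  shows "((\<lambda>t. \<integral>x. g (t - x) \<partial>M) \<longlongrightarrow> measure M UNIV * l) at_top"
proof -
  have sp: "space M = UNIV" using sets_eq_imp_space_eq[OF s] by simp
  have "((\<lambda>t. \<integral>x. g (t - x) \<partial>M) \<longlongrightarrow> (\<integral>x. l \<partial>M)) at_top"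
  proof (rule integral_dominated_convergence_at_top[where w = "\<lambda>_. B"])
    show "integrable M (\<lambda>_. B)" by (rule finite_measure.integrable_const[OF M])
    show "AE x in M. ((\<lambda>t. g (t - x)) \<longlongrightarrow> l) at_top"
    proof (rule AE_I2)
      fix x :: real
      have "filterlim (\<lambda>t. t - x) at_top at_top"
        using filterlim_tendsto_add_at_top[OF tendsto_const[of "- x"] filterlim_ident] by simp
      with lim show "((\<lambda>t. g (t - x)) \<longlongrightarrow> l) at_top" by (rule filterlim_compose)
    qed
  qed (use B in auto)
  then show ?thesis by (simp add: sp)
qed

lemma conv_at_bot:
  fixes g :: "real \<Rightarrow> real"
  assumes M: "finite_measure M" and s [measurable_cong, simp]: "sets M = sets borel"
    and g [measurable]: "g \<in> borel_measurable borel" and B: "\<And>x. \<bar>g x\<bar> \<le> B"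
    and lim: "(g \<longlongrightarrow> l) at_bot"
  shows "((\<lambda>t. \<integral>x. g (t - x) \<partial>M) \<longlongrightarrow> measure M UNIV * l) at_bot"
proof -
  have sp: "space M = UNIV" using sets_eq_imp_space_eq[OF s] by simp
  have "((\<lambda>t. \<integral>x. g (- t - x) \<partial>M) \<longlongrightarrow> (\<integral>x. l \<partial>M)) at_top"
  proof (rule integral_dominated_convergence_at_top[where w = "\<lambda>_. B"])
    show "integrable M (\<lambda>_. B)" by (rule finite_measure.integrable_const[OF M])
    show "AE x in M. ((\<lambda>t. g (- t - x)) \<longlongrightarrow> l) at_top"
    proof (rule AE_I2)
      fix x :: real
      have "filterlim (\<lambda>t. t + x) at_top at_top"
        using filterlim_tendsto_add_at_top[OF tendsto_const[of x] filterlim_ident] by (simp add: add.commute)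
      then have "filterlim (\<lambda>t. - (t + x)) at_bot at_top" by (simp only: filterlim_uminus_at_bot minus_minus)
      then have "filterlim (\<lambda>t. - t - x) at_bot at_top" by simp
      with lim show "((\<lambda>t. g (- t - x)) \<longlongrightarrow> l) at_top" by (rule filterlim_compose)
    qed
  qed (use B in auto)
  then show ?thesis by (simp add: sp filterlim_at_bot_mirror)
qed

lemma conv_continuous:
  fixes g :: "real \<Rightarrow> real"
  assumes M: "finite_measure M" and s [measurable_cong, simp]: "sets M = sets borel"
    and g: "continuous_on UNIV g" and B: "\<And>x. \<bar>g x\<bar> \<le> B"
  shows "continuous_on UNIV (\<lambda>t. \<integral>x. g (t - x) \<partial>M)"
proof (rule continuous_on_sequentiallyI)
  fix X :: "nat \<Rightarrow> real" and t assume X: "X \<longlonglongrightarrow> t"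
  have [measurable]: "g \<in> borel_measurable borel" by (rule borel_measurable_continuous_onI[OF g])
  show "(\<lambda>n. \<integral>x. g (X n - x) \<partial>M) \<longlonglongrightarrow> (\<integral>x. g (t - x) \<partial>M)"
  proof (rule integral_dominated_convergence[where w = "\<lambda>_. B"])
    show "integrable M (\<lambda>_. B)" by (rule finite_measure.integrable_const[OF M])
    show "AE x in M. (\<lambda>n. g (X n - x)) \<longlonglongrightarrow> g (t - x)"
      by (intro AE_I2 continuous_on_tendsto_compose[OF g] tendsto_diff X tendsto_const) auto
  qed (use B in auto)
qed

lemma conv_abs_le:
  fixes g :: "real \<Rightarrow> real"
  assumes M: "finite_measure M" and s [measurable_cong, simp]: "sets M = sets borel"
    and g [measurable]: "g \<in> borel_measurable borel" and B: "\<And>x. \<bar>g x\<bar> \<le> B"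
  shows "\<bar>\<integral>x. g (t - x) \<partial>M\<bar> \<le> measure M UNIV * B"
proof -
  have sp: "space M = UNIV" using sets_eq_imp_space_eq[OF s] by simp
  have "\<bar>\<integral>x. g (t - x) \<partial>M\<bar> \<le> (\<integral>x. \<bar>g (t - x)\<bar> \<partial>M)" by (rule integral_abs_bound)
  also have "\<dots> \<le> (\<integral>x. B \<partial>M)"
    by (intro integral_mono integrable_abs conv_integrable[OF M s g B] finite_measure.integrable_const[OF M] B)
  finally show ?thesis by (simp add: sp)
qed

lemma tent_integral_pos:
  assumes "c > 0" "d > 0" shows "0 < (\<integral>\<^sup>+y. ennreal (tent c a d y) \<partial>lborel)"
proof -
  have "0 < ennreal (c / 2) * ennreal d"
    using assms by (simp add: ennreal_mult[symmetric] ennreal_zero_less_mult_iff)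
  also have "\<dots> = (\<integral>\<^sup>+y. ennreal (c / 2) * indicator {a - d / 2..a + d / 2} y \<partial>lborel)"
    using assms by (subst nn_integral_cmult_indicator) auto
  also have "\<dots> \<le> (\<integral>\<^sup>+y. ennreal (tent c a d y) \<partial>lborel)"
  proof (rule nn_integral_mono)
    fix y
    show "ennreal (c / 2) * indicator {a - d / 2..a + d / 2} y \<le> ennreal (tent c a d y)"
    proof (cases "y \<in> {a - d / 2..a + d / 2}")
      case True
      then have "a - d / 2 \<le> y" "y \<le> a + d / 2" by auto
      then have "\<bar>y - a\<bar> \<le> d / 2" by linarith
      then have "\<bar>y - a\<bar> / d \<le> 1 / 2" using assms by (simp add: divide_le_eq)
      then have "c * (1 / 2) \<le> c * max 0 (1 - \<bar>y - a\<bar> / d)" using assms by (intro mult_left_mono) auto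
      then show ?thesis using True by (simp add: tent_def ennreal_leI)
    qed simp
  qed
  finally show ?thesis .
qed

text \<open>Commutativity of convolution in integrated form. It moves the smoothing from the tent
  onto an arbitrary \<open>f\<close>, so that a power of the kernel smoothed by the tent acts as a
  density against \<open>f\<close>.\<close>

lemma conv_commute:
  fixes f w :: "real \<Rightarrow> ennreal"
  assumes M: "finite_measure M" and s [measurable_cong, simp]: "sets M = sets borel"
    and f [measurable]: "f \<in> borel_measurable borel" and w [measurable]: "w \<in> borel_measurable borel"
  shows "(\<integral>\<^sup>+y. f y * (\<integral>\<^sup>+x. w (t - y - x) \<partial>M) \<partial>lborel) = (\<integral>\<^sup>+y. w y * (\<integral>\<^sup>+x. f (t - y - x) \<partial>M) \<partial>lborel)"
proof -
  interpret finite_measure M by (rule M)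
  interpret pair_sigma_finite M lborel ..
  have *: "(\<integral>\<^sup>+y. f y * w (t - y - x) \<partial>lborel) = (\<integral>\<^sup>+y. w y * f (t - y - x) \<partial>lborel)" for x
    by (subst nn_integral_reflect[of _ "t - x", symmetric]) (auto intro!: nn_integral_cong simp: algebra_simps)
  have "(\<integral>\<^sup>+y. f y * (\<integral>\<^sup>+x. w (t - y - x) \<partial>M) \<partial>lborel) = (\<integral>\<^sup>+y. (\<integral>\<^sup>+x. f y * w (t - y - x) \<partial>M) \<partial>lborel)"
    by (intro nn_integral_cong nn_integral_cmult[symmetric]) measurable
  also have "\<dots> = (\<integral>\<^sup>+x. (\<integral>\<^sup>+y. f y * w (t - y - x) \<partial>lborel) \<partial>M)"
    by (rule Fubini') measurable
  also have "\<dots> = (\<integral>\<^sup>+x. (\<integral>\<^sup>+y. w y * f (t - y - x) \<partial>lborel) \<partial>M)"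
    unfolding * ..
  also have "\<dots> = (\<integral>\<^sup>+y. (\<integral>\<^sup>+x. w y * f (t - y - x) \<partial>M) \<partial>lborel)"
    by (rule Fubini'[symmetric]) measurable
  also have "\<dots> = (\<integral>\<^sup>+y. w y * (\<integral>\<^sup>+x. f (t - y - x) \<partial>M) \<partial>lborel)"
    by (intro nn_integral_cong nn_integral_cmult) measurable
  finally show ?thesis .
qed

lemma sum_lessThan_add:
  fixes F :: "nat \<Rightarrow> 'a::comm_monoid_add"
  shows "(\<Sum>n<p + q. F n) = (\<Sum>n<p. F n) + (\<Sum>n<q. F (p + n))"
  by (induction q) (simp_all add: add.assoc)

text \<open>The Neumann series is the least nonnegative solution of y = x + h y: iterating the
  equation leaves a nonnegative remainder after each partial sum.\<close>

lemma resolvent_lower: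
  assumes h: "kop h" and x: "mfun x" and y: "mfun y" and eq: "\<And>k t. y k t = x k t + h y k t"
  shows "(\<Sum>m. (h ^^ m) x k t) \<le> y k t"
proof -
  have fin: "(\<Sum>m<N. (h ^^ m) x k t) + (h ^^ N) y k t = y k t" for N
  proof (induction N)
    case (Suc N)
    have "y = (\<lambda>k t. x k t + h y k t)" using eq by (simp add: fun_eq_iff)
    then have "(h ^^ N) y = (h ^^ N) (\<lambda>k t. x k t + h y k t)" by (rule arg_cong)
    also have "\<dots> = (\<lambda>k t. (h ^^ N) x k t + (h ^^ N) (h y) k t)"
      by (rule kop_add[OF kop_funpow[OF h] x kop_mfun[OF h y]])
    finally have e: "(h ^^ N) y = (\<lambda>k t. (h ^^ N) x k t + (h ^^ N) (h y) k t)" .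
    have sw: "(h ^^ N) (h y) = (h ^^ Suc N) y"
      by (simp only: funpow_Suc_right comp_def)
    have "(h ^^ N) y k t = (h ^^ N) x k t + (h ^^ Suc N) y k t"
      using arg_cong[where f = "\<lambda>w. w k t", OF e] unfolding sw .
    then show ?case using Suc by (simp only: sum.lessThan_Suc add.assoc)
  qed simp
  show ?thesis
    unfolding suminf_eq_SUP by (rule SUP_least) (rule ennreal_add_eq_imp_le[OF fin])
qed

lemma resolvent_eq:
  assumes h: "kop h" and x: "mfun x"
  shows "(\<Sum>m. (h ^^ m) x k t) = x k t + h (\<lambda>k t. \<Sum>m. (h ^^ m) x k t) k t"
proof -
  have m: "mfun ((h ^^ n) x)" for n by (rule kop_mfun[OF kop_funpow[OF h] x])
  have "h (\<lambda>k t. \<Sum>m. (h ^^ m) x k t) k t = (\<Sum>m. (h ^^ Suc m) x k t)"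
    unfolding kop_suminf[OF h m] by simp
  moreover have "(\<lambda>m. (h ^^ Suc m) x k t) sums (\<Sum>m. (h ^^ Suc m) x k t)"
    by (rule summable_sums[OF summableI])
  then have "(\<lambda>m. (h ^^ m) x k t) sums ((\<Sum>m. (h ^^ Suc m) x k t) + (h ^^ 0) x k t)"
    by (rule sums_Suc)
  ultimately show ?thesis by (simp add: sums_unique[symmetric] add.commute)
qed

context renewal_walk
begin

lemma inv_opn:
  fixes X :: "nat \<Rightarrow> ennreal"
  shows "(\<integral>\<^sup>+k. (op ^^ n) (\<lambda>k s. X k) k 0 \<partial>W) = (\<integral>\<^sup>+k. X k \<partial>W)"
proof (induction n)
  case (Suc n)
  define Y where "Y k = (op ^^ n) (\<lambda>k s. X k) k 0" for k
  have "(op ^^ n) (\<lambda>k s. X k) = (\<lambda>k s. Y k)"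
    unfolding Y_def by (intro ext kop_const_shift[OF kop_opn])
  then have "(\<integral>\<^sup>+k. (op ^^ Suc n) (\<lambda>k s. X k) k 0 \<partial>W) = (\<integral>\<^sup>+k. (\<integral>\<^sup>+z. Y (fst z) \<partial>K k) \<partial>W)"
    by (simp add: op_def)
  also have "\<dots> = (\<integral>\<^sup>+k. Y k \<partial>W)" by (rule W_inv)
  finally show ?case using Suc by (simp add: Y_def)
qed simp

text \<open>Stone's decomposition: \<open>op ^^ p\<close> splits into a defective operator \<open>h\<close> and convolution with a
  tent at \<open>i\<close>. The resolvent \<open>R\<close> of \<open>h\<close> has finite rows by invariance of \<open>W\<close>.\<close>

lemma stone_decomposition:
  assumes i: "i \<in> S" and j: "j \<in> S"
  obtains V1 :: "real measure" and g :: "real \<Rightarrow> real" where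
    "finite_measure V1" "sets V1 = sets borel" "\<And>t. g t \<ge> 0" "bounded (range g)" "continuous_on UNIV g"
    "(g \<longlongrightarrow> enn2real (emeasure W {j}) * rate) at_top" "(g \<longlongrightarrow> 0) at_bot"
    "\<And>C. C \<in> sets borel \<Longrightarrow> rmeas j (\<lambda>x. indicator C (- x)) i 0 =
        emeasure V1 C + (\<integral>\<^sup>+s. indicator C s * ennreal (g s) \<partial>lborel)"
proof -
  obtain p c a d where sp: "spread_at i p c a d" using spread[OF i] by blast
  have p: "p \<ge> 1" and c: "c > 0" and d: "d > 0"
    and spf: "\<And>f t. f \<in> borel_measurable borel \<Longrightarrow>
      (\<integral>\<^sup>+y. ennreal (tent c a d y) * f (t - y) \<partial>lborel) \<le> (op ^^ p) (at_state i f) i t"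
    using sp by (auto simp: spread_at_def)
  define \<tau> where "\<tau> = tent c a d"
  define T where "T y = ennreal (\<tau> y)" for y
  have \<tau>_meas [measurable]: "\<tau> \<in> borel_measurable borel" unfolding \<tau>_def by (rule measurable_tent)
  have T_meas [measurable]: "T \<in> borel_measurable borel" unfolding T_def by measurable
  obtain c' where dom: "dominated c' \<tau>" unfolding \<tau>_def using dominated_tent[OF c d] by metis
  define \<theta> where "\<theta> = (\<integral>\<^sup>+y. T y \<partial>lborel)"
  have \<theta>0: "0 < \<theta>" unfolding \<theta>_def T_def \<tau>_def by (rule tent_integral_pos[OF c d])
  have \<theta>1: "\<theta> < \<top>" using dominated_integral_finite[OF dom] by (simp add: \<theta>_def T_def)
  define A where "A = kop_measure (op ^^ p) i i"
  define Tm where "Tm = density lborel T"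
  have sets_A: "sets A = sets borel" and sets_Tm: "sets Tm = sets borel" by (simp_all add: A_def Tm_def)
  have Tm_U: "emeasure Tm UNIV = \<theta>" by (simp add: Tm_def \<theta>_def emeasure_density)
  have fin_A: "finite_measure A" unfolding A_def by (rule finite_opn)
  have fin_Tm: "finite_measure Tm" by (rule finite_measureI) (use Tm_U \<theta>1 in \<open>simp add: Tm_def\<close>)
  have A_ge: "emeasure Tm B \<le> emeasure A B" if B: "B \<in> sets A" for B
  proof -
    have [measurable]: "B \<in> sets borel" using B sets_A by simp
    have "emeasure Tm B = (\<integral>\<^sup>+y. T y * indicator B (- (0 - y)) \<partial>lborel)"
      by (simp add: Tm_def emeasure_density)
    also have "\<dots> \<le> (op ^^ p) (at_state i (\<lambda>x. indicator B (- x))) i 0"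
      unfolding T_def \<tau>_def by (rule spf) measurable
    also have "\<dots> = emeasure A B" unfolding A_def by (rule emeasure_kop_measure[OF kop_opn, symmetric]) measurable
    finally show ?thesis .
  qed
  \<comment> \<open>What remains of the diagonal entry at \<open>i\<close> of \<open>op ^^ p\<close>
    after removal of the tent.\<close>
  define H where "H = diff_measure A Tm"
  have sets_H: "sets H = sets borel" by (simp add: H_def sets_A)
  have eH: "emeasure H B = emeasure A B - emeasure Tm B" if "B \<in> sets borel" for B
    unfolding H_def using that sets_A by (intro emeasure_diff_measure fin_A fin_Tm A_ge) (simp_all add: sets_Tm)
  have A_split: "emeasure A B = emeasure H B + emeasure Tm B" if B: "B \<in> sets borel" for B
    unfolding eH[OF B] using A_ge[of B] B sets_A by (simp add: diff_add_cancel_ennreal)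
  have fin_H: "finite_measure H"
  proof (rule finite_measureI)
    have "emeasure H UNIV \<le> emeasure A UNIV" by (simp add: eH)
    also have "\<dots> < \<top>" using finite_measure.emeasure_finite[OF fin_A, of UNIV] by (simp add: less_top)
    finally show "emeasure H (space H) \<noteq> \<infinity>" using sets_eq_imp_space_eq[OF sets_H] by simp
  qed
  have nnT: "(\<integral>\<^sup>+y. f y \<partial>Tm) = (\<integral>\<^sup>+y. T y * f y \<partial>lborel)" if [measurable]: "f \<in> borel_measurable borel" for f
    unfolding Tm_def by (rule nn_integral_density) measurable
  let ?mask = "\<lambda>f k t. if k = i then 0 else f k t"
  \<comment> \<open>Row \<open>i\<close> keeps its off-diagonal entries through the mask and has
    \<open>H\<close> on the diagonal; all other rows are those of \<open>op ^^ p\<close>. Thus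
    \<open>op ^^ p\<close> is \<open>h\<close> plus the tent operator \<open>U\<close>.\<close>
  define h where "h = (\<lambda>f k t. if k = i then (\<integral>\<^sup>+y. f i (t - y) \<partial>H) + (op ^^ p) (?mask f) k t else (op ^^ p) f k t)"
  define U where "U = (\<lambda>f k t. if k = i then (\<integral>\<^sup>+y. f i (t - y) \<partial>Tm) else 0)"
  have kop_h: "kop h"
    unfolding h_def
    by (rule kop_row[OF kop_add_op[OF kop_conv[OF fin_H sets_H] kop_comp[OF kop_opn kop_mask]] kop_opn])
  have kop_0: "kop (\<lambda>f k t. 0)"
  proof -
    have "kop (\<lambda>f k t. \<Sum>n\<in>({} :: nat set). f k t)"
      by (rule kop_sum_op) simp_all
    then show ?thesis by (simp only: sum.empty)
  qed
  have kop_U: "kop U"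
    unfolding U_def by (rule kop_row[OF kop_conv[OF fin_Tm sets_Tm] kop_0])
  have opp: "(op ^^ p) f k t = h f k t + U f k t" if f: "mfun f" for f k t
  proof (cases "k = i")
    case True
    have fi: "f i \<in> borel_measurable borel" by (rule mfunD[OF f])
    have fi': "(\<lambda>y. f i (t - y)) \<in> borel_measurable borel" by (rule measurable_compose[OF _ fi]) measurable
    have mm: "mfun (?mask f)" by (rule kop_mfun[OF kop_mask f])
    have "(\<lambda>k s. ?mask f k s + at_state i (f i) k s) = f"
      by (simp add: fun_eq_iff at_state_def)
    then have "(op ^^ p) f i t = (op ^^ p) (?mask f) i t + (op ^^ p) (at_state i (f i)) i t"
      using kop_add[OF kop_opn mm mfun_at_state[OF fi], of p i] by simp
    also have "(op ^^ p) (at_state i (f i)) i t = (\<integral>\<^sup>+y. f i (t - y) \<partial>A)"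
      unfolding A_def by (rule nn_integral_kop_measure[OF kop_opn fi, symmetric])
    also have "\<dots> = (\<integral>\<^sup>+y. f i (t - y) \<partial>H) + (\<integral>\<^sup>+y. f i (t - y) \<partial>Tm)"
      by (rule nn_integral_measure_add[OF sets_A sets_H sets_Tm A_split fi'])
    finally show ?thesis
      unfolding h_def U_def using True by (simp add: ac_simps)
  qed (simp add: h_def U_def)
  \<comment> \<open>Since \<open>op ^^ p\<close> is split rather than \<open>op\<close>, the first
    \<open>p\<close> powers are collected in \<open>B\<close>, and V f = B f + (op ^^ p) (V
    f).\<close>
  define B where "B = (\<lambda>f k t. \<Sum>n<p. (op ^^ n) f k t)"
  define V where "V = (\<lambda>f k t. \<Sum>n. (op ^^ n) f k t)"
  define R where "R = (\<lambda>f k t. \<Sum>m. (h ^^ m) f k t)"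
  have kop_B: "kop B" unfolding B_def by (rule kop_sum_op[OF _ kop_opn]) simp
  have kop_V': "kop V" unfolding V_def by (rule kop_V)
  have kop_R: "kop R" unfolding R_def by (rule kop_suminf_op[OF kop_funpow[OF kop_h]])
  have V_eq: "V f k t = R (B f) k t + R (U (V f)) k t" if f: "mfun f" for f k t
  proof -
    have mV: "mfun (V f)" by (rule kop_mfun[OF kop_V' f])
    have mB: "mfun (B f)" by (rule kop_mfun[OF kop_B f])
    have mU: "mfun (U (V f))" by (rule kop_mfun[OF kop_U mV])
    define x where "x = (\<lambda>k t. B f k t + U (V f) k t)"
    have mx: "mfun x" unfolding x_def by (rule mfun_add[OF mB mU])
    define Z where "Z = R x"
    have mZ: "mfun Z" unfolding Z_def by (rule kop_mfun[OF kop_R mx])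
    have Z_eq: "Z k t = x k t + h Z k t" for k t
      unfolding Z_def R_def by (rule resolvent_eq[OF kop_h mx])
    have mo: "mfun ((op ^^ n) f)" for n by (rule kop_mfun[OF kop_opn f])
    have V_rec: "V f k t = x k t + h (V f) k t" for k t
    proof -
      have "(op ^^ p) (V f) k t = (\<Sum>n. (op ^^ p) ((op ^^ n) f) k t)"
        unfolding V_def by (simp only: kop_suminf[OF kop_opn mo])
      also have "\<dots> = (\<Sum>n. (op ^^ (n + p)) f k t)"
        by (simp add: funpow_add add.commute[of _ p])
      finally have "V f k t = B f k t + (op ^^ p) (V f) k t"
        unfolding V_def B_def using suminf_offset[OF summableI, of "\<lambda>n. (op ^^ n) f k t" p] by (simp add: add.commute)
      then show ?thesis unfolding opp[OF mV] x_def by (simp only: ac_simps)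
    qed
    have "Z k t \<le> V f k t" for k t
      unfolding Z_def R_def by (rule resolvent_lower[OF kop_h mx mV V_rec])
    moreover have "V f k t \<le> Z k t" for k t
    proof -
      \<comment> \<open>Minimality gives only Z \<le> V, and infinite values forbid cancelling. The
        converse bounds partial sums, peeling off \<open>p\<close> powers at a time: induction
        handles the \<open>h\<close> part, and the \<open>U\<close> part is compared with
        \<open>V\<close>. Here p \<ge> 1 makes the horizon drop.\<close>
      have part: "(\<Sum>n<N. (op ^^ n) f k t) \<le> Z k t" for N k t
      proof (induction N arbitrary: k t rule: less_induct)
        case (less N)
        show ?case
        proof (cases "N < p")
          case True
          have "(\<Sum>n<N. (op ^^ n) f k t) \<le> B f k t"
            unfolding B_def using True by (intro sum_mono2) auto
          also have "\<dots> \<le> x k t" by (simp add: x_def)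
          also have "\<dots> \<le> Z k t" unfolding Z_eq[of k t] by simp
          finally show ?thesis .
        next
          case False
          define q where "q = N - p"
          have q: "N = p + q" "q < N" using False p by (auto simp: q_def)
          let ?P = "\<lambda>k t. \<Sum>n<q. (op ^^ n) f k t"
          have mP: "mfun ?P" by (rule mfun_sum[OF mo])
          have le_V: "?P k t \<le> V f k t" for k t
            unfolding V_def by (rule sum_le_suminf[OF summableI]) auto
          have "(\<Sum>n<N. (op ^^ n) f k t) = B f k t + (\<Sum>n<q. (op ^^ (p + n)) f k t)"
            unfolding q(1) B_def by (rule sum_lessThan_add)
          also have "(\<Sum>n<q. (op ^^ (p + n)) f k t) = (op ^^ p) ?P k t"
            unfolding kop_sum[OF kop_opn finite_lessThan mo] by (simp add: funpow_add)
          also have "B f k t + (op ^^ p) ?P k t = B f k t + (h ?P k t + U ?P k t)"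
            unfolding opp[OF mP] ..
          also have "\<dots> \<le> B f k t + (h Z k t + U (V f) k t)"
            by (intro add_left_mono add_mono kop_mono[OF kop_h mP mZ] kop_mono[OF kop_U mP mV] less.IH[OF q(2)] le_V)
          also have "\<dots> = Z k t" unfolding Z_eq[of k t] x_def by (simp only: ac_simps)
          finally show ?thesis .
        qed
      qed
      show ?thesis unfolding V_def suminf_eq_SUP by (rule SUP_least) (rule part)
    qed
    ultimately have "V f k t = Z k t" by (intro antisym)
    also have "\<dots> = R (B f) k t + R (U (V f)) k t"
      unfolding Z_def x_def kop_add[OF kop_R mB mU] ..
    finally show ?thesis .
  qed
  have wi: "0 < emeasure W {i}" "emeasure W {i} < \<top>" using W_pos[OF i] W_fin[of i] by auto
  \<comment> \<open>\<open>op ^^ p\<close> preserves the \<open>W\<close>-integral, so each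
    application of \<open>h\<close> loses exactly \<theta> * W{i} times the value at
    \<open>i\<close>. All losses together cannot exceed the initial integral.\<close>
  have R_bound: "R (\<lambda>k s. X k) i 0 * (\<theta> * emeasure W {i}) \<le> (\<integral>\<^sup>+k. X k \<partial>W)" for X :: "nat \<Rightarrow> ennreal"
  proof -
    define Y where "Y m k = (h ^^ m) (\<lambda>k s. X k) k 0" for m k
    have Y: "(h ^^ m) (\<lambda>k s. X k) = (\<lambda>k s. Y m k)" for m
      unfolding Y_def by (intro ext kop_const_shift[OF kop_funpow[OF kop_h]])
    have step: "(\<integral>\<^sup>+k. Y (Suc m) k \<partial>W) + Y m i * (\<theta> * emeasure W {i}) = (\<integral>\<^sup>+k. Y m k \<partial>W)" for m
    proof -
      have "(\<integral>\<^sup>+k. Y m k \<partial>W) = (\<integral>\<^sup>+k. (op ^^ p) (\<lambda>k s. Y m k) k 0 \<partial>W)" by (rule inv_opn[symmetric])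
      also have "\<dots> = (\<integral>\<^sup>+k. Y (Suc m) k + at_state i (\<lambda>_. \<theta> * Y m i) k 0 \<partial>W)"
      proof (rule nn_integral_cong)
        fix k
        have "(op ^^ p) (\<lambda>k s. Y m k) k 0 = h (\<lambda>k s. Y m k) k 0 + U (\<lambda>k s. Y m k) k 0"
          by (rule opp) simp
        also have "h (\<lambda>k s. Y m k) k 0 = Y (Suc m) k"
          unfolding Y[symmetric] by (simp add: Y_def)
        also have "U (\<lambda>k s. Y m k) k 0 = at_state i (\<lambda>_. \<theta> * Y m i) k 0"
          using Tm_U sets_eq_imp_space_eq[OF sets_Tm] by (simp add: U_def at_state_def mult.commute)
        finally show "(op ^^ p) (\<lambda>k s. Y m k) k 0 = Y (Suc m) k + at_state i (\<lambda>_. \<theta> * Y m i) k 0" .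
      qed
      also have "\<dots> = (\<integral>\<^sup>+k. Y (Suc m) k \<partial>W) + \<theta> * Y m i * emeasure W {i}"
        by (subst nn_integral_add) (simp_all add: nn_integral_W_at)
      finally show ?thesis by (simp add: ac_simps)
    qed
    have gen: "(a + y) * w + z = a * w + (z + y * w)" for a y w z :: ennreal
      unfolding distrib_right by (simp only: ac_simps)
    have tot: "(\<Sum>m<N. Y m i) * (\<theta> * emeasure W {i}) + (\<integral>\<^sup>+k. Y N k \<partial>W) = (\<integral>\<^sup>+k. X k \<partial>W)" for N
    proof (induction N)
      case 0
      then show ?case by (simp add: Y_def)
    next
      case (Suc N)
      have "(\<Sum>m<Suc N. Y m i) * (\<theta> * emeasure W {i}) + (\<integral>\<^sup>+k. Y (Suc N) k \<partial>W) =
          (\<Sum>m<N. Y m i) * (\<theta> * emeasure W {i}) + ((\<integral>\<^sup>+k. Y (Suc N) k \<partial>W) + Y N i * (\<theta> * emeasure W {i}))"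
        unfolding sum.lessThan_Suc by (rule gen)
      then show ?case unfolding step Suc .
    qed
    have "R (\<lambda>k s. X k) i 0 * (\<theta> * emeasure W {i}) = (SUP N. (\<Sum>m<N. Y m i) * (\<theta> * emeasure W {i}))"
      unfolding R_def Y suminf_eq_SUP by (rule SUP_mult_right_ennreal)
    also have "\<dots> \<le> (\<integral>\<^sup>+k. X k \<partial>W)"
      by (rule SUP_least) (rule ennreal_add_eq_imp_le[OF tot])
    finally show ?thesis .
  qed
  have R_fin: "R (\<lambda>k s. X k) i 0 < \<top>" if "(\<integral>\<^sup>+k. X k \<partial>W) < \<top>" for X :: "nat \<Rightarrow> ennreal"
  proof (rule ccontr)
    assume "\<not> ?thesis"
    then have "R (\<lambda>k s. X k) i 0 = \<top>" by (metis top.not_eq_extremum)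
    moreover have "\<theta> * emeasure W {i} \<noteq> 0" using \<theta>0 wi by auto
    ultimately have "R (\<lambda>k s. X k) i 0 * (\<theta> * emeasure W {i}) = \<top>" by (simp add: ennreal_top_mult)
    then show False using R_bound[of X] that by (simp add: top_unique)
  qed
  \<comment> \<open>The finite component. Applied to the indicator of state \<open>j\<close>,
    \<open>B\<close> has \<open>W\<close>-integral p * W{j}, so the bound on the resolvent makes the
    total mass finite.\<close>
  define V1 where "V1 = kop_measure (\<lambda>f. R (B f)) i j"
  have kop_RB: "kop (\<lambda>f. R (B f))" by (rule kop_comp[OF kop_R kop_B])
  have sets_V1: "sets V1 = sets borel" by (simp add: V1_def)
  have one: "at_state k (\<lambda>_. 1) = (\<lambda>l s. if l = k then 1 else 0)" for k by (simp add: at_state_def)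
  have W1: "(\<integral>\<^sup>+l. (if l = k then 1 else 0) \<partial>W) = emeasure W {k}" for k
    using nn_integral_W_at[of k "\<lambda>_. 1" 0] by (simp add: at_state_def)
  have fin_V1: "finite_measure V1"
  proof (rule finite_measureI)
    let ?X = "\<lambda>k. B (at_state j (\<lambda>_. 1)) k 0"
    have BX: "B (at_state j (\<lambda>_. 1)) = (\<lambda>k s. ?X k)"
      unfolding one by (intro ext kop_const_shift[OF kop_B])
    have "(\<integral>\<^sup>+k. ?X k \<partial>W) = (\<Sum>n<p. \<integral>\<^sup>+k. (op ^^ n) (at_state j (\<lambda>_. 1)) k 0 \<partial>W)"
      unfolding B_def by (rule nn_integral_sum) simp
    also have "\<dots> = (\<Sum>n<p. emeasure W {j})" unfolding one inv_opn W1 ..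
    also have "\<dots> < \<top>" using W_fin[of j] by (simp add: ennreal_mult_less_top of_nat_less_top)
    finally have "R (\<lambda>k s. ?X k) i 0 < \<top>" by (rule R_fin)
    then have "R (B (at_state j (\<lambda>_. 1))) i 0 < \<top>" unfolding BX[symmetric] .
    then show "emeasure V1 (space V1) \<noteq> \<infinity>"
      unfolding V1_def using emeasure_kop_measure[OF kop_RB, of UNIV i j] by simp
  qed
  define Rm where "Rm = kop_measure R i i"
  have sets_Rm: "sets Rm = sets borel" by (simp add: Rm_def)
  have fin_Rm: "finite_measure Rm"
  proof (rule finite_measureI)
    have "R (at_state i (\<lambda>_. 1)) i 0 < \<top>"
      unfolding one by (rule R_fin) (use W1 W_fin[of i] in simp)
    then show "emeasure Rm (space Rm) \<noteq> \<infinity>"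
      unfolding Rm_def using emeasure_kop_measure[OF kop_R, of UNIV i i] by simp
  qed
  \<comment> \<open>The potential smoothed by the split-off tent: it is Lipschitz, and its limits
    are already known. Convolving it with the finite measure \<open>Rm\<close> gives the density
    \<open>g\<close>.\<close>
  define G where "G t = enn2real (rmeas j T i t)" for t
  obtain Bd where Bd: "\<And>i t. rmeas j T i t \<le> ennreal Bd" "Bd \<ge> 0" "tame Bd Bd (\<lambda>i t. enn2real (rmeas j T i t))"
    using rmeas_dominated[OF dom, of j] unfolding T_def by metis
  have G_ennreal: "rmeas j T i t = ennreal (G t)" for t
    unfolding G_def using le_less_trans[OF Bd(1)[of i t]] by simp
  have G0: "G t \<ge> 0" for t by (simp add: G_def)
  have G_abs: "\<bar>G t\<bar> \<le> Bd" for t unfolding G_def by (rule tameD(1)[OF Bd(3)])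
  have G_cont: "continuous_on UNIV G" unfolding G_def by (rule tame_continuous[OF Bd(3)])
  have G_meas [measurable]: "G \<in> borel_measurable borel" by (rule borel_measurable_continuous_onI[OF G_cont])
  define l where "l = enn2real (emeasure W {j} * \<theta>) * rate"
  have G_top: "(G \<longlongrightarrow> l) at_top" and G_bot: "(G \<longlongrightarrow> 0) at_bot"
    using renewal_limits[OF j dom, of i] unfolding G_def l_def \<theta>_def T_def by auto
  define \<phi> where "\<phi> t = (\<integral>y. G (t - y) \<partial>Tm)" for t
  define g where "g t = (\<integral>x. G (t - x) \<partial>Rm)" for t
  have V_rmeas: "V (at_state j f) = rmeas j f" for f by (simp add: V_def rmeas_def)
  \<comment> \<open>After commuting the convolutions, the tent is absorbed into the potential and
    \<open>G\<close> becomes a density with respect to Lebesgue measure.\<close>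
  have U_V: "U (V (at_state j f)) = at_state i (\<lambda>t. \<integral>\<^sup>+s. f s * ennreal (G (t - s)) \<partial>lborel)"
    if f [measurable]: "f \<in> borel_measurable borel" for f
  proof -
    let ?A = "\<lambda>n. kop_measure (op ^^ n) i j"
    have nnA: "(op ^^ n) (at_state j w) i t = (\<integral>\<^sup>+x. w (t - x) \<partial>?A n)" if "w \<in> borel_measurable borel" for n w t
      by (rule nn_integral_kop_measure[OF kop_opn that, symmetric])
    have nnm [measurable]: "(\<lambda>y. (op ^^ n) (at_state j w) i (t - y)) \<in> borel_measurable borel"
      if "w \<in> borel_measurable borel" for n w t
      using mfunD[OF kop_mfun[OF kop_opn mfun_at_state[OF that]]] by (rule measurable_compose[rotated]) measurable
    have "(\<integral>\<^sup>+y. V (at_state j f) i (t - y) \<partial>Tm) = (\<integral>\<^sup>+s. f s * ennreal (G (t - s)) \<partial>lborel)" for t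
    proof -
      have mV: "(\<lambda>y. V (at_state j f) i (t - y)) \<in> borel_measurable borel"
        using mfunD[OF kop_mfun[OF kop_V' mfun_at_state[OF f]]] by (rule measurable_compose[rotated]) measurable
      have "(\<integral>\<^sup>+y. V (at_state j f) i (t - y) \<partial>Tm) = (\<integral>\<^sup>+y. (\<Sum>n. T y * (op ^^ n) (at_state j f) i (t - y)) \<partial>lborel)"
        unfolding nnT[OF mV] by (simp add: V_def)
      also have "\<dots> = (\<Sum>n. \<integral>\<^sup>+y. T y * (op ^^ n) (at_state j f) i (t - y) \<partial>lborel)"
        by (rule nn_integral_suminf) (use nnm[OF f] in measurable)
      also have "\<dots> = (\<Sum>n. \<integral>\<^sup>+y. f y * (op ^^ n) (at_state j T) i (t - y) \<partial>lborel)"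
        unfolding nnA[OF f] nnA[OF T_meas]
        by (intro suminf_cong conv_commute[OF finite_opn] sets_kop_measure f T_meas)
      also have "\<dots> = (\<integral>\<^sup>+y. (\<Sum>n. f y * (op ^^ n) (at_state j T) i (t - y)) \<partial>lborel)"
        by (rule nn_integral_suminf[symmetric]) (use nnm[OF T_meas] in measurable)
      also have "\<dots> = (\<integral>\<^sup>+y. f y * ennreal (G (t - y)) \<partial>lborel)"
        unfolding G_ennreal[symmetric] rmeas_def by simp
      finally show ?thesis .
    qed
    then show ?thesis by (simp add: U_def at_state_def fun_eq_iff)
  qed
  have nnR: "R (at_state i w) i t = (\<integral>\<^sup>+x. w (t - x) \<partial>Rm)" if "w \<in> borel_measurable borel" for w t
    unfolding Rm_def by (rule nn_integral_kop_measure[OF kop_R that, symmetric])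
  interpret Rm: finite_measure Rm by (rule fin_Rm)
  interpret RL: pair_sigma_finite Rm lborel ..
  note sets_Rm [measurable_cong]
  have g_int: "(\<integral>\<^sup>+x. ennreal (G (t - x)) \<partial>Rm) = ennreal (g t)" for t
    unfolding g_def by (rule nn_integral_eq_integral[OF conv_integrable[OF fin_Rm sets_Rm G_meas G_abs]]) (simp add: G0)
  have decomposition: "rmeas j (\<lambda>x. indicator C (- x)) i 0 =
      emeasure V1 C + (\<integral>\<^sup>+s. indicator C s * ennreal (g s) \<partial>lborel)" if C [measurable]: "C \<in> sets borel" for C
  proof -
    let ?f = "\<lambda>x :: real. indicator C (- x) :: ennreal"
    have f [measurable]: "?f \<in> borel_measurable borel" by measurable
    have "rmeas j ?f i 0 = R (B (at_state j ?f)) i 0 + R (U (V (at_state j ?f))) i 0"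
      unfolding V_rmeas[symmetric] by (rule V_eq[OF mfun_at_state[OF f]])
    also have "R (B (at_state j ?f)) i 0 = emeasure V1 C"
      unfolding V1_def by (rule emeasure_kop_measure[OF kop_RB C, symmetric])
    also have "R (U (V (at_state j ?f))) i 0 = (\<integral>\<^sup>+x. (\<integral>\<^sup>+s. ?f s * ennreal (G (0 - x - s)) \<partial>lborel) \<partial>Rm)"
      unfolding U_V[OF f] by (rule nnR) measurable
    also have "\<dots> = (\<integral>\<^sup>+x. (\<integral>\<^sup>+s. indicator C s * ennreal (G (s - x)) \<partial>lborel) \<partial>Rm)"
    proof (rule nn_integral_cong)
      fix x :: real
      have e: "0 - x - s = 0 - s - x" for s by simp
      have "(\<integral>\<^sup>+s. indicator C (0 - s) * ennreal (G (0 - s - x)) \<partial>lborel) =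
          (\<integral>\<^sup>+s. indicator C s * ennreal (G (s - x)) \<partial>lborel)"
        by (rule nn_integral_reflect[of "\<lambda>s. indicator C s * ennreal (G (s - x))" 0]) measurable
      then show "(\<integral>\<^sup>+s. ?f s * ennreal (G (0 - x - s)) \<partial>lborel) =
          (\<integral>\<^sup>+s. indicator C s * ennreal (G (s - x)) \<partial>lborel)"
        unfolding e by simp
    qed
    also have "\<dots> = (\<integral>\<^sup>+s. (\<integral>\<^sup>+x. indicator C s * ennreal (G (s - x)) \<partial>Rm) \<partial>lborel)"
      by (rule RL.Fubini'[symmetric]) measurable
    also have "\<dots> = (\<integral>\<^sup>+s. indicator C s * (\<integral>\<^sup>+x. ennreal (G (s - x)) \<partial>Rm) \<partial>lborel)"
      by (intro nn_integral_cong nn_integral_cmult) measurable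
    finally show ?thesis unfolding g_int .
  qed
  have \<phi>_meas [measurable]: "\<phi> \<in> borel_measurable borel"
    unfolding \<phi>_def by (rule borel_measurable_continuous_onI[OF conv_continuous[OF fin_Tm sets_Tm G_cont G_abs]])
  have \<phi>_abs: "\<bar>\<phi> t\<bar> \<le> measure Tm UNIV * Bd" for t
    unfolding \<phi>_def by (rule conv_abs_le[OF fin_Tm sets_Tm G_meas G_abs])
  have \<phi>0: "\<phi> t \<ge> 0" for t unfolding \<phi>_def using G0 by simp
  have \<tau>_abs: "\<bar>\<tau> x\<bar> \<le> c'" for x
  proof -
    have "\<tau> x \<le> c' * exp (- \<bar>x\<bar>)" by (rule dominatedD(3)[OF dom])
    also have "\<dots> \<le> c' * 1" using dominatedD(4)[OF dom] by (intro mult_left_mono) auto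
    finally show ?thesis using dominatedD(2)[OF dom, of x] by simp
  qed
  have \<tau>_top: "(\<tau> \<longlongrightarrow> 0) at_top"
  proof (rule tendsto_eventually)
    show "eventually (\<lambda>x. \<tau> x = 0) at_top"
      using eventually_ge_at_top[of "a + d"]
    proof eventually_elim
      case (elim x)
      then have "1 \<le> \<bar>x - a\<bar> / d" using d by (simp add: le_divide_eq)
      then show ?case by (simp add: \<tau>_def tent_def)
    qed
  qed
  \<comment> \<open>The decomposition is applied to the tent itself. Comparing limits at infinity on
    both sides determines the limit of \<open>g\<close> without computing the mass of
    \<open>Rm\<close>.\<close>
  have G_eq: "G t = (\<integral>x. \<tau> (t - x) \<partial>V1) + (\<integral>x. \<phi> (t - x) \<partial>Rm)" for t
  proof -
    have "rmeas j T i t = R (B (at_state j T)) i t + R (U (V (at_state j T))) i t"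
      unfolding V_rmeas[symmetric] by (rule V_eq[OF mfun_at_state[OF T_meas]])
    also have "R (B (at_state j T)) i t = (\<integral>\<^sup>+x. T (t - x) \<partial>V1)"
      unfolding V1_def by (rule nn_integral_kop_measure[OF kop_RB T_meas, symmetric])
    also have "\<dots> = ennreal (\<integral>x. \<tau> (t - x) \<partial>V1)"
      unfolding T_def
      by (rule nn_integral_eq_integral[OF conv_integrable[OF fin_V1 sets_V1 \<tau>_meas \<tau>_abs]])
         (simp add: dominatedD(2)[OF dom])
    also have "R (U (V (at_state j T))) i t = R (at_state i (\<lambda>t. ennreal (\<phi> t))) i t"
    proof -
      have "(\<integral>\<^sup>+s. T s * ennreal (G (t - s)) \<partial>lborel) = ennreal (\<phi> t)" for t
      proof -
        have mG: "(\<lambda>s. ennreal (G (t - s))) \<in> borel_measurable borel" by measurable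
        show ?thesis
          unfolding \<phi>_def nnT[OF mG, symmetric]
          by (rule nn_integral_eq_integral[OF conv_integrable[OF fin_Tm sets_Tm G_meas G_abs]]) (simp add: G0)
      qed
      then show ?thesis unfolding U_V[OF T_meas] by simp
    qed
    also have "\<dots> = (\<integral>\<^sup>+x. ennreal (\<phi> (t - x)) \<partial>Rm)" by (rule nnR) measurable
    also have "\<dots> = ennreal (\<integral>x. \<phi> (t - x) \<partial>Rm)"
      by (rule nn_integral_eq_integral[OF conv_integrable[OF fin_Rm sets_Rm \<phi>_meas \<phi>_abs]]) (simp add: \<phi>0)
    finally have "ennreal (G t) = ennreal (\<integral>x. \<tau> (t - x) \<partial>V1) + ennreal (\<integral>x. \<phi> (t - x) \<partial>Rm)"
      unfolding G_ennreal .
    moreover have "0 \<le> (\<integral>x. \<tau> (t - x) \<partial>V1)" "0 \<le> (\<integral>x. \<phi> (t - x) \<partial>Rm)"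
      using dominatedD(2)[OF dom] \<phi>0 by simp_all
    ultimately show ?thesis using G0[of t] by (simp add: ennreal_plus[symmetric] del: ennreal_plus)
  qed
  let ?\<rho> = "measure Rm UNIV" and ?th = "measure Tm UNIV"
  have th: "?th = enn2real \<theta>" by (simp add: measure_def Tm_U)
  have th0: "?th > 0" unfolding th using \<theta>0 \<theta>1 by (simp add: enn2real_positive_iff)
  have "((\<lambda>t. (\<integral>x. \<tau> (t - x) \<partial>V1) + (\<integral>x. \<phi> (t - x) \<partial>Rm)) \<longlongrightarrow> measure V1 UNIV * 0 + ?\<rho> * (?th * l)) at_top"
  proof (intro tendsto_add conv_at_top[OF fin_V1 sets_V1 \<tau>_meas \<tau>_abs \<tau>_top] conv_at_top[OF fin_Rm sets_Rm \<phi>_meas \<phi>_abs])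
    show "(\<phi> \<longlongrightarrow> ?th * l) at_top"
      unfolding \<phi>_def by (rule conv_at_top[OF fin_Tm sets_Tm G_meas G_abs G_top])
  qed
  then have "(G \<longlongrightarrow> ?\<rho> * (?th * l)) at_top" unfolding G_eq[symmetric] by simp
  then have l_eq: "l = ?\<rho> * (?th * l)"
    using G_top by (intro tendsto_unique[of at_top G]) auto
  have l_eq2: "l = enn2real (emeasure W {j}) * ?th * rate"
    unfolding l_def th by (simp add: enn2real_mult)
  \<comment> \<open>Only the positive mass of the tent is divided out, so the case l = 0, which
    occurs for infinite mean, is included.\<close>
  have lim_eq: "?\<rho> * l = enn2real (emeasure W {j}) * rate"
  proof -
    have "?th * (?\<rho> * l) = ?th * (enn2real (emeasure W {j}) * rate)"
      using l_eq l_eq2 by (simp add: ac_simps)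
    then show ?thesis using th0 by simp
  qed
  show thesis
  proof (rule that[OF fin_V1 sets_V1 _ _ _ _ _ decomposition])
    show "g t \<ge> 0" for t unfolding g_def using G0 by simp
    show "bounded (range g)"
      unfolding bounded_iff g_def using conv_abs_le[OF fin_Rm sets_Rm G_meas G_abs] by auto
    show "continuous_on UNIV g" unfolding g_def by (rule conv_continuous[OF fin_Rm sets_Rm G_cont G_abs])
    show "(g \<longlongrightarrow> enn2real (emeasure W {j}) * rate) at_top"
      unfolding g_def lim_eq[symmetric] by (rule conv_at_top[OF fin_Rm sets_Rm G_meas G_abs G_top])
    show "(g \<longlongrightarrow> 0) at_bot"
      unfolding g_def using conv_at_bot[OF fin_Rm sets_Rm G_meas G_abs G_bot] by simp
  qed
qed

end

section \<open>Nonsingular convolution powers\<close>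

text \<open>The convolution of the indicator of \<open>C\<close> with itself exceeds a constant near
  some \<open>r0\<close>. By Fubini it is positive somewhere. A compact \<open>K\<close> inside the
  overlap set at \<open>r0\<close> changes little under small translations, and K \<inter> (K + h)
  lies in the overlap set at r0 + h.\<close>

lemma steinhaus_convolution:
  assumes C [measurable]: "C \<in> sets borel" and bd: "C \<subseteq> {-L..L}" and pos: "0 < emeasure lborel C"
  obtains c a d :: real where "c > 0" "d > 0"
    "\<And>r. \<bar>r - a\<bar> < d \<Longrightarrow> ennreal c \<le> emeasure lborel {x. x \<in> C \<and> r - x \<in> C}"
proof -
  have fin: "emeasure lborel C < \<top>"
  proof -
    have "emeasure lborel C \<le> emeasure lborel {-L..L}" by (rule emeasure_mono[OF bd]) simp
    also have "\<dots> < \<top>" by (simp add: emeasure_lborel_Icc_eq)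
    finally show ?thesis .
  qed
  define D where "D r = {x. x \<in> C \<and> r - x \<in> C}" for r
  have [measurable]: "D r \<in> sets borel" for r unfolding D_def by measurable
  have D_eq: "emeasure lborel (D r) = (\<integral>\<^sup>+x. indicator C x * indicator C (r - x) \<partial>lborel)" for r
  proof -
    have "emeasure lborel (D r) = (\<integral>\<^sup>+x. indicator (D r) x \<partial>lborel)" by simp
    also have "\<dots> = (\<integral>\<^sup>+x. indicator C x * indicator C (r - x) \<partial>lborel)"
      by (intro nn_integral_cong) (auto simp: D_def split: split_indicator)
    finally show ?thesis .
  qed
  have "\<exists>r. 0 < emeasure lborel (D r)"
  proof (rule ccontr)
    assume "\<not> ?thesis"
    then have z: "emeasure lborel (D r) = 0" for r by (simp add: zero_less_iff_neq_zero)
    have sh: "(\<integral>\<^sup>+r. indicator C x * indicator C (r - x) \<partial>lborel) = indicator C x * emeasure lborel C" for x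
    proof -
      have "(\<integral>\<^sup>+r. indicator C (- x + r) \<partial>lborel) = (\<integral>\<^sup>+r. indicator C r \<partial>lborel)"
        by (rule nn_integral_shift) measurable
      then show ?thesis by (subst nn_integral_cmult) (simp_all add: algebra_simps)
    qed
    have "0 = (\<integral>\<^sup>+r. (\<integral>\<^sup>+x. indicator C x * indicator C (r - x) \<partial>lborel) \<partial>(lborel :: real measure))"
      unfolding D_eq[symmetric] z by simp
    also have "\<dots> = (\<integral>\<^sup>+x. (\<integral>\<^sup>+r. indicator C x * indicator C (r - x) \<partial>lborel) \<partial>lborel)"
      by (rule lborel_pair.Fubini') measurable
    also have "\<dots> = emeasure lborel C * emeasure lborel C"
      unfolding sh by (simp add: nn_integral_multc)
    finally show False using pos by simp
  qed
  then obtain r0 where r0: "0 < emeasure lborel (D r0)" by blast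
  have D_le: "emeasure lborel (D r0) \<le> emeasure lborel C"
    by (rule emeasure_mono) (auto simp: D_def)
  let ?M = "density lborel (indicator (D r0))"
  have eM: "emeasure ?M B = emeasure lborel (D r0 \<inter> B)" if "B \<in> sets borel" for B
    using that by (subst emeasure_density) (auto simp: indicator_inter_arith[symmetric])
  have "emeasure ?M (D r0) = (SUP K\<in>{K. K \<subseteq> D r0 \<and> compact K}. emeasure ?M K)"
    by (rule inner_regular) (use eM[of UNIV] D_le fin in \<open>auto simp: top_unique\<close>)
  then have "0 < (SUP K\<in>{K. K \<subseteq> D r0 \<and> compact K}. emeasure ?M K)"
    using r0 eM[of "D r0"] by simp
  then obtain K where K: "K \<subseteq> D r0" "compact K" "0 < emeasure ?M K"
    unfolding less_SUP_iff by blast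
  have [measurable]: "K \<in> sets borel" using K(2) by (rule borel_compact)
  have K_pos: "0 < emeasure lborel K"
    using K(3) eM[of K] K(1) by (simp add: Int_absorb1)
  have K_fin: "emeasure lborel K < \<top>" using emeasure_compact_finite[OF K(2)] by simp
  define k where "k = enn2real (emeasure lborel K)"
  have k: "k > 0" "emeasure lborel K = ennreal k"
    using K_pos K_fin by (simp_all add: k_def enn2real_positive_iff)
  \<comment> \<open>The excess is below half the measure of \<open>K\<close>; small translates of
    \<open>K\<close> stay inside \<open>Ou\<close> and hence meet \<open>K\<close> in at least the
    other half.\<close>
  obtain Ou where Ou: "open Ou" "K \<subseteq> Ou" "emeasure lborel (Ou - K) < ennreal (k / 2)"
    using outer_regular_lborel[of K "k / 2"] k(1) by auto
  obtain \<delta> where \<delta>: "\<delta> > 0" "(\<Union>x\<in>K. ball x \<delta>) \<subseteq> Ou"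
    using compact_subset_open_imp_ball_epsilon_subset[OF K(2) Ou(1,2)] by metis
  have [measurable]: "Ou \<in> sets borel" using Ou(1) by simp
  show thesis
  proof (rule that[of "k / 2" \<delta> r0])
    fix r assume r: "\<bar>r - r0\<bar> < \<delta>"
    define h where "h = r - r0"
    define Kh where "Kh = {x. x - h \<in> K}"
    have [measurable]: "Kh \<in> sets borel" unfolding Kh_def by measurable
    have "emeasure lborel Kh = (\<integral>\<^sup>+x. indicator K (- h + x) \<partial>lborel)"
    proof -
      have "emeasure lborel Kh = (\<integral>\<^sup>+x. indicator Kh x \<partial>lborel)" by simp
      also have "\<dots> = (\<integral>\<^sup>+x. indicator K (- h + x) \<partial>lborel)"
        by (intro nn_integral_cong) (auto simp: Kh_def add.commute split: split_indicator)
      finally show ?thesis .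
    qed
    also have "\<dots> = (\<integral>\<^sup>+x. indicator K x \<partial>lborel)" by (rule nn_integral_shift) measurable
    finally have Kh: "emeasure lborel Kh = ennreal k" using k(2) by simp
    have "Kh \<subseteq> Ou"
    proof
      fix x assume "x \<in> Kh"
      then have "x - h \<in> K" by (simp add: Kh_def)
      moreover have "x \<in> ball (x - h) \<delta>" using r by (simp add: dist_real_def h_def)
      ultimately show "x \<in> Ou" using \<delta>(2) by blast
    qed
    then have "Kh \<subseteq> (K \<inter> Kh) \<union> (Ou - K)" by blast
    then have "emeasure lborel Kh \<le> emeasure lborel ((K \<inter> Kh) \<union> (Ou - K))"
      by (rule emeasure_mono) measurable
    also have "\<dots> \<le> emeasure lborel (K \<inter> Kh) + emeasure lborel (Ou - K)"
      by (rule emeasure_subadditive) measurable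
    also have "\<dots> \<le> emeasure lborel (K \<inter> Kh) + ennreal (k / 2)"
      using Ou(3) by (intro add_left_mono) simp
    finally have le: "ennreal (k / 2) + ennreal (k / 2) \<le> emeasure lborel (K \<inter> Kh) + ennreal (k / 2)"
      using k(1) unfolding Kh by (simp add: ennreal_plus[symmetric] del: ennreal_plus)
    have "ennreal (k / 2) \<le> emeasure lborel (K \<inter> Kh)"
      using le unfolding add.commute[of "emeasure lborel (K \<inter> Kh)"] by (simp add: ennreal_add_left_cancel_le)
    also have "\<dots> \<le> emeasure lborel (D r)"
    proof (rule emeasure_mono)
      show "K \<inter> Kh \<subseteq> D r"
      proof
        fix x assume x: "x \<in> K \<inter> Kh"
        then have "x \<in> D r0" "x - h \<in> D r0" using K(1) by (auto simp: Kh_def)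
        then show "x \<in> D r" by (simp add: D_def h_def algebra_simps)
      qed
    qed measurable
    finally show "ennreal (k / 2) \<le> emeasure lborel {x. x \<in> C \<and> r - x \<in> C}" by (simp add: D_def)
  qed (use k \<delta> in auto)
qed

text \<open>Hahn decompositions of \<open>M\<close> against 1 / (n + 1) times Lebesgue measure on
  [-n, n]. If every set where \<open>M\<close> dominates were negligible inside its window,
  \<open>M\<close> would live on their union and be singular.\<close>

lemma nonsingular_minorant:
  assumes M: "finite_measure M" and sM [measurable_cong, simp]: "sets M = sets borel"
    and ns: "\<not> (\<exists>A\<in>sets borel. emeasure lborel A = 0 \<and> emeasure M (- A) = 0)"
  obtains C :: "real set" and \<epsilon> L :: real where "C \<in> sets borel" "C \<subseteq> {-L..L}" "0 < emeasure lborel C" "\<epsilon> > 0"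
    "\<And>B. B \<in> sets borel \<Longrightarrow> B \<subseteq> C \<Longrightarrow> ennreal \<epsilon> * emeasure lborel B \<le> emeasure M B"
proof -
  interpret finite_measure M by (rule M)
  define A :: "nat \<Rightarrow> real set" where "A n = {- real n..real n}" for n
  define e where "e n = inverse (real (Suc n))" for n
  define N where "N n = density lborel (\<lambda>x. ennreal (e n) * indicator (A n) x)" for n
  have [measurable]: "A n \<in> sets borel" for n by (simp add: A_def)
  have e_pos: "e n > 0" for n by (simp add: e_def)
  have sN [simp]: "sets (N n) = sets borel" for n by (simp add: N_def)
  have eN: "emeasure (N n) B = ennreal (e n) * emeasure lborel (A n \<inter> B)" if [measurable]: "B \<in> sets borel" for n B
  proof -
    have "emeasure (N n) B = (\<integral>\<^sup>+x. ennreal (e n) * indicator (A n \<inter> B) x \<partial>lborel)"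
      unfolding N_def by (subst emeasure_density) (auto intro!: nn_integral_cong split: split_indicator)
    then show ?thesis by (simp add: nn_integral_cmult_indicator)
  qed
  have A_fin: "emeasure lborel (A n) = ennreal (2 * real n)" for n
    by (simp add: A_def)
  have fin_N: "finite_measure (N n)" for n
  proof (rule finite_measureI)
    have "emeasure (N n) UNIV = ennreal (e n) * ennreal (2 * real n)" by (subst eN) (simp_all add: A_fin)
    also have "\<dots> < \<top>" by (simp add: ennreal_mult_less_top)
    finally show "emeasure (N n) (space (N n)) \<noteq> \<infinity>" by (simp add: N_def)
  qed
  have "\<exists>Y\<in>sets M. (\<forall>X\<in>sets M. X \<subseteq> Y \<longrightarrow> emeasure (N n) X \<le> emeasure M X) \<and>
      (\<forall>X\<in>sets M. X \<inter> Y = {} \<longrightarrow> emeasure M X \<le> emeasure (N n) X)" for n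
    by (rule finite_unsigned_Hahn_decomposition[OF M fin_N]) simp
  then obtain Y0 where Y: "\<And>n. Y0 n \<in> sets M"
    "\<And>n X. X \<in> sets M \<Longrightarrow> X \<subseteq> Y0 n \<Longrightarrow> emeasure (N n) X \<le> emeasure M X"
    "\<And>n X. X \<in> sets M \<Longrightarrow> X \<inter> Y0 n = {} \<Longrightarrow> emeasure M X \<le> emeasure (N n) X" by metis
  have [measurable]: "Y0 n \<in> sets borel" for n using Y(1) by simp
  define Y where "Y n = Y0 n \<inter> A n" for n
  have [measurable]: "Y n \<in> sets borel" for n unfolding Y_def by measurable
  show thesis
  proof (cases "\<exists>n. 0 < emeasure lborel (Y n)")
    case True
    then obtain n where n: "0 < emeasure lborel (Y n)" by blast
    show ?thesis
    proof (rule that[of "Y n" "real n" "e n"])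
      show "Y n \<subseteq> {- real n..real n}" by (auto simp: A_def Y_def)
      show "ennreal (e n) * emeasure lborel B \<le> emeasure M B" if B: "B \<in> sets borel" "B \<subseteq> Y n" for B
      proof -
        have "A n \<inter> B = B" using B(2) by (auto simp: Y_def)
        moreover have "emeasure (N n) B \<le> emeasure M B" using B by (intro Y(2)) (auto simp: Y_def)
        ultimately show ?thesis using eN[OF B(1), of n] by simp
      qed
    qed (use n e_pos in auto)
  next
    case False
    then have z: "Y n \<in> null_sets lborel" for n by (auto simp: zero_less_iff_neq_zero)
    define Z where "Z = (\<Union>n. Y n)"
    have Z: "Z \<in> null_sets lborel" unfolding Z_def by (rule null_sets_UN) (rule z)
    then have [measurable]: "Z \<in> sets borel" by auto
    \<comment> \<open>Off the union, \<open>M\<close> on the window [-m, m] is at most 2 m / (n + 1)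
      for all n \<ge> m, hence zero.\<close>
    have "A m - Z \<in> null_sets M" for m
    proof -
      have le: "emeasure M (A m - Z) \<le> ennreal (e n * (2 * real m))" if "n \<ge> m" for n
      proof -
        have "A m \<subseteq> A n" using that by (auto simp: A_def)
        then have "(A m - Z) \<inter> Y0 n = {}" by (auto simp: Z_def Y_def)
        then have "emeasure M (A m - Z) \<le> emeasure (N n) (A m - Z)" by (intro Y(3)) simp_all
        also have "\<dots> \<le> ennreal (e n) * emeasure lborel (A m)"
          by (subst eN) (auto intro!: mult_left_mono emeasure_mono)
        also have "\<dots> = ennreal (e n * (2 * real m))"
          using e_pos[of n] by (simp add: A_fin ennreal_mult)
        finally show ?thesis .
      qed
      have "(\<lambda>n. e n * (2 * real m)) \<longlonglongrightarrow> 0 * (2 * real m)"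
        unfolding e_def by (intro tendsto_mult LIMSEQ_inverse_real_of_nat tendsto_const)
      then have "(\<lambda>n. ennreal (e n * (2 * real m))) \<longlonglongrightarrow> ennreal 0" by (intro tendsto_ennrealI) simp
      then have "emeasure M (A m - Z) \<le> ennreal 0"
        by (rule LIMSEQ_le_const) (use le in blast)
      then show ?thesis by (simp add: null_sets_def)
    qed
    then have "(\<Union>m. A m - Z) \<in> null_sets M" by (rule null_sets_UN)
    moreover have "(\<Union>m. A m - Z) = - Z"
    proof -
      have "\<exists>m. x \<in> A m" for x
      proof -
        obtain m where m: "\<bar>x\<bar> \<le> real m" using real_arch_simple by blast
        have "- real m \<le> x" "x \<le> real m" using m by linarith+
        then show ?thesis by (auto simp: A_def)
      qed
      then show ?thesis by blast
    qed
    ultimately have "emeasure M (- Z) = 0" by auto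
    then show ?thesis using ns Z by (auto simp: null_sets_def)
  qed
qed

text \<open>A nonzero measure charges some ball of radius d / 2 with mass \<open>m\<close>.
  Averaging over that ball translates the interval by \<open>y0\<close>, halves its half-width and
  multiplies the height by \<open>m\<close>.\<close>

lemma interval_conv_lower:
  assumes N: "finite_measure N" and sN [measurable_cong, simp]: "sets N = sets borel" and pos: "emeasure N UNIV > 0"
    and c: "c > 0" "d > 0"
  obtains c' a' d' :: real where "c' > 0" "d' > 0"
    "\<And>f t. f \<in> borel_measurable borel \<Longrightarrow>
      (\<integral>\<^sup>+y. ennreal c' * indicator {y. \<bar>y - a'\<bar> < d'} y * f (t - y) \<partial>lborel) \<le>
      (\<integral>\<^sup>+x. (\<integral>\<^sup>+y. ennreal c * indicator {y. \<bar>y - a\<bar> < d} y * f (t - x - y) \<partial>lborel) \<partial>N)"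
proof -
  interpret N: finite_measure N by (rule N)
  interpret NL: pair_sigma_finite N lborel ..
  have "\<exists>y0\<in>(UNIV::real set). 0 < emeasure N (ball y0 (d / 2))"
  proof (rule ccontr)
    assume "\<not> ?thesis"
    then have z: "ball y (d / 2) \<in> null_sets N" for y by (simp add: null_sets_def zero_less_iff_neq_zero)
    have "(\<Union>q. ball (of_rat q :: real) (d / 2)) \<in> null_sets N" by (rule null_sets_UN) (rule z)
    moreover have "(\<Union>q. ball (of_rat q :: real) (d / 2)) = UNIV"
    proof -
      have "\<exists>q. x \<in> ball (of_rat q :: real) (d / 2)" for x
      proof -
        obtain q where "x < of_rat q" "of_rat q < x + d / 2" using of_rat_dense[of x "x + d / 2"] c by auto
        then show ?thesis by (intro exI[of _ q]) (simp add: dist_real_def)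
      qed
      then show ?thesis by blast
    qed
    ultimately show False using pos by (simp add: null_sets_def)
  qed
  then obtain y0 where y0: "0 < emeasure N (ball y0 (d / 2))" by blast
  define m where "m = measure N (ball y0 (d / 2))"
  have m: "emeasure N (ball y0 (d / 2)) = ennreal m" "m > 0"
    using y0 by (simp_all add: m_def N.emeasure_eq_measure)
  let ?I = "\<lambda>y. indicator {y. \<bar>y - a\<bar> < d} y :: ennreal"
  let ?J = "\<lambda>y. ennreal (c * m) * indicator {y. \<bar>y - (a + y0)\<bar> < d / 2} y :: ennreal"
  show thesis
  proof (rule that[of "c * m" "d / 2" "a + y0"])
    fix f :: "real \<Rightarrow> ennreal" and t assume f [measurable]: "f \<in> borel_measurable borel"
    have sub: "(\<integral>\<^sup>+y. ennreal c * ?I y * f (t - x - y) \<partial>lborel) = (\<integral>\<^sup>+y. ennreal c * ?I (y - x) * f (t - y) \<partial>lborel)" for x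
      by (subst nn_integral_shift[of _ "- x", symmetric]) (auto intro!: nn_integral_cong simp: algebra_simps)
    have "(\<integral>\<^sup>+x. (\<integral>\<^sup>+y. ennreal c * ?I y * f (t - x - y) \<partial>lborel) \<partial>N) =
        (\<integral>\<^sup>+y. (\<integral>\<^sup>+x. ennreal c * ?I (y - x) * f (t - y) \<partial>N) \<partial>lborel)"
      unfolding sub by (rule NL.Fubini'[symmetric]) measurable
    also have "\<dots> \<ge> (\<integral>\<^sup>+y. ?J y * f (t - y) \<partial>lborel)"
    proof (rule nn_integral_mono)
      fix y
      have "?J y \<le> (\<integral>\<^sup>+x. ennreal c * ?I (y - x) \<partial>N)"
      proof (cases "\<bar>y - (a + y0)\<bar> < d / 2")
        case True
        then have "?J y = ennreal c * ennreal m"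
          using c m by (simp add: ennreal_mult)
        also have "\<dots> = (\<integral>\<^sup>+x. ennreal c * indicator (ball y0 (d / 2)) x \<partial>N)"
          by (subst nn_integral_cmult_indicator) (simp_all add: m)
        also have "\<dots> \<le> (\<integral>\<^sup>+x. ennreal c * ?I (y - x) \<partial>N)"
        proof (intro nn_integral_mono mult_left_mono)
          fix x
          have "\<bar>y - x - a\<bar> < d" if "dist y0 x < d / 2"
            using that True unfolding dist_real_def by linarith
          then show "indicator (ball y0 (d / 2)) x \<le> ?I (y - x)" by (auto split: split_indicator)
        qed simp
        finally show ?thesis .
      qed simp
      then have "?J y * f (t - y) \<le> (\<integral>\<^sup>+x. ennreal c * ?I (y - x) \<partial>N) * f (t - y)"
        by (rule mult_right_mono) simp
      also have "\<dots> = (\<integral>\<^sup>+x. ennreal c * ?I (y - x) * f (t - y) \<partial>N)"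
        by (rule nn_integral_multc[symmetric]) measurable
      finally show "?J y * f (t - y) \<le> (\<integral>\<^sup>+x. ennreal c * ?I (y - x) * f (t - y) \<partial>N)" .
    qed
    finally show "(\<integral>\<^sup>+y. ?J y * f (t - y) \<partial>lborel) \<le>
      (\<integral>\<^sup>+x. (\<integral>\<^sup>+y. ennreal c * ?I y * f (t - x - y) \<partial>lborel) \<partial>N)" .
  qed (use c m in auto)
qed

section \<open>Lower bounds for kernel powers along paths of states\<close>

context markov_walk
begin

text \<open>The precursor of \<open>spread_at\<close> for arbitrary pairs of states. A constant on
  an interval is used because it survives convolution with further steps in the same shape.\<close>

definition lower_at :: "nat \<Rightarrow> nat \<Rightarrow> nat \<Rightarrow> real \<Rightarrow> real \<Rightarrow> real \<Rightarrow> bool" where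
  "lower_at i k n c a d \<longleftrightarrow> c > 0 \<and> d > 0 \<and>
     (\<forall>f\<in>borel_measurable borel. \<forall>t.
        (\<integral>\<^sup>+y. ennreal c * indicator {y. \<bar>y - a\<bar> < d} y * f (t - y) \<partial>lborel) \<le> (op ^^ n) (at_state k f) i t)"

lemma lower_at_of_conv:
  assumes pos: "emeasure (kop_measure (op ^^ m) i' k') UNIV > 0" and c: "c > 0" "d > 0"
    and le: "\<And>f t. f \<in> borel_measurable borel \<Longrightarrow>
      (\<integral>\<^sup>+x. (\<integral>\<^sup>+y. ennreal c * indicator {y. \<bar>y - a\<bar> < d} y * f (t - x - y) \<partial>lborel) \<partial>kop_measure (op ^^ m) i' k')
        \<le> (op ^^ n) (at_state k f) i t"
  shows "\<exists>c a d. lower_at i k n c a d"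
proof -
  obtain c' a' d' :: real where "c' > 0" "d' > 0"
    "\<And>f t. f \<in> borel_measurable borel \<Longrightarrow>
      (\<integral>\<^sup>+y. ennreal c' * indicator {y. \<bar>y - a'\<bar> < d'} y * f (t - y) \<partial>lborel) \<le>
      (\<integral>\<^sup>+x. (\<integral>\<^sup>+y. ennreal c * indicator {y. \<bar>y - a\<bar> < d} y * f (t - x - y) \<partial>lborel) \<partial>kop_measure (op ^^ m) i' k')"
    by (rule interval_conv_lower[OF finite_opn sets_kop_measure pos c]) (rule that)
  then have "lower_at i k n c' a' d'"
    unfolding lower_at_def using order_trans[OF _ le] by blast
  then show ?thesis by blast
qed

lemma opn_add: "(op ^^ (m + n)) f = (op ^^ m) ((op ^^ n) f)"
  by (simp add: funpow_add)

lemma opn_compose_ge: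
  assumes f: "f \<in> borel_measurable borel"
  shows "(\<integral>\<^sup>+x. (op ^^ n) (at_state k f) l (t - x) \<partial>kop_measure (op ^^ m) i l) \<le> (op ^^ (m + n)) (at_state k f) i t"
  unfolding opn_add by (rule kop_ge_at_state[OF kop_opn kop_mfun[OF kop_opn mfun_at_state[OF f]]])

lemma lower_at_left:
  assumes lo: "lower_at k l n c a d" and pos: "emeasure (kop_measure (op ^^ m) i k) UNIV > 0"
  shows "\<exists>c a d. lower_at i l (m + n) c a d"
proof (rule lower_at_of_conv[OF pos, of c d a])
  fix f :: "real \<Rightarrow> ennreal" and t assume f: "f \<in> borel_measurable borel"
  have "(\<integral>\<^sup>+x. (\<integral>\<^sup>+y. ennreal c * indicator {y. \<bar>y - a\<bar> < d} y * f (t - x - y) \<partial>lborel) \<partial>kop_measure (op ^^ m) i k) \<le>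
      (\<integral>\<^sup>+x. (op ^^ n) (at_state l f) k (t - x) \<partial>kop_measure (op ^^ m) i k)"
    using lo f unfolding lower_at_def by (intro nn_integral_mono) blast
  also have "\<dots> \<le> (op ^^ (m + n)) (at_state l f) i t" by (rule opn_compose_ge[OF f])
  finally show "(\<integral>\<^sup>+x. (\<integral>\<^sup>+y. ennreal c * indicator {y. \<bar>y - a\<bar> < d} y * f (t - x - y) \<partial>lborel) \<partial>kop_measure (op ^^ m) i k)
      \<le> (op ^^ (m + n)) (at_state l f) i t" .
qed (use lo in \<open>auto simp: lower_at_def\<close>)

lemma lower_at_right:
  assumes lo: "lower_at i k n c a d" and pos: "emeasure (kop_measure (op ^^ m) k l) UNIV > 0"
  shows "\<exists>c a d. lower_at i l (n + m) c a d"
proof (rule lower_at_of_conv[OF pos, of c d a])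
  fix f :: "real \<Rightarrow> ennreal" and t assume f [measurable]: "f \<in> borel_measurable borel"
  let ?N = "kop_measure (op ^^ m) k l"
  interpret N: finite_measure ?N by (rule finite_opn)
  interpret NL: pair_sigma_finite ?N lborel ..
  let ?c = "\<lambda>y. ennreal c * indicator {y. \<bar>y - a\<bar> < d} y"
  have mg: "mfun ((op ^^ m) (at_state l f))" by (rule kop_mfun[OF kop_opn mfun_at_state[OF f]])
  have "(\<integral>\<^sup>+x. (\<integral>\<^sup>+y. ?c y * f (t - x - y) \<partial>lborel) \<partial>?N) = (\<integral>\<^sup>+y. (\<integral>\<^sup>+x. ?c y * f (t - x - y) \<partial>?N) \<partial>lborel)"
    by (rule NL.Fubini'[symmetric]) measurable
  also have "\<dots> = (\<integral>\<^sup>+y. ?c y * (op ^^ m) (at_state l f) k (t - y) \<partial>lborel)"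
  proof (rule nn_integral_cong)
    fix y
    have "(\<integral>\<^sup>+x. ?c y * f (t - x - y) \<partial>?N) = ?c y * (\<integral>\<^sup>+x. f (t - y - x) \<partial>?N)"
      by (subst nn_integral_cmult[symmetric]) (auto intro!: nn_integral_cong simp: algebra_simps)
    then show "(\<integral>\<^sup>+x. ?c y * f (t - x - y) \<partial>?N) = ?c y * (op ^^ m) (at_state l f) k (t - y)"
      unfolding nn_integral_kop_measure[OF kop_opn f] .
  qed
  also have "\<dots> \<le> (op ^^ n) (at_state k ((op ^^ m) (at_state l f) k)) i t"
    using lo mfunD[OF mg] unfolding lower_at_def by blast
  also have "\<dots> \<le> (op ^^ n) ((op ^^ m) (at_state l f)) i t"
    by (rule kop_mono[OF kop_opn mfun_at_state[OF mfunD[OF mg]] mg]) (simp add: at_state_def)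
  finally show "(\<integral>\<^sup>+x. (\<integral>\<^sup>+y. ?c y * f (t - x - y) \<partial>lborel) \<partial>?N) \<le> (op ^^ (n + m)) (at_state l f) i t"
    unfolding opn_add .
qed (use lo in \<open>auto simp: lower_at_def\<close>)

text \<open>The minorant \<open>q\<close> of a nonsingular entry need not contain an interval, but
  \<open>q\<close> convolved with itself does. So the entry from \<open>a\<close> to
  \<open>b\<close> is used twice, with a return from \<open>b\<close> to \<open>a\<close> in
  between, whose measure is absorbed by \<open>interval_conv_lower\<close>.\<close>

lemma lower_at_nonsingular:
  assumes ns: "\<not> (\<exists>A\<in>sets borel. emeasure lborel A = 0 \<and> emeasure (kop_measure (op ^^ n) a b) (- A) = 0)"
    and pos: "emeasure (kop_measure (op ^^ m) b a) UNIV > 0"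
  shows "\<exists>c e d. lower_at a b (n + (m + n)) c e d"
proof -
  let ?M = "kop_measure (op ^^ n) a b" and ?N = "kop_measure (op ^^ m) b a"
  obtain C :: "real set" and \<epsilon> L :: real where C [measurable]: "C \<in> sets borel" and CL: "C \<subseteq> {-L..L}" "0 < emeasure lborel C"
    and \<epsilon>: "\<epsilon> > 0" and minor: "\<And>B. B \<in> sets borel \<Longrightarrow> B \<subseteq> C \<Longrightarrow> ennreal \<epsilon> * emeasure lborel B \<le> emeasure ?M B"
    by (rule nonsingular_minorant[OF finite_opn sets_kop_measure ns]) (rule that)
  obtain c e d :: real where c: "c > 0" "d > 0"
    and st: "\<And>r. \<bar>r - e\<bar> < d \<Longrightarrow> ennreal c \<le> emeasure lborel {x. x \<in> C \<and> r - x \<in> C}"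
    by (rule steinhaus_convolution[OF C CL]) (rule that)
  define q where "q x = ennreal \<epsilon> * indicator C x" for x
  have [measurable]: "q \<in> borel_measurable borel" unfolding q_def by measurable
  have qM: "(\<integral>\<^sup>+y. q y * f y \<partial>lborel) \<le> (\<integral>\<^sup>+y. f y \<partial>?M)" if [measurable]: "f \<in> borel_measurable borel" for f
  proof -
    have "(\<integral>\<^sup>+y. q y * f y \<partial>lborel) = (\<integral>\<^sup>+y. f y \<partial>density lborel q)"
      by (rule nn_integral_density[symmetric]) measurable
    also have "\<dots> \<le> (\<integral>\<^sup>+y. f y \<partial>?M)"
    proof (rule nn_integral_mono_measure)
      show "density lborel q \<le> ?M"
      proof (subst le_measure)
        show "\<forall>B\<in>sets (density lborel q). emeasure (density lborel q) B \<le> emeasure ?M B"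
        proof
          fix B assume "B \<in> sets (density lborel q)"
          then have [measurable]: "B \<in> sets borel" by simp
          have "emeasure (density lborel q) B = (\<integral>\<^sup>+x. ennreal \<epsilon> * indicator (C \<inter> B) x \<partial>lborel)"
            unfolding q_def by (subst emeasure_density) (auto intro!: nn_integral_cong split: split_indicator)
          also have "\<dots> = ennreal \<epsilon> * emeasure lborel (C \<inter> B)"
            by (rule nn_integral_cmult_indicator) measurable
          also have "\<dots> \<le> emeasure ?M (C \<inter> B)" by (rule minor) auto
          also have "\<dots> \<le> emeasure ?M B" by (rule emeasure_mono) auto
          finally show "emeasure (density lborel q) B \<le> emeasure ?M B" .
        qed
      qed simp
    qed simp
    finally show ?thesis .
  qed
  interpret N: finite_measure ?N by (rule finite_opn)
  interpret NL: pair_sigma_finite ?N lborel ..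
  show ?thesis
  proof (rule lower_at_of_conv[OF pos, of "\<epsilon> * \<epsilon> * c" d e])
    fix f :: "real \<Rightarrow> ennreal" and t assume f [measurable]: "f \<in> borel_measurable borel"
    have qq: "ennreal (\<epsilon> * \<epsilon> * c) * indicator {y. \<bar>y - e\<bar> < d} r \<le> (\<integral>\<^sup>+x. q x * q (r - x) \<partial>lborel)" for r
    proof (cases "\<bar>r - e\<bar> < d")
      case True
      have [measurable]: "{x. x \<in> C \<and> r - x \<in> C} \<in> sets borel" by measurable
      have "ennreal (\<epsilon> * \<epsilon> * c) * indicator {y. \<bar>y - e\<bar> < d} r = ennreal (\<epsilon> * \<epsilon>) * ennreal c"
        using True \<epsilon> c by (simp add: ennreal_mult[symmetric])
      also have "\<dots> \<le> ennreal (\<epsilon> * \<epsilon>) * emeasure lborel {x. x \<in> C \<and> r - x \<in> C}"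
        by (intro mult_left_mono st True) simp
      also have "\<dots> = (\<integral>\<^sup>+x. ennreal (\<epsilon> * \<epsilon>) * indicator {x. x \<in> C \<and> r - x \<in> C} x \<partial>lborel)"
        by (rule nn_integral_cmult_indicator[symmetric]) measurable
      also have "\<dots> = (\<integral>\<^sup>+x. q x * q (r - x) \<partial>lborel)"
        using \<epsilon> by (intro nn_integral_cong) (auto simp: q_def ennreal_mult split: split_indicator)
      finally show ?thesis .
    qed simp
    define \<phi> where "\<phi> s = (op ^^ n) (at_state b f) a s" for s
    have \<phi>m [measurable]: "\<phi> \<in> borel_measurable borel"
      unfolding \<phi>_def using mfunD[OF kop_mfun[OF kop_opn mfun_at_state[OF f]]] .
    have \<phi>_ge: "(\<integral>\<^sup>+w. q w * f (s - w) \<partial>lborel) \<le> \<phi> s" for s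
      unfolding \<phi>_def nn_integral_kop_measure[OF kop_opn f, symmetric] by (rule qM) measurable
    have inner: "(\<integral>\<^sup>+r. ennreal (\<epsilon> * \<epsilon> * c) * indicator {y. \<bar>y - e\<bar> < d} r * f (s - r) \<partial>lborel) \<le> (\<integral>\<^sup>+x. q x * \<phi> (s - x) \<partial>lborel)" for s
    proof -
      have "(\<integral>\<^sup>+r. ennreal (\<epsilon> * \<epsilon> * c) * indicator {y. \<bar>y - e\<bar> < d} r * f (s - r) \<partial>lborel) \<le>
          (\<integral>\<^sup>+r. (\<integral>\<^sup>+x. q x * q (r - x) \<partial>lborel) * f (s - r) \<partial>lborel)"
        by (intro nn_integral_mono mult_right_mono qq) simp
      also have "\<dots> = (\<integral>\<^sup>+r. (\<integral>\<^sup>+x. q x * q (r - x) * f (s - r) \<partial>lborel) \<partial>lborel)"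
        by (intro nn_integral_cong nn_integral_multc[symmetric]) measurable
      also have "\<dots> = (\<integral>\<^sup>+x. (\<integral>\<^sup>+r. q x * q (r - x) * f (s - r) \<partial>lborel) \<partial>lborel)"
        by (rule lborel_pair.Fubini') measurable
      also have "\<dots> = (\<integral>\<^sup>+x. q x * (\<integral>\<^sup>+w. q w * f (s - x - w) \<partial>lborel) \<partial>lborel)"
      proof (rule nn_integral_cong)
        fix x
        have "(\<integral>\<^sup>+r. q x * q (r - x) * f (s - r) \<partial>lborel) = (\<integral>\<^sup>+w. q x * (q w * f (s - x - w)) \<partial>lborel)"
          by (subst nn_integral_shift[of _ x, symmetric]) (auto intro!: nn_integral_cong simp: algebra_simps)
        also have "\<dots> = q x * (\<integral>\<^sup>+w. q w * f (s - x - w) \<partial>lborel)" by (rule nn_integral_cmult) measurable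
        finally show "(\<integral>\<^sup>+r. q x * q (r - x) * f (s - r) \<partial>lborel) = q x * (\<integral>\<^sup>+w. q w * f (s - x - w) \<partial>lborel)" .
      qed
      also have "\<dots> \<le> (\<integral>\<^sup>+x. q x * \<phi> (s - x) \<partial>lborel)"
        by (intro nn_integral_mono mult_left_mono \<phi>_ge) simp
      finally show ?thesis .
    qed
    have "(\<integral>\<^sup>+x. (\<integral>\<^sup>+y. ennreal (\<epsilon> * \<epsilon> * c) * indicator {y. \<bar>y - e\<bar> < d} y * f (t - x - y) \<partial>lborel) \<partial>?N) \<le>
        (\<integral>\<^sup>+x. (\<integral>\<^sup>+y. q y * \<phi> (t - x - y) \<partial>lborel) \<partial>?N)"
      by (intro nn_integral_mono inner)
    also have "\<dots> = (\<integral>\<^sup>+y. (\<integral>\<^sup>+x. q y * \<phi> (t - x - y) \<partial>?N) \<partial>lborel)"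
      by (rule NL.Fubini'[symmetric]) measurable
    also have "\<dots> = (\<integral>\<^sup>+y. q y * (\<integral>\<^sup>+x. \<phi> (t - y - x) \<partial>?N) \<partial>lborel)"
    proof (rule nn_integral_cong)
      fix y
      show "(\<integral>\<^sup>+x. q y * \<phi> (t - x - y) \<partial>?N) = q y * (\<integral>\<^sup>+x. \<phi> (t - y - x) \<partial>?N)"
        by (subst nn_integral_cmult[symmetric]) (auto intro!: nn_integral_cong simp: algebra_simps)
    qed
    also have "\<dots> \<le> (\<integral>\<^sup>+y. q y * (op ^^ (m + n)) (at_state b f) b (t - y) \<partial>lborel)"
      unfolding \<phi>_def by (intro nn_integral_mono mult_left_mono opn_compose_ge f) simp
    also have "\<dots> \<le> (\<integral>\<^sup>+y. (op ^^ (m + n)) (at_state b f) b (t - y) \<partial>?M)"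
    proof (rule qM)
      show "(\<lambda>y. (op ^^ (m + n)) (at_state b f) b (t - y)) \<in> borel_measurable borel"
        using mfunD[OF kop_mfun[OF kop_opn mfun_at_state[OF f]]] by (rule measurable_compose[rotated]) measurable
    qed
    also have "\<dots> \<le> (op ^^ (n + (m + n))) (at_state b f) a t" by (rule opn_compose_ge[OF f])
    finally show "(\<integral>\<^sup>+x. (\<integral>\<^sup>+y. ennreal (\<epsilon> * \<epsilon> * c) * indicator {y. \<bar>y - e\<bar> < d} y * f (t - x - y) \<partial>lborel) \<partial>?N) \<le>
        (op ^^ (n + (m + n))) (at_state b f) a t" .
  qed (use \<epsilon> c in auto)
qed

text \<open>Irreducibility closes the path from \<open>i\<close> to \<open>a\<close>, from
  \<open>a\<close> to \<open>b\<close> with the interval density, and from \<open>b\<close> back to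
  \<open>i\<close>. The tent fits under the interval obtained.\<close>

lemma spread_at_of_nonsingular:
  assumes ns: "\<not> (\<exists>A\<in>sets borel. emeasure lborel A = 0 \<and> emeasure (kop_measure (op ^^ n) a b) (- A) = 0)"
    and n: "n \<ge> 1" and ab: "a \<in> S" "b \<in> S" and i: "i \<in> S"
    and irr: "\<And>i k. i \<in> S \<Longrightarrow> k \<in> S \<Longrightarrow> \<exists>m. emeasure (kop_measure (op ^^ m) i k) UNIV > 0"
  shows "\<exists>p c e d. spread_at i p c e d"
proof -
  obtain m where m: "emeasure (kop_measure (op ^^ m) b a) UNIV > 0" using irr[OF ab(2,1)] by blast
  obtain m1 where m1: "emeasure (kop_measure (op ^^ m1) i a) UNIV > 0" using irr[OF i ab(1)] by blast
  obtain m2 where m2: "emeasure (kop_measure (op ^^ m2) b i) UNIV > 0" using irr[OF ab(2) i] by blast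
  obtain c1 e1 d1 where "lower_at a b (n + (m + n)) c1 e1 d1" using lower_at_nonsingular[OF ns m] by blast
  then obtain c2 e2 d2 where "lower_at i b (m1 + (n + (m + n))) c2 e2 d2" using lower_at_left[OF _ m1] by blast
  then obtain c e d where lo: "lower_at i i (m1 + (n + (m + n)) + m2) c e d" using lower_at_right[OF _ m2] by blast
  let ?p = "m1 + (n + (m + n)) + m2"
  have cd: "c > 0" "d > 0" using lo by (auto simp: lower_at_def)
  have tent_le: "ennreal (tent c e d y) \<le> ennreal c * indicator {y. \<bar>y - e\<bar> < d} y" for y
  proof (cases "\<bar>y - e\<bar> < d")
    case True
    have "tent c e d y \<le> c * 1" unfolding tent_def using cd by (intro mult_left_mono) auto
    then show ?thesis using True by (simp add: ennreal_leI)
  next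
    case False
    then have "1 \<le> \<bar>y - e\<bar> / d" using cd by (simp add: le_divide_eq)
    then show ?thesis by (simp add: tent_def)
  qed
  have "spread_at i ?p c e d"
    unfolding spread_at_def
  proof (intro conjI ballI allI cd)
    show "1 \<le> ?p" using n by simp
    fix f :: "real \<Rightarrow> ennreal" and t assume f: "f \<in> borel_measurable borel"
    have "(\<integral>\<^sup>+y. ennreal (tent c e d y) * f (t - y) \<partial>lborel) \<le>
        (\<integral>\<^sup>+y. ennreal c * indicator {y. \<bar>y - e\<bar> < d} y * f (t - y) \<partial>lborel)"
      by (intro nn_integral_mono mult_right_mono tent_le) simp
    also have "\<dots> \<le> (op ^^ ?p) (at_state i f) i t"
      using lo f unfolding lower_at_def by blast
    finally show "(\<integral>\<^sup>+y. ennreal (tent c e d y) * f (t - y) \<partial>lborel) \<le> (op ^^ ?p) (at_state i f) i t" .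
  qed
  then show ?thesis by blast
qed

end

section \<open>Matrix renewal measures\<close>

text \<open>The bridge from the unconditional sums in the definitions to integrals against counting
  measure, where Fubini and monotone convergence apply.\<close>

lemma infsum_eq_nn_integral:
  fixes f :: "'a::countable \<Rightarrow> ennreal"
  shows "infsum f A = (\<integral>\<^sup>+x. f x * indicator A x \<partial>count_space UNIV)"
proof (rule antisym)
  have S: "infsum f A = (SUP F\<in>{F. finite F \<and> F \<subseteq> A}. sum f F)"
    by (rule nonneg_infsum_complete) simp
  have fin: "(\<integral>\<^sup>+x. f x * indicator F x \<partial>count_space UNIV) = sum f F" if F: "finite F" for F
  proof -
    have "(\<integral>\<^sup>+x. f x * indicator F x \<partial>count_space UNIV) = (\<integral>\<^sup>+x. f x \<partial>count_space F)"
      by (simp add: nn_integral_count_space_indicator)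
    then show ?thesis using nn_integral_count_space_finite[OF F, of f] by simp
  qed
  show "infsum f A \<le> (\<integral>\<^sup>+x. f x * indicator A x \<partial>count_space UNIV)"
    unfolding S
  proof (rule SUP_least)
    fix F assume F: "F \<in> {F. finite F \<and> F \<subseteq> A}"
    then have "sum f F = (\<integral>\<^sup>+x. f x * indicator F x \<partial>count_space UNIV)" using fin by simp
    also have "\<dots> \<le> (\<integral>\<^sup>+x. f x * indicator A x \<partial>count_space UNIV)"
      using F by (intro nn_integral_mono) (auto split: split_indicator)
    finally show "sum f F \<le> (\<integral>\<^sup>+x. f x * indicator A x \<partial>count_space UNIV)" .
  qed
  define T where "T n = {x\<in>A. to_nat x < n}" for n
  have T_fin: "finite (T n)" for n
  proof (rule finite_subset)
    show "T n \<subseteq> from_nat ` {..<n}"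
    proof
      fix x assume "x \<in> T n"
      then have "to_nat x \<in> {..<n}" by (simp add: T_def)
      then have "from_nat (to_nat x) \<in> (from_nat ` {..<n} :: 'a set)" by (rule imageI)
      then show "x \<in> from_nat ` {..<n}" by simp
    qed
  qed simp
  have ind: "(SUP n. f x * indicator (T n) x) = f x * indicator A x" for x
  proof (rule antisym)
    show "(SUP n. f x * indicator (T n) x) \<le> f x * indicator A x"
      by (rule SUP_least) (auto simp: T_def split: split_indicator)
    show "f x * indicator A x \<le> (SUP n. f x * indicator (T n) x)"
      by (rule SUP_upper2[of "Suc (to_nat x)"]) (auto simp: T_def split: split_indicator)
  qed
  have "(\<integral>\<^sup>+x. f x * indicator A x \<partial>count_space UNIV) = (\<integral>\<^sup>+x. (SUP n. f x * indicator (T n) x) \<partial>count_space UNIV)"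
    unfolding ind ..
  also have "\<dots> = (SUP n. \<integral>\<^sup>+x. f x * indicator (T n) x \<partial>count_space UNIV)"
    by (rule nn_integral_monotone_convergence_SUP)
      (auto simp: incseq_def le_fun_def T_def split: split_indicator)
  also have "\<dots> = (SUP n. sum f (T n))" using fin[OF T_fin] by simp
  also have "\<dots> \<le> infsum f A"
    unfolding S using T_fin by (intro SUP_least SUP_upper) (auto simp: T_def)
  finally show "(\<integral>\<^sup>+x. f x * indicator A x \<partial>count_space UNIV) \<le> infsum f A" .
qed

lemma nn_integral_has_sum:
  fixes f :: "'a::countable \<Rightarrow> real"
  assumes f: "(f has_sum x) A" and nn: "\<And>k. k \<in> A \<Longrightarrow> 0 \<le> f k"
  shows "(\<integral>\<^sup>+k. ennreal (f k) * indicator A k \<partial>count_space UNIV) = ennreal x"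
proof -
  have "((\<lambda>F. ennreal (sum f F)) \<longlongrightarrow> ennreal x) (finite_subsets_at_top A)"
    using f unfolding has_sum_def by (rule tendsto_ennrealI)
  moreover have "\<forall>\<^sub>F F in finite_subsets_at_top A. ennreal (sum f F) = (\<Sum>k\<in>F. ennreal (f k))"
    by (intro eventually_finite_subsets_at_top_weakI sum_ennreal[symmetric]) (use nn in auto)
  ultimately have hs: "((\<lambda>k. ennreal (f k)) has_sum ennreal x) A"
    unfolding has_sum_def by (rule Lim_transform_eventually)
  show ?thesis
    using infsum_eq_nn_integral[of "\<lambda>k. ennreal (f k)" A] infsumI[OF hs] by simp
qed

lemma has_sum_nn_integral:
  fixes f :: "'a::countable \<Rightarrow> real"
  assumes f: "(\<integral>\<^sup>+k. ennreal (f k) * indicator A k \<partial>count_space UNIV) = ennreal x"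
    and nn: "\<And>k. k \<in> A \<Longrightarrow> 0 \<le> f k" and x: "0 \<le> x"
  shows "(f has_sum x) A"
proof -
  have "sum f F \<le> x" if F: "F \<subseteq> A" "finite F" for F
  proof -
    have "ennreal (sum f F) = (\<Sum>k\<in>F. ennreal (f k))"
      using F nn by (intro sum_ennreal[symmetric]) auto
    also have "\<dots> \<le> (SUP F\<in>{F. finite F \<and> F \<subseteq> A}. \<Sum>k\<in>F. ennreal (f k))"
      using F by (intro SUP_upper) auto
    also have "\<dots> = infsum (\<lambda>k. ennreal (f k)) A" by (rule nonneg_infsum_complete[symmetric]) simp
    also have "\<dots> = ennreal x" unfolding infsum_eq_nn_integral by (rule f)
    finally show ?thesis using x by simp
  qed
  then have "f summable_on A"
    by (intro nonneg_bdd_above_summable_on nn) (auto intro!: bdd_aboveI[where M = x])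
  then obtain y where y: "(f has_sum y) A" by (auto simp: summable_on_def)
  have "0 \<le> y" using y nn by (rule has_sum_nonneg)
  then have "x = y" using nn_integral_has_sum[OF y nn] f x by simp
  then show ?thesis using y by simp
qed

definition walk_kernel :: "nat pmf \<Rightarrow> (nat \<Rightarrow> real measure) \<Rightarrow> (nat \<times> real) measure" where
  "walk_kernel p G =
     measure_pmf p \<bind> (\<lambda>k. distr (G k) (count_space UNIV \<Otimes>\<^sub>M borel) (Pair k))"

context
  fixes G :: "nat \<Rightarrow> real measure"
  assumes G: "\<And>k. real_distribution (G k)"
begin

lemma measurable_Pair_G: "Pair k \<in> measurable (G k) (count_space (UNIV::nat set) \<Otimes>\<^sub>M borel)"
proof -
  have s: "sets (G k) = sets borel" using G[of k] by (rule real_distribution.events_eq_borel)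
  show ?thesis unfolding measurable_cong_sets[OF s refl] by measurable
qed

lemma prob_walk_step: "prob_space (distr (G k) (count_space (UNIV::nat set) \<Otimes>\<^sub>M borel) (Pair k))"
  using G[of k] measurable_Pair_G
  by (intro prob_space.prob_space_distr) (auto simp: real_distribution_def)

lemma measurable_walk_step:
  "(\<lambda>k. distr (G k) (count_space UNIV \<Otimes>\<^sub>M borel) (Pair k)) \<in>
     measurable (measure_pmf p) (subprob_algebra (count_space (UNIV::nat set) \<Otimes>\<^sub>M borel))"
  using prob_walk_step by (auto simp: space_subprob_algebra intro: prob_space_imp_subprob_space)

lemma sets_walk_kernel: "sets (walk_kernel p G) = sets (count_space UNIV \<Otimes>\<^sub>M borel)"
  unfolding walk_kernel_def by (rule sets_bind) auto

lemma prob_walk_kernel: "prob_space (walk_kernel p G)"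
  unfolding walk_kernel_def
  by (rule prob_space.prob_space_bind[OF measure_pmf.prob_space_axioms _ measurable_walk_step])
    (simp add: prob_walk_step)

lemma nn_integral_walk_kernel:
  assumes f: "f \<in> borel_measurable (count_space UNIV \<Otimes>\<^sub>M borel)"
  shows "(\<integral>\<^sup>+z. f z \<partial>walk_kernel p G) =
     (\<integral>\<^sup>+k. ennreal (pmf p k) * (\<integral>\<^sup>+x. f (k, x) \<partial>G k) \<partial>count_space UNIV)"
  unfolding walk_kernel_def nn_integral_bind[OF f measurable_walk_step]
  by (simp add: nn_integral_measure_pmf nn_integral_distr[OF measurable_Pair_G] f)

lemma AE_walk_kernel: "AE z in walk_kernel p G. fst z \<in> set_pmf p"
proof -
  have P: "Measurable.pred (count_space (UNIV::nat set) \<Otimes>\<^sub>M (borel :: real measure)) (\<lambda>z. fst z \<in> set_pmf p)"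
    by measurable
  have s: "{z \<in> space (count_space (UNIV::nat set) \<Otimes>\<^sub>M (borel :: real measure)). fst z \<in> set_pmf p} \<in>
      sets (count_space UNIV \<Otimes>\<^sub>M borel)"
    using P by (simp add: pred_def)
  have "AE k in measure_pmf p. AE z in distr (G k) (count_space UNIV \<Otimes>\<^sub>M borel) (Pair k). fst z \<in> set_pmf p"
  proof (rule AE_pmfI)
    fix k assume k: "k \<in> set_pmf p"
    show "AE z in distr (G k) (count_space UNIV \<Otimes>\<^sub>M borel) (Pair k). fst z \<in> set_pmf p"
      unfolding AE_distr_iff[OF measurable_Pair_G s] using k by simp
  qed
  then show ?thesis unfolding walk_kernel_def AE_bind[OF measurable_walk_step P] .
qed

end

lemma interval_measure_eqI:
  assumes N: "finite_borel_measure N" and c: "\<And>t. H t = measure N {..t}"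
    and H: "\<And>x y. x \<le> y \<Longrightarrow> H x \<le> H y" "\<And>a. continuous (at_right a) H"
  shows "interval_measure H = N"
proof -
  have H_cdf: "H = cdf N" using c by (simp add: cdf_def fun_eq_iff)
  have eq: "emeasure (interval_measure H) {a<..b} = emeasure N {a<..b}" for a b
  proof (cases "a \<le> b")
    case True
    show ?thesis
      using emeasure_interval_measure_Ioc[OF True H] finite_borel_measure.emeasure_Ioc[OF N True]
      by (simp add: H_cdf)
  qed simp
  show ?thesis
  proof (rule measure_eqI_generator_eq[where \<Omega>=UNIV])
    fix X assume "X \<in> range (\<lambda>(a, b). {a<..b::real})"
    then show "emeasure (interval_measure H) X = emeasure N X" using eq by auto
  next
    show "(\<Union>i. {- real (i::nat)<..real i}) = UNIV" by (rule UN_Ioc_eq_UNIV)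
  next
    fix i :: nat
    show "emeasure (interval_measure H) {- real i<..real i} \<noteq> \<infinity>"
      by (simp add: emeasure_interval_measure_Ioc[OF _ H])
  qed (auto simp: finite_borel_measure.M_is_borel[OF N] borel_sigma_sets_Ioc Int_stable_def)
qed

lemma finite_measure_scale:
  assumes "finite_measure M" "r < \<top>" shows "finite_measure (scale_measure r M)"
proof (rule finite_measureI)
  show "emeasure (scale_measure r M) (space (scale_measure r M)) \<noteq> \<infinity>"
    using assms finite_measure.emeasure_finite[OF assms(1), of "space M"]
    by (simp add: space_scale_measure ennreal_mult_eq_top_iff)
qed

text \<open>A far window misses all but a small tail of \<open>V1\<close> and sees a density close
  to \<open>L\<close>. Both errors are bounded by the window alone, hence uniformly in the
  subset.\<close>

lemma total_variation_limit:
  fixes V V1 :: "real measure" and h :: "real \<Rightarrow> real" and b L :: real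
  assumes V1: "finite_measure V1" "sets V1 = sets borel"
    and h: "\<And>t. h t \<ge> 0" "h \<in> borel_measurable borel" "(h \<longlongrightarrow> L) at_top"
    and V: "\<And>C. C \<in> sets borel \<Longrightarrow>
      emeasure V C = emeasure V1 C + (\<integral>\<^sup>+s. ennreal (h s) * indicator C s \<partial>lborel)"
    and b: "b > 0"
  shows "((\<lambda>t. SUP B\<in>{B. B \<in> sets borel \<and> B \<subseteq> {0..b}}.
      \<bar>enn2ereal (emeasure V ((+) t ` B)) - ereal (L * measure lborel B)\<bar>) \<longlongrightarrow> 0) at_top"
    (is "(?f \<longlongrightarrow> 0) at_top")
proof -
  interpret finite_borel_measure V1
    using V1 by (auto simp: finite_borel_measure_def finite_borel_measure_axioms_def)
  note h(2)[measurable]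
  have space_V1: "space V1 = UNIV" using sets_eq_imp_space_eq[OF V1(2)] by simp
  have main: "eventually (\<lambda>t. ?f t \<le> ereal \<delta>) at_top" if \<delta>: "\<delta> > 0" for \<delta>
  proof -
    \<comment> \<open>The tail of \<open>V1\<close> costs at most \<epsilon> and the density at most
      \<epsilon> times the length \<open>b\<close>, together \<delta>.\<close>
    define \<epsilon> where "\<epsilon> = \<delta> / (1 + b)"
    have "\<epsilon> + \<epsilon> * b = \<epsilon> * (1 + b)" by (simp add: algebra_simps)
    also have "\<dots> = \<delta>" using b by (simp add: \<epsilon>_def)
    finally have \<epsilon>: "\<epsilon> > 0" "\<epsilon> + \<epsilon> * b = \<delta>" using \<delta> b by (simp_all add: \<epsilon>_def)
    have "eventually (\<lambda>s. cdf V1 s > measure V1 (space V1) - \<epsilon>) at_top"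
      using cdf_lim_at_top by (rule order_tendstoD) (use \<epsilon> in simp)
    then obtain s0 where s0: "cdf V1 s0 > measure V1 (space V1) - \<epsilon>"
      using eventually_happens'[OF trivial_limit_at_top_linorder] by blast
    have "{s0<..} = space V1 - {..s0}" by (auto simp: space_V1)
    then have tail: "measure V1 {s0<..} < \<epsilon>"
      using s0 finite_measure_compl[of "{..s0}"] by (simp add: cdf_def V1(2))
    have "eventually (\<lambda>s. dist (h s) L < \<epsilon>) at_top" using h(3) \<epsilon>(1) by (rule tendstoD)
    then obtain s1 where s1: "\<And>s. s \<ge> s1 \<Longrightarrow> \<bar>h s - L\<bar> < \<epsilon>"
      by (auto simp: eventually_at_top_linorder dist_real_def)
    have bound: "?f t \<le> ereal \<delta>" if t: "t > s0" "t \<ge> s1" for t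
    proof (rule SUP_least)
      fix B :: "real set" assume "B \<in> {B. B \<in> sets borel \<and> B \<subseteq> {0..b}}"
      then have B: "B \<in> sets borel" "B \<subseteq> {0..b}" by auto
      define C where "C = (+) t ` B"
      have C_eq: "C = (\<lambda>x. x - t) -` B"
      proof (intro set_eqI iffI)
        fix x assume "x \<in> (\<lambda>x. x - t) -` B"
        then have "t + (x - t) \<in> C" unfolding C_def by (intro imageI) simp
        then show "x \<in> C" by simp
      qed (auto simp: C_def)
      have "(\<lambda>x. x - t) -` B \<inter> space borel \<in> sets borel"
        by (rule measurable_sets[OF _ B(1)]) measurable
      then have C [measurable]: "C \<in> sets borel" unfolding C_eq by simp
      have "emeasure lborel C = emeasure (distr lborel borel ((+) t)) C" by (simp add: lborel_distr_plus)
      also have "\<dots> = emeasure lborel ((+) t -` C \<inter> space lborel)"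
        by (rule emeasure_distr) (use C in simp_all)
      also have "(+) t -` C \<inter> space lborel = B" by (auto simp: C_def)
      finally have len: "emeasure lborel C = emeasure lborel B" .
      have "emeasure lborel B \<le> emeasure lborel {0..b}" using B by (intro emeasure_mono) auto
      then have le: "emeasure lborel B \<le> ennreal b" using b by simp
      define l where "l = measure lborel B"
      have "emeasure lborel B \<noteq> \<top>" using le by (auto simp: top_unique)
      then have lB: "emeasure lborel B = ennreal l" unfolding l_def by (rule emeasure_eq_ennreal_measure)
      have l: "0 \<le> l" "l \<le> b" using le b unfolding lB by (auto simp: l_def)
      have C_sub: "C \<subseteq> {s0<..}" "\<And>s. s \<in> C \<Longrightarrow> s \<ge> s1" using B t by (force simp: C_def)+
      define a where "a = measure V1 C"
      have "a \<le> measure V1 {s0<..}" unfolding a_def using C_sub by (intro finite_measure_mono) (auto simp: V1(2))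
      then have a: "0 \<le> a" "a < \<epsilon>" using tail by (auto simp: a_def)
      have aC: "emeasure V1 C = ennreal a" unfolding a_def by (rule emeasure_eq_measure)
      define X where "X = (\<integral>\<^sup>+s. ennreal (h s) * indicator C s \<partial>lborel)"
      have const: "(\<integral>\<^sup>+s. ennreal r * indicator C s \<partial>lborel) = ennreal r * ennreal l" for r
        using C by (subst nn_integral_cmult_indicator) (simp_all add: len lB)
      have "X \<le> (\<integral>\<^sup>+s. ennreal (L + \<epsilon>) * indicator C s \<partial>lborel)"
        unfolding X_def
      proof (rule nn_integral_mono)
        fix s
        show "ennreal (h s) * indicator C s \<le> ennreal (L + \<epsilon>) * indicator C s"
          using s1[OF C_sub(2), of s] by (auto split: split_indicator intro!: ennreal_leI)
      qed
      then have up: "X \<le> ennreal (L + \<epsilon>) * ennreal l" unfolding const .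
      have "(\<integral>\<^sup>+s. ennreal (L - \<epsilon>) * indicator C s \<partial>lborel) \<le> X"
        unfolding X_def
      proof (rule nn_integral_mono)
        fix s
        show "ennreal (L - \<epsilon>) * indicator C s \<le> ennreal (h s) * indicator C s"
          using s1[OF C_sub(2), of s] by (auto split: split_indicator intro!: ennreal_leI)
      qed
      then have lo: "ennreal (L - \<epsilon>) * ennreal l \<le> X" unfolding const .
      have "L + \<epsilon> \<ge> 0" using s1[of s1] h(1)[of s1] by simp
      then have up': "X \<le> ennreal ((L + \<epsilon>) * l)" using up l by (simp add: ennreal_mult)
      then obtain x where x: "X = ennreal x" "0 \<le> x" by (cases X) (auto simp: top_unique)
      have x_up: "x \<le> (L + \<epsilon>) * l" using up' x \<open>L + \<epsilon> \<ge> 0\<close> l by simp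
      \<comment> \<open>For negative L - \<epsilon> the \<open>ennreal\<close> bound is truncated to
        0, and the claim holds because \<open>x\<close> is nonnegative.\<close>
      have x_lo: "(L - \<epsilon>) * l \<le> x"
      proof (cases "L - \<epsilon> \<ge> 0")
        case True
        then have "ennreal ((L - \<epsilon>) * l) \<le> ennreal x" using lo x l by (simp add: ennreal_mult)
        then show ?thesis using x by simp
      next
        case False
        then have "(L - \<epsilon>) * l \<le> 0" using l by (intro mult_nonpos_nonneg) auto
        then show ?thesis using x by simp
      qed
      have "\<epsilon> * l \<le> \<epsilon> * b" using l \<epsilon> by (intro mult_left_mono) auto
      then have fin: "\<bar>a + x - L * l\<bar> \<le> \<delta>"
        using x_up x_lo a \<epsilon> unfolding abs_le_iff distrib_right left_diff_distrib by linarith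
      have "emeasure V C = ennreal (a + x)"
        unfolding V[OF C] X_def[symmetric] aC x(1) using a x by simp
      moreover have "enn2ereal (ennreal (a + x)) = ereal (a + x)"
        by (rule enn2ereal_ennreal[OF add_nonneg_nonneg[OF a(1) x(2)]])
      ultimately have "enn2ereal (emeasure V C) = ereal (a + x)" by (simp only:)
      then show "\<bar>enn2ereal (emeasure V ((+) t ` B)) - ereal (L * measure lborel B)\<bar> \<le> ereal \<delta>"
        using fin unfolding C_def[symmetric] l_def[symmetric] by simp
    qed
    show ?thesis
      using eventually_gt_at_top[of s0] eventually_ge_at_top[of s1] 
      by eventually_elim (rule bound)
  qed
  have nn: "0 \<le> ?f t" for t by (rule SUP_upper2[of "{}"]) auto
  show ?thesis
  proof (rule order_tendstoI)
    fix a :: ereal assume "a < 0"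
    then show "eventually (\<lambda>t. a < ?f t) at_top" using nn by (auto intro: always_eventually less_le_trans)
  next
    fix a :: ereal assume "0 < a"
    then obtain \<delta> where d: "0 < ereal \<delta>" "ereal \<delta> < a" using ereal_dense2 by blast
    show "eventually (\<lambda>t. ?f t < a) at_top"
      using main[of \<delta>] d by (auto elim!: eventually_mono intro: le_less_trans)
  qed
qed

section \<open>The Markov random walk attached to the matrix\<close>

locale spread_out_system =
  fixes S :: "nat set" and Q :: "nat \<Rightarrow> nat \<Rightarrow> real" and u v :: "nat \<Rightarrow> real"
    and F :: "nat \<Rightarrow> nat \<Rightarrow> real measure"
  assumes index: "index_set S"
    and quasi: "quasi_stochastic S Q"
    and left: "pos_left_eigenvector S Q u"
    and right: "pos_right_eigenvector S Q v"
    and F: "\<And>i j. i \<in> S \<Longrightarrow> j \<in> S \<Longrightarrow> real_distribution (F i j)"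
    and recurrent: "\<exists>i\<in>S. (\<Sum>n. ennreal (matpow S Q (Suc n) i i)) = \<infinity>"
    and well_defined: "mean_well_defined S Q F u v"
    and mean_gt_0: "mean S Q F u v > 0"
    and spread_out: "spread_out S Q F u v"
begin

text \<open>Outside \<open>S\<close> the row of one fixed state of \<open>S\<close> is borrowed, so
  every such state moves into \<open>S\<close> in one step.\<close>

definition proj :: "nat \<Rightarrow> nat" where
  "proj i = (if i \<in> S then i else (SOME k. k \<in> S))"

text \<open>The Doob transform of \<open>Q\<close> by \<open>v\<close>; rows and columns outside \<open>S\<close> are filled up so that it is
  stochastic on all of \<^typ>\<open>nat\<close>.\<close>

definition p :: "nat \<Rightarrow> nat \<Rightarrow> real" where
  "p i k = (if k \<in> S then Q (proj i) k * v k / v (proj i) else 0)"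

text \<open>The point mass at 0 in columns outside \<open>S\<close> is a harmless default, reached
  with probability 0 under \<open>p\<close>.\<close>

definition G :: "nat \<Rightarrow> nat \<Rightarrow> real measure" where
  "G i k = (if k \<in> S then F (proj i) k else return borel 0)"

definition K :: "nat \<Rightarrow> (nat \<times> real) measure" where
  "K i = walk_kernel (embed_pmf (p i)) (G i)"

definition w :: "nat \<Rightarrow> real" where
  "w i = (if i \<in> S then u i * v i else 0)"

definition W :: "nat measure" where
  "W = density (count_space UNIV) (\<lambda>i. ennreal (w i))"

lemma S_ne: "S \<noteq> {}"
  using index by (auto simp: index_set_def)

lemma proj_in: "proj i \<in> S"
  unfolding proj_def using S_ne by (auto intro: someI)

lemma proj_eq [simp]: "i \<in> S \<Longrightarrow> proj i = i"
  by (simp add: proj_def)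

lemma v_pos: "i \<in> S \<Longrightarrow> v i > 0" and u_pos: "i \<in> S \<Longrightarrow> u i > 0"
  using left right by (auto simp: pos_left_eigenvector_def pos_right_eigenvector_def)

lemma nonneg: "nonneg_matrix S Q"
  using quasi by (simp add: quasi_stochastic_def)

lemma Q_nonneg: "i \<in> S \<Longrightarrow> k \<in> S \<Longrightarrow> Q i k \<ge> 0"
  using nonneg by (auto simp: nonneg_matrix_def)

lemma v_sum: "i \<in> S \<Longrightarrow> ((\<lambda>k. Q i k * v k) has_sum v i) S"
  using right by (auto simp: pos_right_eigenvector_def)

lemma u_sum: "k \<in> S \<Longrightarrow> ((\<lambda>i. u i * Q i k) has_sum u k) S"
  using left by (auto simp: pos_left_eigenvector_def)

lemma p_nonneg: "p i k \<ge> 0"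
  using Q_nonneg[OF proj_in, of k i] v_pos[of k] v_pos[OF proj_in[of i]] by (auto simp: p_def)

lemma p_sum: "(\<integral>\<^sup>+k. ennreal (p i k) \<partial>count_space UNIV) = 1"
proof -
  have vi: "v (proj i) > 0" by (rule v_pos[OF proj_in])
  have hs: "((\<lambda>k. 1 / v (proj i) * (Q (proj i) k * v k)) has_sum (1 / v (proj i) * v (proj i))) S"
    by (rule has_sum_cmult_right[OF v_sum[OF proj_in]])
  have nn: "0 \<le> 1 / v (proj i) * (Q (proj i) k * v k)" if "k \<in> S" for k
    using Q_nonneg[OF proj_in[of i] that] v_pos[OF that] vi by simp
  have "(\<integral>\<^sup>+k. ennreal (p i k) \<partial>count_space UNIV) =
      (\<integral>\<^sup>+k. ennreal (1 / v (proj i) * (Q (proj i) k * v k)) * indicator S k \<partial>count_space UNIV)"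
    by (rule nn_integral_cong) (simp add: p_def split: split_indicator)
  also have "\<dots> = ennreal (1 / v (proj i) * v (proj i))" by (rule nn_integral_has_sum[OF hs nn])
  finally show ?thesis using vi by simp
qed

lemma pmf_p: "pmf (embed_pmf (p i)) k = p i k"
  by (rule pmf_embed_pmf[OF p_nonneg p_sum])

lemma G_dist: "real_distribution (G i k)"
proof (cases "k \<in> S")
  case True
  then show ?thesis using F[OF proj_in True] by (simp add: G_def)
next
  case False
  have "real_distribution (return borel (0::real))"
    by (auto simp: real_distribution_def real_distribution_axioms_def intro!: prob_space_return)
  then show ?thesis using False by (simp add: G_def)
qed

lemma emeasure_G [simp]: "emeasure (G i k) (space (G i k)) = 1"
  using G_dist[of i k] by (intro prob_space.emeasure_space_1) (simp add: real_distribution_def)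

sublocale markov_walk K S
proof (rule markov_walk.intro)
  show "prob_space (K i)" for i unfolding K_def by (rule prob_walk_kernel[OF G_dist])
  show "sets (K i) = sets (count_space UNIV \<Otimes>\<^sub>M borel)" for i
    unfolding K_def by (rule sets_walk_kernel[OF G_dist])
  show "AE z in K i. fst z \<in> S" for i
  proof -
    have "set_pmf (embed_pmf (p i)) \<subseteq> S" by (auto simp: set_pmf_iff pmf_p p_def split: if_splits)
    moreover have "AE z in K i. fst z \<in> set_pmf (embed_pmf (p i))"
      unfolding K_def by (rule AE_walk_kernel[OF G_dist])
    ultimately show ?thesis by (auto elim: eventually_mono)
  qed
qed

lemma nn_integral_K:
  assumes "f \<in> borel_measurable (count_space UNIV \<Otimes>\<^sub>M borel)"
  shows "(\<integral>\<^sup>+z. f z \<partial>K i) = (\<integral>\<^sup>+k. ennreal (p i k) * (\<integral>\<^sup>+x. f (k, x) \<partial>G i k) \<partial>count_space UNIV)"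
  unfolding K_def nn_integral_walk_kernel[OF G_dist assms] pmf_p ..

lemma nn_integral_K_fst:
  "(\<integral>\<^sup>+z. f (fst z) \<partial>K i) = (\<integral>\<^sup>+k. ennreal (p i k) * f k \<partial>count_space UNIV)"
proof -
  have "(\<lambda>z. f (fst z)) \<in> borel_measurable (count_space UNIV \<Otimes>\<^sub>M borel)"
    by (rule measurable_compose[OF measurable_fst]) simp
  from nn_integral_K[OF this] show ?thesis by simp
qed

lemma op_eq:
  assumes f: "mfun f"
  shows "op f i t = (\<integral>\<^sup>+k. ennreal (p i k) * (\<integral>\<^sup>+x. f k (t - x) \<partial>G i k) \<partial>count_space UNIV)"
proof -
  have "(\<lambda>z. f (fst z) (t - snd z)) \<in> borel_measurable (count_space UNIV \<Otimes>\<^sub>M borel)"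
  proof (rule measurable_compose_countable[where f = "\<lambda>k z. f k (t - snd z)" and g = fst])
    fix k
    note mfunD[OF f, measurable]
    show "(\<lambda>z. f k (t - snd z)) \<in> borel_measurable (count_space UNIV \<Otimes>\<^sub>M borel)" by measurable
  qed measurable
  from nn_integral_K[OF this] show ?thesis unfolding op_def by simp
qed

text \<open>Conjugation by \<open>v\<close> in a single step, shared by \<open>conv_power\<close>
  and \<open>matpow\<close>. The bound c k \<le> v k / v j makes the sum converge by comparison with
  the right eigenvector equation.\<close>

lemma op_step:
  assumes i: "i \<in> S" and j: "j \<in> S"
    and c: "\<And>k. k \<in> S \<Longrightarrow> 0 \<le> c k \<and> c k \<le> v k / v j"
    and X: "\<And>k. k \<in> S \<Longrightarrow> ennreal (c k) = ennreal (v k / v j) * X k"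
  shows "ennreal (\<Sum>\<^sub>\<infinity>k\<in>S. Q i k * c k) =
    ennreal (v i / v j) * (\<integral>\<^sup>+k. ennreal (p i k) * X k \<partial>count_space UNIV)"
proof -
  have vi: "v i > 0" "v j > 0" using v_pos i j by auto
  have nn: "0 \<le> Q i k * c k" if "k \<in> S" for k using Q_nonneg[OF i that] c[OF that] by simp
  have sv: "(\<lambda>k. 1 / v j * (Q i k * v k)) summable_on S"
    by (rule has_sum_imp_summable[OF has_sum_cmult_right[OF v_sum[OF i]]])
  have "(\<lambda>k. Q i k * c k) summable_on S"
  proof (rule summable_on_comparison_test[OF sv])
    fix k assume k: "k \<in> S"
    have "Q i k * c k \<le> Q i k * (v k / v j)" using Q_nonneg[OF i k] c[OF k] by (intro mult_left_mono) auto
    then show "Q i k * c k \<le> 1 / v j * (Q i k * v k)" by simp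
    show "0 \<le> Q i k * c k" by (rule nn[OF k])
  qed
  from nn_integral_has_sum[OF has_sum_infsum[OF this] nn]
  have "ennreal (\<Sum>\<^sub>\<infinity>k\<in>S. Q i k * c k) = (\<integral>\<^sup>+k. ennreal (Q i k * c k) * indicator S k \<partial>count_space UNIV)" by simp
  also have "\<dots> = (\<integral>\<^sup>+k. ennreal (v i / v j) * (ennreal (p i k) * X k) \<partial>count_space UNIV)"
  proof (rule nn_integral_cong)
    fix k
    show "ennreal (Q i k * c k) * indicator S k = ennreal (v i / v j) * (ennreal (p i k) * X k)"
    proof (cases "k \<in> S")
      case True
      have vk: "v k > 0" and Qk: "Q i k \<ge> 0" using v_pos Q_nonneg i True by auto
      have "ennreal (Q i k * c k) = ennreal (Q i k) * (ennreal (v k / v j) * X k)"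
        using ennreal_mult[OF Qk, of "c k"] c[OF True] X[OF True] by simp
      also have "\<dots> = ennreal (Q i k * (v k / v j)) * X k"
        by (simp only: ennreal_mult[OF Qk divide_nonneg_pos[OF less_imp_le[OF vk] vi(2)]] mult.assoc)
      also have "Q i k * (v k / v j) = v i / v j * p i k" using True i vi by (simp add: p_def)
      also have "ennreal (v i / v j * p i k) * X k = ennreal (v i / v j) * (ennreal (p i k) * X k)"
        by (simp only: ennreal_mult[OF divide_nonneg_pos[OF less_imp_le[OF vi(1)] vi(2)] p_nonneg] mult.assoc)
      finally show ?thesis using True by simp
    qed (simp add: p_def)
  qed
  also have "\<dots> = ennreal (v i / v j) * (\<integral>\<^sup>+k. ennreal (p i k) * X k \<partial>count_space UNIV)"
    by (rule nn_integral_cmult) simp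
  finally show ?thesis .
qed

lemma measurable_F:
  assumes "i \<in> S" "k \<in> S" and g: "g \<in> borel_measurable borel"
  shows "(\<lambda>x. g (t - x)) \<in> borel_measurable (F i k)"
proof -
  have "(\<lambda>x. g (t - x)) \<in> borel_measurable borel" by (rule measurable_compose[OF _ g]) measurable
  then show ?thesis by (rule real_distribution.measurable_finite_borel[OF F[OF assms(1,2)]])
qed

lemma conv_power_bounds:
  assumes "i \<in> S" "j \<in> S"
  shows "mono (conv_power S Q F n i j) \<and>
    (\<forall>t. continuous (at_right t) (conv_power S Q F n i j)) \<and>
    (\<forall>t. 0 \<le> conv_power S Q F n i j t \<and> conv_power S Q F n i j t \<le> v i / v j)"
  by (rule conv_power_regular[OF nonneg right _ assms]) (rule F)

lemma conv_power_eq: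
  assumes i: "i \<in> S" and j: "j \<in> S"
  shows "ennreal (conv_power S Q F n i j t) =
    ennreal (v i / v j) * (op ^^ n) (at_state j (indicator {0..})) i t"
  using i
proof (induction n arbitrary: i t)
  case 0
  then show ?case using v_pos[OF j] by (auto simp: at_state_def split: split_indicator)
next
  case (Suc n)
  let ?f = "at_state j (indicator {0..})"
  have mf: "mfun ((op ^^ n) ?f)" by (rule kop_mfun[OF kop_opn mfun_at_state]) simp
  have vj: "v j > 0" by (rule v_pos[OF j])
  let ?c = "\<lambda>k. \<integral>x. conv_power S Q F n k j (t - x) \<partial>F i k"
  let ?X = "\<lambda>k. \<integral>\<^sup>+x. (op ^^ n) ?f k (t - x) \<partial>G i k"
  have cX: "0 \<le> ?c k \<and> ?c k \<le> v k / v j" "ennreal (?c k) = ennreal (v k / v j) * ?X k" if k: "k \<in> S" for k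
  proof -
    interpret F: real_distribution "F i k" by (rule F[OF Suc.prems k])
    note reg = conv_power_bounds[OF k j, of n]
    have "conv_power S Q F n k j \<in> borel_measurable borel"
      using reg by (intro borel_measurable_mono) auto
    from measurable_F[OF Suc.prems k this]
    have m: "(\<lambda>x. conv_power S Q F n k j (t - x)) \<in> borel_measurable (F i k)" .
    have int: "integrable (F i k) (\<lambda>x. conv_power S Q F n k j (t - x))"
      by (rule F.integrable_const_bound[where B = "v k / v j", OF _ m]) (use reg in auto)
    have "?c k \<le> (\<integral>x. v k / v j \<partial>F i k)" using int reg by (intro integral_mono) auto
    then show "0 \<le> ?c k \<and> ?c k \<le> v k / v j"
      using reg F.prob_space by (auto intro!: Bochner_Integration.integral_nonneg)
    have "ennreal (?c k) = (\<integral>\<^sup>+x. ennreal (conv_power S Q F n k j (t - x)) \<partial>F i k)"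
      using int reg by (intro nn_integral_eq_integral[symmetric]) auto
    also have "\<dots> = (\<integral>\<^sup>+x. ennreal (v k / v j) * (op ^^ n) ?f k (t - x) \<partial>F i k)"
      unfolding Suc.IH[OF k] ..
    also have "\<dots> = ennreal (v k / v j) * (\<integral>\<^sup>+x. (op ^^ n) ?f k (t - x) \<partial>F i k)"
      by (rule nn_integral_cmult[OF measurable_F[OF Suc.prems k mfunD[OF mf]]])
    finally show "ennreal (?c k) = ennreal (v k / v j) * ?X k" using k Suc.prems by (simp add: G_def)
  qed
  have "ennreal (conv_power S Q F (Suc n) i j t) =
      ennreal (v i / v j) * (\<integral>\<^sup>+k. ennreal (p i k) * ?X k \<partial>count_space UNIV)"
    unfolding conv_power.simps by (rule op_step[OF Suc.prems j cX])
  then show ?case using op_eq[OF mf, of i t] by simp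
qed

text \<open>Matrix powers are convolution powers with all increments equal to 0, so the bounds known
  for \<open>conv_power\<close> carry over to \<open>matpow\<close>.\<close>

lemma conv_power_return:
  "conv_power S Q (\<lambda>_ _. return borel 0) n i j t = (if t \<ge> 0 then matpow S Q n i j else 0)"
proof (induction n arbitrary: i t)
  case (Suc n)
  have "(\<integral>x. conv_power S Q (\<lambda>_ _. return borel 0) n k j (t - x) \<partial>return borel 0) =
      (if t \<ge> 0 then matpow S Q n k j else 0)" for k
    unfolding Suc by (subst integral_return) auto
  then show ?case by simp
qed simp

lemma matpow_bounds:
  assumes "i \<in> S" "j \<in> S"
  shows "0 \<le> matpow S Q n i j \<and> matpow S Q n i j \<le> v i / v j"
proof -
  have "real_distribution (return borel (0::real))"
    by (auto simp: real_distribution_def real_distribution_axioms_def intro!: prob_space_return)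
  then show ?thesis
    using conv_power_regular[OF nonneg right, of "\<lambda>_ _. return borel 0" i j n] assms
    unfolding conv_power_return by (auto dest: spec[of _ 0])
qed

lemma matpow_eq:
  assumes i: "i \<in> S" and j: "j \<in> S"
  shows "ennreal (matpow S Q n i j) = ennreal (v i / v j) * (op ^^ n) (at_state j (\<lambda>_. 1)) i t"
  using i
proof (induction n arbitrary: i t)
  case 0
  then show ?case using v_pos[OF j] by (auto simp: at_state_def)
next
  case (Suc n)
  let ?f = "at_state j (\<lambda>_. 1)"
  have mf: "mfun ((op ^^ n) ?f)" by (rule kop_mfun[OF kop_opn mfun_at_state]) simp
  let ?X = "\<lambda>k. \<integral>\<^sup>+x. (op ^^ n) ?f k (t - x) \<partial>G i k"
  have X: "ennreal (matpow S Q n k j) = ennreal (v k / v j) * ?X k" if k: "k \<in> S" for k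
  proof -
    have "ennreal (matpow S Q n k j) = (\<integral>\<^sup>+x. ennreal (matpow S Q n k j) \<partial>G i k)" by simp
    also have "\<dots> = (\<integral>\<^sup>+x. ennreal (v k / v j) * (op ^^ n) ?f k (t - x) \<partial>G i k)"
      by (rule nn_integral_cong) (rule Suc.IH[OF k])
    also have "\<dots> = ennreal (v k / v j) * ?X k"
      using k Suc.prems by (intro nn_integral_cmult) (auto simp: G_def intro: measurable_F[OF _ _ mfunD[OF mf]])
    finally show ?thesis .
  qed
  have "ennreal (matpow S Q (Suc n) i j) =
      ennreal (v i / v j) * (\<integral>\<^sup>+k. ennreal (p i k) * ?X k \<partial>count_space UNIV)"
    unfolding matpow.simps by (rule op_step[OF Suc.prems j matpow_bounds[OF _ j] X])
  then show ?case using op_eq[OF mf, of i t] by simp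
qed

lemma conv_power_kop:
  assumes i: "i \<in> S" and j: "j \<in> S"
  shows "conv_power S Q F n i j t = v i / v j * measure (kop_measure (op ^^ n) i j) {..t}"
proof -
  have c: "v i / v j > 0" using v_pos i j by simp
  have "(op ^^ n) (at_state j (indicator {0..})) i t =
      (\<integral>\<^sup>+x. indicator {0..} (t - x) \<partial>kop_measure (op ^^ n) i j)"
    by (rule nn_integral_kop_measure[OF kop_opn, symmetric]) simp
  also have "\<dots> = (\<integral>\<^sup>+x. indicator {..t} x \<partial>kop_measure (op ^^ n) i j)"
    by (rule nn_integral_cong) (simp split: split_indicator)
  also have "\<dots> = emeasure (kop_measure (op ^^ n) i j) {..t}" by simp
  also have "\<dots> = ennreal (measure (kop_measure (op ^^ n) i j) {..t})"
    by (rule finite_measure.emeasure_eq_measure[OF finite_opn])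
  finally have "ennreal (conv_power S Q F n i j t) =
      ennreal (v i / v j * measure (kop_measure (op ^^ n) i j) {..t})"
    using conv_power_eq[OF i j, of n t] c by (simp only: ennreal_mult less_imp_le measure_nonneg)
  moreover have "0 \<le> conv_power S Q F n i j t" using conv_power_bounds[OF i j, of n] by blast
  moreover have "0 \<le> v i / v j * measure (kop_measure (op ^^ n) i j) {..t}"
    by (rule mult_nonneg_nonneg[OF less_imp_le[OF c] measure_nonneg])
  ultimately show ?thesis by (simp only: ennreal_inj)
qed

text \<open>The divisor \<open>r\<close> covers two uses: r = 1 for the renewal measure and r =
  \<open>matpow S Q n i j\<close> for the normalised distribution in the spread-out
  condition.\<close>

lemma interval_measure_conv:
  assumes i: "i \<in> S" and j: "j \<in> S" and r: "r > 0"
  shows "interval_measure (\<lambda>t. conv_power S Q F n i j t / r) =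
    scale_measure (ennreal (v i / v j / r)) (kop_measure (op ^^ n) i j)"
proof (rule interval_measure_eqI)
  have c: "v i / v j > 0" using v_pos i j by simp
  note reg = conv_power_bounds[OF i j, of n]
  show "finite_borel_measure (scale_measure (ennreal (v i / v j / r)) (kop_measure (op ^^ n) i j))"
    using finite_measure_scale[OF finite_opn, of "ennreal (v i / v j / r)" n i j]
    by (simp add: finite_borel_measure_def finite_borel_measure_axioms_def)
  show "conv_power S Q F n i j t / r =
      measure (scale_measure (ennreal (v i / v j / r)) (kop_measure (op ^^ n) i j)) {..t}" for t
    unfolding conv_power_kop[OF i j] measure_scale_measure[OF divide_nonneg_pos[OF less_imp_le[OF c] r]] by simp
  show "conv_power S Q F n i j x / r \<le> conv_power S Q F n i j y / r" if "x \<le> y" for x y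
    using reg r that by (intro divide_right_mono) (auto simp: mono_def)
  show "continuous (at_right a) (\<lambda>t. conv_power S Q F n i j t / r)" for a
    unfolding divide_inverse using reg by (intro continuous_mult continuous_const) auto
qed

lemma spread_ex:
  assumes i: "i \<in> S"
  shows "\<exists>q c e d. spread_at i q c e d"
proof -
  obtain n a b where n: "n \<ge> 1" and ab: "a \<in> S" "b \<in> S" and pos: "u a * matpow S Q n a b * v b > 0"
    and ns: "\<not> singular_wrt_lborel (conv_distr S Q F n a b)"
    using spread_out unfolding spread_out_def by blast
  have mp: "matpow S Q n a b > 0"
    using pos u_pos[OF ab(1)] v_pos[OF ab(2)] by (simp add: zero_less_mult_iff)
  \<comment> \<open>The two measures differ by a positive factor, which changes no null set.\<close>
  have ns': "\<not> (\<exists>A\<in>sets borel. emeasure lborel A = 0 \<and> emeasure (kop_measure (op ^^ n) a b) (- A) = 0)"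
    using ns unfolding singular_wrt_lborel_def conv_distr_def interval_measure_conv[OF ab mp] by auto
  show ?thesis
  proof (rule spread_at_of_nonsingular[OF ns' n ab i])
    fix i k assume ik: "i \<in> S" "k \<in> S"
    then obtain m where m: "matpow S Q m i k > 0"
      using quasi unfolding quasi_stochastic_def irreducible_matrix_def by blast
    have "emeasure (kop_measure (op ^^ m) i k) UNIV = (op ^^ m) (at_state k (\<lambda>_. 1)) i 0"
      by (subst emeasure_kop_measure[OF kop_opn]) simp_all
    moreover have "(op ^^ m) (at_state k (\<lambda>_. 1)) i 0 \<noteq> 0"
      using matpow_eq[OF ik, of m 0] m by auto
    ultimately have "emeasure (kop_measure (op ^^ m) i k) UNIV > 0" by (simp add: zero_less_iff_neq_zero)
    then show "\<exists>m. emeasure (kop_measure (op ^^ m) i k) UNIV > 0" by blast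
  qed
qed

section \<open>Stationarity and the Liouville property of the driving chain\<close>

lemma W_integral: "(\<integral>\<^sup>+i. f i \<partial>W) = (\<integral>\<^sup>+i. ennreal (w i) * f i \<partial>count_space UNIV)"
  unfolding W_def by (rule nn_integral_density) auto

lemma W_K_integral:
  assumes g: "g \<in> borel_measurable borel"
  shows "(\<integral>\<^sup>+i. (\<integral>\<^sup>+z. g (snd z) \<partial>K i) \<partial>W) =
    (\<Sum>\<^sub>\<infinity>(i, j)\<in>S \<times> S. ennreal (u i * Q i j * v j) * (\<integral>\<^sup>+x. g x \<partial>F i j))"
proof -
  have m: "(\<lambda>z. g (snd z)) \<in> borel_measurable (count_space (UNIV::nat set) \<Otimes>\<^sub>M borel)"
    by (rule measurable_compose[OF measurable_snd g])
  let ?\<phi> = "\<lambda>(i, k). ennreal (w i) * (ennreal (p i k) * (\<integral>\<^sup>+x. g x \<partial>G i k))"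
  have "(\<integral>\<^sup>+i. (\<integral>\<^sup>+z. g (snd z) \<partial>K i) \<partial>W) =
      (\<integral>\<^sup>+i. (\<integral>\<^sup>+k. ?\<phi> (i, k) \<partial>count_space UNIV) \<partial>count_space UNIV)"
    unfolding W_integral nn_integral_K[OF m] by (intro nn_integral_cong) (simp add: nn_integral_cmult)
  also have "\<dots> = (\<integral>\<^sup>+z. ?\<phi> z \<partial>count_space UNIV)" by (rule nn_integral_fst_count_space)
  also have "\<dots> = (\<integral>\<^sup>+z. (\<lambda>(i, j). ennreal (u i * Q i j * v j) * (\<integral>\<^sup>+x. g x \<partial>F i j)) z * indicator (S \<times> S) z
      \<partial>count_space UNIV)"
  proof (rule nn_integral_cong)
    have eq: "?\<phi> (i, k) = (\<lambda>(i, j). ennreal (u i * Q i j * v j) * (\<integral>\<^sup>+x. g x \<partial>F i j)) (i, k) * indicator (S \<times> S) (i, k)" for i k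
    proof (cases "i \<in> S \<and> k \<in> S")
      case True
      then have pos: "u i > 0" "v i > 0" "v k > 0" "Q i k \<ge> 0" using u_pos v_pos Q_nonneg by auto
      have "u i * Q i k * v k = w i * p i k" using True pos by (simp add: w_def p_def)
      moreover have "w i \<ge> 0" using True pos by (simp add: w_def)
      ultimately have "ennreal (u i * Q i k * v k) = ennreal (w i) * ennreal (p i k)"
        by (simp add: ennreal_mult p_nonneg)
      then show ?thesis using True by (simp add: G_def mult.assoc)
    qed (auto simp: w_def p_def)
    fix z :: "nat \<times> nat"
    show "?\<phi> z = (\<lambda>(i, j). ennreal (u i * Q i j * v j) * (\<integral>\<^sup>+x. g x \<partial>F i j)) z * indicator (S \<times> S) z"
    proof (cases z)
      case (Pair i k)
      show ?thesis unfolding Pair by (rule eq)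
    qed
  qed
  also have "\<dots> = (\<Sum>\<^sub>\<infinity>(i, j)\<in>S \<times> S. ennreal (u i * Q i j * v j) * (\<integral>\<^sup>+x. g x \<partial>F i j))"
    by (rule infsum_eq_nn_integral[symmetric])
  finally show ?thesis .
qed

text \<open>The left eigenvector equation: the sum of w i * p i k over i is v k times the sum of u i
  * Q i k, that is u k * v k.\<close>

lemma W_invariant: "(\<integral>\<^sup>+i. (\<integral>\<^sup>+z. f (fst z) \<partial>K i) \<partial>W) = (\<integral>\<^sup>+i. f i \<partial>W)"
proof -
  let ?\<phi> = "\<lambda>(i, k). ennreal (w i) * (ennreal (p i k) * f k)"
  have col: "(\<integral>\<^sup>+i. ?\<phi> (i, k) \<partial>count_space UNIV) = ennreal (w k) * f k" for k
  proof (cases "k \<in> S")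
    case True
    have vk: "v k > 0" by (rule v_pos[OF True])
    have nn: "0 \<le> v k * (u i * Q i k)" if "i \<in> S" for i
      using u_pos[OF that] Q_nonneg[OF that True] vk by simp
    have "(\<integral>\<^sup>+i. ?\<phi> (i, k) \<partial>count_space UNIV) =
        (\<integral>\<^sup>+i. f k * (ennreal (v k * (u i * Q i k)) * indicator S i) \<partial>count_space UNIV)"
    proof (rule nn_integral_cong)
      fix i
      show "?\<phi> (i, k) = f k * (ennreal (v k * (u i * Q i k)) * indicator S i)"
      proof (cases "i \<in> S")
        case i: True
        have "v k * (u i * Q i k) = w i * p i k" using i True v_pos[OF i] by (simp add: w_def p_def)
        moreover have "w i \<ge> 0" using i u_pos v_pos by (simp add: w_def less_imp_le)
        ultimately have "ennreal (v k * (u i * Q i k)) = ennreal (w i) * ennreal (p i k)"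
          by (simp add: ennreal_mult p_nonneg)
        then show ?thesis using i by (simp add: mult_ac)
      qed (simp add: w_def)
    qed
    also have "\<dots> = f k * ennreal (v k * u k)"
      using nn_integral_has_sum[OF has_sum_cmult_right[OF u_sum[OF True]] nn] by (simp add: nn_integral_cmult)
    finally show ?thesis using True by (simp add: w_def mult.commute)
  next
    case False
    then show ?thesis by (simp add: w_def p_def)
  qed
  have "(\<integral>\<^sup>+i. (\<integral>\<^sup>+z. f (fst z) \<partial>K i) \<partial>W) =
      (\<integral>\<^sup>+i. (\<integral>\<^sup>+k. ?\<phi> (i, k) \<partial>count_space UNIV) \<partial>count_space UNIV)"
    unfolding W_integral nn_integral_K_fst by (intro nn_integral_cong) (simp add: nn_integral_cmult)
  also have "\<dots> = (\<integral>\<^sup>+k. (\<integral>\<^sup>+i. ?\<phi> (i, k) \<partial>count_space UNIV) \<partial>count_space UNIV)"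
    using nn_integral_fst_count_space[of ?\<phi>] nn_integral_snd_count_space[of ?\<phi>] by simp
  also have "\<dots> = (\<integral>\<^sup>+k. f k \<partial>W)" unfolding col W_integral ..
  finally show ?thesis .
qed

lemma emeasure_W: "emeasure W {j} = ennreal (w j)"
  unfolding W_def by (subst emeasure_density) simp_all

text \<open>The defect \<open>D\<close> of a bounded superharmonic function has a finite potential, which recurrence
  forces to vanish; then \<open>v (H + 1)\<close> is a positive right eigenvector.\<close>

lemma superharmonic_const:
  fixes H :: "nat \<Rightarrow> real"
  assumes H: "\<And>k. 0 \<le> H k" "\<And>k. H k \<le> C" "\<And>k. (\<integral>z. H (fst z) \<partial>K k) \<le> H k"
    and ij: "i \<in> S" "j \<in> S"
  shows "H i = H j"
proof -
  have int: "integrable (K k) (\<lambda>z. H (fst z))" for k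
  proof (rule finite_measure.integrable_const_bound[OF prob_space.finite_measure[OF prob_K], where B = C])
    show "AE z in K k. norm (H (fst z)) \<le> C" using H(1,2) by simp
    have "(\<lambda>z. H (fst z)) \<in> borel_measurable (count_space UNIV \<Otimes>\<^sub>M (borel :: real measure))"
      by (rule measurable_compose[OF measurable_fst]) simp
    then show "(\<lambda>z. H (fst z)) \<in> borel_measurable (K k)" unfolding measurable_cong_sets[OF sets_K refl] .
  qed
  define D where "D k = H k - (\<integral>z. H (fst z) \<partial>K k)" for k
  have D0: "D k \<ge> 0" for k using H(3)[of k] by (simp add: D_def)
  let ?h = "\<lambda>k (t::real). ennreal (H k)" and ?d = "\<lambda>k (t::real). ennreal (D k)"
  have hd: "?h = (\<lambda>k t. op ?h k t + ?d k t)"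
  proof (intro ext)
    fix k t
    have "op ?h k t = ennreal (\<integral>z. H (fst z) \<partial>K k)"
      unfolding op_def using int H(1) by (intro nn_integral_eq_integral) auto
    moreover have "(\<integral>z. H (fst z) \<partial>K k) \<ge> 0" using H(1) by (intro Bochner_Integration.integral_nonneg)
    ultimately show "ennreal (H k) = op ?h k t + ?d k t"
      using D0[of k] by (simp add: D_def flip: ennreal_plus)
  qed
  have mop: "mfun (op ?h)" by (rule kop_mfun[OF kop_op mfun_const])
  obtain i1 where i1: "i1 \<in> S" "(\<Sum>n. ennreal (matpow S Q (Suc n) i1 i1)) = \<infinity>" using recurrent by blast
  have pt: "ennreal (matpow S Q n i1 i1) = (op ^^ n) (at_state i1 (\<lambda>_. 1)) i1 0" for n
    using matpow_eq[OF i1(1) i1(1), of n 0] v_pos[OF i1(1)] by simp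
  define a where "a n = (op ^^ n) ?h i1 0" for n
  define b where "b n = (op ^^ n) ?d i1 0" for n
  have ab: "a n = a (Suc n) + b n" for n
  proof -
    have "(op ^^ n) ?h = (op ^^ n) (\<lambda>k t. op ?h k t + ?d k t)" using hd by (rule arg_cong)
    also have "\<dots> = (\<lambda>k t. (op ^^ n) (op ?h) k t + (op ^^ n) ?d k t)"
      by (rule kop_add[OF kop_opn mop mfun_const])
    finally have eq: "(op ^^ n) ?h = (\<lambda>k t. (op ^^ n) (op ?h) k t + (op ^^ n) ?d k t)" .
    have sw: "(op ^^ Suc n) ?h = (op ^^ n) (op ?h)" by (simp only: funpow_Suc_right comp_apply)
    show ?thesis unfolding a_def b_def sw by (rule fun_cong[OF fun_cong[OF eq]])
  qed
  have aC: "a n \<le> ennreal C" for n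
  proof -
    have "a n \<le> (op ^^ n) (\<lambda>k t. ennreal C) i1 0"
      unfolding a_def by (rule kop_mono[OF kop_opn mfun_const mfun_const]) (rule ennreal_leI[OF H(2)])
    then show ?thesis by (simp add: opn_const)
  qed
  have tele: "(\<Sum>n<N. b (n + s)) + a (N + s) = a s" for N s
  proof (induction N)
    case (Suc N)
    have "(\<Sum>n<Suc N. b (n + s)) + a (Suc N + s) = (\<Sum>n<N. b (n + s)) + (a (Suc (N + s)) + b (N + s))"
      by (simp add: add_ac)
    also have "\<dots> = (\<Sum>n<N. b (n + s)) + a (N + s)" unfolding ab[of "N + s"] ..
    also have "\<dots> = a s" by (rule Suc)
    finally show ?case .
  qed simp
  \<comment> \<open>A return to \<open>i1\<close> after n + 1 steps followed by \<open>m\<close>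
    further steps shows that \<open>e\<close> times the return weight is at most a defect term. The
    defects sum to at most C, whereas the return weights have infinite sum, so \<open>e\<close>
    vanishes.\<close>
  have e0: "(op ^^ m) ?d i1 0 = 0" for m
  proof -
    let ?e = "(op ^^ m) ?d i1 0"
    have cs: "(op ^^ m) ?d i1 t = ?e" for t by (rule kop_const_shift[OF kop_opn])
    have ge: "?e * ennreal (matpow S Q (Suc n) i1 i1) \<le> b (n + Suc m)" for n
    proof -
      have "?e * ennreal (matpow S Q (Suc n) i1 i1) = (op ^^ Suc n) (\<lambda>k t. ?e * at_state i1 (\<lambda>_. 1) k t) i1 0"
        unfolding pt by (subst kop_cmult[OF kop_opn mfun_at_state]) simp_all
      also have "\<dots> \<le> (op ^^ Suc n) ((op ^^ m) ?d) i1 0"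
      proof (rule kop_mono[OF kop_opn _ kop_mfun[OF kop_opn mfun_const]])
        show "mfun (\<lambda>k t. ?e * at_state i1 (\<lambda>_. 1) k t)" by (rule mfun_cmult) simp
        fix k and t :: real
        show "?e * at_state i1 (\<lambda>_. 1) k t \<le> (op ^^ m) ?d k t"
          using cs[of t] by (cases "k = i1") (simp_all add: at_state_def)
      qed
      also have "\<dots> = b (n + Suc m)"
      proof -
        have "n + Suc m = Suc n + m" by simp
        then show ?thesis unfolding b_def by (simp only: funpow_add comp_apply)
      qed
      finally show ?thesis .
    qed
    have part: "(\<Sum>n<N. b (n + Suc m)) \<le> ennreal C" for N
    proof -
      have "(\<Sum>n<N. b (n + Suc m)) \<le> (\<Sum>n<N. b (n + Suc m)) + a (N + Suc m)" by simp
      then show ?thesis unfolding tele using aC[of "Suc m"] by (rule order_trans)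
    qed
    have "?e * \<infinity> = (\<Sum>n. ?e * ennreal (matpow S Q (Suc n) i1 i1))" unfolding i1(2)[symmetric] by simp
    also have "\<dots> \<le> (\<Sum>n. b (n + Suc m))" using ge by (intro suminf_le) auto
    also have "\<dots> \<le> ennreal C" unfolding suminf_eq_SUP using part by (rule SUP_least)
    finally have "?e * \<top> < \<top>" by (simp add: le_less_trans[OF _ ennreal_less_top])
    then show ?thesis by (cases "?e = 0") (simp_all add: ennreal_mult_top)
  qed
  have D_zero: "D k = 0" if k: "k \<in> S" for k
  proof -
    obtain m where m: "matpow S Q m i1 k > 0"
      using quasi i1(1) k unfolding quasi_stochastic_def irreducible_matrix_def by blast
    have "ennreal (D k) * (op ^^ m) (at_state k (\<lambda>_. 1)) i1 0 = (op ^^ m) (\<lambda>l t. ennreal (D k) * at_state k (\<lambda>_. 1) l t) i1 0"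
      by (subst kop_cmult[OF kop_opn mfun_at_state]) simp_all
    also have "\<dots> \<le> (op ^^ m) ?d i1 0"
    proof (rule kop_mono[OF kop_opn _ mfun_const])
      show "mfun (\<lambda>l t. ennreal (D k) * at_state k (\<lambda>_. 1) l t)" by (rule mfun_cmult) simp
    qed (simp add: at_state_def)
    finally have "ennreal (D k) * (op ^^ m) (at_state k (\<lambda>_. 1)) i1 0 = 0" unfolding e0 by simp
    moreover have "(op ^^ m) (at_state k (\<lambda>_. 1)) i1 0 \<noteq> 0" using matpow_eq[OF i1(1) k, of m 0] m by auto
    ultimately have "ennreal (D k) = 0" by simp
    then show ?thesis using D0[of k] by simp
  qed
  \<comment> \<open>\<open>H\<close> may vanish; adding 1 makes the new eigenvector strictly
    positive, as uniqueness requires.\<close>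
  let ?v = "\<lambda>k. v k * (H k + 1)"
  have "pos_right_eigenvector S Q ?v"
    unfolding pos_right_eigenvector_def
  proof (intro conjI ballI)
    fix k assume k: "k \<in> S"
    show "?v k > 0" using v_pos[OF k] H(1)[of k] by (intro mult_pos_pos) auto
    have "(\<integral>\<^sup>+z. ennreal (H (fst z) + 1) \<partial>K k) = ennreal (\<integral>z. H (fst z) + 1 \<partial>K k)"
      using int H(1) by (intro nn_integral_eq_integral Bochner_Integration.integrable_add
        finite_measure.integrable_const[OF prob_space.finite_measure[OF prob_K]]) auto
    also have "(\<integral>z. H (fst z) + 1 \<partial>K k) = H k + 1"
      using int D_zero[OF k] prob_space.prob_space[OF prob_K, of k]
      by (subst Bochner_Integration.integral_add)
        (auto simp: D_def intro!: finite_measure.integrable_const[OF prob_space.finite_measure[OF prob_K]])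
    finally have "(\<integral>\<^sup>+l. ennreal (p k l) * ennreal (H l + 1) \<partial>count_space UNIV) = ennreal (H k + 1)"
      unfolding nn_integral_K_fst[where f = "\<lambda>l. ennreal (H l + 1)"] .
    moreover have "ennreal (p k l * (H l + 1)) * indicator S l = ennreal (p k l) * ennreal (H l + 1)" for l
    proof (cases "l \<in> S")
      case True
      then show ?thesis using p_nonneg[of k l] H(1)[of l] by (simp add: ennreal_mult)
    qed (simp add: p_def)
    ultimately have "(\<integral>\<^sup>+l. ennreal (p k l * (H l + 1)) * indicator S l \<partial>count_space UNIV) = ennreal (H k + 1)"
      by simp
    then have "((\<lambda>l. p k l * (H l + 1)) has_sum (H k + 1)) S"
      using p_nonneg H(1) by (intro has_sum_nn_integral) (auto intro!: mult_nonneg_nonneg add_nonneg_nonneg)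
    from has_sum_cmult_right[OF this, of "v k"]
    show "((\<lambda>l. Q k l * ?v l) has_sum ?v k) S"
    proof (rule iffD1[OF has_sum_cong, rotated])
      fix l assume "l \<in> S"
      then show "v k * (p k l * (H l + 1)) = Q k l * ?v l"
        using k v_pos[OF k] by (simp add: p_def)
    qed
  qed
  moreover obtain v0 where v0: "\<And>v'. pos_right_eigenvector S Q v' \<Longrightarrow> \<exists>c. \<forall>i\<in>S. v' i = c * v0 i"
    using quasi unfolding quasi_stochastic_def by blast
  ultimately obtain c1 where c1: "\<And>i. i \<in> S \<Longrightarrow> ?v i = c1 * v0 i" by blast
  obtain c2 where c2: "\<And>i. i \<in> S \<Longrightarrow> v i = c2 * v0 i" using v0[OF right] by blast
  have "c2 \<noteq> 0" using c2[OF ij(1)] v_pos[OF ij(1)] by auto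
  have "H k + 1 = c1 / c2" if k: "k \<in> S" for k
  proof -
    have "v0 k \<noteq> 0" using c2[OF k] v_pos[OF k] by auto
    have "c2 * v0 k * (H k + 1) = c1 * v0 k" using c1[OF k] c2[OF k] by simp
    then have "v0 k * ((H k + 1) * c2) = v0 k * c1" by (simp only: mult_ac)
    with \<open>v0 k \<noteq> 0\<close> have "(H k + 1) * c2 = c1" by (simp only: mult_cancel_left) simp
    then show ?thesis by (rule nonzero_eq_divide_eq[OF \<open>c2 \<noteq> 0\<close>, THEN iffD2])
  qed
  from this[OF ij(1)] this[OF ij(2)] show ?thesis by simp
qed

section \<open>Drift and return to the matrix renewal measure\<close>

lemma mean_pos_eq: "(\<integral>\<^sup>+i. (\<integral>\<^sup>+z. ennreal (max (snd z) 0) \<partial>K i) \<partial>W) = mean_pos_part S Q F u v"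
  unfolding mean_pos_part_def by (rule W_K_integral) measurable

lemma mean_neg_eq: "(\<integral>\<^sup>+i. (\<integral>\<^sup>+z. ennreal (max (- snd z) 0) \<partial>K i) \<partial>W) = mean_neg_part S Q F u v"
  unfolding mean_neg_part_def by (rule W_K_integral) measurable

text \<open>In \<open>ereal\<close> the difference \<infinity> - \<infinity> is \<infinity>, so
  positivity of the mean alone does not give this; \<open>mean_well_defined\<close> excludes that
  case.\<close>

lemma mean_neg_less_pos: "mean_neg_part S Q F u v < mean_pos_part S Q F u v"
proof (cases "mean_neg_part S Q F u v")
  case (real y)
  show ?thesis
  proof (cases "mean_pos_part S Q F u v")
    case x: (real x)
    then show ?thesis using real mean_gt_0 unfolding mean_def by (simp add: enn2ereal_ennreal ennreal_less_iff)
  qed (use real in simp)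
next
  case top
  then obtain x where "mean_pos_part S Q F u v = ennreal x" "0 \<le> x"
    using well_defined unfolding mean_well_defined_def by (cases "mean_pos_part S Q F u v") auto
  then show ?thesis using mean_gt_0 top unfolding mean_def by (simp add: enn2ereal_ennreal)
qed

lemma renewal_walk: "renewal_walk K S W"
proof
  show "sets W = UNIV" by (simp add: W_def)
  show "emeasure W {i} > 0" if "i \<in> S" for i
    using that u_pos[OF that] v_pos[OF that] by (simp add: emeasure_W w_def)
  show "emeasure W {i} < \<infinity>" for i by (simp add: emeasure_W)
qed (fact W_invariant S_ne superharmonic_const spread_ex mean_neg_less_pos[folded mean_neg_eq mean_pos_eq])+

text \<open>The factor c = v i / v j undoes the conjugation and turns the limit W{j} * rate into v_i
  u_j * rate. The clause for all \<open>x\<close> allows the centring by \<lambda>(B) to be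
  rewritten with the same real \<open>L\<close>.\<close>

lemma decomposition:
  assumes i: "i \<in> S" and j: "j \<in> S"
  shows "\<exists>(V1 :: real measure) h.
    sets V1 = sets borel \<and> finite_measure V1 \<and> (\<forall>t. h t \<ge> 0) \<and> bounded (range h) \<and> continuous_on UNIV h \<and>
    (\<forall>B\<in>sets borel. emeasure (renewal_measure S Q F i j) B =
       emeasure V1 B + (\<integral>\<^sup>+s. ennreal (h s) * indicator B s \<partial>lborel)) \<and>
    (\<exists>L. (h \<longlongrightarrow> L) at_top \<and> ereal L = ereal (v i * u j) / mean S Q F u v \<and>
      (\<forall>x. ereal (L * x) = ereal (v i * u j * x) / mean S Q F u v)) \<and>
    (h \<longlongrightarrow> 0) at_bot"
proof -
  interpret R: renewal_walk K S W by (rule renewal_walk)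
  have mp: "R.mean_pos = mean_pos_part S Q F u v" "R.mean_neg = mean_neg_part S Q F u v"
    unfolding R.mean_pos_def R.mean_neg_def by (fact mean_pos_eq mean_neg_eq)+
  have rate: "ereal L / mean S Q F u v = ereal (L * R.rate)" for L
  proof -
    obtain y where y: "mean_neg_part S Q F u v = ennreal y" "0 \<le> y"
      using R.mean_neg_finite unfolding mp by (cases "mean_neg_part S Q F u v") auto
    show ?thesis
    proof (cases "mean_pos_part S Q F u v")
      case (real x)
      then have "y < x" using mean_neg_less_pos y by (simp add: ennreal_less_iff)
      then show ?thesis using real y unfolding R.rate_def mp mean_def by (simp add: enn2ereal_ennreal)
    next
      case top
      then show ?thesis using y unfolding R.rate_def mp mean_def by (simp add: enn2ereal_ennreal)
    qed
  qed
  define c where "c = v i / v j"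
  have c: "c > 0" using v_pos i j by (simp add: c_def)
  obtain V1 g where V1: "finite_measure V1" "sets V1 = sets borel" and g: "\<And>t. g t \<ge> 0" "bounded (range g)"
    "continuous_on UNIV g" "(g \<longlongrightarrow> enn2real (emeasure W {j}) * R.rate) at_top" "(g \<longlongrightarrow> 0) at_bot"
    and dec: "\<And>C. C \<in> sets borel \<Longrightarrow> R.rmeas j (\<lambda>x. indicator C (- x)) i 0 =
        emeasure V1 C + (\<integral>\<^sup>+s. indicator C s * ennreal (g s) \<partial>lborel)"
    using R.stone_decomposition[OF i j] by blast
  note [measurable] = borel_measurable_continuous_onI[OF g(3)]
  let ?h = "\<lambda>t. c * g t" and ?V1 = "scale_measure (ennreal c) V1"
  have ren: "emeasure (renewal_measure S Q F i j) B =
      emeasure ?V1 B + (\<integral>\<^sup>+s. ennreal (?h s) * indicator B s \<partial>lborel)" if B: "B \<in> sets borel" for B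
  proof -
    note B[measurable]
    have conv1: "interval_measure (conv_power S Q F n i j) = scale_measure (ennreal c) (kop_measure (op ^^ n) i j)" for n
      using interval_measure_conv[OF i j, of 1 n] by (simp add: c_def)
    have "emeasure (renewal_measure S Q F i j) B = (\<Sum>n. ennreal c * (op ^^ n) (at_state j (\<lambda>x. indicator B (- x))) i 0)"
      unfolding emeasure_renewal_measure[OF B] conv1
      by (simp add: emeasure_kop_measure[OF kop_opn B])
    also have "\<dots> = ennreal c * R.rmeas j (\<lambda>x. indicator B (- x)) i 0"
      unfolding R.rmeas_def by (rule ennreal_suminf_cmult)
    also have "\<dots> = ennreal c * emeasure V1 B + ennreal c * (\<integral>\<^sup>+s. indicator B s * ennreal (g s) \<partial>lborel)"
      unfolding dec[OF B] by (rule distrib_left)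
    also have "ennreal c * (\<integral>\<^sup>+s. indicator B s * ennreal (g s) \<partial>lborel) =
        (\<integral>\<^sup>+s. ennreal c * (indicator B s * ennreal (g s)) \<partial>lborel)"
      by (rule nn_integral_cmult[symmetric]) measurable
    also have "\<dots> = (\<integral>\<^sup>+s. ennreal (?h s) * indicator B s \<partial>lborel)"
      using c g(1) by (intro nn_integral_cong) (simp add: ennreal_mult mult_ac)
    finally show ?thesis by simp
  qed
  define L where "L = v i * u j * R.rate"
  have "c * (enn2real (emeasure W {j}) * R.rate) = L"
    using u_pos[OF j] v_pos[OF j] j by (simp add: emeasure_W w_def c_def L_def)
  then have limL: "(?h \<longlongrightarrow> L) at_top" using tendsto_mult_left[OF g(4), of c] by simp
  have lim0: "(?h \<longlongrightarrow> 0) at_bot" using tendsto_mult_left[OF g(5), of c] by simp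
  have Lx: "ereal (L * x) = ereal (v i * u j * x) / mean S Q F u v" for x
    unfolding rate L_def by (simp add: mult_ac)
  have bdd: "bounded (range ?h)"
    using bounded_scaling[OF g(2), of c] by (simp add: image_image)
  show ?thesis
  proof (intro exI[of _ ?V1] exI[of _ ?h] conjI allI ballI)
    show "\<exists>L. (?h \<longlongrightarrow> L) at_top \<and> ereal L = ereal (v i * u j) / mean S Q F u v \<and>
      (\<forall>x. ereal (L * x) = ereal (v i * u j * x) / mean S Q F u v)"
      using limL Lx Lx[of 1] by auto
    show "finite_measure ?V1" by (rule finite_measure_scale[OF V1(1)]) simp
    show "continuous_on UNIV ?h" by (intro continuous_intros g(3))
  qed (use V1 c g(1) bdd ren lim0 in auto)
qed

end

theorem theorem1p2:
  fixes S :: "nat set"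
    and Q :: "nat \<Rightarrow> nat \<Rightarrow> real"
    and u v :: "nat \<Rightarrow> real"
    and F :: "nat \<Rightarrow> nat \<Rightarrow> real measure"
  assumes "index_set S"
    and "quasi_stochastic S Q"
    and "pos_left_eigenvector S Q u"
    and "pos_right_eigenvector S Q v"
    and "\<And>i j. i \<in> S \<Longrightarrow> j \<in> S \<Longrightarrow> real_distribution (F i j)"
    and "\<exists>i\<in>S. (\<Sum>n. ennreal (matpow S Q (Suc n) i i)) = \<infinity>"
    and "mean_well_defined S Q F u v"
    and "mean S Q F u v > 0"
    and "spread_out S Q F u v"
  shows
    "(\<exists>(V1 :: nat \<Rightarrow> nat \<Rightarrow> real measure) (V2 :: nat \<Rightarrow> nat \<Rightarrow> real measure)
       (h :: nat \<Rightarrow> nat \<Rightarrow> real \<Rightarrow> real).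
       \<forall>i\<in>S. \<forall>j\<in>S.
         sets (V1 i j) = sets borel \<and> sets (V2 i j) = sets borel \<and>
         (\<forall>B\<in>sets borel.
            emeasure (renewal_measure S Q F i j) B = emeasure (V1 i j) B + emeasure (V2 i j) B) \<and>
         finite_measure (V1 i j) \<and>
         absolutely_continuous lborel (V2 i j) \<and>
         (\<forall>t. h i j t \<ge> 0) \<and>
         V2 i j = density lborel (\<lambda>t. ennreal (h i j t)) \<and>
         bounded (range (h i j)) \<and>
         continuous_on UNIV (h i j) \<and>
         ((\<lambda>t. ereal (h i j t)) \<longlongrightarrow> ereal (v i * u j) / mean S Q F u v) at_top \<and>
         (h i j \<longlongrightarrow> 0) at_bot)
     \<and>
     (\<forall>b>0. \<forall>i\<in>S. \<forall>j\<in>S.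
        ((\<lambda>t. SUP B\<in>{B. B \<in> sets borel \<and> B \<subseteq> {0..b}}.
               \<bar>enn2ereal (emeasure (renewal_measure S Q F i j) ((+) t ` B))
                 - ereal (v i * u j * measure lborel B) / mean S Q F u v\<bar>)
          \<longlongrightarrow> 0) at_top)"
proof -
  interpret spread_out_system S Q u v F by (rule spread_out_system.intro) (fact assms)+
  define good where "good i j V1 h \<longleftrightarrow>
    sets V1 = sets borel \<and> finite_measure V1 \<and> (\<forall>t. h t \<ge> 0) \<and> bounded (range h) \<and> continuous_on UNIV h \<and>
    (\<forall>B\<in>sets borel. emeasure (renewal_measure S Q F i j) B =
       emeasure V1 B + (\<integral>\<^sup>+s. ennreal (h s) * indicator B s \<partial>lborel)) \<and>
    (\<exists>L. (h \<longlongrightarrow> L) at_top \<and> ereal L = ereal (v i * u j) / mean S Q F u v \<and>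
      (\<forall>x. ereal (L * x) = ereal (v i * u j * x) / mean S Q F u v)) \<and>
    (h \<longlongrightarrow> 0) at_bot" for i j and V1 :: "real measure" and h :: "real \<Rightarrow> real"
  have "\<exists>V1 h. good i j V1 h" if "i \<in> S" "j \<in> S" for i j
    using decomposition[OF that] unfolding good_def .
  then obtain V1 h where good: "\<And>i j. i \<in> S \<Longrightarrow> j \<in> S \<Longrightarrow> good i j (V1 i j) (h i j)" by metis
  have meas: "h i j \<in> borel_measurable borel" if "i \<in> S" "j \<in> S" for i j
    using good[OF that] unfolding good_def by (intro borel_measurable_continuous_onI) blast
  show ?thesis
  proof (intro conjI allI impI ballI)
    show "\<exists>V1 V2 h. \<forall>i\<in>S. \<forall>j\<in>S.
         sets (V1 i j) = sets borel \<and> sets (V2 i j) = sets borel \<and>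
         (\<forall>B\<in>sets borel.
            emeasure (renewal_measure S Q F i j) B = emeasure (V1 i j) B + emeasure (V2 i j) B) \<and>
         finite_measure (V1 i j) \<and>
         absolutely_continuous lborel (V2 i j) \<and>
         (\<forall>t. h i j t \<ge> 0) \<and>
         V2 i j = density lborel (\<lambda>t. ennreal (h i j t)) \<and>
         bounded (range (h i j)) \<and>
         continuous_on UNIV (h i j) \<and>
         ((\<lambda>t. ereal (h i j t)) \<longlongrightarrow> ereal (v i * u j) / mean S Q F u v) at_top \<and>
         (h i j \<longlongrightarrow> 0) at_bot"
    proof (rule exI[of _ V1], rule exI[of _ "\<lambda>i j. density lborel (\<lambda>t. ennreal (h i j t))"],
        rule exI[of _ h], intro ballI)
      fix i j assume ij: "i \<in> S" "j \<in> S"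
      note gd = good[OF ij, unfolded good_def]
      note [measurable] = meas[OF ij]
      obtain L where L: "(h i j \<longlongrightarrow> L) at_top" "ereal L = ereal (v i * u j) / mean S Q F u v" using gd by blast
      have lim: "((\<lambda>t. ereal (h i j t)) \<longlongrightarrow> ereal (v i * u j) / mean S Q F u v) at_top"
        using tendsto_ereal[OF L(1)] unfolding L(2) .
      have "emeasure (density lborel (\<lambda>t. ennreal (h i j t))) B = (\<integral>\<^sup>+s. ennreal (h i j s) * indicator B s \<partial>lborel)"
        if "B \<in> sets borel" for B
        using that by (intro emeasure_density) auto
      moreover have "absolutely_continuous lborel (density lborel (\<lambda>t. ennreal (h i j t)))"
        by (rule absolutely_continuousI_density) measurable
      ultimately show "sets (V1 i j) = sets borel \<and> sets (density lborel (\<lambda>t. ennreal (h i j t))) = sets borel \<and>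
         (\<forall>B\<in>sets borel.
            emeasure (renewal_measure S Q F i j) B =
              emeasure (V1 i j) B + emeasure (density lborel (\<lambda>t. ennreal (h i j t))) B) \<and>
         finite_measure (V1 i j) \<and>
         absolutely_continuous lborel (density lborel (\<lambda>t. ennreal (h i j t))) \<and>
         (\<forall>t. h i j t \<ge> 0) \<and>
         density lborel (\<lambda>t. ennreal (h i j t)) = density lborel (\<lambda>t. ennreal (h i j t)) \<and>
         bounded (range (h i j)) \<and>
         continuous_on UNIV (h i j) \<and>
         ((\<lambda>t. ereal (h i j t)) \<longlongrightarrow> ereal (v i * u j) / mean S Q F u v) at_top \<and>
         (h i j \<longlongrightarrow> 0) at_bot"
        using gd lim by simp
    qed
  next
    fix b :: real and i j assume b: "b > 0" and ij: "i \<in> S" "j \<in> S"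
    note gd = good[OF ij, unfolded good_def]
    obtain L where L: "(h i j \<longlongrightarrow> L) at_top" "\<And>x. ereal (v i * u j * x) / mean S Q F u v = ereal (L * x)"
      using gd by metis
    show "((\<lambda>t. SUP B\<in>{B. B \<in> sets borel \<and> B \<subseteq> {0..b}}.
               \<bar>enn2ereal (emeasure (renewal_measure S Q F i j) ((+) t ` B))
                 - ereal (v i * u j * measure lborel B) / mean S Q F u v\<bar>)
          \<longlongrightarrow> 0) at_top"
      unfolding L(2) by (rule total_variation_limit[OF _ _ _ meas[OF ij] L(1) _ b, of "V1 i j"]) (use gd in auto)
  qed
qed

end
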